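(* Let $G=(V,E)$ be an undirected graph with $n$ vertices, $m$ edges and maximum degree $d$, and let $\alpha,\varepsilon>0$. Let $\ell=\frac{32d^2\ln(n/\varepsilon)}{\alpha^2}$. There is a randomized MPC algorithm (given $G,\alpha,\varepsilon$) such that: if $G$ is an $\alpha$-vertex-expander it outputs "accept" with high probability; if $G$ is $\varepsilon$-far from every $\alpha^*$-vertex-expander, where $\alpha^*=\frac{c\alpha^2}{d^2\ln(n/\varepsilon)}$ and $c$ is a large enough constant, it outputs "reject" with high probability. The algorithm can be implemented in $O(\log\ell)$ MPC rounds using sublinear space per machine and $O(m\ell\log n)$ total space.
   Context: For $X,Y\subseteq V$, $N(X,Y)=\{v\in Y:\exists u\in X,\ \{u,v\}\in E\}$. $G$ is an $\alpha$-vertex-expander if every $U\subset V$ with $|U|\le|V|/2$ satisfies $|N(U,V\setminus U)|\ge\alpha|U|$. A graph of maximum degree $d$ is $\varepsilon$-far from every $\alpha^*$-vertex-expander if more than $\varepsilon dn$ edges must be changed (added or removed) to obtain an $\alpha^*$-vertex-expander. "With high probability" means with probability $1-1/\operatorname{poly}(n)$. MPC model: the input edges are distributed over machines with $S$ words of space each; computation proceeds in synchronous rounds of local computation followed by message exchange, with at most $S$ words sent and received per machine per round; total space is the number of machines times $S$.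
   Formalization: Proved for graphs with at least one edge and 0<ε≤1, with some absolute constant c>0 in place of "c large enough": for large c, or ε near n, α* exceeds any possible expansion and a complete graph would have to be both accepted and rejected; log ℓ and ℓ are read as at least 1. *)

theory Defs
  imports "HOL-Probability.Product_PMF"
begin

section \<open>Graphs, vertex expansion and distance to expansion\<close>

definition ugraph :: "'a set \<Rightarrow> 'a set set \<Rightarrow> bool" where
  "ugraph V E \<longleftrightarrow> finite V \<and> (\<forall>e\<in>E. e \<subseteq> V \<and> card e = 2)"

definition max_degree :: "'a set \<Rightarrow> 'a set set \<Rightarrow> nat" where
  "max_degree V E = Max ((\<lambda>v. card {e \<in> E. v \<in> e}) ` V)"

definition nbhd :: "'a set set \<Rightarrow> 'a set \<Rightarrow> 'a set \<Rightarrow> 'a set" where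
  "nbhd E X Y = {v \<in> Y. \<exists>u\<in>X. {u, v} \<in> E}"

definition vertex_expander :: "'a set \<Rightarrow> 'a set set \<Rightarrow> real \<Rightarrow> bool" where
  "vertex_expander V E \<alpha> \<longleftrightarrow>
     (\<forall>U\<subseteq>V. real (card U) \<le> real (card V) / 2 \<longrightarrow>
        real (card (nbhd E U (V - U))) \<ge> \<alpha> * real (card U))"

text \<open>The graphs \<open>(V, E')\<close> below are not required to have maximum degree at most \<open>d\<close>.\<close>

definition far_from_expanders :: "'a set \<Rightarrow> 'a set set \<Rightarrow> real \<Rightarrow> real \<Rightarrow> bool" where
  "far_from_expanders V E \<epsilon> \<beta> \<longleftrightarrow>
     (\<forall>E'. ugraph V E' \<and> vertex_expander V E' \<beta> \<longrightarrow>
        real (card ((E - E') \<union> (E' - E))) > \<epsilon> * real (max_degree V E) * real (card V))"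

section \<open>The MPC model\<close>

datatype verdict = Accept | Reject

text \<open>
  Words are natural numbers below \<open>2 ^ word_bits\<close>. A mailbox assigns to each machine a
  list of words: an outbox is indexed by the recipient, an inbox by the sender. A machine holds
  its memory and its inbox. In round \<open>t\<close>, \<open>local_step P t i\<close> is the (randomized,
  otherwise unrestricted) computation of machine \<open>i\<close>; it yields a new memory and an outbox.
  Once all rounds are over, machine \<open>0\<close> announces the verdict.
\<close>

type_synonym mailbox = "nat \<Rightarrow> nat list"
type_synonym config = "nat \<Rightarrow> nat list \<times> mailbox"

record mpc =
  machines :: nat
  local_space :: nat
  word_bits :: nat
  rounds :: nat
  local_step :: "nat \<Rightarrow> nat \<Rightarrow> nat list \<Rightarrow> mailbox \<Rightarrow> (nat list \<times> mailbox) pmf"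
  announce :: "nat list \<Rightarrow> mailbox \<Rightarrow> verdict"

definition total_space :: "mpc \<Rightarrow> nat" where
  "total_space P = machines P * local_space P"

definition deliver :: "(nat \<Rightarrow> nat list \<times> mailbox) \<Rightarrow> config" where
  "deliver \<tau> = (\<lambda>j. (fst (\<tau> j), \<lambda>i. snd (\<tau> i) j))"

text \<open>The machines draw their random choices independently of each other.\<close>

definition mpc_round :: "mpc \<Rightarrow> nat \<Rightarrow> config \<Rightarrow> config pmf" where
  "mpc_round P t \<sigma> =
     map_pmf deliver
       (Pi_pmf {..<machines P} ([], \<lambda>_. []) (\<lambda>i. local_step P t i (fst (\<sigma> i)) (snd (\<sigma> i))))"

primrec mpc_run :: "mpc \<Rightarrow> nat \<Rightarrow> config \<Rightarrow> config pmf" where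
  "mpc_run P 0 \<sigma> = return_pmf \<sigma>"
| "mpc_run P (Suc t) \<sigma> = bind_pmf (mpc_run P t \<sigma>) (mpc_round P t)"

definition mpc_output :: "mpc \<Rightarrow> config \<Rightarrow> verdict pmf" where
  "mpc_output P \<sigma> =
     map_pmf (\<lambda>\<rho>. announce P (fst (\<rho> 0)) (snd (\<rho> 0))) (mpc_run P (rounds P) \<sigma>)"

definition fits :: "mpc \<Rightarrow> nat list \<Rightarrow> bool" where
  "fits P ws \<longleftrightarrow> length ws \<le> local_space P \<and> (\<forall>w\<in>set ws. w < 2 ^ word_bits P)"

definition mailbox_fits :: "mpc \<Rightarrow> mailbox \<Rightarrow> bool" where
  "mailbox_fits P b \<longleftrightarrow>
     (\<Sum>j<machines P. length (b j)) \<le> local_space P \<and>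
     (\<forall>j<machines P. \<forall>w\<in>set (b j). w < 2 ^ word_bits P) \<and>
     (\<forall>j\<ge>machines P. b j = [])"

text \<open>The limits have to be met for every outcome of the random choices, not just with high
  probability.\<close>

definition within_limits :: "mpc \<Rightarrow> config \<Rightarrow> bool" where
  "within_limits P \<sigma> \<longleftrightarrow>
     (\<forall>t\<le>rounds P. \<forall>\<rho>\<in>set_pmf (mpc_run P t \<sigma>). \<forall>i<machines P.
        fits P (fst (\<rho> i)) \<and> mailbox_fits P (snd (\<rho> i)) \<and>
        (t < rounds P \<longrightarrow>
          (\<forall>(mem, outbox)\<in>set_pmf (local_step P t i (fst (\<rho> i)) (snd (\<rho> i))).
             mailbox_fits P outbox)))"

text \<open>
  The input edges may be placed arbitrarily: machine \<open>i\<close> initially stores the edges listed in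
  \<open>es i\<close>, two words per edge and as many as its memory can hold. The condition on the lengths
  says that no edge is stored twice.
\<close>

definition initial_config :: "mpc \<Rightarrow> nat set set \<Rightarrow> config \<Rightarrow> bool" where
  "initial_config P E \<sigma> \<longleftrightarrow>
     (\<exists>es :: nat \<Rightarrow> (nat \<times> nat) list.
        (\<Union>i<machines P. (\<lambda>(u, v). {u, v}) ` set (es i)) = E \<and>
        (\<Sum>i<machines P. length (es i)) = card E \<and>
        (\<forall>i<machines P. 2 * length (es i) \<le> local_space P) \<and>
        (\<forall>i. \<sigma> i = (if i < machines P then concat (map (\<lambda>(u, v). [u, v]) (es i)) else [],
                     \<lambda>_. [])))"

text \<open>Enough room for the input, so that initial configurations exist.\<close>

definition can_store :: "mpc \<Rightarrow> nat \<Rightarrow> bool" where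
  "can_store P m \<longleftrightarrow> m \<le> machines P * (local_space P div 2)"

end

theory Submission
  imports Defs "HOL-Probability.Hoeffding" "HOL-Library.Nat_Bijection"
begin

text \<open>
  Let \<open>P\<close> be the transition matrix of the lazy random walk on \<open>G\<close> and \<open>L\<close> a power of two of order
  \<open>\<ell>\<close>. If \<open>G\<close> is an \<open>\<alpha>\<close>-vertex-expander, a Cheeger-type inequality bounds the spectral gap of \<open>P\<close>
  from below by a multiple of \<open>\<alpha>\<^sup>2 / d\<^sup>2\<close>, so that the trace of \<open>P\<^sup>L\<close> is at most \<open>1.1\<close>. If \<open>G\<close> is far
  from every \<open>\<alpha>\<^sup>*\<close>-vertex-expander, then \<open>G\<close> is not one itself; the walk rarely leaves a set that
  witnesses this within \<open>L\<close> steps, and the trace of \<open>P\<^sup>L\<close> is at least \<open>1.9\<close>.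

  The trace is the expected number of vertices to which a walk of length \<open>L\<close> returns. Start such a
  walk at every vertex and let walks that meet coalesce, that is, let step \<open>t\<close> be a random map
  \<open>\<phi>\<^sub>t\<close> on the vertices. The composition of \<open>\<phi>\<^sub>1, \<dots>, \<phi>\<^sub>L\<close> is computed by pointer doubling in \<open>log L\<close>
  phases, and its fixed points are counted. Distinct walks are independent until they meet, which
  bounds the second moment of the count; Hoeffding's inequality for truncated counts of
  \<open>O(log n)\<close> independent repetitions then separates the two cases.

  Each of the \<open>O(\<ell> log n)\<close> maps lives in its own copy of an array of \<open>N = s\<^sup>q = O(m)\<close> cells, \<open>s\<close> cells to
  a machine with \<open>s = O(n\<^sup>\<delta>)\<close>. As \<open>q\<close> is a constant, prefix sums, radix sort and table lookups in all
  copies take \<open>O(1)\<close> rounds. When \<open>\<alpha> > d\<close> or \<open>2 m < n\<close>, the graph cannot be an expander and nothing has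
  to be computed.
\<close>

section \<open>Powers of a symmetric stochastic kernel\<close>

text \<open>The limits on space and messages must hold for every outcome of the random choices, so
  many walkers sitting at one vertex must not cause congestion. Coalescence achieves this: a step of
  all walks is one table with \<open>n\<close> entries, whatever was drawn. It destroys the
  independence of walkers, but pairs that have not met still factorise, and a second moment involves
  only pairs. A second moment alone does not lead to failure probabilities \<open>1 / n ^ k\<close>,
  and a count may be as large as \<open>n\<close>, too large a range for Hoeffding's inequality;
  hence the truncation at \<open>10\<close>. The truncated mean is at most \<open>1.1\<close> in one
  case and at least \<open>1.7\<close> in the other, and the threshold \<open>1.4\<close> keeps a
  distance of \<open>0.3\<close> from both. The other obstacle is that data of arbitrary layout has
  to be moved by small machines. All movement is reduced to steps in which a cell receives at most
  one word and a machine sends at most \<open>2 * s\<close> words; this is shown for arbitrary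
  contents of the cells, separately from correctness.\<close>

locale kernel =
  fixes n :: nat and P :: "nat \<Rightarrow> nat \<Rightarrow> real"
  assumes P_nonneg: "\<And>u v. u < n \<Longrightarrow> v < n \<Longrightarrow> 0 \<le> P u v"
    and P_sym: "\<And>u v. u < n \<Longrightarrow> v < n \<Longrightarrow> P u v = P v u"
    and P_row: "\<And>u. u < n \<Longrightarrow> (\<Sum>v<n. P u v) = 1"
begin

primrec pw :: "nat \<Rightarrow> nat \<Rightarrow> nat \<Rightarrow> real" where
  "pw 0 u v = of_bool (u = v)"
| "pw (Suc t) u v = (\<Sum>x<n. pw t u x * P x v)"

lemma pw_nonneg: "u < n \<Longrightarrow> v < n \<Longrightarrow> 0 \<le> pw t u v"
  by (induction t arbitrary: v) (auto intro!: sum_nonneg mult_nonneg_nonneg P_nonneg)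

lemma pw_row: "u < n \<Longrightarrow> (\<Sum>v<n. pw t u v) = 1"
proof (induction t)
  case (Suc t)
  have "(\<Sum>v<n. pw (Suc t) u v) = (\<Sum>x<n. \<Sum>v<n. pw t u x * P x v)"
    by simp (rule sum.swap)
  also have "\<dots> = (\<Sum>x<n. pw t u x)"
    by (intro sum.cong refl) (simp add: P_row flip: sum_distrib_left)
  finally show ?case using Suc by simp
qed auto

lemma pw_add:
  assumes "u < n" "v < n"
  shows "pw (s + t) u v = (\<Sum>x<n. pw s u x * pw t x v)"
  using assms(2)
proof (induction t arbitrary: v)
  case (Suc t)
  have "pw (s + Suc t) u v = (\<Sum>y<n. (\<Sum>x<n. pw s u x * pw t x y) * P y v)"
    using Suc.IH by simp
  also have "\<dots> = (\<Sum>x<n. \<Sum>y<n. pw s u x * pw t x y * P y v)"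
    unfolding sum_distrib_right by (rule sum.swap)
  finally show ?case
    by (simp add: sum_distrib_left mult.assoc)
qed simp

lemma pw_one: "u < n \<Longrightarrow> v < n \<Longrightarrow> pw 1 u v = P u v"
  by (simp add: of_bool_def if_distrib[where f = "\<lambda>z. z * _"] sum.delta cong: if_cong)

lemma pw_sym: "u < n \<Longrightarrow> v < n \<Longrightarrow> pw t u v = pw t v u"
proof (induction t arbitrary: u v)
  case (Suc t)
  have "pw (Suc t) v u = pw (1 + t) v u"
    by simp
  also have "\<dots> = (\<Sum>x<n. pw 1 v x * pw t x u)"
    using Suc.prems by (subst pw_add) auto
  also have "\<dots> = (\<Sum>x<n. pw t u x * P x v)"
    using Suc by (intro sum.cong refl) (simp add: pw_one P_sym[of v] del: pw.simps One_nat_def)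
  finally show ?case by simp
qed auto

lemma pw_col: "v < n \<Longrightarrow> (\<Sum>u<n. pw t u v) = 1"
  using pw_row[of v t] pw_sym[of _ v t] by (metis (no_types, lifting) lessThan_iff sum.cong)

text \<open>\<open>pw t\<close> is symmetric, so the trace of the even power is the squared
  Frobenius norm of \<open>pw t\<close>. Both trace estimates start from this, which is why walk
  lengths appear in the form \<open>2 * t\<close>.\<close>

lemma trace_double: "(\<Sum>u<n. pw (2 * t) u u) = (\<Sum>u<n. \<Sum>v<n. (pw t u v)\<^sup>2)"
  unfolding mult_2
  by (intro sum.cong refl) (simp add: pw_add power2_eq_square pw_sym[of _ _ t])

text \<open>Each row of \<open>pw t\<close>, minus the uniform distribution, has sum zero, and every
  application of \<open>P\<close> shrinks its squared norm by the factor
  \<open>1 - \<gamma>\<close>. Summed over the \<open>n\<close> rows, the uniform parts give the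
  \<open>1\<close> and the deviations give the error term.\<close>

lemma trace_upper:
  fixes \<gamma> :: real
  assumes "n > 0"
    and contr: "\<And>h. (\<Sum>u<n. h u) = 0 \<Longrightarrow>
      (\<Sum>u<n. (\<Sum>x<n. h x * P x u)\<^sup>2) \<le> (1 - \<gamma>) * (\<Sum>u<n. (h u)\<^sup>2)"
    and \<gamma>: "\<gamma> \<le> 1"
  shows "(\<Sum>u<n. pw (2 * t) u u) \<le> 1 + n * (1 - \<gamma>) ^ t"
proof -
  have *: "(\<Sum>u<n. (pw t v u - 1 / n)\<^sup>2) \<le> (1 - \<gamma>) ^ t" if "v < n" for v
  proof (induction t)
    case 0
    have "(\<Sum>u<n. (pw 0 v u - 1 / n)\<^sup>2) = (\<Sum>u<n. of_bool (v = u) - 2 / n * of_bool (v = u) + 1 / n\<^sup>2)"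
      by (intro sum.cong refl) (auto simp: power2_eq_square algebra_simps)
    also have "\<dots> = 1 - 2 / n + n * (1 / n\<^sup>2)"
    proof -
      have "(\<Sum>u<n. of_bool (v = u)) = (1::real)"
        using that by (simp add: of_bool_def sum.delta)
      then show ?thesis
        unfolding sum.distrib sum_subtractf sum_distrib_left[symmetric] by simp
    qed
    also have "\<dots> \<le> 1"
      using \<open>n > 0\<close> by (simp add: power2_eq_square field_simps)
    finally show ?case by simp
  next
    case (Suc t)
    define h where "h = (\<lambda>u. pw t v u - 1 / n)"
    have "(\<Sum>u<n. h u) = 0"
      using that \<open>n > 0\<close> by (simp add: h_def sum_subtractf pw_row)
    from contr[OF this]
    have "(\<Sum>u<n. (\<Sum>x<n. h x * P x u)\<^sup>2) \<le> (1 - \<gamma>) * (1 - \<gamma>) ^ t"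
      using mult_left_mono[OF Suc, of "1 - \<gamma>"] \<gamma> by (simp add: h_def)
    moreover have "(\<Sum>x<n. h x * P x u) = pw (Suc t) v u - 1 / n" if "u < n" for u
    proof -
      have "(\<Sum>x<n. P x u) = 1"
        using P_row[OF that] P_sym that by (metis (no_types, lifting) lessThan_iff sum.cong)
      then show ?thesis
        by (simp add: h_def left_diff_distrib sum_subtractf flip: sum_divide_distrib)
    qed
    ultimately show ?case
      by simp
  qed
  have "(\<Sum>u<n. (pw t v u)\<^sup>2) \<le> 1 / n + (1 - \<gamma>) ^ t" if "v < n" for v
  proof -
    have "(\<Sum>u<n. (pw t v u - 1 / n)\<^sup>2) = (\<Sum>u<n. (pw t v u)\<^sup>2 - 2 / n * pw t v u + 1 / n\<^sup>2)"
      by (intro sum.cong refl) (auto simp: power2_eq_square algebra_simps)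
    also have "\<dots> = (\<Sum>u<n. (pw t v u)\<^sup>2) - 1 / n"
      using that \<open>n > 0\<close>
      unfolding sum.distrib sum_subtractf sum_distrib_left[symmetric]
      by (simp add: pw_row) (simp add: field_simps power2_eq_square)
    finally show ?thesis
      using *[OF that] by simp
  qed
  then have "(\<Sum>v<n. \<Sum>u<n. (pw t v u)\<^sup>2) \<le> (\<Sum>v<n. 1 / n + (1 - \<gamma>) ^ t)"
    by (intro sum_mono) auto
  also have "\<dots> = 1 + n * (1 - \<gamma>) ^ t"
    using \<open>n > 0\<close> by (simp add: distrib_left)
  finally show ?thesis
    by (simp add: trace_double)
qed

text \<open>One step loses from \<open>U\<close> the escape probability of \<open>x\<close> times
  the mass at \<open>x\<close>. As columns sum to one, this mass never exceeds one when a unit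
  starts at every vertex of \<open>U\<close>, so each step loses at most the total escape
  probability.\<close>

lemma stay_lower:
  assumes U: "U \<subseteq> {..<n}"
  shows "(\<Sum>u\<in>U. \<Sum>v\<in>U. pw t u v) \<ge> card U - t * (\<Sum>x\<in>U. \<Sum>y\<in>{..<n} - U. P x y)"
proof (induction t)
  case 0
  have "finite U" using U finite_subset by blast
  then show ?case by (simp add: of_bool_def sum.delta)
next
  case (Suc t)
  have fin: "finite U" using U finite_subset by blast
  define q where "q = (\<lambda>x. \<Sum>y\<in>{..<n} - U. P x y)"
  have q0: "0 \<le> q x" if "x < n" for x
    using that P_nonneg by (auto simp: q_def intro!: sum_nonneg)
  have q1: "(\<Sum>y\<in>U. P x y) = 1 - q x" if "x < n" for x
    using P_row[OF that] sum.subset_diff[OF U, of "P x"] by (simp add: q_def)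
  have "(\<Sum>u\<in>U. \<Sum>v\<in>U. pw (Suc t) u v) = (\<Sum>u\<in>U. \<Sum>x<n. \<Sum>v\<in>U. pw t u x * P x v)"
    by (rule sum.cong[OF refl]) (simp, rule sum.swap)
  also have "\<dots> \<ge> (\<Sum>u\<in>U. \<Sum>x\<in>U. \<Sum>v\<in>U. pw t u x * P x v)"
    by (intro sum_mono sum_mono2) (use U in \<open>auto intro!: sum_nonneg mult_nonneg_nonneg pw_nonneg P_nonneg\<close>)
  also have "(\<Sum>u\<in>U. \<Sum>x\<in>U. \<Sum>v\<in>U. pw t u x * P x v) = (\<Sum>u\<in>U. \<Sum>x\<in>U. pw t u x * (1 - q x))"
    using U by (intro sum.cong refl) (auto simp: q1 simp flip: sum_distrib_left)
  also have "\<dots> = (\<Sum>u\<in>U. \<Sum>x\<in>U. pw t u x) - (\<Sum>x\<in>U. \<Sum>u\<in>U. pw t u x * q x)"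
    by (simp add: sum_subtractf right_diff_distrib) (rule sum.swap)
  finally have 1: "(\<Sum>u\<in>U. \<Sum>v\<in>U. pw (Suc t) u v)
      \<ge> (\<Sum>u\<in>U. \<Sum>x\<in>U. pw t u x) - (\<Sum>x\<in>U. \<Sum>u\<in>U. pw t u x * q x)" .
  have "(\<Sum>x\<in>U. \<Sum>u\<in>U. pw t u x * q x) \<le> (\<Sum>x\<in>U. q x)"
  proof (rule sum_mono)
    fix x assume x: "x \<in> U"
    have "(\<Sum>u\<in>U. pw t u x) \<le> (\<Sum>u<n. pw t u x)"
      using U x by (intro sum_mono2) (auto intro!: pw_nonneg)
    also have "\<dots> = 1" using x U by (intro pw_col) auto
    finally show "(\<Sum>u\<in>U. pw t u x * q x) \<le> q x"
      using q0[of x] x U by (simp add: mult_left_le_one_le sum_nonneg pw_nonneg subset_iff flip: sum_distrib_right)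
  qed
  with 1 show ?case
    using Suc by (simp add: q_def algebra_simps)
qed

text \<open>Cauchy-Schwarz over all pairs in \<open>U\<close>: a block whose row sums are near one
  on average cannot have a small Frobenius norm.\<close>

lemma block_lower:
  fixes \<eta> :: real
  assumes U: "U \<subseteq> {..<n}" "U \<noteq> {}"
    and "(\<Sum>u\<in>U. \<Sum>v\<in>U. pw t u v) \<ge> card U * (1 - \<eta>)" "\<eta> \<le> 1"
  shows "(\<Sum>u\<in>U. \<Sum>v\<in>U. (pw t u v)\<^sup>2) \<ge> (1 - \<eta>)\<^sup>2"
proof -
  have fin: "finite U" using U finite_subset by blast
  have c: "card U > 0" using fin U by (simp add: card_gt_0_iff)
  have "(card U * (1 - \<eta>))\<^sup>2 \<le> (\<Sum>u\<in>U. \<Sum>v\<in>U. pw t u v)\<^sup>2"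
    using assms by (intro power_mono) auto
  also have "\<dots> = (\<Sum>z\<in>U\<times>U. pw t (fst z) (snd z) * 1)\<^sup>2"
    by (simp add: sum.cartesian_product case_prod_unfold)
  also have "\<dots> \<le> (\<Sum>z\<in>U\<times>U. (pw t (fst z) (snd z))\<^sup>2) * (\<Sum>z\<in>U\<times>U. 1\<^sup>2)"
    by (rule Cauchy_Schwarz_ineq_sum)
  also have "\<dots> = (\<Sum>u\<in>U. \<Sum>v\<in>U. (pw t u v)\<^sup>2) * (real (card U))\<^sup>2"
    by (simp add: sum.cartesian_product case_prod_unfold card_cartesian_product power2_eq_square)
  finally show ?thesis
    using c by (simp add: power_mult_distrib mult.commute)
qed

text \<open>Both diagonal blocks of \<open>pw t\<close>, on a set \<open>U\<close> that is hard to leave and on its complement,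
  contribute almost \<open>1\<close> to the trace of \<open>pw (2 * t)\<close>.\<close>

lemma trace_lower:
  fixes \<beta> :: real
  assumes U: "U \<subseteq> {..<n}" "U \<noteq> {}" "2 * card U \<le> n"
    and esc: "(\<Sum>x\<in>U. \<Sum>y\<in>{..<n} - U. P x y) \<le> \<beta> * card U" and b: "t * \<beta> \<le> 1" "0 \<le> \<beta>"
  shows "(\<Sum>u<n. pw (2 * t) u u) \<ge> 2 * (1 - t * \<beta>)\<^sup>2"
proof -
  define V where "V = {..<n} - U"
  have fin: "finite U" "finite V" using U finite_subset by (auto simp: V_def)
  have cV: "card V = n - card U" using U fin by (simp add: V_def card_Diff_subset)
  have cU: "card U > 0" using U fin by (simp add: card_gt_0_iff)
  have s1: "(\<Sum>u\<in>U. \<Sum>v\<in>U. pw t u v) \<ge> card U * (1 - t * \<beta>)"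
    using stay_lower[OF U(1), of t] mult_left_mono[OF esc, of t] by (simp add: algebra_simps)
  \<comment> \<open>The kernel is doubly stochastic, so the mass that enters \<open>U\<close> from
    \<open>V\<close> equals the mass that leaves \<open>U\<close>. The loss of the larger side
    \<open>V\<close> is thereby bounded by that of \<open>U\<close>.\<close>
  have UV: "(\<Sum>u\<in>U. \<Sum>v\<in>U. pw t u v) + (\<Sum>u\<in>V. \<Sum>v\<in>U. pw t u v) = card U"
  proof -
    have "(\<Sum>u<n. \<Sum>v\<in>U. pw t u v) = (\<Sum>v\<in>U. \<Sum>u<n. pw t u v)" by (rule sum.swap)
    also have "\<dots> = card U" using U by (simp add: pw_col subset_iff)
    finally show ?thesis
      using sum.subset_diff[OF U(1), of "\<lambda>u. \<Sum>v\<in>U. pw t u v"] by (simp add: V_def)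
  qed
  have "(\<Sum>u\<in>V. \<Sum>v\<in>U. pw t u v) + (\<Sum>u\<in>V. \<Sum>v\<in>V. pw t u v) = (\<Sum>u\<in>V. \<Sum>v<n. pw t u v)"
    unfolding sum.distrib[symmetric] V_def
    by (intro sum.cong refl) (simp add: sum.subset_diff[OF U(1)])
  also have "\<dots> = card V" by (simp add: V_def pw_row)
  finally have "(\<Sum>u\<in>V. \<Sum>v\<in>V. pw t u v) \<ge> card V - card U * (t * \<beta>)"
    using s1 UV by (simp add: algebra_simps)
  moreover have "card U * (t * \<beta>) \<le> card V * (t * \<beta>)"
    using U cV b by (intro mult_right_mono) auto
  ultimately have s2: "(\<Sum>u\<in>V. \<Sum>v\<in>V. pw t u v) \<ge> card V * (1 - t * \<beta>)"
    by (simp add: algebra_simps)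
  have "V \<noteq> {}" using cV cU U by auto
  have "2 * (1 - t * \<beta>)\<^sup>2 \<le> (\<Sum>u\<in>U. \<Sum>v\<in>U. (pw t u v)\<^sup>2) + (\<Sum>u\<in>V. \<Sum>v\<in>V. (pw t u v)\<^sup>2)"
    using block_lower[OF U(1,2) s1 b(1)] block_lower[OF _ \<open>V \<noteq> {}\<close> s2 b(1)] by (simp add: V_def)
  also have "\<dots> \<le> (\<Sum>u\<in>U. \<Sum>v<n. (pw t u v)\<^sup>2) + (\<Sum>u\<in>V. \<Sum>v<n. (pw t u v)\<^sup>2)"
    using U by (intro add_mono sum_mono sum_mono2) (auto simp: V_def)
  also have "\<dots> = (\<Sum>u<n. \<Sum>v<n. (pw t u v)\<^sup>2)"
    using sum.subset_diff[OF U(1), of "\<lambda>u. \<Sum>v<n. (pw t u v)\<^sup>2"] by (simp add: V_def)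
  finally show ?thesis by (simp add: trace_double)
qed

text \<open>For a lazy kernel, \<open>\<parallel>Pf\<parallel>\<^sup>2 \<le> \<langle>f, Pf\<rangle>\<close>: write \<open>P = (I + Q) / 2\<close> with a stochastic contraction \<open>Q\<close>.\<close>

lemma lazy_contraction:
  assumes lazy: "\<And>u. u < n \<Longrightarrow> P u u \<ge> 1 / 2"
  shows "(\<Sum>u<n. (\<Sum>x<n. h x * P x u)\<^sup>2) \<le> (\<Sum>u<n. h u * (\<Sum>x<n. h x * P x u))"
proof -
  define Q where "Q = (\<lambda>x u. 2 * P x u - of_bool (x = u))"
  define r where "r = (\<lambda>u. \<Sum>x<n. h x * Q x u)"
  have Q0: "0 \<le> Q x u" if "x < n" "u < n" for x u
    using lazy[of x] P_nonneg that by (auto simp: Q_def)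
  have Pcol: "(\<Sum>x<n. P x u) = 1" if "u < n" for u
    using P_row[OF that] P_sym that by (metis (no_types, lifting) lessThan_iff sum.cong)
  have Qcol: "(\<Sum>x<n. Q x u) = 1" if "u < n" for u
    using that Pcol[OF that] by (simp add: Q_def sum_subtractf of_bool_def sum.delta flip: sum_distrib_left)
  have Qrow: "(\<Sum>u<n. Q x u) = 1" if "x < n" for x
    using that P_row[OF that] by (simp add: Q_def sum_subtractf of_bool_def sum.delta flip: sum_distrib_left)
  have r: "(\<Sum>x<n. h x * P x u) = (h u + r u) / 2" if "u < n" for u
  proof -
    have "r u = 2 * (\<Sum>x<n. h x * P x u) - (\<Sum>x<n. h x * of_bool (x = u))"
      by (simp add: r_def Q_def right_diff_distrib sum_subtractf sum_distrib_left mult_ac)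
    also have "(\<Sum>x<n. h x * of_bool (x = u)) = h u"
      using that by (simp add: of_bool_def if_distrib sum.delta cong: if_cong)
    finally show ?thesis by simp
  qed
  \<comment> \<open>Jensen's inequality for the weights \<open>Q x u\<close>, as Cauchy-Schwarz with
    the square roots of the weights.\<close>
  have "(r u)\<^sup>2 \<le> (\<Sum>x<n. (h x)\<^sup>2 * Q x u)" if "u < n" for u
  proof -
    have "(r u)\<^sup>2 = (\<Sum>x<n. (h x * sqrt (Q x u)) * sqrt (Q x u))\<^sup>2"
      unfolding r_def using Q0 that by (intro arg_cong[where f = "\<lambda>z. z\<^sup>2"] sum.cong refl) (auto simp: mult.assoc)
    also have "\<dots> \<le> (\<Sum>x<n. (h x * sqrt (Q x u))\<^sup>2) * (\<Sum>x<n. (sqrt (Q x u))\<^sup>2)"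
      by (rule Cauchy_Schwarz_ineq_sum)
    also have "(\<Sum>x<n. (sqrt (Q x u))\<^sup>2) = 1"
      using Q0 that Qcol by simp
    also have "(\<Sum>x<n. (h x * sqrt (Q x u))\<^sup>2) = (\<Sum>x<n. (h x)\<^sup>2 * Q x u)"
      using Q0 that by (simp add: power_mult_distrib)
    finally show ?thesis by simp
  qed
  then have "(\<Sum>u<n. (r u)\<^sup>2) \<le> (\<Sum>u<n. \<Sum>x<n. (h x)\<^sup>2 * Q x u)"
    by (intro sum_mono) auto
  also have "\<dots> = (\<Sum>x<n. \<Sum>u<n. (h x)\<^sup>2 * Q x u)" by (rule sum.swap)
  also have "\<dots> = (\<Sum>x<n. (h x)\<^sup>2)" using Qrow by (simp flip: sum_distrib_left)
  finally have "0 \<le> (\<Sum>u<n. (h u)\<^sup>2 - (r u)\<^sup>2)" by (simp add: sum_subtractf)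
  also have "\<dots> = 4 * (\<Sum>u<n. h u * ((h u + r u) / 2) - ((h u + r u) / 2)\<^sup>2)"
    unfolding sum_distrib_left by (intro sum.cong refl) (simp add: power2_eq_square field_simps)
  finally have "(\<Sum>u<n. ((h u + r u) / 2)\<^sup>2) \<le> (\<Sum>u<n. h u * ((h u + r u) / 2))"
    by (simp add: sum_subtractf)
  also have "(\<Sum>u<n. h u * ((h u + r u) / 2)) = (\<Sum>u<n. h u * (\<Sum>x<n. h x * P x u))"
    by (intro sum.cong refl arg_cong2[where f = "(*)"]) (simp add: r)
  also have "(\<Sum>u<n. ((h u + r u) / 2)\<^sup>2) = (\<Sum>u<n. (\<Sum>x<n. h x * P x u)\<^sup>2)"
    by (intro sum.cong refl arg_cong[where f = "\<lambda>z. z\<^sup>2"]) (simp add: r)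
  finally show ?thesis .
qed

end

section \<open>The lazy random walk on a graph of bounded degree\<close>

locale lazy_walk =
  fixes n d :: nat and E :: "nat set set"
  assumes graph: "ugraph {..<n} E"
    and d_pos: "0 < d"
    and degree_le: "\<And>u. u < n \<Longrightarrow> card {v. {u, v} \<in> E} \<le> d"
begin

definition adj :: "nat \<Rightarrow> nat \<Rightarrow> real" where
  "adj u v = of_bool ({u, v} \<in> E)"

text \<open>Every edge has probability \<open>1 / (2 * d)\<close>, whatever the degrees of its ends:
  this makes the kernel symmetric and the holding probability at least one half.\<close>

definition P :: "nat \<Rightarrow> nat \<Rightarrow> real" where
  "P u v = (if u = v then 1 - (\<Sum>x<n. adj u x) / (2 * d) else adj u v / (2 * d))"

lemma adj_sym: "adj u v = adj v u"
  by (simp add: adj_def insert_commute)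

lemma adj_nonneg: "0 \<le> adj u v"
  by (simp add: adj_def)

lemma edge_bounds: "{u, v} \<in> E \<Longrightarrow> u < n \<and> v < n \<and> u \<noteq> v"
  using graph by (auto simp: ugraph_def)

lemma adj_self: "adj u u = 0"
  using edge_bounds[of u u] by (auto simp: adj_def)

lemma sum_adj: "(\<Sum>v<n. adj u v) = card {v. {u, v} \<in> E}"
proof -
  have "{..<n} \<inter> {v. {u, v} \<in> E} = {v. {u, v} \<in> E}" using edge_bounds by blast
  then show ?thesis by (simp add: adj_def)
qed

lemma sum_adj_le: "u < n \<Longrightarrow> (\<Sum>v<n. adj u v) \<le> d"
  using degree_le by (simp add: sum_adj)

sublocale kernel n P
proof
  show "0 \<le> P u v" if "u < n" "v < n" for u v
    using sum_adj_le[OF that(1)] d_pos by (auto simp: P_def adj_nonneg field_simps)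
  show "P u v = P v u" for u v by (simp add: P_def adj_sym)
  show "(\<Sum>v<n. P u v) = 1" if "u < n" for u
  proof -
    have "(\<Sum>v<n. P u v) = (\<Sum>v<n. (if u = v then 1 - (\<Sum>x<n. adj u x) / (2 * d) else 0) + adj u v / (2 * d))"
      by (intro sum.cong refl) (auto simp: P_def adj_self)
    then show ?thesis
      using that by (simp add: sum.distrib sum.delta flip: sum_divide_distrib)
  qed
qed

lemma P_lazy: "u < n \<Longrightarrow> P u u \<ge> 1 / 2"
  using sum_adj_le[of u] d_pos by (simp add: P_def field_simps)

definition energy :: "(nat \<Rightarrow> real) \<Rightarrow> real" where
  "energy f = (\<Sum>u<n. \<Sum>v<n. adj u v * (f u - f v)\<^sup>2)"

text \<open>\<open>energy\<close> ranges over ordered pairs and counts every edge twice, hence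
  \<open>4 * d\<close> where the transition probabilities have \<open>2 * d\<close>.\<close>

lemma energy_eq: "(\<Sum>u<n. h u * (\<Sum>x<n. h x * P x u)) = (\<Sum>u<n. (h u)\<^sup>2) - energy h / (4 * d)"
proof -
  have 1: "(\<Sum>x<n. h x * P x u) = h u - (\<Sum>x<n. adj u x * (h u - h x)) / (2 * d)" if "u < n" for u
  proof -
    have "(\<Sum>x<n. h x * P x u)
        = (\<Sum>x<n. (if u = x then h u * (1 - (\<Sum>x<n. adj u x) / (2 * d)) else 0) + adj u x * h x / (2 * d))"
      by (intro sum.cong refl) (auto simp: P_def adj_self adj_sym)
    also have "\<dots> = h u * (1 - (\<Sum>x<n. adj u x) / (2 * d)) + (\<Sum>x<n. adj u x * h x) / (2 * d)"
      using that by (simp add: sum.distrib sum.delta sum_divide_distrib)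
    also have "\<dots> = h u - (\<Sum>x<n. adj u x * (h u - h x)) / (2 * d)"
      by (simp add: right_diff_distrib sum_subtractf diff_divide_distrib mult.commute[of "h u"] flip: sum_distrib_right)
    finally show ?thesis .
  qed
  have e1: "(\<Sum>u<n. \<Sum>v<n. h v * adj u v * (h u - h v)) = - (\<Sum>u<n. \<Sum>v<n. h u * adj u v * (h u - h v))"
    by (subst sum.swap) (simp add: adj_sym algebra_simps flip: sum_negf)
  have "energy h = (\<Sum>u<n. \<Sum>v<n. h u * adj u v * (h u - h v) - h v * adj u v * (h u - h v))"
    unfolding energy_def by (intro sum.cong refl) (simp add: power2_eq_square algebra_simps)
  also have "\<dots> = 2 * (\<Sum>u<n. \<Sum>v<n. h u * adj u v * (h u - h v))"
    by (simp add: sum_subtractf e1)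
  finally have e: "energy h = 2 * (\<Sum>u<n. h u * (\<Sum>v<n. adj u v * (h u - h v)))"
    by (simp add: sum_distrib_left mult_ac)
  have "(\<Sum>u<n. h u * (\<Sum>x<n. h x * P x u))
      = (\<Sum>u<n. (h u)\<^sup>2 - h u * (\<Sum>x<n. adj u x * (h u - h x)) / (2 * d))"
    by (intro sum.cong refl) (simp add: 1 power2_eq_square algebra_simps)
  also have "\<dots> = (\<Sum>u<n. (h u)\<^sup>2) - (\<Sum>u<n. h u * (\<Sum>x<n. adj u x * (h u - h x))) / (2 * d)"
    by (simp add: sum_subtractf flip: sum_divide_distrib)
  finally show ?thesis
    using d_pos by (simp add: e)
qed

end

section \<open>A Cheeger-type inequality for vertex expanders\<close>

locale expander_walk = lazy_walk +
  fixes \<alpha> :: real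
  assumes expander: "vertex_expander {..<n} E \<alpha>" and \<alpha>_pos: "0 < \<alpha>"
begin

text \<open>Every outer neighbour of \<open>S\<close> is the end of at least one cut edge. Vertex
  expansion enters the spectral bound only here; afterwards edge expansion is enough.\<close>

lemma boundary_ge:
  assumes "S \<subseteq> {..<n}" "2 * card S \<le> n"
  shows "(\<Sum>u\<in>S. \<Sum>v\<in>{..<n} - S. adj u v) \<ge> \<alpha> * card S"
proof -
  have fin: "finite S" using assms finite_subset by blast
  let ?N = "nbhd E S ({..<n} - S)"
  have N: "?N \<subseteq> {..<n} - S" by (auto simp: nbhd_def)
  have "\<alpha> * card S \<le> (\<Sum>v\<in>?N. 1)"
    using expander assms by (auto simp: vertex_expander_def)
  also have "\<dots> \<le> (\<Sum>v\<in>?N. \<Sum>u\<in>S. adj u v)"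
  proof (rule sum_mono)
    fix v assume "v \<in> ?N"
    then obtain u where "u \<in> S" "{u, v} \<in> E" by (auto simp: nbhd_def)
    then show "1 \<le> (\<Sum>u\<in>S. adj u v)"
      using member_le_sum[of u S "\<lambda>u. adj u v"] fin by (simp add: adj_def)
  qed
  also have "\<dots> \<le> (\<Sum>v\<in>{..<n} - S. \<Sum>u\<in>S. adj u v)"
    using N by (intro sum_mono2) (auto intro!: sum_nonneg adj_nonneg)
  finally show ?thesis by (subst sum.swap)
qed

text \<open>Co-area inequality, by peeling off level sets from below.\<close>

lemma coarea:
  assumes "\<And>u. u < n \<Longrightarrow> 0 \<le> a u" "2 * card {u. u < n \<and> a u \<noteq> 0} \<le> n"
  shows "(\<Sum>u<n. \<Sum>v<n. adj u v * \<bar>a u - a v\<bar>) \<ge> 2 * \<alpha> * (\<Sum>u<n. a u)"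
  using assms
proof (induction "card {u. u < n \<and> a u \<noteq> 0}" arbitrary: a rule: less_induct)
  case less
  define S where "S = {u. u < n \<and> a u \<noteq> 0}"
  have S: "S \<subseteq> {..<n}" "finite S" "2 * card S \<le> n" using less.prems by (auto simp: S_def)
  show ?case
  proof (cases "S = {}")
    case True
    then have "(\<Sum>u<n. a u) = 0" by (intro sum.neutral) (auto simp: S_def)
    then show ?thesis by (simp add: sum_nonneg adj_nonneg)
  next
    case False
    define \<mu> where "\<mu> = Min (a ` S)"
    have \<mu>: "\<mu> \<in> a ` S" using S False by (auto simp: \<mu>_def)
    have \<mu>le: "\<mu> \<le> a u" if "u \<in> S" for u using S that by (simp add: \<mu>_def)
    have \<mu>0: "0 \<le> \<mu>" using \<mu> less.prems(1) by (auto simp: S_def)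
    define b where "b = (\<lambda>u. a u - \<mu> * of_bool (u \<in> S))"
    have b0: "0 \<le> b u" if "u < n" for u
      using \<mu>le[of u] less.prems(1)[OF that] by (auto simp: b_def)
    have sub: "{u. u < n \<and> b u \<noteq> 0} \<subset> S"
      using \<mu> by (auto simp: b_def S_def)
    then have lt: "card {u. u < n \<and> b u \<noteq> 0} < card S"
      using S by (intro psubset_card_mono)
    have IH: "(\<Sum>u<n. \<Sum>v<n. adj u v * \<bar>b u - b v\<bar>) \<ge> 2 * \<alpha> * (\<Sum>u<n. b u)"
      using lt S b0 by (intro less.hyps) (auto simp: S_def)
    \<comment> \<open>Only pairs separated by \<open>S\<close> change their distance, by exactly
      \<open>\<mu>\<close>: outside \<open>S\<close> both functions vanish, and on \<open>S\<close>
      they differ by the constant \<open>\<mu>\<close>, the least value of \<open>a\<close>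
      there.\<close>
    have ab: "\<bar>a u - a v\<bar> = \<bar>b u - b v\<bar> + \<mu> * (of_bool (u \<in> S \<and> v \<notin> S) + of_bool (v \<in> S \<and> u \<notin> S))"
      if "u < n" "v < n" for u v
      using that \<mu>le[of u] \<mu>le[of v] \<mu>0 less.prems(1)[of u] less.prems(1)[of v]
      by (cases "u \<in> S"; cases "v \<in> S") (auto simp: b_def S_def)
    have cut: "(\<Sum>u<n. \<Sum>v<n. adj u v * of_bool (u \<in> S \<and> v \<notin> S)) = (\<Sum>u\<in>S. \<Sum>v\<in>{..<n} - S. adj u v)"
    proof -
      have "(\<Sum>u<n. \<Sum>v<n. adj u v * of_bool (u \<in> S \<and> v \<notin> S)) = (\<Sum>u\<in>S. \<Sum>v<n. adj u v * of_bool (u \<in> S \<and> v \<notin> S))"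
        using S by (intro sum.mono_neutral_right) auto
      also have "\<dots> = (\<Sum>u\<in>S. \<Sum>v\<in>{..<n} - S. adj u v * of_bool (u \<in> S \<and> v \<notin> S))"
        using S by (intro sum.cong refl sum.mono_neutral_right) auto
      finally show ?thesis by simp
    qed
    have cut': "(\<Sum>u<n. \<Sum>v<n. adj u v * of_bool (v \<in> S \<and> u \<notin> S)) = (\<Sum>u\<in>S. \<Sum>v\<in>{..<n} - S. adj u v)"
      by (subst sum.swap) (simp add: cut[symmetric] adj_sym)
    have "(\<Sum>u<n. \<Sum>v<n. adj u v * \<bar>a u - a v\<bar>) = (\<Sum>u<n. \<Sum>v<n. adj u v * \<bar>b u - b v\<bar>
        + \<mu> * (adj u v * of_bool (u \<in> S \<and> v \<notin> S)) + \<mu> * (adj u v * of_bool (v \<in> S \<and> u \<notin> S)))"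
      by (intro sum.cong refl) (simp add: ab algebra_simps)
    also have "\<dots> = (\<Sum>u<n. \<Sum>v<n. adj u v * \<bar>b u - b v\<bar>) + 2 * \<mu> * (\<Sum>u\<in>S. \<Sum>v\<in>{..<n} - S. adj u v)"
      unfolding sum.distrib sum_distrib_left[symmetric] cut cut' by simp
    also have "\<dots> \<ge> 2 * \<alpha> * (\<Sum>u<n. b u) + 2 * \<mu> * (\<alpha> * card S)"
      using IH boundary_ge[OF S(1,3)] \<mu>0 by (intro add_mono mult_left_mono) auto
    also have "2 * \<alpha> * (\<Sum>u<n. b u) + 2 * \<mu> * (\<alpha> * card S) = 2 * \<alpha> * (\<Sum>u<n. a u)"
    proof -
      have "(\<Sum>u<n. of_bool (u \<in> S)) = real (card S)"
        using S by (simp add: Int_absorb1)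
      then show ?thesis
        by (simp add: b_def sum_subtractf algebra_simps flip: sum_distrib_left)
    qed
    finally show ?thesis by simp
  qed
qed

text \<open>The co-area inequality is applied to the square of \<open>g\<close>; the differences of
  squares are factorised, and Cauchy-Schwarz splits off the energy from the sum of the
  \<open>(g u + g v)^2\<close>, which the degree bound limits to \<open>4 * d\<close> times the
  squared norm.\<close>

lemma energy_ge_half:
  assumes "\<And>u. u < n \<Longrightarrow> 0 \<le> g u" "2 * card {u. u < n \<and> g u \<noteq> 0} \<le> n"
  shows "energy g \<ge> \<alpha>\<^sup>2 / d * (\<Sum>u<n. (g u)\<^sup>2)"
proof -
  define G where "G = (\<Sum>u<n. (g u)\<^sup>2)"
  have G0: "0 \<le> G" by (simp add: G_def sum_nonneg)
  let ?V = "{..<n} \<times> {..<n}"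
  have s: "(\<Sum>u<n. \<Sum>v<n. f u v) = (\<Sum>z\<in>?V. f (fst z) (snd z))" for f :: "nat \<Rightarrow> nat \<Rightarrow> real"
    by (simp add: sum.cartesian_product case_prod_unfold)
  have adj2: "adj u v * adj u v = adj u v" for u v by (simp add: adj_def)
  have "2 * \<alpha> * G \<le> (\<Sum>u<n. \<Sum>v<n. adj u v * \<bar>(g u)\<^sup>2 - (g v)\<^sup>2\<bar>)"
    unfolding G_def by (rule coarea) (use assms in auto)
  also have "\<dots> = (\<Sum>u<n. \<Sum>v<n. (adj u v * \<bar>g u - g v\<bar>) * (adj u v * (g u + g v)))"
  proof (intro sum.cong refl)
    fix u v assume "u \<in> {..<n}" "v \<in> {..<n}"
    then have "\<bar>(g u)\<^sup>2 - (g v)\<^sup>2\<bar> = \<bar>g u - g v\<bar> * (g u + g v)"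
      using assms(1)[of u] assms(1)[of v] by (simp add: power2_eq_square square_diff_square_factored abs_mult)
    then show "adj u v * \<bar>(g u)\<^sup>2 - (g v)\<^sup>2\<bar> = (adj u v * \<bar>g u - g v\<bar>) * (adj u v * (g u + g v))"
      using adj2[of u v] by (simp add: adj_def)
  qed
  finally have "(2 * \<alpha> * G)\<^sup>2 \<le> (\<Sum>u<n. \<Sum>v<n. (adj u v * \<bar>g u - g v\<bar>) * (adj u v * (g u + g v)))\<^sup>2"
    using G0 \<alpha>_pos by (intro power_mono) auto
  also have "\<dots> \<le> (\<Sum>u<n. \<Sum>v<n. (adj u v * \<bar>g u - g v\<bar>)\<^sup>2) * (\<Sum>u<n. \<Sum>v<n. (adj u v * (g u + g v))\<^sup>2)"
    unfolding s by (rule Cauchy_Schwarz_ineq_sum)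
  also have "(\<Sum>u<n. \<Sum>v<n. (adj u v * \<bar>g u - g v\<bar>)\<^sup>2) = energy g"
    unfolding energy_def by (intro sum.cong refl) (auto simp: adj_def power_mult_distrib)
  also have "energy g * (\<Sum>u<n. \<Sum>v<n. (adj u v * (g u + g v))\<^sup>2) \<le> energy g * (4 * d * G)"
  proof (rule mult_left_mono)
    have "(\<Sum>u<n. \<Sum>v<n. (adj u v * (g u + g v))\<^sup>2) \<le> (\<Sum>u<n. \<Sum>v<n. 2 * (adj u v * (g u)\<^sup>2) + 2 * (adj u v * (g v)\<^sup>2))"
    proof (intro sum_mono)
      fix u v
      have "(g u + g v)\<^sup>2 \<le> 2 * (g u)\<^sup>2 + 2 * (g v)\<^sup>2"
        using zero_le_power2[of "g u - g v"] by (simp add: power2_eq_square algebra_simps)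
      then show "(adj u v * (g u + g v))\<^sup>2 \<le> 2 * (adj u v * (g u)\<^sup>2) + 2 * (adj u v * (g v)\<^sup>2)"
        by (simp add: adj_def)
    qed
    also have "\<dots> = 4 * (\<Sum>u<n. \<Sum>v<n. adj u v * (g u)\<^sup>2)"
    proof -
      have "(\<Sum>u<n. \<Sum>v<n. adj u v * (g v)\<^sup>2) = (\<Sum>u<n. \<Sum>v<n. adj u v * (g u)\<^sup>2)"
        by (subst sum.swap) (simp add: adj_sym)
      then show ?thesis by (simp add: sum.distrib flip: sum_distrib_left)
    qed
    also have "\<dots> \<le> 4 * (\<Sum>u<n. d * (g u)\<^sup>2)"
      using sum_adj_le by (intro mult_left_mono sum_mono) (auto intro!: mult_right_mono simp flip: sum_distrib_right)
    finally show "(\<Sum>u<n. \<Sum>v<n. (adj u v * (g u + g v))\<^sup>2) \<le> 4 * d * G"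
      by (simp add: G_def mult.assoc flip: sum_distrib_left)
    show "0 \<le> energy g" by (auto simp: energy_def intro!: sum_nonneg mult_nonneg_nonneg adj_nonneg)
  qed
  finally have *: "G * (\<alpha>\<^sup>2 * G) \<le> G * (energy g * d)"
    by (simp add: power2_eq_square algebra_simps)
  have "\<alpha>\<^sup>2 * G \<le> energy g * d"
  proof (cases "G = 0")
    case False
    then show ?thesis using * G0 by simp
  next
    case True
    then show ?thesis by (auto simp: energy_def intro!: sum_nonneg mult_nonneg_nonneg adj_nonneg)
  qed
  then show ?thesis
    using d_pos by (simp add: G_def field_simps)
qed

text \<open>\<open>m\<close> is the least value of \<open>f\<close> with at most half of the
  vertices strictly above it. The next smaller value \<open>y\<close> has more than half above it,
  which leaves less than half for the vertices below \<open>m\<close>.\<close>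

lemma median_exists:
  fixes f :: "nat \<Rightarrow> real"
  shows "\<exists>m. 2 * card {u. u < n \<and> m < f u} \<le> n \<and> 2 * card {u. u < n \<and> f u < m} \<le> n"
proof (cases "n = 0")
  case False
  define T where "T = {x \<in> f ` {..<n}. 2 * card {u. u < n \<and> x < f u} \<le> n}"
  have "Max (f ` {..<n}) \<in> T"
  proof -
    have "{u. u < n \<and> Max (f ` {..<n}) < f u} = {}"
      by (auto simp: not_less intro!: Max_ge)
    then have "card {u. u < n \<and> Max (f ` {..<n}) < f u} = 0" by (metis card.empty)
    moreover have "Max (f ` {..<n}) \<in> f ` {..<n}" using False by (intro Max_in) auto
    ultimately show ?thesis unfolding T_def mem_Collect_eq by (metis mult_0_right zero_le)
  qed
  then have T: "T \<noteq> {}" "finite T" by (auto simp: T_def)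
  define m where "m = Min T"
  have mT: "m \<in> T" using T by (simp add: m_def)
  have "2 * card {u. u < n \<and> f u < m} \<le> n"
  proof (cases "{u. u < n \<and> f u < m} = {}")
    case True
    then show ?thesis by (metis card.empty mult_zero_right zero_le)
  next
    case False
    define B where "B = {u. u < n \<and> f u < m}"
    define y where "y = Max (f ` B)"
    have B: "finite B" "B \<noteq> {}" using False by (auto simp: B_def)
    have y: "y \<in> f ` B" using B by (auto simp: y_def)
    then have "y < m" by (auto simp: B_def)
    then have "y \<notin> T" using Min_le[OF T(2), of y] by (auto simp: m_def)
    then have 1: "2 * card {u. u < n \<and> y < f u} > n"
      using y by (auto simp: T_def B_def)
    have "{u. u < n \<and> y < f u} \<inter> B = {}"
      using B by (auto simp: y_def)
    then have "card {u. u < n \<and> y < f u} + card B = card ({u. u < n \<and> y < f u} \<union> B)"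
      using B by (subst card_Un_disjoint) auto
    also have "\<dots> \<le> card {..<n}" by (intro card_mono) (auto simp: B_def)
    finally show ?thesis using 1 by (simp add: B_def)
  qed
  then show ?thesis using mT by (auto simp: T_def)
qed auto

text \<open>A shift by a median splits \<open>f\<close> into a positive and a negative part, each
  supported on at most half of the vertices. The shift cannot decrease the norm because
  \<open>f\<close> has mean zero. Between any two vertices the changes of the two parts never have
  the same sign, so their energies add up to at most that of \<open>f\<close>.\<close>

lemma energy_ge:
  assumes "(\<Sum>u<n. f u) = 0"
  shows "energy f \<ge> \<alpha>\<^sup>2 / d * (\<Sum>u<n. (f u)\<^sup>2)"
proof -
  obtain m where m: "2 * card {u. u < n \<and> m < f u} \<le> n" "2 * card {u. u < n \<and> f u < m} \<le> n"
    using median_exists by blast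
  define g h where "g = (\<lambda>u. max 0 (f u - m))" and "h = (\<lambda>u. max 0 (m - f u))"
  have sets: "{u. u < n \<and> g u \<noteq> 0} = {u. u < n \<and> m < f u}" "{u. u < n \<and> h u \<noteq> 0} = {u. u < n \<and> f u < m}"
    by (auto simp: g_def h_def)
  have g: "energy g \<ge> \<alpha>\<^sup>2 / d * (\<Sum>u<n. (g u)\<^sup>2)"
    by (rule energy_ge_half) (use m sets in \<open>auto simp: g_def\<close>)
  have h: "energy h \<ge> \<alpha>\<^sup>2 / d * (\<Sum>u<n. (h u)\<^sup>2)"
    by (rule energy_ge_half) (use m sets in \<open>auto simp: h_def\<close>)
  have "(\<Sum>u<n. (f u)\<^sup>2) \<le> (\<Sum>u<n. (f u)\<^sup>2) - 2 * m * (\<Sum>u<n. f u) + n * m\<^sup>2"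
    using assms by simp
  also have "\<dots> = (\<Sum>u<n. (f u - m)\<^sup>2)"
    by (simp add: power2_eq_square algebra_simps sum.distrib sum_subtractf sum_distrib_left)
  also have "\<dots> = (\<Sum>u<n. (g u)\<^sup>2) + (\<Sum>u<n. (h u)\<^sup>2)"
    unfolding sum.distrib[symmetric]
    by (intro sum.cong refl) (auto simp: g_def h_def max_def power2_eq_square algebra_simps)
  finally have "\<alpha>\<^sup>2 / d * (\<Sum>u<n. (f u)\<^sup>2) \<le> \<alpha>\<^sup>2 / d * ((\<Sum>u<n. (g u)\<^sup>2) + (\<Sum>u<n. (h u)\<^sup>2))"
    by (intro mult_left_mono) auto
  also have "\<dots> \<le> energy g + energy h"
    using g h by (simp add: distrib_left)
  also have "\<dots> \<le> energy f"
    unfolding energy_def sum.distrib[symmetric]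
  proof (intro sum_mono)
    fix u v
    have "(g u - g v)\<^sup>2 + (h u - h v)\<^sup>2 \<le> (f u - f v)\<^sup>2"
    proof -
      have "f u - f v = (g u - g v) - (h u - h v)" by (simp add: g_def h_def)
      moreover have "(g u - g v) * (h u - h v) \<le> 0"
        by (auto simp: g_def h_def max_def mult_le_0_iff)
      moreover have "(x - y)\<^sup>2 = x\<^sup>2 + y\<^sup>2 - 2 * (x * y)" for x y :: real
        by (simp add: power2_eq_square algebra_simps)
      ultimately show ?thesis by simp
    qed
    then show "adj u v * (g u - g v)\<^sup>2 + adj u v * (h u - h v)\<^sup>2 \<le> adj u v * (f u - f v)\<^sup>2"
      using mult_left_mono[OF _ adj_nonneg] by (simp flip: distrib_left)
  qed
  finally show ?thesis .
qed

text \<open>By laziness the squared norm contracts as fast as the quadratic form. Its loss is the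
  energy bound \<open>\<alpha>^2 / d\<close> divided by the \<open>4 * d\<close> of
  \<open>energy_eq\<close>, and \<open>\<alpha> \<le> d\<close> keeps this gap below one.\<close>

lemma trace_expander:
  assumes "0 < n" "\<alpha> \<le> d"
  shows "(\<Sum>u<n. pw (2 * t) u u) \<le> 1 + n * (1 - \<alpha>\<^sup>2 / (4 * (real d)\<^sup>2)) ^ t"
proof (rule trace_upper)
  fix h :: "nat \<Rightarrow> real" assume h: "(\<Sum>u<n. h u) = 0"
  have "(\<Sum>u<n. (\<Sum>x<n. h x * P x u)\<^sup>2) \<le> (\<Sum>u<n. (h u)\<^sup>2) - energy h / (4 * d)"
    using lazy_contraction[OF P_lazy, of h] by (simp add: energy_eq)
  also have "\<dots> \<le> (\<Sum>u<n. (h u)\<^sup>2) - \<alpha>\<^sup>2 / d * (\<Sum>u<n. (h u)\<^sup>2) / (4 * d)"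
    using energy_ge[OF h] d_pos by (intro diff_left_mono divide_right_mono) auto
  finally show "(\<Sum>u<n. (\<Sum>x<n. h x * P x u)\<^sup>2) \<le> (1 - \<alpha>\<^sup>2 / (4 * (real d)\<^sup>2)) * (\<Sum>u<n. (h u)\<^sup>2)"
    by (simp add: left_diff_distrib power2_eq_square algebra_simps)
next
  have "\<alpha>\<^sup>2 \<le> (real d)\<^sup>2" using assms \<alpha>_pos by (intro power_mono) auto
  also have "\<dots> \<le> 4 * (real d)\<^sup>2" by simp
  finally show "\<alpha>\<^sup>2 / (4 * (real d)\<^sup>2) \<le> 1" using d_pos by (simp add: divide_le_eq)
qed fact

end

section \<open>Slow mixing on graphs that are not expanders\<close>

context lazy_walk
begin

text \<open>The witness \<open>U\<close> has fewer than \<open>\<beta> * card U\<close> outer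
  neighbours, each with at most \<open>d\<close> edges into \<open>U\<close> of weight
  \<open>1 / (2 * d)\<close>; this gives the escape rate \<open>\<beta> / 2\<close>.\<close>

lemma trace_nonexpander:
  fixes \<beta> :: real
  assumes "\<not> vertex_expander {..<n} E \<beta>" "t * \<beta> \<le> 2" "0 \<le> \<beta>"
  shows "(\<Sum>u<n. pw (2 * t) u u) \<ge> 2 * (1 - t * (\<beta> / 2))\<^sup>2"
proof -
  obtain U where U: "U \<subseteq> {..<n}" "real (card U) \<le> n / 2"
      "card (nbhd E U ({..<n} - U)) < \<beta> * card U"
    using assms by (auto simp: vertex_expander_def not_le)
  let ?N = "nbhd E U ({..<n} - U)"
  have N: "?N \<subseteq> {..<n} - U" by (auto simp: nbhd_def)
  have "(\<Sum>x\<in>U. \<Sum>y\<in>{..<n} - U. adj x y) = (\<Sum>y\<in>{..<n} - U. \<Sum>x\<in>U. adj x y)" by (rule sum.swap)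
  also have "\<dots> = (\<Sum>y\<in>?N. \<Sum>x\<in>U. adj x y)"
    using N by (intro sum.mono_neutral_right) (auto simp: nbhd_def adj_def)
  also have "\<dots> \<le> (\<Sum>y\<in>?N. real d)"
  proof (rule sum_mono)
    fix y assume "y \<in> ?N"
    then have "y < n" by (auto simp: nbhd_def)
    have "(\<Sum>x\<in>U. adj x y) \<le> (\<Sum>x<n. adj x y)"
      using U by (intro sum_mono2) (auto simp: adj_nonneg)
    then show "(\<Sum>x\<in>U. adj x y) \<le> d"
      using sum_adj_le[OF \<open>y < n\<close>] by (simp add: adj_sym)
  qed
  also have "\<dots> \<le> d * (\<beta> * card U)"
    using U by (simp add: mult.commute mult_left_mono)
  finally have b: "(\<Sum>x\<in>U. \<Sum>y\<in>{..<n} - U. adj x y) \<le> d * (\<beta> * card U)" .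
  have "(\<Sum>x\<in>U. \<Sum>y\<in>{..<n} - U. P x y) = (\<Sum>x\<in>U. \<Sum>y\<in>{..<n} - U. adj x y) / (2 * d)"
    unfolding sum_divide_distrib by (intro sum.cong refl) (auto simp: P_def)
  also have "\<dots> \<le> \<beta> / 2 * card U"
    using b d_pos by (simp add: field_simps)
  finally have "(\<Sum>x\<in>U. \<Sum>y\<in>{..<n} - U. P x y) \<le> \<beta> / 2 * card U" .
  moreover have "U \<noteq> {}" using U by auto
  moreover have "2 * card U \<le> n" using U by linarith
  ultimately show ?thesis
    using trace_lower[of U "\<beta> / 2" t] U assms by simp
qed

end

section \<open>Products of probability mass functions\<close>

text \<open>Independent draws may be indexed in one level or in two. Cells are regrouped this way
  into copies, copies into walks, and the cells of separate machines into one array. Within the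
  support \<open>\<psi>\<close> is the only preimage of \<open>g\<close>, and both masses are the
  same product.\<close>

lemma Pi_pmf_flatten:
  fixes R L :: nat
  shows "map_pmf (\<lambda>\<psi> i. if i < R * L then \<psi> (i div L) (i mod L) else d)
     (Pi_pmf {..<R} (\<lambda>_. d) (\<lambda>_. Pi_pmf {..<L} d (\<lambda>_. p))) = Pi_pmf {..<R * L} d (\<lambda>_. p)"
  (is "map_pmf ?h ?M = _")
proof (rule pmf_eqI)
  fix g :: "nat \<Rightarrow> 'a"
  define \<psi> where "\<psi> = (\<lambda>r t. if r < R \<and> t < L then g (r * L + t) else d)"
  have idx: "r * L + t < R * L" if "r < R" "t < L" for r t
  proof -
    have "r * L + t < Suc r * L" using that by simp
    also have "\<dots> \<le> R * L" using that by (intro mult_right_mono) auto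
    finally show ?thesis .
  qed
  show "pmf (map_pmf ?h ?M) g = pmf (Pi_pmf {..<R * L} d (\<lambda>_. p)) g"
  proof (cases "\<forall>i. i \<ge> R * L \<longrightarrow> g i = d")
    case True
    have iff: "?h \<phi> = g \<longleftrightarrow> \<phi> = \<psi>" if "\<phi> \<in> set_pmf ?M" for \<phi>
    proof
      have 1: "\<phi> r t = d" if "\<not> (r < R \<and> t < L)" for r t
      proof -
        have "\<phi> \<in> PiE_dflt {..<R} (\<lambda>_. d) (\<lambda>_. PiE_dflt {..<L} d (\<lambda>_. set_pmf p))"
          using \<open>\<phi> \<in> set_pmf ?M\<close> by (simp add: set_Pi_pmf o_def)
        then show ?thesis using that by (cases "r < R") (auto simp: PiE_dflt_def)
      qed
      assume h: "?h \<phi> = g"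
      show "\<phi> = \<psi>"
      proof (intro ext)
        fix r t
        show "\<phi> r t = \<psi> r t"
          using 1[of r t] fun_cong[OF h, of "r * L + t"] idx[of r t]
          by (cases "r < R \<and> t < L") (auto simp: \<psi>_def)
      qed
    next
      assume \<phi>: "\<phi> = \<psi>"
      show "?h \<phi> = g"
      proof
        fix i
        have "i div L < R" "i mod L < L" if "i < R * L"
          using that by (auto simp: less_mult_imp_div_less intro!: mod_less_divisor Nat.gr0I)
        then show "?h \<phi> i = g i" using True by (auto simp: \<phi> \<psi>_def)
      qed
    qed
    have "pmf (map_pmf ?h ?M) g = measure_pmf.prob ?M {\<psi>}"
      unfolding pmf_map using iff by (intro measure_pmf.finite_measure_eq_AE AE_pmfI) auto
    also have "\<dots> = pmf ?M \<psi>" by (simp add: measure_pmf_single)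
    also have "\<dots> = (\<Prod>r<R. pmf (Pi_pmf {..<L} d (\<lambda>_. p)) (\<psi> r))"
      by (rule pmf_Pi') (auto simp: \<psi>_def)
    also have "\<dots> = (\<Prod>r<R. \<Prod>t<L. pmf p (\<psi> r t))"
      by (intro prod.cong refl pmf_Pi') (auto simp: \<psi>_def)
    also have "\<dots> = (\<Prod>r<R. \<Prod>i\<in>{r * L..<r * L + L}. pmf p (g i))"
    proof (rule prod.cong[OF refl])
      fix r assume "r \<in> {..<R}"
      have "(\<Prod>i\<in>{r * L..<r * L + L}. pmf p (g i)) = (\<Prod>t<L. pmf p (g (r * L + t)))"
        using prod.shift_bounds_nat_ivl[of "\<lambda>i. pmf p (g i)" 0 "r * L" L]
        by (simp add: add.commute lessThan_atLeast0)
      then show "(\<Prod>t<L. pmf p (\<psi> r t)) = (\<Prod>i\<in>{r * L..<r * L + L}. pmf p (g i))"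
        using \<open>r \<in> {..<R}\<close> by (simp add: \<psi>_def)
    qed
    also have "\<dots> = (\<Prod>i<R * L. pmf p (g i))" by (rule prod.nat_group)
    also have "\<dots> = pmf (Pi_pmf {..<R * L} d (\<lambda>_. p)) g"
      using True by (intro pmf_Pi'[symmetric]) auto
    finally show ?thesis .
  next
    case False
    then have "g \<notin> ?h ` set_pmf ?M" by auto
    then have "pmf (map_pmf ?h ?M) g = 0" by (rule pmf_map_outside)
    moreover have "pmf (Pi_pmf {..<R * L} d (\<lambda>_. p)) g = 0"
      using False by (intro pmf_Pi_outside) (auto simp: not_less)
    ultimately show ?thesis by simp
  qed
qed

lemma Pi_pmf_unflatten:
  fixes R L :: nat
  shows "map_pmf (\<lambda>g r t. if r < R \<and> t < L then g (r * L + t) else d) (Pi_pmf {..<R * L} d (\<lambda>_. p)) =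
     Pi_pmf {..<R} (\<lambda>_. d) (\<lambda>_. Pi_pmf {..<L} d (\<lambda>_. p))"
proof -
  have idx: "r * L + t < R * L" if "r < R" "t < L" for r t
  proof -
    have "r * L + t < Suc r * L" using that by simp
    also have "\<dots> \<le> R * L" using that by (intro mult_right_mono) auto
    finally show ?thesis .
  qed
  let ?M = "Pi_pmf {..<R} (\<lambda>_. d) (\<lambda>_. Pi_pmf {..<L} d (\<lambda>_. p))"
  have "map_pmf (\<lambda>g r t. if r < R \<and> t < L then g (r * L + t) else d) (Pi_pmf {..<R * L} d (\<lambda>_. p))
      = map_pmf (\<lambda>\<psi>. \<psi>) ?M"
    unfolding Pi_pmf_flatten[symmetric] map_pmf_comp
  proof (rule map_pmf_cong[OF refl])
    fix \<psi> assume "\<psi> \<in> set_pmf ?M"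
    then have "\<psi> \<in> PiE_dflt {..<R} (\<lambda>_. d) (\<lambda>_. PiE_dflt {..<L} d (\<lambda>_. set_pmf p))"
      by (simp add: set_Pi_pmf o_def)
    then show "(\<lambda>r t. if r < R \<and> t < L
        then if r * L + t < R * L then \<psi> ((r * L + t) div L) ((r * L + t) mod L) else d else d) = \<psi>"
      using idx by (simp add: PiE_dflt_def fun_eq_iff) metis
  qed
  then show ?thesis by simp
qed

lemma Hoeffding_iid:
  fixes p :: "'a pmf" and Y :: "'a \<Rightarrow> real" and R :: nat and \<epsilon> B :: real
  assumes Y: "\<And>x. Y x \<in> {0..B}" and "0 < B" "0 < R" "0 \<le> \<epsilon>"
  defines "\<mu> \<equiv> measure_pmf.expectation p Y"
  shows "measure_pmf.prob (Pi_pmf {..<R} z (\<lambda>_. p)) {\<phi>. (\<Sum>r<R. Y (\<phi> r)) \<ge> real R * (\<mu> + \<epsilon>)}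
           \<le> exp (- 2 * real R * \<epsilon>\<^sup>2 / B\<^sup>2)" (is ?ge)
    and "measure_pmf.prob (Pi_pmf {..<R} z (\<lambda>_. p)) {\<phi>. (\<Sum>r<R. Y (\<phi> r)) \<le> real R * (\<mu> - \<epsilon>)}
           \<le> exp (- 2 * real R * \<epsilon>\<^sup>2 / B\<^sup>2)" (is ?le)
proof -
  let ?M = "Pi_pmf {..<R} z (\<lambda>_. p)"
  have ex: "measure_pmf.expectation ?M (\<lambda>\<phi>. Y (\<phi> i)) = \<mu>" if "i < R" for i
  proof -
    have "measure_pmf.expectation ?M (\<lambda>\<phi>. Y (\<phi> i)) = measure_pmf.expectation (map_pmf (\<lambda>\<phi>. \<phi> i) ?M) Y"
      by simp
    also have "map_pmf (\<lambda>\<phi>. \<phi> i) ?M = p" using that by (subst Pi_pmf_component) auto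
    finally show ?thesis by (simp add: \<mu>_def)
  qed
  interpret H: Hoeffding_ineq "measure_pmf ?M" "{..<R}" "\<lambda>i \<phi>. Y (\<phi> i)" "\<lambda>_. 0" "\<lambda>_. B"
      "\<Sum>i<R. measure_pmf.expectation ?M (\<lambda>\<phi>. Y (\<phi> i))"
  proof unfold_locales
    show "prob_space.indep_vars (measure_pmf ?M) (\<lambda>_. borel) (\<lambda>i \<phi>. Y (\<phi> i)) {..<R}"
      by (rule prob_space.indep_vars_compose2[OF measure_pmf.prob_space_axioms indep_vars_Pi_pmf, where Y = "\<lambda>_. Y"]) auto
  qed (use Y in auto)
  have m: "(\<Sum>i<R. measure_pmf.expectation ?M (\<lambda>\<phi>. Y (\<phi> i))) = R * \<mu>"
    using ex by simp
  have e: "- 2 * (real R * \<epsilon>)\<^sup>2 / (\<Sum>i<R. (B - 0)\<^sup>2) = - 2 * real R * \<epsilon>\<^sup>2 / B\<^sup>2"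
    using assms by (simp add: power2_eq_square field_simps)
  show ?ge
    using H.Hoeffding_ineq_ge[of "R * \<epsilon>"] assms unfolding m e by (simp add: distrib_left)
  show ?le
    using H.Hoeffding_ineq_le[of "R * \<epsilon>"] assms unfolding m e by (simp add: right_diff_distrib)
qed

section \<open>Coalescing random walks\<close>

context lazy_walk
begin

text \<open>The rank of \<open>v\<close> among the neighbours of \<open>u\<close>. Under a uniform
  port below \<open>2 * d\<close> every edge has probability \<open>1 / (2 * d)\<close>, and a port
  not below the degree means staying put, which reproduces \<open>P\<close>. In a sorted list of
  arcs the port is also the offset of the arc.\<close>

definition port :: "nat \<Rightarrow> nat \<Rightarrow> nat" where
  "port u v = card {v'. {u, v'} \<in> E \<and> v' < v}"

definition step_to :: "nat \<Rightarrow> nat \<Rightarrow> nat" where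
  "step_to u p = (if \<exists>v. {u, v} \<in> E \<and> port u v = p then THE v. {u, v} \<in> E \<and> port u v = p else u)"

lemma finite_nbrs: "finite {v. {u, v} \<in> E}"
  by (rule finite_subset[of _ "{..<n}"]) (use edge_bounds in auto)

lemma port_less: "{u, v} \<in> E \<Longrightarrow> {u, v'} \<in> E \<Longrightarrow> v < v' \<Longrightarrow> port u v < port u v'"
  unfolding port_def by (intro psubset_card_mono finite_subset[OF _ finite_nbrs[of u]]) auto

lemma port_inj: "{u, v} \<in> E \<Longrightarrow> {u, v'} \<in> E \<Longrightarrow> port u v = port u v' \<Longrightarrow> v = v'"
  by (metis less_irrefl linorder_neqE_nat port_less)

lemma port_bound:
  assumes "{u, v} \<in> E"
  shows "port u v < d"
proof -
  have "port u v < card {v. {u, v} \<in> E}"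
    unfolding port_def using assms by (intro psubset_card_mono finite_nbrs) auto
  also have "\<dots> \<le> d" using edge_bounds[OF assms] by (intro degree_le) auto
  finally show ?thesis .
qed

lemma step_to_port: "{u, v} \<in> E \<Longrightarrow> step_to u (port u v) = v"
  unfolding step_to_def using port_inj by (auto intro!: the_equality)

lemma step_to_cases:
  obtains v where "{u, v} \<in> E" "port u v = p" "step_to u p = v"
  | "\<forall>v. {u, v} \<in> E \<longrightarrow> port u v \<noteq> p" "step_to u p = u"
proof (cases "\<exists>v. {u, v} \<in> E \<and> port u v = p")
  case True
  then show ?thesis using step_to_port that(1) by metis
next
  case False
  then have "\<forall>v. {u, v} \<in> E \<longrightarrow> port u v \<noteq> p" "step_to u p = u" by (auto simp: step_to_def)
  then show ?thesis by (rule that(2))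
qed

lemma step_to_less: "u < n \<Longrightarrow> step_to u p < n"
  by (cases rule: step_to_cases[of u p]) (auto dest: edge_bounds)

abbreviation ports :: "nat pmf" where
  "ports \<equiv> pmf_of_set {..<2 * d}"

text \<open>Ports are injective on the neighbours of \<open>u\<close>, so one port leads to each
  neighbour and all the remaining ones out of \<open>2 * d\<close> are holding steps.\<close>

lemma prob_step_to:
  assumes "u < n"
  shows "measure_pmf.prob ports {p. step_to u p = x} = P u x"
proof -
  have fin: "{..<2 * d} \<noteq> {}" using d_pos by (simp add: lessThan_empty_iff)
  have "real (card ({..<2 * d} \<inter> {p. step_to u p = x})) = 2 * d * P u x"
  proof (cases "u = x")
    case False
    show ?thesis
    proof (cases "{u, x} \<in> E")
      case True
      have "{..<2 * d} \<inter> {p. step_to u p = x} = {port u x}"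
      proof (intro equalityI subsetI)
        fix p assume "p \<in> {..<2 * d} \<inter> {p. step_to u p = x}"
        then show "p \<in> {port u x}" using False by (cases rule: step_to_cases[of u p]) auto
      next
        fix p assume "p \<in> {port u x}"
        then show "p \<in> {..<2 * d} \<inter> {p. step_to u p = x}"
          using step_to_port[OF True] port_bound[OF True] by auto
      qed
      then show ?thesis using False True d_pos by (simp add: P_def adj_def)
    next
      case E: False
      have "step_to u p \<noteq> x" for p
        using False E by (cases rule: step_to_cases[of u p]) auto
      then show ?thesis using False E by (simp add: P_def adj_def)
    qed
  next
    case True
    have "{..<2 * d} \<inter> {p. step_to u p = u} = {..<2 * d} - port u ` {v. {u, v} \<in> E}"
    proof (intro equalityI subsetI)
      fix p assume "p \<in> {..<2 * d} \<inter> {p. step_to u p = u}"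
      then show "p \<in> {..<2 * d} - port u ` {v. {u, v} \<in> E}"
        using step_to_port[of u] edge_bounds[of u u] by auto
    next
      fix p assume "p \<in> {..<2 * d} - port u ` {v. {u, v} \<in> E}"
      then show "p \<in> {..<2 * d} \<inter> {p. step_to u p = u}"
        by (cases rule: step_to_cases[of u p]) auto
    qed
    moreover have "card (port u ` {v. {u, v} \<in> E}) = card {v. {u, v} \<in> E}"
      using port_inj by (intro card_image inj_onI) auto
    moreover have "port u ` {v. {u, v} \<in> E} \<subseteq> {..<2 * d}"
      using port_bound[of u] by (auto simp: mult_2 intro: trans_less_add1)
    ultimately have "card ({..<2 * d} \<inter> {p. step_to u p = u}) = 2 * d - card {v. {u, v} \<in> E}"
      by (simp add: card_Diff_subset finite_nbrs)
    moreover have "card {v. {u, v} \<in> E} \<le> 2 * d" using degree_le[OF assms] by simp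
    ultimately show ?thesis using True d_pos by (simp add: P_def sum_adj field_simps of_nat_diff)
  qed
  then show ?thesis using fin d_pos by (simp add: measure_pmf_of_set)
qed

text \<open>One port is drawn per vertex and not per walker: walkers that share a vertex move
  together from then on.\<close>

definition step_pmf :: "(nat \<Rightarrow> nat) pmf" where
  "step_pmf = map_pmf (\<lambda>\<omega> u. step_to u (\<omega> u)) (Pi_pmf {..<n} 0 (\<lambda>_. ports))"

primrec flow_pmf :: "nat \<Rightarrow> (nat \<Rightarrow> nat) pmf" where
  "flow_pmf 0 = return_pmf id"
| "flow_pmf (Suc t) = bind_pmf (flow_pmf t) (\<lambda>F. map_pmf (\<lambda>f. f \<circ> F) step_pmf)"

lemma step_pmf_single:
  assumes "u < n"
  shows "pmf (map_pmf (\<lambda>f. f u) step_pmf) x = P u x"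
proof -
  have "pmf (map_pmf (\<lambda>f. f u) step_pmf) x =
      measure_pmf.prob (map_pmf (\<lambda>\<omega>. \<omega> u) (Pi_pmf {..<n} 0 (\<lambda>_. ports))) {p. step_to u p = x}"
    by (simp add: step_pmf_def map_pmf_comp pmf_map vimage_def)
  also have "map_pmf (\<lambda>\<omega>. \<omega> u) (Pi_pmf {..<n} 0 (\<lambda>_. ports)) = ports"
    using assms by (subst Pi_pmf_component) auto
  finally show ?thesis using prob_step_to[OF assms] by simp
qed

lemma step_pmf_pair:
  assumes "u < n" "v < n" "u \<noteq> v"
  shows "pmf (map_pmf (\<lambda>f. (f u, f v)) step_pmf) (x, y) = P u x * P v y"
proof -
  define B where "B = (\<lambda>w. if w = u then {p. step_to u p = x} else if w = v then {p. step_to v p = y} else UNIV)"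
  have "pmf (map_pmf (\<lambda>f. (f u, f v)) step_pmf) (x, y) =
      measure_pmf.prob (Pi_pmf {..<n} 0 (\<lambda>_. ports)) (Pi {..<n} B)"
    unfolding step_pmf_def map_pmf_comp pmf_map using assms
    by (intro arg_cong[where f = "measure_pmf.prob _"]) (auto simp: B_def Pi_def split: if_splits)
  also have "\<dots> = (\<Prod>w<n. measure_pmf.prob ports (B w))"
    by (rule measure_Pi_pmf_Pi) simp
  also have "\<dots> = (\<Prod>w\<in>{u, v}. measure_pmf.prob ports (B w))"
    using assms by (intro prod.mono_neutral_right) (auto simp: B_def)
  finally show ?thesis using assms by (simp add: B_def prob_step_to)
qed

lemma flow_less: "F \<in> set_pmf (flow_pmf t) \<Longrightarrow> u < n \<Longrightarrow> F u < n"
  by (induction t arbitrary: F) (auto simp: step_pmf_def step_to_less)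

lemma flow_single:
  assumes "u < n" "x < n"
  shows "pmf (map_pmf (\<lambda>F. F u) (flow_pmf t)) x = pw t u x"
  using assms(2)
proof (induction t arbitrary: x)
  case 0
  then show ?case by (simp add: indicator_def)
next
  case (Suc t)
  have "map_pmf (\<lambda>F. F u) (flow_pmf (Suc t))
      = bind_pmf (map_pmf (\<lambda>F. F u) (flow_pmf t)) (\<lambda>z. map_pmf (\<lambda>f. f z) step_pmf)"
    by (simp add: map_bind_pmf bind_map_pmf map_pmf_comp)
  then have "pmf (map_pmf (\<lambda>F. F u) (flow_pmf (Suc t))) x
      = measure_pmf.expectation (map_pmf (\<lambda>F. F u) (flow_pmf t)) (\<lambda>z. pmf (map_pmf (\<lambda>f. f z) step_pmf) x)"
    by (simp only: pmf_bind)
  also have "\<dots> = (\<Sum>z<n. pmf (map_pmf (\<lambda>f. f z) step_pmf) x * pmf (map_pmf (\<lambda>F. F u) (flow_pmf t)) z)"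
    using flow_less assms by (intro integral_measure_pmf_real) auto
  also have "\<dots> = pw (Suc t) u x"
    using Suc.IH by (simp add: step_pmf_single mult.commute)
  finally show ?case .
qed

text \<open>Two walks in the same flow move independently as long as they have not met, and after they
  have met they stay together.\<close>

lemma flow_pair:
  assumes "u < n" "v < n" "u \<noteq> v" "x < n" "y < n" "x \<noteq> y"
  shows "pmf (map_pmf (\<lambda>F. (F u, F v)) (flow_pmf t)) (x, y) \<le> pw t u x * pw t v y"
  using assms(4-6)
proof (induction t arbitrary: x y)
  case 0
  then show ?case by (simp add: indicator_def)
next
  case (Suc t)
  let ?W = "map_pmf (\<lambda>F. (F u, F v)) (flow_pmf t)"
  let ?S = "\<lambda>z. pmf (map_pmf (\<lambda>f. (f (fst z), f (snd z))) step_pmf) (x, y)"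
  have "map_pmf (\<lambda>F. (F u, F v)) (flow_pmf (Suc t))
      = bind_pmf ?W (\<lambda>z. map_pmf (\<lambda>f. (f (fst z), f (snd z))) step_pmf)"
    by (simp add: map_bind_pmf bind_map_pmf map_pmf_comp)
  then have "pmf (map_pmf (\<lambda>F. (F u, F v)) (flow_pmf (Suc t))) (x, y) = measure_pmf.expectation ?W ?S"
    by (simp only: pmf_bind)
  also have "\<dots> = (\<Sum>z\<in>{..<n} \<times> {..<n}. ?S z * pmf ?W z)"
    using flow_less assms by (intro integral_measure_pmf_real) auto
  also have "\<dots> \<le> (\<Sum>z\<in>{..<n} \<times> {..<n}. (pw t u (fst z) * P (fst z) x) * (pw t v (snd z) * P (snd z) y))"
  proof (rule sum_mono)
    fix z assume z: "z \<in> {..<n} \<times> {..<n}"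
    obtain a b where ab: "z = (a, b)" by (cases z)
    show "?S z * pmf ?W z \<le> (pw t u (fst z) * P (fst z) x) * (pw t v (snd z) * P (snd z) y)"
    proof (cases "a = b")
      case True
      \<comment> \<open>Walkers that have met stay together and cannot reach distinct
        \<open>x\<close> and \<open>y\<close>. These lost pairs are the reason for an inequality
        instead of an equality.\<close>
      have "?S z = 0"
        using Suc.prems by (intro pmf_map_outside) (auto simp: ab True)
      then show ?thesis using z assms Suc.prems
        by (auto simp: ab intro!: mult_nonneg_nonneg pw_nonneg P_nonneg)
    next
      case False
      have "?S z * pmf ?W z = P a x * P b y * pmf ?W (a, b)"
        using step_pmf_pair[of a b x y] z False by (simp add: ab)
      also have "\<dots> \<le> P a x * P b y * (pw t u a * pw t v b)"
        using Suc.IH[of a b] z False Suc.prems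
        by (intro mult_left_mono mult_nonneg_nonneg P_nonneg) (auto simp: ab)
      finally show ?thesis by (simp add: ab mult_ac)
    qed
  qed
  also have "\<dots> = pw (Suc t) u x * pw (Suc t) v y"
    by (simp add: sum_product sum.cartesian_product case_prod_unfold)
  finally show ?case .
qed

lemma finite_flow: "finite (set_pmf (flow_pmf t))"
proof -
  have "finite (set_pmf step_pmf)"
    using d_pos by (auto simp: step_pmf_def set_Pi_pmf lessThan_empty_iff)
  then show ?thesis by (induction t) auto
qed

section \<open>Moments and concentration of the number of returning walks\<close>

definition fixpoints :: "(nat \<Rightarrow> nat) \<Rightarrow> nat" where
  "fixpoints F = card {v. v < n \<and> F v = v}"

lemma fixpoints_sum: "real (fixpoints F) = (\<Sum>v<n. of_bool (F v = v))"
proof -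
  have "{v. v < n \<and> F v = v} = {..<n} \<inter> {v. F v = v}" by auto
  then show ?thesis by (simp add: fixpoints_def)
qed

lemma int_flow: "integrable (measure_pmf (flow_pmf t)) (f :: _ \<Rightarrow> real)"
  by (rule integrable_measure_pmf_finite[OF finite_flow])

lemma expectation_bool:
  "measure_pmf.expectation p (\<lambda>x. of_bool (Q x)) = measure_pmf.prob p {x. Q x}"
proof -
  have "(\<lambda>x. of_bool (Q x) :: real) = indicator {x. Q x}" by (auto simp: indicator_def)
  then show ?thesis by simp
qed

lemma expectation_fixpoints:
  "measure_pmf.expectation (flow_pmf t) (\<lambda>F. fixpoints F) = (\<Sum>v<n. pw t v v)"
proof -
  have "measure_pmf.expectation (flow_pmf t) (\<lambda>F. fixpoints F)
      = (\<Sum>v<n. measure_pmf.expectation (flow_pmf t) (\<lambda>F. of_bool (F v = v)))"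
    unfolding fixpoints_sum by (intro Bochner_Integration.integral_sum int_flow)
  also have "\<dots> = (\<Sum>v<n. pw t v v)"
    using flow_single[of _ _ t]
    by (intro sum.cong refl) (simp add: expectation_bool pmf_map vimage_def)
  finally show ?thesis .
qed

text \<open>Off the diagonal, \<open>flow_pair\<close> bounds the joint return probability by the
  product of the single ones; the diagonal contributes the additional \<open>\<mu>\<close>.\<close>

lemma expectation_fixpoints_sq:
  fixes t defines "\<mu> \<equiv> (\<Sum>v<n. pw t v v)"
  shows "measure_pmf.expectation (flow_pmf t) (\<lambda>F. (fixpoints F)\<^sup>2) \<le> \<mu> + \<mu>\<^sup>2"
proof -
  let ?E = "measure_pmf.expectation (flow_pmf t)"
  have "?E (\<lambda>F. (fixpoints F)\<^sup>2) = ?E (\<lambda>F. \<Sum>u<n. \<Sum>v<n. of_bool (F u = u \<and> F v = v))"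
    unfolding power2_eq_square of_nat_mult fixpoints_sum sum_product of_bool_conj ..
  also have "\<dots> = (\<Sum>u<n. \<Sum>v<n. ?E (\<lambda>F. of_bool (F u = u \<and> F v = v)))"
    by (simp add: Bochner_Integration.integral_sum int_flow del: sum_of_bool_eq)
  also have "\<dots> \<le> (\<Sum>u<n. \<Sum>v<n. of_bool (u = v) * pw t u u + pw t u u * pw t v v)"
  proof (intro sum_mono)
    fix u v assume uv: "u \<in> {..<n}" "v \<in> {..<n}"
    show "?E (\<lambda>F. of_bool (F u = u \<and> F v = v)) \<le> of_bool (u = v) * pw t u u + pw t u u * pw t v v"
    proof (cases "u = v")
      case True
      then show ?thesis
        using flow_single[of u u t] uv pw_nonneg[of u u t] by (simp add: expectation_bool pmf_map vimage_def)
    next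
      case False
      then show ?thesis
        using flow_pair[of u v u v t] uv by (simp add: expectation_bool pmf_map vimage_def)
    qed
  qed
  also have "\<dots> = \<mu> + \<mu>\<^sup>2"
    by (simp add: \<mu>_def sum.distrib power2_eq_square sum_product of_bool_def if_distrib[where f = "\<lambda>z. z * _"]
        sum.delta cong: if_cong)
  finally show ?thesis .
qed

text \<open>\<open>\<theta>\<close> rescales the count to mean \<open>19 / 10\<close>, so that a
  large \<open>\<mu>\<close> does no harm. The parabola \<open>y - y^2 / 40\<close> has its maximum
  \<open>10\<close> at \<open>y = 20\<close>; taken at \<open>y = \<theta> * x\<close> it lies below
  \<open>min x 10\<close>, and its mean involves only the first two moments.\<close>

lemma truncated_lower:
  fixes t
  defines "\<mu> \<equiv> (\<Sum>v<n. pw t v v)"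
  assumes "\<mu> \<ge> 19 / 10"
  shows "measure_pmf.expectation (flow_pmf t) (\<lambda>F. min (fixpoints F) 10) \<ge> 17 / 10"
proof -
  let ?E = "measure_pmf.expectation (flow_pmf t)"
  define \<theta> where "\<theta> = 19 / 10 / \<mu>"
  have \<theta>: "0 \<le> \<theta>" "\<theta> \<le> 1" using assms by (auto simp: \<theta>_def)
  have *: "min x 10 \<ge> \<theta> * x - \<theta>\<^sup>2 * x\<^sup>2 / 40" if "0 \<le> x" for x :: real
  proof -
    have "\<theta> * x - \<theta>\<^sup>2 * x\<^sup>2 / 40 \<le> 10"
      using zero_le_power2[of "\<theta> * x - 20"] by (simp add: power2_eq_square algebra_simps)
    moreover have "\<theta> * x \<le> x" using that \<theta> by (simp add: mult_left_le_one_le)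
    moreover have "0 \<le> \<theta>\<^sup>2 * x\<^sup>2" by simp
    ultimately show ?thesis by linarith
  qed
  have "?E (\<lambda>F. \<theta> * fixpoints F - \<theta>\<^sup>2 / 40 * (fixpoints F)\<^sup>2) \<le> ?E (\<lambda>F. min (fixpoints F) 10)"
  proof (intro integral_mono int_flow)
    show "\<theta> * fixpoints F - \<theta>\<^sup>2 / 40 * (fixpoints F)\<^sup>2 \<le> min (fixpoints F) 10" for F
      using *[of "real (fixpoints F)"] by (simp add: min_def split: if_splits)
  qed
  also have "?E (\<lambda>F. \<theta> * fixpoints F - \<theta>\<^sup>2 / 40 * (fixpoints F)\<^sup>2)
      = \<theta> * \<mu> - \<theta>\<^sup>2 / 40 * ?E (\<lambda>F. (fixpoints F)\<^sup>2)"
    using expectation_fixpoints[of t]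
    by (subst Bochner_Integration.integral_diff) (auto simp: int_flow \<mu>_def)
  also have "\<dots> \<ge> \<theta> * \<mu> - \<theta>\<^sup>2 / 40 * (\<mu> + \<mu>\<^sup>2)"
    using expectation_fixpoints_sq[of t] by (intro diff_left_mono mult_left_mono) (auto simp: \<mu>_def)
  also have "\<theta> * \<mu> - \<theta>\<^sup>2 / 40 * (\<mu> + \<mu>\<^sup>2) = 19 / 10 - 361 / 100 / 40 * (1 / \<mu> + 1)"
    using assms by (simp add: \<theta>_def power2_eq_square field_simps)
  also have "\<dots> \<ge> 19 / 10 - 361 / 100 / 40 * (10 / 19 + 1)"
    using assms by (intro diff_left_mono mult_left_mono add_right_mono) (auto simp: field_simps)
  finally show ?thesis by simp
qed

lemma truncated_upper:
  "measure_pmf.expectation (flow_pmf t) (\<lambda>F. min (fixpoints F) 10) \<le> (\<Sum>v<n. pw t v v)"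
  unfolding expectation_fixpoints[symmetric] by (intro integral_mono int_flow) simp

text \<open>The threshold \<open>14 / 10\<close> is \<open>3 / 10\<close> above the largest
  truncated mean of this case and, in \<open>accept_rare\<close>, \<open>3 / 10\<close> below the
  smallest one. For values in \<open>{0..10}\<close> Hoeffding's exponent is
  \<open>9 * R / 5000\<close>, which exceeds \<open>R / 600\<close>.\<close>

lemma reject_rare:
  assumes "0 < R" "(\<Sum>v<n. pw t v v) \<le> 11 / 10"
  shows "measure_pmf.prob (Pi_pmf {..<R} z (\<lambda>_. flow_pmf t)) {\<phi>. 14 * R \<le> 10 * (\<Sum>r<R. min (fixpoints (\<phi> r)) 10)}
    \<le> exp (- real R / 600)"
proof -
  let ?Y = "\<lambda>F. real (min (fixpoints F) 10)"
  have "measure_pmf.prob (Pi_pmf {..<R} z (\<lambda>_. flow_pmf t)) {\<phi>. 14 * R \<le> 10 * (\<Sum>r<R. min (fixpoints (\<phi> r)) 10)}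
      \<le> measure_pmf.prob (Pi_pmf {..<R} z (\<lambda>_. flow_pmf t))
          {\<phi>. (\<Sum>r<R. ?Y (\<phi> r)) \<ge> R * (measure_pmf.expectation (flow_pmf t) ?Y + 3 / 10)}"
  proof (intro measure_pmf.finite_measure_mono subsetI)
    fix \<phi> assume "\<phi> \<in> {\<phi>. 14 * R \<le> 10 * (\<Sum>r<R. min (fixpoints (\<phi> r)) 10)}"
    then have "real (14 * R) \<le> real (10 * (\<Sum>r<R. min (fixpoints (\<phi> r)) 10))"
      by (simp only: mem_Collect_eq of_nat_le_iff)
    moreover have "measure_pmf.expectation (flow_pmf t) ?Y \<le> 11 / 10"
      using truncated_upper[of t] assms by simp
    then have "R * (measure_pmf.expectation (flow_pmf t) ?Y + 3 / 10) \<le> R * (14 / 10)"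
      by (intro mult_left_mono) auto
    ultimately show "\<phi> \<in> {\<phi>. (\<Sum>r<R. ?Y (\<phi> r)) \<ge> R * (measure_pmf.expectation (flow_pmf t) ?Y + 3 / 10)}"
      by simp
  qed auto
  also have "\<dots> \<le> exp (- 2 * real R * (3 / 10)\<^sup>2 / 10\<^sup>2)"
    by (rule Hoeffding_iid) (use assms in auto)
  also have "\<dots> \<le> exp (- real R / 600)" by (simp add: power2_eq_square)
  finally show ?thesis .
qed

lemma accept_rare:
  assumes "0 < R" "(\<Sum>v<n. pw t v v) \<ge> 19 / 10"
  shows "measure_pmf.prob (Pi_pmf {..<R} z (\<lambda>_. flow_pmf t)) {\<phi>. \<not> 14 * R \<le> 10 * (\<Sum>r<R. min (fixpoints (\<phi> r)) 10)}
    \<le> exp (- real R / 600)"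
proof -
  let ?Y = "\<lambda>F. real (min (fixpoints F) 10)"
  have "measure_pmf.prob (Pi_pmf {..<R} z (\<lambda>_. flow_pmf t)) {\<phi>. \<not> 14 * R \<le> 10 * (\<Sum>r<R. min (fixpoints (\<phi> r)) 10)}
      \<le> measure_pmf.prob (Pi_pmf {..<R} z (\<lambda>_. flow_pmf t))
          {\<phi>. (\<Sum>r<R. ?Y (\<phi> r)) \<le> R * (measure_pmf.expectation (flow_pmf t) ?Y - 3 / 10)}"
  proof (intro measure_pmf.finite_measure_mono subsetI)
    fix \<phi> assume "\<phi> \<in> {\<phi>. \<not> 14 * R \<le> 10 * (\<Sum>r<R. min (fixpoints (\<phi> r)) 10)}"
    then have "real (10 * (\<Sum>r<R. min (fixpoints (\<phi> r)) 10)) \<le> real (14 * R)"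
      unfolding of_nat_le_iff by simp
    moreover have "measure_pmf.expectation (flow_pmf t) ?Y \<ge> 17 / 10"
      using truncated_lower[of t] assms by simp
    then have "R * (measure_pmf.expectation (flow_pmf t) ?Y - 3 / 10) \<ge> R * (14 / 10)"
      by (intro mult_left_mono) auto
    ultimately show "\<phi> \<in> {\<phi>. (\<Sum>r<R. ?Y (\<phi> r)) \<le> R * (measure_pmf.expectation (flow_pmf t) ?Y - 3 / 10)}"
      by simp
  qed auto
  also have "\<dots> \<le> exp (- 2 * real R * (3 / 10)\<^sup>2 / 10\<^sup>2)"
    by (rule Hoeffding_iid) (use assms in auto)
  also have "\<dots> \<le> exp (- real R / 600)" by (simp add: power2_eq_square)
  finally show ?thesis .
qed

end

section \<open>Networks of machines holding one word per cell\<close>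

text \<open>
  Machine \<open>B\<close> holds the \<open>s\<close> cells with numbers \<open>B * s + k\<close>, \<open>k < s\<close>. In one step it looks at its
  cells and emits words, each addressed to some cell of the network. Cells that receive no word
  become \<open>0\<close>.
\<close>

type_synonym emitter = "nat \<Rightarrow> (nat \<Rightarrow> nat) \<Rightarrow> (nat \<times> nat) list"

definition blk :: "nat \<Rightarrow> (nat \<Rightarrow> nat) \<Rightarrow> nat \<Rightarrow> nat \<Rightarrow> nat" where
  "blk s x B = (\<lambda>k. if k < s then x (B * s + k) else 0)"

definition emissions :: "nat \<Rightarrow> nat \<Rightarrow> emitter \<Rightarrow> (nat \<Rightarrow> nat) \<Rightarrow> (nat \<times> nat) list" where
  "emissions M s em x = concat (map (\<lambda>B. em B (blk s x B)) [0..<M])"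

definition net_step :: "nat \<Rightarrow> nat \<Rightarrow> emitter \<Rightarrow> (nat \<Rightarrow> nat) \<Rightarrow> nat \<Rightarrow> nat" where
  "net_step M s em x = (\<lambda>c. case map_of (emissions M s em x) c of None \<Rightarrow> 0 | Some v \<Rightarrow> v)"

text \<open>Distinct addresses bound the traffic into a machine by its \<open>s\<close> cells. The
  outgoing traffic may be twice as large, because a cell may have two readers.\<close>

definition net_ok :: "nat \<Rightarrow> nat \<Rightarrow> nat \<Rightarrow> emitter \<Rightarrow> (nat \<Rightarrow> nat) \<Rightarrow> bool" where
  "net_ok M s Z em x \<longleftrightarrow> distinct (map fst (emissions M s em x)) \<and>
     (\<forall>B<M. length (em B (blk s x B)) \<le> 2 * s) \<and>
     (\<forall>(c, v)\<in>set (emissions M s em x). c < M * s \<and> v < Z)"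

abbreviation net_run :: "nat \<Rightarrow> nat \<Rightarrow> emitter list \<Rightarrow> (nat \<Rightarrow> nat) \<Rightarrow> nat \<Rightarrow> nat" where
  "net_run M s es x \<equiv> fold (net_step M s) es x"

primrec net_oks :: "nat \<Rightarrow> nat \<Rightarrow> nat \<Rightarrow> emitter list \<Rightarrow> (nat \<Rightarrow> nat) \<Rightarrow> bool" where
  "net_oks M s Z [] x \<longleftrightarrow> True"
| "net_oks M s Z (em # es) x \<longleftrightarrow> net_ok M s Z em x \<and> net_oks M s Z es (net_step M s em x)"

lemma net_oks_append:
  "net_oks M s Z (es @ es') x \<longleftrightarrow> net_oks M s Z es x \<and> net_oks M s Z es' (net_run M s es x)"
  by (induction es arbitrary: x) auto

text \<open>An emitter described from the receiving end: cell \<open>c\<close> gets a function of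
  the block of machine \<open>src c\<close>, or \<open>0\<close> if there is no such machine.
  Addresses are distinct by construction, so that mainly the load of the senders has to be
  checked.\<close>

definition pull :: "nat \<Rightarrow> (nat \<Rightarrow> nat) \<Rightarrow> (nat \<Rightarrow> (nat \<Rightarrow> nat) \<Rightarrow> nat) \<Rightarrow> emitter" where
  "pull T src h B y = map (\<lambda>c. (c, h c y)) (filter (\<lambda>c. src c = B) [0..<T])"

lemma emissions_pull:
  "map fst (emissions M s (pull T src h) x) = concat (map (\<lambda>B. filter (\<lambda>c. src c = B) [0..<T]) [0..<M])"
  "set (emissions M s (pull T src h) x) = (\<lambda>c. (c, h c (blk s x (src c)))) ` {c. c < T \<and> src c < M}"
  by (auto simp: emissions_def pull_def map_concat o_def)

lemma distinct_pull: "distinct (map fst (emissions M s (pull T src h) x))"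
proof -
  have "distinct (concat (map (\<lambda>B. filter (\<lambda>c. src c = B) [0..<T]) [0..<M]))"
    by (induction M) auto
  then show ?thesis by (simp add: emissions_pull)
qed

lemma net_step_pull:
  "net_step M s (pull T src h) x = (\<lambda>c. if c < T \<and> src c < M then h c (blk s x (src c)) else 0)"
proof
  fix c
  let ?es = "emissions M s (pull T src h) x"
  show "net_step M s (pull T src h) x c = (if c < T \<and> src c < M then h c (blk s x (src c)) else 0)"
  proof (cases "c < T \<and> src c < M")
    case True
    then have "(c, h c (blk s x (src c))) \<in> set ?es" by (auto simp: emissions_pull)
    then have "map_of ?es c = Some (h c (blk s x (src c)))"
      using distinct_pull by (intro map_of_is_SomeI)
    then show ?thesis using True by (simp add: net_step_def)
  next
    case False
    then have "c \<notin> fst ` set ?es" by (auto simp: emissions_pull)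
    then have "map_of ?es c = None" by (simp add: map_of_eq_None_iff)
    then show ?thesis using False by (auto simp: net_step_def)
  qed
qed

lemma net_ok_pull:
  assumes "T \<le> M * s"
    and "\<And>B. B < M \<Longrightarrow> card {c. c < T \<and> src c = B} \<le> 2 * s"
    and "\<And>c. c < T \<Longrightarrow> src c < M \<Longrightarrow> h c (blk s x (src c)) < Z"
  shows "net_ok M s Z (pull T src h) x"
proof -
  have "length (filter (\<lambda>c. src c = B) [0..<T]) = card {c. c < T \<and> src c = B}" for B
  proof -
    have "set (filter (\<lambda>c. src c = B) [0..<T]) = {c. c < T \<and> src c = B}" by auto
    then show ?thesis by (metis distinct_card distinct_filter distinct_upt)
  qed
  then show ?thesis
    unfolding net_ok_def using assms distinct_pull by (auto simp: emissions_pull(2)) (simp add: pull_def)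
qed

lemma concat_blocks:
  "concat (map (\<lambda>B. map (\<lambda>k. f (B * s + k)) [0..<s]) [0..<M]) = map f [0..<M * s]"
proof (induction M)
  case (Suc M)
  have "[0..<Suc M * s] = [0..<M * s] @ map (\<lambda>k. M * s + k) [0..<s]"
    by (intro nth_equalityI) (auto simp: nth_append add.commute)
  then show ?case using Suc by simp
qed simp

text \<open>The counterpart of \<open>pull\<close> for steps in which the sender computes the
  address, as in sorting. Distinctness of the addresses now rests on injectivity of
  \<open>D\<close>.\<close>

lemma push_step:
  assumes em: "\<forall>B<M. em B (blk s x B) = map (\<lambda>k. (D (B * s + k), V (B * s + k))) [0..<s]"
    and inj: "inj_on D {..<M * s}" and D: "\<forall>c<M * s. D c < M * s"
    and V: "\<forall>c<M * s. V c < Z"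
  shows "net_ok M s Z em x"
    and "\<And>c. c < M * s \<Longrightarrow> net_step M s em x (D c) = V c"
    and "\<And>c. M * s \<le> c \<Longrightarrow> net_step M s em x c = 0"
proof -
  have e: "emissions M s em x = map (\<lambda>c. (D c, V c)) [0..<M * s]"
    unfolding emissions_def concat_blocks[symmetric] using em by (intro arg_cong[where f = concat]) auto
  have dis: "distinct (map fst (emissions M s em x))"
    using inj by (simp add: e o_def distinct_map atLeast0LessThan)
  show "net_ok M s Z em x"
    using dis em D V by (auto simp: net_ok_def e)
  show "net_step M s em x (D c) = V c" if "c < M * s" for c
  proof -
    have "map_of (emissions M s em x) (D c) = Some (V c)"
      using dis that by (intro map_of_is_SomeI) (auto simp: e)
    then show ?thesis by (simp add: net_step_def)
  qed
  show "net_step M s em x c = 0" if "M * s \<le> c" for c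
  proof -
    have "c \<notin> fst ` set (emissions M s em x)" using D that by (force simp: e)
    then show ?thesis by (simp add: net_step_def map_of_eq_None_iff[THEN iffD2])
  qed
qed

lemma rank_bij:
  fixes \<tau> :: "nat \<Rightarrow> nat"
  assumes inj: "inj_on \<tau> {..<N}"
  defines "rk \<equiv> \<lambda>p. card {p'. p' < N \<and> \<tau> p' < \<tau> p}"
  shows "bij_betw rk {..<N} {..<N}"
    and "\<And>p p'. p < N \<Longrightarrow> p' < N \<Longrightarrow> rk p < rk p' \<Longrightarrow> \<tau> p < \<tau> p'"
proof -
  have mono: "rk p < rk p'" if "p < N" "p' < N" "\<tau> p < \<tau> p'" for p p'
    unfolding rk_def using that by (intro psubset_card_mono) auto
  have lt: "rk p < N" if "p < N" for p
  proof -
    have "rk p < card {..<N}" unfolding rk_def using that by (intro psubset_card_mono) auto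
    then show ?thesis by simp
  qed
  have "inj_on rk {..<N}"
    using inj mono by (intro inj_onI) (metis inj_onD lessThan_iff less_irrefl linorder_neqE_nat)
  then show "bij_betw rk {..<N} {..<N}"
    using lt by (intro bij_betw_imageI endo_inj_surj) auto
  show "\<tau> p < \<tau> p'" if "p < N" "p' < N" "rk p < rk p'" for p p'
    using mono[of p' p] that inj by (metis inj_onD lessThan_iff less_asym linorder_neqE_nat)
qed

text \<open>Words handed from one routine to the next lie below \<open>Y0\<close>. \<open>Y\<close>
  bounds pairs of them, such as a word with a counter, and \<open>Z\<close> bounds the triples
  carried through a prefix sum, hence everything that is sent.\<close>

locale net =
  fixes s q a Y0 Y Z :: nat
  assumes s_ge2: "2 \<le> s" and q_pos: "0 < q"
    and Y0_gt: "s ^ q < Y0"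
    and enc2: "\<And>u v. u < Y0 \<Longrightarrow> v < Y0 \<Longrightarrow> prod_encode (u, v) < Y"
    and enc3: "\<And>u v w. u < Y \<Longrightarrow> v < Y \<Longrightarrow> w < Y \<Longrightarrow> prod_encode (u, prod_encode (v, w)) < Z"
begin

definition N where "N = s ^ q"
definition NB where "NB = s ^ (q - 1)"
definition M where "M = 2 ^ a * NB"
definition T where "T = 2 ^ a * N"

abbreviation "run \<equiv> net_run M s"
abbreviation "oks \<equiv> net_oks M s Z"

lemma N_eq: "N = NB * s" and N_eq': "N = s * NB"
  using q_pos by (auto simp: N_def NB_def power_eq_if)

lemma T_eq: "T = M * s"
  by (simp add: T_def M_def N_eq)

lemma N_pos: "0 < N" and NB_pos: "0 < NB" and s_pos: "0 < s"
  using s_ge2 by (auto simp: N_def NB_def)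

lemma N_less: "N < Y0" using Y0_gt by (simp add: N_def)

lemma Y0_le: "Y0 \<le> Y"
proof (rule ccontr)
  assume "\<not> Y0 \<le> Y"
  then have "prod_encode (Y, 0) < Y" by (intro enc2) auto
  then show False using le_prod_encode_1[of Y 0] by simp
qed

lemma Y_le: "Y \<le> Z"
proof (rule ccontr)
  assume "\<not> Y \<le> Z"
  then have "prod_encode (Z, prod_encode (0, 0)) < Z" by (intro enc3) auto
  then show False using le_prod_encode_1[of Z "prod_encode (0, 0)"] by simp
qed

lemma cell_less: "\<kappa> < 2 ^ a \<Longrightarrow> p < N \<Longrightarrow> \<kappa> * N + p < T"
proof -
  assume "\<kappa> < 2 ^ a" "p < N"
  then have "\<kappa> * N + p < Suc \<kappa> * N" by simp
  also have "\<dots> \<le> T" unfolding T_def using \<open>\<kappa> < 2 ^ a\<close> by (intro mult_right_mono) auto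
  finally show ?thesis .
qed

lemma cell_div: "p < N \<Longrightarrow> (\<kappa> * N + p) div N = \<kappa>" and cell_mod: "p < N \<Longrightarrow> (\<kappa> * N + p) mod N = p"
  by auto

lemma cell_div_s: "(\<kappa> * N + p) div s = \<kappa> * NB + p div s" and cell_mod_s: "(\<kappa> * N + p) mod s = p mod s"
  using s_pos by (auto simp: N_eq' mult.left_commute[of \<kappa>] mult.assoc)

lemma cell_cases:
  assumes "c < T"
  obtains \<kappa> p where "\<kappa> < 2 ^ a" "p < N" "c = \<kappa> * N + p"
proof (rule that)
  show "c div N < 2 ^ a" using assms by (simp add: T_def less_mult_imp_div_less)
  show "c mod N < N" using N_pos by simp
  show "c = c div N * N + c mod N" by (rule div_mult_mod_eq[symmetric])
qed

lemma blk_cell: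
  assumes "p < N"
  shows "blk s x ((\<kappa> * N + p) div s) k = (if k < s then x (\<kappa> * N + (p div s * s + k)) else 0)"
  by (simp add: blk_def cell_div_s) (simp add: N_eq algebra_simps)

text \<open>The same permutation acts in every copy, and \<open>h\<close> sees the whole block that
  contains the source cell, so lines of \<open>s\<close> cells can be aggregated while they are
  moved. Injectivity of \<open>g\<close> keeps every sender at \<open>s\<close> words.\<close>

definition permute :: "(nat \<Rightarrow> nat) \<Rightarrow> (nat \<Rightarrow> nat \<Rightarrow> (nat \<Rightarrow> nat) \<Rightarrow> nat) \<Rightarrow> emitter" where
  "permute g h = pull T (\<lambda>c. (c div N * N + g (c mod N)) div s) (\<lambda>c. h c (g (c mod N) mod s))"

abbreviation pval :: "(nat \<Rightarrow> nat) \<Rightarrow> (nat \<Rightarrow> nat \<Rightarrow> (nat \<Rightarrow> nat) \<Rightarrow> nat) \<Rightarrow> (nat \<Rightarrow> nat) \<Rightarrow> nat \<Rightarrow> nat \<Rightarrow> nat" where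
  "pval g h x \<kappa> p \<equiv>
     h (\<kappa> * N + p) (g p mod s) (\<lambda>k. if k < s then x (\<kappa> * N + (g p div s * s + k)) else 0)"

lemma permute_step:
  assumes inj: "inj_on g {..<N}" and g': "\<forall>p<N. g p < N"
  shows "\<And>\<kappa> p. \<kappa> < 2 ^ a \<Longrightarrow> p < N \<Longrightarrow> net_step M s (permute g h) x (\<kappa> * N + p) = pval g h x \<kappa> p"
    and "\<And>c. T \<le> c \<Longrightarrow> net_step M s (permute g h) x c = 0"
    and "(\<And>\<kappa> p. \<kappa> < 2 ^ a \<Longrightarrow> p < N \<Longrightarrow> pval g h x \<kappa> p < Z) \<Longrightarrow> net_ok M s Z (permute g h) x"
proof -
  have g: "g p < N" if "p < N" for p using g' that by simp
  have src: "(\<kappa> * N + g p) div s < M" if "\<kappa> < 2 ^ a" "p < N" for \<kappa> p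
    using cell_less[OF that(1) g[OF that(2)]] by (simp add: T_eq less_mult_imp_div_less)
  have val: "h (\<kappa> * N + p) (g p mod s) (blk s x ((\<kappa> * N + g p) div s)) = pval g h x \<kappa> p" if "p < N" for \<kappa> p
    using blk_cell[OF g[OF that]] by (intro arg_cong[where f = "h _ _"]) auto
  show "net_step M s (permute g h) x (\<kappa> * N + p) = pval g h x \<kappa> p" if "\<kappa> < 2 ^ a" "p < N" for \<kappa> p
    using val[OF that(2), of \<kappa>] src[OF that] cell_less[OF that] that
    by (simp add: permute_def net_step_pull cell_div cell_mod)
  show "net_step M s (permute g h) x c = 0" if "T \<le> c" for c
    using that by (simp add: permute_def net_step_pull)
  show "net_ok M s Z (permute g h) x" if *: "\<And>\<kappa> p. \<kappa> < 2 ^ a \<Longrightarrow> p < N \<Longrightarrow> pval g h x \<kappa> p < Z"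
    unfolding permute_def
  proof (rule net_ok_pull)
    show "T \<le> M * s" by (simp add: T_eq)
    show "card {c. c < T \<and> (c div N * N + g (c mod N)) div s = B} \<le> 2 * s" for B
    proof -
      let ?\<pi> = "\<lambda>c. c div N * N + g (c mod N)"
      have "inj_on ?\<pi> {..<T}"
      proof (rule inj_onI)
        fix c c' assume "c \<in> {..<T}" "c' \<in> {..<T}" and eq: "?\<pi> c = ?\<pi> c'"
        have "c div N = c' div N" "g (c mod N) = g (c' mod N)"
          using arg_cong[OF eq, of "\<lambda>z. z div N"] arg_cong[OF eq, of "\<lambda>z. z mod N"] g N_pos by auto
        then show "c = c'"
          using inj N_pos by (metis inj_onD lessThan_iff mod_less_divisor div_mult_mod_eq)
      qed
      then have "card {c. c < T \<and> ?\<pi> c div s = B} = card (?\<pi> ` {c. c < T \<and> ?\<pi> c div s = B})"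
        by (intro card_image[symmetric]) (auto elim: inj_on_subset)
      also have "\<dots> \<le> card {B * s..<B * s + s}"
      proof (intro card_mono)
        show "?\<pi> ` {c. c < T \<and> ?\<pi> c div s = B} \<subseteq> {B * s..<B * s + s}"
        proof
          fix z assume "z \<in> ?\<pi> ` {c. c < T \<and> ?\<pi> c div s = B}"
          then have "z div s = B" by auto
          then show "z \<in> {B * s..<B * s + s}"
            using div_mult_mod_eq[of z s] mod_less_divisor[OF s_pos, of z] by auto
        qed
      qed simp
      finally show ?thesis by simp
    qed
    fix c assume "c < T"
    then show "h c (g (c mod N) mod s) (blk s x ((c div N * N + g (c mod N)) div s)) < Z"
      using * val by (elim cell_cases) (simp add: cell_div cell_mod)
  qed
qed

text \<open>On positions with \<open>q\<close> digits in base \<open>s\<close>, \<open>rot\<close>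
  moves the lowest digit to the front and \<open>unrot\<close> moves it back.\<close>

definition rot where "rot p = (p mod s) * NB + p div s"
definition unrot where "unrot p = (p mod NB) * s + p div NB"

lemma rot_less: "p < N \<Longrightarrow> rot p < N"
proof -
  assume "p < N"
  then have "p div s < NB" by (simp add: N_eq less_mult_imp_div_less)
  then have "rot p < Suc (p mod s) * NB" by (simp add: rot_def)
  also have "\<dots> \<le> s * NB" using s_pos by (intro mult_right_mono) (auto simp: Suc_le_eq)
  finally show ?thesis by (simp add: N_eq')
qed

lemma unrot_less: "p < N \<Longrightarrow> unrot p < N"
proof -
  assume "p < N"
  then have "p div NB < s" by (simp add: N_eq' less_mult_imp_div_less)
  then have "unrot p < Suc (p mod NB) * s" by (simp add: unrot_def)
  also have "\<dots> \<le> NB * s" using NB_pos by (intro mult_right_mono) (auto simp: Suc_le_eq)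
  finally show ?thesis by (simp add: N_eq)
qed

lemma unrot_rot: "p < N \<Longrightarrow> unrot (rot p) = p"
proof -
  assume "p < N"
  then have "p div s < NB" by (simp add: N_eq less_mult_imp_div_less)
  then show ?thesis by (simp add: rot_def unrot_def)
qed

lemma rot_unrot: "p < N \<Longrightarrow> rot (unrot p) = p"
proof -
  assume "p < N"
  then have "p div NB < s" by (simp add: N_eq' less_mult_imp_div_less)
  then show ?thesis using div_mult_mod_eq[of p NB] by (simp add: rot_def unrot_def)
qed

lemma inj_rot: "inj_on rot {..<N}" and inj_unrot: "inj_on unrot {..<N}"
  by (metis inj_onI lessThan_iff unrot_rot) (metis inj_onI lessThan_iff rot_unrot)

section \<open>Prefix sums\<close>

abbreviation acc :: "(nat \<Rightarrow> nat \<Rightarrow> nat) \<Rightarrow> (nat \<Rightarrow> nat) \<Rightarrow> nat set \<Rightarrow> nat" where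
  "acc f \<equiv> comm_monoid_set.F f 0"

text \<open>During a prefix sum a cell holds a triple: its word, the sum over the earlier cells of
  its current block, and the total of that block. The initial blocks are single cells.\<close>

definition scan_init where
  "scan_init g = permute (\<lambda>p. p) (\<lambda>c k y. prod_encode (y k, prod_encode (0, g c (y k))))"

definition scan_line where
  "scan_line f = permute unrot (\<lambda>c k y.
     let x = fst (prod_decode (y k)); t = (\<lambda>i. snd (prod_decode (snd (prod_decode (y i)))))
     in prod_encode (x, prod_encode
          (f (acc f t {..<k}) (fst (prod_decode (snd (prod_decode (y k))))), acc f t {..<s})))"

definition scan_fin where
  "scan_fin h = permute (\<lambda>p. p) (\<lambda>c k y.
     h c (fst (prod_decode (y k))) (fst (prod_decode (snd (prod_decode (y k))))))"

text \<open>
  Exclusive prefix sums in every copy. The \<open>j\<close>-th line step aggregates along the \<open>j\<close>-th base-\<open>s\<close>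
  digit of the positions; rotating the digits after every step keeps the digit in question inside
  the machines.
\<close>

definition scan where
  "scan f g h = scan_init g # replicate q (scan_line f) @ [scan_fin h]"

text \<open>The position of cell \<open>p\<close> after \<open>j\<close> rotations: its
  \<open>j\<close> lowest digits have moved to the front.\<close>

definition rotn where
  "rotn j p = (p mod s ^ j) * s ^ (q - j) + p div s ^ j"

lemma digits:
  assumes "p < N" "j < q"
  obtains h k r where "p = h * s ^ Suc j + k * s ^ j + r" "k < s" "r < s ^ j" "h < s ^ (q - Suc j)"
proof
  let ?k = "(p div s ^ j) mod s" and ?r = "p mod s ^ j" and ?h = "p div s ^ Suc j"
  have "p div s ^ Suc j = p div s ^ j div s"
    by (simp add: div_mult2_eq power_Suc2 del: power_Suc)
  then have "p div s ^ j = ?h * s + ?k" by simp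
  then have "p = (?h * s + ?k) * s ^ j + ?r" by (metis div_mult_mod_eq)
  then show "p = ?h * s ^ Suc j + ?k * s ^ j + ?r" by (simp add: algebra_simps)
  show "?k < s" "?r < s ^ j" using s_pos by auto
  have "N = s ^ (q - Suc j) * s ^ Suc j" using assms by (simp add: N_def del: power_Suc flip: power_add)
  then show "?h < s ^ (q - Suc j)" using assms by (simp add: less_mult_imp_div_less)
qed

lemma digits_less:
  assumes "k < s" "r < s ^ j" "h < s ^ (q - Suc j)" "j < q"
  shows "h * s ^ Suc j + k * s ^ j + r < N"
proof -
  have "k * s ^ j + r < Suc k * s ^ j" using assms by simp
  also have "\<dots> \<le> s * s ^ j" using assms by (intro mult_right_mono) auto
  finally have "h * s ^ Suc j + k * s ^ j + r < Suc h * s ^ Suc j" by simp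
  also have "\<dots> \<le> s ^ (q - Suc j) * s ^ Suc j" using assms by (intro mult_right_mono) auto
  also have "\<dots> = N" using assms by (simp add: N_def del: power_Suc flip: power_add)
  finally show ?thesis .
qed

lemma digits_div: 
  assumes "k < s" "r < s ^ j"
  shows "(h * s ^ Suc j + k * s ^ j + r) div s ^ j = h * s + k"
    and "(h * s ^ Suc j + k * s ^ j + r) mod s ^ j = r"
    and "(h * s ^ Suc j + k * s ^ j + r) div s ^ Suc j = h"
    and "(h * s ^ Suc j + k * s ^ j + r) mod s ^ Suc j = k * s ^ j + r"
proof -
  have 1: "h * s ^ Suc j + k * s ^ j + r = (h * s + k) * s ^ j + r" by (simp add: algebra_simps)
  show "(h * s ^ Suc j + k * s ^ j + r) div s ^ j = h * s + k"
    "(h * s ^ Suc j + k * s ^ j + r) mod s ^ j = r"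
    unfolding 1 using assms by auto
  have "k * s ^ j + r < Suc k * s ^ j" using assms by simp
  also have "\<dots> \<le> s * s ^ j" using assms by (intro mult_right_mono) auto
  finally have 2: "k * s ^ j + r < s ^ Suc j" by simp
  show "(h * s ^ Suc j + k * s ^ j + r) div s ^ Suc j = h"
    "(h * s ^ Suc j + k * s ^ j + r) mod s ^ Suc j = k * s ^ j + r"
    unfolding add.assoc using div_mult_self3[of "s ^ Suc j" "k * s ^ j + r" h] s_pos 2
    by (auto simp del: power_Suc)
qed

text \<open>After \<open>j\<close> rotations the digit \<open>k\<close> of weight
  \<open>s ^ j\<close> is the lowest one, so the \<open>s\<close> positions that differ only in
  \<open>k\<close> share a machine. The next rotation brings this digit to the front.\<close>

lemma rotn_digits:
  assumes "k < s" "r < s ^ j" "h < s ^ (q - Suc j)" "j < q"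
  shows "rotn j (h * s ^ Suc j + k * s ^ j + r) = (r * s ^ (q - Suc j) + h) * s + k"
    and "rotn (Suc j) (h * s ^ Suc j + k * s ^ j + r) = k * NB + (r * s ^ (q - Suc j) + h)"
    and "r * s ^ (q - Suc j) + h < NB"
proof -
  have e: "q - j = Suc (q - Suc j)" using assms by simp
  have nb: "NB = s ^ j * s ^ (q - Suc j)" using assms by (simp add: NB_def flip: power_add)
  show "rotn j (h * s ^ Suc j + k * s ^ j + r) = (r * s ^ (q - Suc j) + h) * s + k"
    unfolding rotn_def digits_div[OF assms(1,2)] e by (simp add: algebra_simps)
  show "rotn (Suc j) (h * s ^ Suc j + k * s ^ j + r) = k * NB + (r * s ^ (q - Suc j) + h)"
    unfolding rotn_def digits_div[OF assms(1,2)] nb by (simp add: algebra_simps)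
  have "r * s ^ (q - Suc j) + h < Suc r * s ^ (q - Suc j)" using assms by simp
  also have "\<dots> \<le> s ^ j * s ^ (q - Suc j)" using assms by (intro mult_right_mono) auto
  finally show "r * s ^ (q - Suc j) + h < NB" by (simp add: nb)
qed

lemma unrot_rotn:
  assumes "p < N" "j < q"
  shows "unrot (rotn (Suc j) p) = rotn j p"
proof -
  obtain h k r where p: "p = h * s ^ Suc j + k * s ^ j + r" and b: "k < s" "r < s ^ j" "h < s ^ (q - Suc j)"
    using digits[OF assms] by metis
  show ?thesis
    unfolding p rotn_digits(1,2)[OF b assms(2)] unrot_def using rotn_digits(3)[OF b assms(2)] by simp
qed

lemma rotn_bij: "j \<le> q \<Longrightarrow> bij_betw (rotn j) {..<N} {..<N}"
proof (induction j)
  case 0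
  have "rotn 0 p = p" for p by (simp add: rotn_def)
  then show ?case by (auto simp: bij_betw_def inj_on_def)
next
  case (Suc j)
  have lt: "rotn (Suc j) p < N" if "p < N" for p
  proof -
    obtain h k r where p: "p = h * s ^ Suc j + k * s ^ j + r" and b: "k < s" "r < s ^ j" "h < s ^ (q - Suc j)"
      using digits[OF \<open>p < N\<close>] Suc.prems by (metis Suc_le_lessD)
    have "rotn (Suc j) p < Suc k * NB"
      unfolding p using rotn_digits(2,3)[OF b] Suc.prems by simp
    also have "\<dots> \<le> s * NB" using b by (intro mult_right_mono) auto
    finally show ?thesis by (simp add: N_eq')
  qed
  have "inj_on (rotn j) {..<N}" using Suc by (auto simp: bij_betw_def)
  then have "inj_on (rotn (Suc j)) {..<N}"
    using unrot_rotn Suc.prems by (intro inj_onI) (metis Suc_le_lessD inj_onD lessThan_iff)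
  then show ?case using lt by (intro bij_betw_imageI endo_inj_surj) auto
qed

context
  fixes f :: "nat \<Rightarrow> nat \<Rightarrow> nat"
  assumes f: "comm_monoid_set f 0"
begin

interpretation F: comm_monoid_set f 0 by (rule f)

lemma acc_split:
  fixes i j k :: nat
  assumes "i \<le> j" "j \<le> k"
  shows "F.F g {i..<k} = f (F.F g {i..<j}) (F.F g {j..<k})"
proof -
  have "{i..<k} = {i..<j} \<union> {j..<k}" using assms by auto
  then show ?thesis by (simp add: F.union_disjoint)
qed

lemma acc_group:
  fixes b w k :: nat
  shows "F.F (\<lambda>i. F.F g {b + i * w..<b + i * w + w}) {..<k} = F.F g {b..<b + k * w}"
proof (induction k)
  case (Suc k)
  have "F.F (\<lambda>i. F.F g {b + i * w..<b + i * w + w}) {..<Suc k}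
      = f (F.F g {b..<b + k * w}) (F.F g {b + k * w..<b + k * w + w})"
    using Suc by (simp add: lessThan_Suc F.commute)
  also have "\<dots> = F.F g {b..<b + Suc k * w}"
    by (subst acc_split[of b "b + k * w"]) (auto simp: algebra_simps)
  finally show ?case .
qed simp

text \<open>The blocks after \<open>j\<close> line steps are the aligned intervals of length
  \<open>s ^ j\<close>. Every cell of a block carries its total, so that for each offset the line
  through that offset sees the totals of all \<open>s\<close> subblocks.\<close>

definition scan_inv where
  "scan_inv v x j z \<longleftrightarrow> (\<forall>\<kappa><2 ^ a. \<forall>p<N. z (\<kappa> * N + rotn j p) =
     prod_encode (x (\<kappa> * N + p), prod_encode
       (F.F (v \<kappa>) {p div s ^ j * s ^ j..<p}, F.F (v \<kappa>) {p div s ^ j * s ^ j..<p div s ^ j * s ^ j + s ^ j})))"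

lemma scan_line_step:
  assumes inv: "scan_inv v x j z" and j: "j < q"
    and x: "\<And>c. x c < Y" and v: "\<And>\<kappa> A. \<kappa> < 2 ^ a \<Longrightarrow> A \<subseteq> {..<N} \<Longrightarrow> F.F (v \<kappa>) A < Y"
  shows "scan_inv v x (Suc j) (net_step M s (scan_line f) z)" "net_ok M s Z (scan_line f) z"
proof -
  define H where "H = (\<lambda>(c::nat) k y.
     let x = fst (prod_decode (y k)); t = (\<lambda>i. snd (prod_decode (snd (prod_decode (y i)))))
     in prod_encode (x, prod_encode
          (f (F.F t {..<k}) (fst (prod_decode (snd (prod_decode (y k))))), F.F t {..<s})))"
  have line: "scan_line f = permute unrot H" by (simp add: scan_line_def H_def)
  have val: "H (\<kappa> * N + rotn (Suc j) p) (unrot (rotn (Suc j) p) mod s)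
        (\<lambda>k. if k < s then z (\<kappa> * N + (unrot (rotn (Suc j) p) div s * s + k)) else 0) =
      prod_encode (x (\<kappa> * N + p), prod_encode
       (F.F (v \<kappa>) {p div s ^ Suc j * s ^ Suc j..<p},
        F.F (v \<kappa>) {p div s ^ Suc j * s ^ Suc j..<p div s ^ Suc j * s ^ Suc j + s ^ Suc j}))"
    if \<kappa>: "\<kappa> < 2 ^ a" and pN: "p < N" for \<kappa> p
  proof -
    obtain h k r where p: "p = h * s ^ Suc j + k * s ^ j + r" and b: "k < s" "r < s ^ j" "h < s ^ (q - Suc j)"
      using digits[OF pN j] by metis
    \<comment> \<open>The line through \<open>p\<close>: the same \<open>h\<close> and
      \<open>r\<close> with every digit \<open>i\<close>. The totals of these cells belong to
      \<open>s\<close> consecutive intervals, which \<open>acc_group\<close> joins.\<close>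
    define pp where "pp = (\<lambda>i. h * s ^ Suc j + i * s ^ j + r)"
    define y where "y = (\<lambda>k. if k < s then z (\<kappa> * N + (unrot (rotn (Suc j) p) div s * s + k)) else 0)"
    have un: "unrot (rotn (Suc j) p) = (r * s ^ (q - Suc j) + h) * s + k"
      using unrot_rotn[OF pN j] rotn_digits(1)[OF b j, folded p] by simp
    have y: "y i = prod_encode (x (\<kappa> * N + pp i), prod_encode
        (F.F (v \<kappa>) {h * s ^ Suc j + i * s ^ j..<pp i},
         F.F (v \<kappa>) {h * s ^ Suc j + i * s ^ j..<h * s ^ Suc j + i * s ^ j + s ^ j}))" if "i < s" for i
    proof -
      have "y i = z (\<kappa> * N + rotn j (pp i))"
        unfolding pp_def rotn_digits(1)[OF that b(2,3) j] y_def using that b(1) by (simp add: un)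
      moreover have "pp i < N" unfolding pp_def by (rule digits_less[OF that b(2,3) j])
      moreover have "pp i div s ^ j * s ^ j = h * s ^ Suc j + i * s ^ j"
        unfolding pp_def digits_div[OF that b(2)] by (simp add: algebra_simps)
      ultimately show ?thesis using inv \<kappa> by (simp add: scan_inv_def)
    qed
    have g: "F.F (\<lambda>i. snd (prod_decode (snd (prod_decode (y i))))) {..<k'} =
        F.F (v \<kappa>) {h * s ^ Suc j..<h * s ^ Suc j + k' * s ^ j}" if "k' \<le> s" for k'
      unfolding acc_group[symmetric] using that y by (intro F.cong) auto
    have pd: "p div s ^ Suc j * s ^ Suc j = h * s ^ Suc j"
      unfolding p digits_div[OF b(1,2)] ..
    have p_eq: "p = pp k" by (simp add: p pp_def)
    have "f (F.F (v \<kappa>) {h * s ^ Suc j..<h * s ^ Suc j + k * s ^ j}) (F.F (v \<kappa>) {h * s ^ Suc j + k * s ^ j..<pp k})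
        = F.F (v \<kappa>) {h * s ^ Suc j..<p}"
      unfolding p_eq by (rule acc_split[symmetric]) (auto simp: pp_def)
    moreover have "unrot (rotn (Suc j) p) mod s = k" unfolding un using b(1) by simp
    ultimately show ?thesis
      using g[of k] g[of s] b(1) y[of k] unfolding pd
      by (simp add: H_def Let_def p_eq flip: y_def)
  qed
  have un: "inj_on unrot {..<N}" "\<forall>p<N. unrot p < N" using inj_unrot unrot_less by auto
  have bij: "bij_betw (rotn (Suc j)) {..<N} {..<N}" using rotn_bij[of "Suc j"] j by simp
  show "scan_inv v x (Suc j) (net_step M s (scan_line f) z)"
    unfolding scan_inv_def
  proof (intro allI impI)
    fix \<kappa> p :: nat assume *: "\<kappa> < 2 ^ a" "p < N"
    have r: "rotn (Suc j) p < N" using bij *(2) by (auto simp: bij_betw_def)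
    show "net_step M s (scan_line f) z (\<kappa> * N + rotn (Suc j) p) = prod_encode (x (\<kappa> * N + p), prod_encode
       (F.F (v \<kappa>) {p div s ^ Suc j * s ^ Suc j..<p},
        F.F (v \<kappa>) {p div s ^ Suc j * s ^ Suc j..<p div s ^ Suc j * s ^ Suc j + s ^ Suc j}))"
      unfolding line permute_step(1)[OF un *(1) r] by (rule val[OF *])
  qed
  show "net_ok M s Z (scan_line f) z"
    unfolding line
  proof (rule permute_step(3)[OF un])
    fix \<kappa> p' :: nat assume *: "\<kappa> < 2 ^ a" "p' < N"
    obtain p where p: "p < N" "p' = rotn (Suc j) p"
      using bij *(2) unfolding bij_betw_def by (metis imageE lessThan_iff)
    have "p div s ^ Suc j < s ^ (q - Suc j)"
    proof -
      have "N = s ^ (q - Suc j) * s ^ Suc j" using j by (simp add: N_def del: power_Suc flip: power_add)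
      then show ?thesis using p(1) less_mult_imp_div_less by metis
    qed
    then have "p div s ^ Suc j * s ^ Suc j + s ^ Suc j \<le> N"
    proof -
      assume "p div s ^ Suc j < s ^ (q - Suc j)"
      then have "Suc (p div s ^ Suc j) * s ^ Suc j \<le> s ^ (q - Suc j) * s ^ Suc j"
        by (intro mult_right_mono) auto
      also have "\<dots> = N" using j by (simp add: N_def del: power_Suc flip: power_add)
      finally show ?thesis by simp
    qed
    then show "H (\<kappa> * N + p') (unrot p' mod s)
          (\<lambda>k. if k < s then z (\<kappa> * N + (unrot p' div s * s + k)) else 0) < Z"
      unfolding p(2) val[OF *(1) p(1)] using p(1) by (intro enc3 x v *(1)) auto
  qed
qed

lemma scan_run:
  assumes x: "\<And>c. x c < Y"
    and v': "\<forall>\<kappa><2 ^ a. \<forall>A\<subseteq>{..<N}. F.F (\<lambda>i. g (\<kappa> * N + i) (x (\<kappa> * N + i))) A < Y"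
    and h': "\<forall>\<kappa><2 ^ a. \<forall>p<N.
      h (\<kappa> * N + p) (x (\<kappa> * N + p)) (F.F (\<lambda>i. g (\<kappa> * N + i) (x (\<kappa> * N + i))) {..<p}) < Z"
  shows "oks (scan f g h) x"
    and "\<And>\<kappa> p. \<kappa> < 2 ^ a \<Longrightarrow> p < N \<Longrightarrow> run (scan f g h) x (\<kappa> * N + p) =
      h (\<kappa> * N + p) (x (\<kappa> * N + p)) (F.F (\<lambda>i. g (\<kappa> * N + i) (x (\<kappa> * N + i))) {..<p})"
    and "\<And>c. T \<le> c \<Longrightarrow> run (scan f g h) x c = 0"
proof -
  define w where "w = (\<lambda>\<kappa> i. g (\<kappa> * N + i) (x (\<kappa> * N + i)))"
  have w: "F.F (w \<kappa>) A < Y" if "\<kappa> < 2 ^ a" "A \<subseteq> {..<N}" for \<kappa> A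
    using v' that by (simp add: w_def)
  have id: "inj_on (\<lambda>p. p) {..<N}" "\<forall>p<N. p < N" by auto
  define z where "z = net_step M s (scan_init g) x"
  have i0: "scan_inv w x 0 z"
  proof -
    have "z (\<kappa> * N + p) = prod_encode (x (\<kappa> * N + p), prod_encode (0, w \<kappa> p))" if "\<kappa> < 2 ^ a" "p < N" for \<kappa> p
      unfolding z_def scan_init_def using s_pos by (subst permute_step(1)[OF id that]) (simp add: w_def)
    then show ?thesis by (simp add: scan_inv_def rotn_def)
  qed
  have ok0: "net_ok M s Z (scan_init g) x"
    unfolding scan_init_def
  proof (rule permute_step(3)[OF id])
    fix \<kappa> p :: nat assume "\<kappa> < 2 ^ a" "p < N"
    moreover have "w \<kappa> p < Y" using w[of \<kappa> "{p}"] \<open>\<kappa> < 2 ^ a\<close> \<open>p < N\<close> by simp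
    moreover have "0 < Y" using x[of 0] by simp
    ultimately show "prod_encode ((if p mod s < s then x (\<kappa> * N + (p div s * s + p mod s)) else 0),
        prod_encode (0, g (\<kappa> * N + p) (if p mod s < s then x (\<kappa> * N + (p div s * s + p mod s)) else 0))) < Z"
      using s_pos x by (auto simp: w_def intro!: enc3)
  qed
  have lines: "scan_inv w x j (run (replicate j (scan_line f)) z) \<and> oks (replicate j (scan_line f)) z"
    if "j \<le> q" for j
    using that
  proof (induction j)
    case (Suc j)
    let ?z = "run (replicate j (scan_line f)) z"
    have "scan_inv w x j ?z" "j < q" "oks (replicate j (scan_line f)) z" using Suc by auto
    moreover have "replicate (Suc j) (scan_line f) = replicate j (scan_line f) @ [scan_line f]"
      by (simp add: replicate_append_same)
    ultimately show ?case
      using scan_line_step[of w x j ?z, OF _ _ x w] by (simp only: net_oks_append fold_append) simp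
  qed (simp add: i0)
  define z' where "z' = run (replicate q (scan_line f)) z"
  have z': "z' (\<kappa> * N + p) = prod_encode (x (\<kappa> * N + p), prod_encode (F.F (w \<kappa>) {..<p}, F.F (w \<kappa>) {..<N}))"
    if "\<kappa> < 2 ^ a" "p < N" for \<kappa> p
  proof -
    have "rotn q p = p" using that by (simp add: rotn_def flip: N_def)
    moreover have "scan_inv w x q z'" using lines[of q] by (simp add: z'_def)
    ultimately show ?thesis using that unfolding scan_inv_def
      by (metis (no_types, lifting) N_def add_0 atLeast0LessThan div_less mult_0)
  qed
  have fin: "(if p mod s < s then z' (\<kappa> * N + (p div s * s + p mod s)) else 0) = z' (\<kappa> * N + p)" for \<kappa> p
    using s_pos by simp
  have run: "run (scan f g h) x = net_step M s (scan_fin h) z'"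
    by (simp add: scan_def z_def z'_def)
  show "run (scan f g h) x (\<kappa> * N + p) =
      h (\<kappa> * N + p) (x (\<kappa> * N + p)) (F.F (\<lambda>i. g (\<kappa> * N + i) (x (\<kappa> * N + i))) {..<p})"
    if "\<kappa> < 2 ^ a" "p < N" for \<kappa> p
    unfolding run scan_fin_def
    by (rule trans[OF permute_step(1)[OF id that]]) (simp only: fin z'[OF that], simp add: w_def)
  show "run (scan f g h) x c = 0" if "T \<le> c" for c
    unfolding run scan_fin_def by (rule permute_step(2)[OF id that])
  have okf: "net_ok M s Z (scan_fin h) z'"
    unfolding scan_fin_def
  proof (rule permute_step(3)[OF id])
    fix \<kappa> p :: nat assume *: "\<kappa> < 2 ^ a" "p < N"
    show "h (\<kappa> * N + p) (fst (prod_decode (if p mod s < s then z' (\<kappa> * N + (p div s * s + p mod s)) else 0)))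
        (fst (prod_decode (snd (prod_decode (if p mod s < s then z' (\<kappa> * N + (p div s * s + p mod s)) else 0))))) < Z"
      unfolding fin z'[OF *] using h' * by (simp add: w_def)
  qed
  show "oks (scan f g h) x"
    using ok0 lines[of q] okf by (simp add: scan_def net_oks_append z_def z'_def)
qed

end

section \<open>Radix sort\<close>

lemma acc_plus: "acc (+) g A = sum g A"
  by (simp add: sum_def)

lemma comm_monoid_set_plus: "comm_monoid_set (+) (0::nat)"
  by (rule sum.comm_monoid_set_axioms)

lemma lex_less:
  fixes m :: nat
  assumes "b < m" "b' < m"
  shows "u * m + b < u' * m + b' \<longleftrightarrow> u < u' \<or> (u = u' \<and> b < b')"
proof -
  have *: "u * m + b < u' * m + b'" if "u < u'" "b < m" for u u' b b'
  proof -
    have "u * m + b < Suc u * m" using that by simp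
    also have "\<dots> \<le> u' * m" using that by (intro mult_right_mono) auto
    finally show ?thesis by simp
  qed
  show ?thesis using *[of u u' b b'] *[of u' u b' b] assms by (cases u u' rule: linorder_cases) auto
qed

definition dig :: "(nat \<Rightarrow> nat) \<Rightarrow> nat \<Rightarrow> nat \<Rightarrow> nat" where
  "dig key j w = (key w div s ^ j) mod s"

text \<open>Cell \<open>g\<close> of machine \<open>B\<close> holds the number of words in the copy
  that have a smaller digit, or digit \<open>g\<close> in an earlier machine. The rank within the
  machine completes the address; counting only \<open>i < k\<close> keeps the order of equal
  digits.\<close>

definition send :: "(nat \<Rightarrow> nat) \<Rightarrow> nat \<Rightarrow> emitter" where
  "send key j B y = map (\<lambda>k. let w = fst (prod_decode (y k)); g = dig key j w in
     (B div NB * N + (snd (prod_decode (y g)) + card {i. i < k \<and> dig key j (fst (prod_decode (y i))) = g}), w))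
     [0..<s]"

text \<open>
  Counting sort by one digit. Machine \<open>B\<close> puts the number of its words with digit \<open>g\<close> into its
  \<open>g\<close>-th cell; in the rotated array these counts are ordered by \<open>(g, B)\<close>, so that their prefix sums
  are the addresses where the words have to go.
\<close>

definition pass :: "(nat \<Rightarrow> nat) \<Rightarrow> nat \<Rightarrow> emitter list" where
  "pass key j = permute unrot (\<lambda>c k y. prod_encode (y k, card {i. i < s \<and> dig key j (y i) = k})) #
     scan (+) (\<lambda>c w. snd (prod_decode w)) (\<lambda>c w P. prod_encode (fst (prod_decode w), P)) @
     [permute rot (\<lambda>c k y. y k), send key j]"

definition good :: "(nat \<Rightarrow> nat) \<Rightarrow> bool" where
  "good x \<longleftrightarrow> (\<forall>c. x c < Y0) \<and> (\<forall>c\<ge>T. x c = 0)"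

definition shuffled :: "(nat \<Rightarrow> nat) \<Rightarrow> (nat \<Rightarrow> nat) \<Rightarrow> nat \<Rightarrow> (nat \<Rightarrow> nat) \<Rightarrow> bool" where
  "shuffled x x' \<kappa> \<pi> \<longleftrightarrow> bij_betw \<pi> {..<N} {..<N} \<and> (\<forall>i<N. x' (\<kappa> * N + i) = x (\<kappa> * N + \<pi> i))"

lemma dig_less: "dig key j w < s"
  using s_pos by (simp add: dig_def)

text \<open>\<open>\<iota>\<close> numbers the counters by digit and machine, \<open>\<tau>\<close>
  orders the words by digit and position. The address of a word turns out to be its rank under
  \<open>\<tau>\<close>. Since \<open>\<tau>\<close> is injective, ranks form a permutation, which
  yields distinct addresses and stability at once.\<close>

lemma pass_run:
  assumes x: "\<And>c. x c < Y0"
  shows "oks (pass key j) x" "good (run (pass key j) x)"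
    and "\<And>\<kappa>. \<kappa> < 2 ^ a \<Longrightarrow> \<exists>\<pi>. shuffled x (run (pass key j) x) \<kappa> \<pi> \<and>
      (\<forall>i i'. i < i' \<and> i' < N \<longrightarrow> dig key j (x (\<kappa> * N + \<pi> i)) * N + \<pi> i < dig key j (x (\<kappa> * N + \<pi> i')) * N + \<pi> i')"
proof -
  define dg where "dg = (\<lambda>\<kappa> p. dig key j (x (\<kappa> * N + p)))"
  define \<iota> where "\<iota> = (\<lambda>\<kappa> p. dg \<kappa> p * NB + p div s)"
  define \<tau> where "\<tau> = (\<lambda>\<kappa> p. dg \<kappa> p * N + p)"
  define rk where "rk = (\<lambda>\<kappa> p. card {p'. p' < N \<and> \<tau> \<kappa> p' < \<tau> \<kappa> p})"
  have dg: "dg \<kappa> p < s" for \<kappa> p by (simp add: dg_def dig_less)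
  have un: "inj_on unrot {..<N}" "\<forall>p<N. unrot p < N" using inj_unrot unrot_less by auto
  have ro: "inj_on rot {..<N}" "\<forall>p<N. rot p < N" using inj_rot rot_less by auto
  have sN: "s \<le> N" using NB_pos by (simp add: N_eq)
  have block: "p div s * s + i < N" if "p < N" "i < s" for p i
  proof -
    have "p div s < NB" using that by (simp add: N_eq less_mult_imp_div_less)
    then have "Suc (p div s) * s \<le> N" unfolding N_eq by (intro mult_right_mono) auto
    then show ?thesis using that by simp
  qed
  define cnt where "cnt = (\<lambda>\<kappa> p. card {i. i < s \<and> dg \<kappa> (p div s * s + i) = p mod s})"
  have cnt_le: "cnt \<kappa> p \<le> s" for \<kappa> p
    unfolding cnt_def using card_mono[of "{..<s}" "{i. i < s \<and> dg \<kappa> (p div s * s + i) = p mod s}"] by auto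
  \<comment> \<open>The counter that is moved to cell \<open>i\<close> counts the positions with
    index \<open>i\<close>, so prefix sums of counters count the positions with smaller
    index.\<close>
  have cnt: "cnt \<kappa> (unrot i) = card {p. p < N \<and> \<iota> \<kappa> p = i}" if "i < N" for \<kappa> i
  proof -
    let ?p = "unrot i"
    have p: "?p < N" "rot ?p = i" using that un(2) by (auto simp: rot_unrot)
    have B: "?p div s < NB" using p by (simp add: N_eq less_mult_imp_div_less)
    have "bij_betw (\<lambda>k. ?p div s * s + k) {k. k < s \<and> dg \<kappa> (?p div s * s + k) = ?p mod s} {p. p < N \<and> \<iota> \<kappa> p = i}"
    proof (rule bij_betw_imageI)
      show "(\<lambda>k. ?p div s * s + k) ` {k. k < s \<and> dg \<kappa> (?p div s * s + k) = ?p mod s} = {p. p < N \<and> \<iota> \<kappa> p = i}"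
      proof (intro equalityI subsetI)
        fix p' assume "p' \<in> (\<lambda>k. ?p div s * s + k) ` {k. k < s \<and> dg \<kappa> (?p div s * s + k) = ?p mod s}"
        then show "p' \<in> {p. p < N \<and> \<iota> \<kappa> p = i}"
          using block[OF p(1)] p(2) by (auto simp: \<iota>_def rot_def)
      next
        fix p' assume "p' \<in> {p. p < N \<and> \<iota> \<kappa> p = i}"
        then have p': "p' < N" "dg \<kappa> p' * NB + p' div s = ?p mod s * NB + ?p div s"
          using p(2) by (auto simp: \<iota>_def rot_def)
        have "p' div s < NB" using p' by (simp add: N_eq less_mult_imp_div_less)
        then have *: "dg \<kappa> p' = ?p mod s" "p' div s = ?p div s"
          using arg_cong[OF p'(2), of "\<lambda>z. z div NB"] arg_cong[OF p'(2), of "\<lambda>z. z mod NB"] B by auto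
        have e: "p' = ?p div s * s + p' mod s" using *(2) by (metis div_mult_mod_eq)
        show "p' \<in> (\<lambda>k. ?p div s * s + k) ` {k. k < s \<and> dg \<kappa> (?p div s * s + k) = ?p mod s}"
          using s_pos *(1) by (intro image_eqI[where x = "p' mod s"] e) (simp flip: e)
      qed
    qed (auto simp: inj_on_def)
    from bij_betw_same_card[OF this] show ?thesis by (simp only: cnt_def)
  qed
  have cnt_sum: "(\<Sum>i\<in>A. cnt \<kappa> (unrot i)) = card {p. p < N \<and> \<iota> \<kappa> p \<in> A}" if "A \<subseteq> {..<N}" for A \<kappa>
  proof -
    have fin: "finite A" using that finite_subset by blast
    have "(\<Sum>i\<in>A. cnt \<kappa> (unrot i)) = (\<Sum>i\<in>A. card {p. p < N \<and> \<iota> \<kappa> p = i})"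
      using cnt that by (intro sum.cong) auto
    also have "\<dots> = card (\<Union>i\<in>A. {p. p < N \<and> \<iota> \<kappa> p = i})"
      using fin by (intro card_UN_disjoint[symmetric]) auto
    also have "(\<Union>i\<in>A. {p. p < N \<and> \<iota> \<kappa> p = i}) = {p. p < N \<and> \<iota> \<kappa> p \<in> A}" by auto
    finally show ?thesis .
  qed
  have cnt_sum_le: "(\<Sum>i\<in>A. cnt \<kappa> (unrot i)) \<le> N" if "A \<subseteq> {..<N}" for A \<kappa>
    unfolding cnt_sum[OF that] using card_mono[of "{..<N}" "{p. p < N \<and> \<iota> \<kappa> p \<in> A}"] by auto

  let ?H1 = "\<lambda>(c::nat) k y. prod_encode (y k, card {i. i < s \<and> dig key j (y i) = k})"
  define x1 where "x1 = net_step M s (permute unrot ?H1) x"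
  have v1: "pval unrot ?H1 x \<kappa> p = prod_encode (x (\<kappa> * N + unrot p), cnt \<kappa> (unrot p))"
    if "p < N" for \<kappa> p
  proof -
    have "{i. i < s \<and> dig key j (if i < s then x (\<kappa> * N + (unrot p div s * s + i)) else 0) = unrot p mod s}
        = {i. i < s \<and> dg \<kappa> (unrot p div s * s + i) = unrot p mod s}" by (auto simp: dg_def)
    then show ?thesis using s_pos by (simp add: cnt_def)
  qed
  have b1: "prod_encode (x c, cnt \<kappa> p) < Y" for c \<kappa> p
    using x cnt_le[of \<kappa> p] sN N_less by (intro enc2) auto
  have x1: "x1 (\<kappa> * N + p) = prod_encode (x (\<kappa> * N + unrot p), cnt \<kappa> (unrot p))"
    if "\<kappa> < 2 ^ a" "p < N" for \<kappa> p
    unfolding x1_def permute_step(1)[OF un that] by (rule v1[OF that(2)])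
  have x1_Y: "x1 c < Y" for c
  proof (cases "c < T")
    case True
    then show ?thesis using b1 by (elim cell_cases) (simp add: x1)
  next
    case False
    then show ?thesis using permute_step(2)[OF un, of c] b1[of 0 0 0] by (simp add: x1_def)
  qed
  have ok1: "net_ok M s Z (permute unrot ?H1) x"
    using b1 Y_le by (intro permute_step(3)[OF un]) (simp only: v1, meson less_le_trans)

  let ?g = "\<lambda>(c::nat) w. snd (prod_decode w)"
  let ?h = "\<lambda>(c::nat) w P. prod_encode (fst (prod_decode w), P)"
  have sc_sum: "acc (+) (\<lambda>i. ?g (\<kappa> * N + i) (x1 (\<kappa> * N + i))) A = (\<Sum>i\<in>A. cnt \<kappa> (unrot i))"
    if "\<kappa> < 2 ^ a" "A \<subseteq> {..<N}" for \<kappa> A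
    unfolding acc_plus using that x1 by (intro sum.cong) auto
  have sc_v: "acc (+) (\<lambda>i. ?g (\<kappa> * N + i) (x1 (\<kappa> * N + i))) A < Y" if "\<kappa> < 2 ^ a" "A \<subseteq> {..<N}" for \<kappa> A
    unfolding sc_sum[OF that] using cnt_sum_le[OF that(2), of \<kappa>] N_less Y0_le by linarith
  have sc_h: "?h (\<kappa> * N + p) (x1 (\<kappa> * N + p)) (acc (+) (\<lambda>i. ?g (\<kappa> * N + i) (x1 (\<kappa> * N + i))) {..<p})
      = prod_encode (x (\<kappa> * N + unrot p), card {p'. p' < N \<and> \<iota> \<kappa> p' < p})" if "\<kappa> < 2 ^ a" "p < N" for \<kappa> p
    using that sc_sum[OF that(1), of "{..<p}"] cnt_sum[of "{..<p}" \<kappa>] by (simp add: x1 subset_iff)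
  have b2: "prod_encode (x c, card {p'. p' < N \<and> \<iota> \<kappa> p' < p}) < Z" for c \<kappa> p
  proof -
    have "card {p'. p' < N \<and> \<iota> \<kappa> p' < p} \<le> card {..<N}" by (intro card_mono) auto
    then have "prod_encode (x c, card {p'. p' < N \<and> \<iota> \<kappa> p' < p}) < Y"
      using x N_less by (intro enc2) auto
    then show ?thesis using Y_le by simp
  qed
  have sc_hZ: "?h (\<kappa> * N + p) (x1 (\<kappa> * N + p)) (acc (+) (\<lambda>i. ?g (\<kappa> * N + i) (x1 (\<kappa> * N + i))) {..<p}) < Z"
    if "\<kappa> < 2 ^ a" "p < N" for \<kappa> p
    unfolding sc_h[OF that] by (rule b2)
  have sc_v': "\<forall>\<kappa><2 ^ a. \<forall>A\<subseteq>{..<N}. acc (+) (\<lambda>i. ?g (\<kappa> * N + i) (x1 (\<kappa> * N + i))) A < Y"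
    using sc_v by blast
  have sc_hZ': "\<forall>\<kappa><2 ^ a. \<forall>p<N.
      ?h (\<kappa> * N + p) (x1 (\<kappa> * N + p)) (acc (+) (\<lambda>i. ?g (\<kappa> * N + i) (x1 (\<kappa> * N + i))) {..<p}) < Z"
    using sc_hZ by blast
  note sc = scan_run[OF comm_monoid_set_plus, where x = x1 and g = ?g and h = ?h, OF x1_Y sc_v' sc_hZ']
  define x2 where "x2 = run (scan (+) ?g ?h) x1"
  have x2: "x2 (\<kappa> * N + p) = prod_encode (x (\<kappa> * N + unrot p), card {p'. p' < N \<and> \<iota> \<kappa> p' < p})"
    if "\<kappa> < 2 ^ a" "p < N" for \<kappa> p
    unfolding x2_def sc(2)[OF that] by (rule sc_h[OF that])
  note ok2 = sc(1)

  let ?H3 = "\<lambda>(c::nat) k y. y k"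
  define x3 where "x3 = net_step M s (permute rot ?H3) x2"
  have v3: "pval rot ?H3 x2 \<kappa> p = prod_encode (x (\<kappa> * N + p), card {p'. p' < N \<and> \<iota> \<kappa> p' < rot p})"
    if "\<kappa> < 2 ^ a" "p < N" for \<kappa> p
    using x2[OF that(1) rot_less[OF that(2)]] s_pos that by (simp add: unrot_rot)
  have x3: "x3 (\<kappa> * N + p) = prod_encode (x (\<kappa> * N + p), card {p'. p' < N \<and> \<iota> \<kappa> p' < rot p})"
    if "\<kappa> < 2 ^ a" "p < N" for \<kappa> p
    unfolding x3_def permute_step(1)[OF ro that] by (rule v3[OF that])
  have ok3: "net_ok M s Z (permute rot ?H3) x2"
    using b2 by (intro permute_step(3)[OF ro]) (simp only: v3)

  have inj\<tau>: "inj_on (\<tau> \<kappa>) {..<N}" for \<kappa>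
  proof (rule inj_onI)
    fix p p' assume "p \<in> {..<N}" "p' \<in> {..<N}" and e: "\<tau> \<kappa> p = \<tau> \<kappa> p'"
    then show "p = p'"
      using arg_cong[OF e[unfolded \<tau>_def], of "\<lambda>z. z mod N"] by simp
  qed
  have rk: "bij_betw (rk \<kappa>) {..<N} {..<N}"
    "\<And>p p'. p < N \<Longrightarrow> p' < N \<Longrightarrow> rk \<kappa> p < rk \<kappa> p' \<Longrightarrow> \<tau> \<kappa> p < \<tau> \<kappa> p'" for \<kappa>
    using rank_bij[OF inj\<tau>[of \<kappa>]] unfolding rk_def by auto
  \<comment> \<open>Smaller under \<open>\<tau>\<close> means smaller under \<open>\<iota>\<close>,
    or earlier in the same machine with the same digit; the two cases are disjoint.\<close>
  have rk_eq: "card {p'. p' < N \<and> \<iota> \<kappa> p' < \<iota> \<kappa> (b * s + k)} + card {i. i < k \<and> dg \<kappa> (b * s + i) = dg \<kappa> (b * s + k)}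
      = rk \<kappa> (b * s + k)" if bk: "b < NB" "k < s" for \<kappa> b k
  proof -
    let ?A = "{p'. p' < N \<and> \<iota> \<kappa> p' < \<iota> \<kappa> (b * s + k)}"
    let ?I = "{i. i < k \<and> dg \<kappa> (b * s + i) = dg \<kappa> (b * s + k)}"
    have p: "b * s + k < N"
    proof -
      have "b * s + k < Suc b * s" using bk by simp
      also have "\<dots> \<le> N" unfolding N_eq using bk by (intro mult_right_mono) auto
      finally show ?thesis .
    qed
    have i: "\<iota> \<kappa> p' < \<iota> \<kappa> (b * s + k) \<longleftrightarrow> dg \<kappa> p' < dg \<kappa> (b * s + k) \<or> (dg \<kappa> p' = dg \<kappa> (b * s + k) \<and> p' div s < b)"
      if "p' < N" for p'
    proof -
      have "p' div s < NB" using that by (simp add: N_eq less_mult_imp_div_less)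
      then show ?thesis using bk lex_less[of "p' div s" NB b] by (simp add: \<iota>_def)
    qed
    have t: "\<tau> \<kappa> p' < \<tau> \<kappa> (b * s + k) \<longleftrightarrow> dg \<kappa> p' < dg \<kappa> (b * s + k) \<or> (dg \<kappa> p' = dg \<kappa> (b * s + k) \<and> p' < b * s + k)"
      if "p' < N" for p'
      using lex_less[OF that p] by (simp add: \<tau>_def)
    have "{p'. p' < N \<and> \<tau> \<kappa> p' < \<tau> \<kappa> (b * s + k)} = ?A \<union> (\<lambda>i. b * s + i) ` ?I"
    proof (intro equalityI subsetI)
      fix p' assume "p' \<in> {p'. p' < N \<and> \<tau> \<kappa> p' < \<tau> \<kappa> (b * s + k)}"
      then have p': "p' < N" "dg \<kappa> p' < dg \<kappa> (b * s + k) \<or> (dg \<kappa> p' = dg \<kappa> (b * s + k) \<and> p' < b * s + k)"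
        using t by auto
      show "p' \<in> ?A \<union> (\<lambda>i. b * s + i) ` ?I"
      proof (cases "\<iota> \<kappa> p' < \<iota> \<kappa> (b * s + k)")
        case False
        then have *: "dg \<kappa> p' = dg \<kappa> (b * s + k)" "p' < b * s + k" "b \<le> p' div s"
          using i[OF p'(1)] p'(2) by auto
        then have "b * s \<le> p'"
          by (metis div_times_less_eq_dividend le_trans mult_le_mono1)
        then have "p' = b * s + (p' - b * s)" "p' - b * s < k" using * by auto
        then show ?thesis using * by (intro UnI2 image_eqI[of _ _ "p' - b * s"]) auto
      qed (use p' in auto)
    next
      fix p' assume "p' \<in> ?A \<union> (\<lambda>i. b * s + i) ` ?I"
      then show "p' \<in> {p'. p' < N \<and> \<tau> \<kappa> p' < \<tau> \<kappa> (b * s + k)}"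
      proof
        assume "p' \<in> ?A"
        then have p': "p' < N" "dg \<kappa> p' < dg \<kappa> (b * s + k) \<or> (dg \<kappa> p' = dg \<kappa> (b * s + k) \<and> p' div s < b)"
          using i by auto
        moreover have "p' < b * s + k" if "p' div s < b"
        proof -
          have "p' < Suc (p' div s) * s" using s_pos by (simp add: dividend_less_div_times add.commute)
          also have "\<dots> \<le> b * s" using that by (intro mult_right_mono) auto
          finally show ?thesis by simp
        qed
        ultimately show ?thesis using t by auto
      next
        assume "p' \<in> (\<lambda>i. b * s + i) ` ?I"
        then show ?thesis using t p by auto
      qed
    qed
    moreover have "?A \<inter> (\<lambda>i. b * s + i) ` ?I = {}"
      using bk i by (auto simp: \<iota>_def)
    moreover have "card ((\<lambda>i. b * s + i) ` ?I) = card ?I" by (intro card_image) (auto simp: inj_on_def)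
    ultimately show ?thesis
      by (simp add: rk_def card_Un_disjoint)
  qed
  define D where "D = (\<lambda>c. c div N * N + rk (c div N) (c mod N))"
  have rk_less: "rk \<kappa> p < N" if "p < N" for \<kappa> p
    using rk(1)[of \<kappa>] that by (auto simp: bij_betw_def)
  have D: "D (\<kappa> * N + p) = \<kappa> * N + rk \<kappa> p" if "p < N" for \<kappa> p
    using that by (simp add: D_def)
  have em: "send key j B (blk s x3 B) = map (\<lambda>k. (D (B * s + k), x (B * s + k))) [0..<s]" if "B < M" for B
  proof -
    define \<kappa> b where "\<kappa> = B div NB" and "b = B mod NB"
    have \<kappa>: "\<kappa> < 2 ^ a" and b: "b < NB" and B: "B = \<kappa> * NB + b"
      using that NB_pos div_mult_mod_eq[of B NB] by (auto simp: \<kappa>_def b_def M_def less_mult_imp_div_less)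
    have cell: "B * s + k = \<kappa> * N + (b * s + k)" for k by (simp add: B N_eq algebra_simps)
    have pN: "b * s + k < N" if "k < s" for k
    proof -
      have "b * s + k < Suc b * s" using that by simp
      also have "\<dots> \<le> N" unfolding N_eq using b by (intro mult_right_mono) auto
      finally show ?thesis .
    qed
    have y: "blk s x3 B k = prod_encode (x (\<kappa> * N + (b * s + k)), card {p'. p' < N \<and> \<iota> \<kappa> p' < k * NB + b})"
      if "k < s" for k
      using x3[OF \<kappa> pN[OF that]] that by (simp add: blk_def cell rot_def)
    show ?thesis
      unfolding send_def
    proof (rule map_cong[OF refl])
      fix k assume "k \<in> set [0..<s]"
      then have k: "k < s" by simp
      have "card {i. i < k \<and> dig key j (fst (prod_decode (blk s x3 B i))) = dg \<kappa> (b * s + k)}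
          = card {i. i < k \<and> dg \<kappa> (b * s + i) = dg \<kappa> (b * s + k)}"
        using y k by (intro arg_cong[where f = card]) (auto simp: dg_def)
      moreover have "snd (prod_decode (blk s x3 B (dg \<kappa> (b * s + k)))) = card {p'. p' < N \<and> \<iota> \<kappa> p' < \<iota> \<kappa> (b * s + k)}"
        using y[OF dg] k by (simp add: \<iota>_def)
      ultimately show "(let w = fst (prod_decode (blk s x3 B k)); g = dig key j w in
          (B div NB * N + (snd (prod_decode (blk s x3 B g))
             + card {i. i < k \<and> dig key j (fst (prod_decode (blk s x3 B i))) = g}), w)) = (D (B * s + k), x (B * s + k))"
        using y[OF k] rk_eq[OF b k, of \<kappa>] D[OF pN[OF k], of \<kappa>]
        by (simp add: Let_def cell \<kappa>_def[symmetric]) (simp add: dg_def)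
    qed
  qed
  have injD: "inj_on D {..<M * s}"
  proof (rule inj_onI)
    fix c c' assume c: "c \<in> {..<M * s}" "c' \<in> {..<M * s}" and e: "D c = D c'"
    have r: "rk (c div N) (c mod N) < N" "rk (c' div N) (c' mod N) < N" using rk_less N_pos by auto
    have 1: "c div N = c' div N" using arg_cong[OF e, of "\<lambda>z. z div N"] r by (simp add: D_def)
    have "rk (c div N) (c mod N) = rk (c div N) (c' mod N)"
      using arg_cong[OF e, of "\<lambda>z. z mod N"] r 1 by (simp add: D_def)
    then have "c mod N = c' mod N"
      using rk(1)[of "c div N"] N_pos unfolding bij_betw_def by (meson inj_onD lessThan_iff mod_less_divisor)
    then show "c = c'" using 1 by (metis div_mult_mod_eq)
  qed
  have D_less: "D c < M * s" if "c < M * s" for c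
    using that unfolding T_eq[symmetric] by (elim cell_cases) (simp add: D cell_less rk_less)
  have xZ: "x c < Z" for c using x[of c] Y0_le Y_le by simp
  have "\<forall>B<M. send key j B (blk s x3 B) = map (\<lambda>k. (D (B * s + k), x (B * s + k))) [0..<s]"
    "\<forall>c<M * s. D c < M * s" "\<forall>c<M * s. x c < Z"
    using em D_less xZ by auto
  note send = push_step[where M = M and s = s and Z = Z and em = "send key j" and D = D and V = x and x = x3,
    OF this(1) injD this(2,3), unfolded T_eq[symmetric]]
  define x4 where "x4 = net_step M s (send key j) x3"
  have run: "run (pass key j) x = x4"
    by (simp add: pass_def x1_def x2_def x3_def x4_def)
  have x4: "x4 (\<kappa> * N + rk \<kappa> p) = x (\<kappa> * N + p)" if "\<kappa> < 2 ^ a" "p < N" for \<kappa> p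
    using send(2)[OF cell_less[OF that]] D[OF that(2), of \<kappa>] by (simp add: x4_def)
  show "oks (pass key j) x"
    using ok1 ok2 ok3 send(1) by (simp add: pass_def net_oks_append x1_def x2_def x3_def)
  have ex: "\<exists>p<N. i = rk \<kappa> p" if "i < N" for i \<kappa>
    using rk(1)[of \<kappa>] that unfolding bij_betw_def by (metis imageE lessThan_iff)
  show "good (run (pass key j) x)"
    unfolding run good_def
  proof (intro conjI allI impI)
    show z: "x4 c = 0" if "T \<le> c" for c using send(3)[OF that] by (simp add: x4_def)
    show "x4 c < Y0" for c
    proof (cases "c < T")
      case True
      then show ?thesis
      proof (rule cell_cases)
        fix \<kappa> p assume *: "\<kappa> < 2 ^ a" "p < N" "c = \<kappa> * N + p"
        then obtain p' where "p' < N" "p = rk \<kappa> p'" using ex by metis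
        then show ?thesis using x4 * x by simp
      qed
    qed (use z N_less in auto)
  qed
  fix \<kappa> :: nat assume \<kappa>: "\<kappa> < 2 ^ a"
  define \<pi> where "\<pi> = inv_into {..<N} (rk \<kappa>)"
  have \<pi>: "bij_betw \<pi> {..<N} {..<N}" unfolding \<pi>_def by (rule bij_betw_inv_into[OF rk(1)])
  have \<pi>N: "\<pi> i < N" if "i < N" for i using \<pi> that by (auto simp: bij_betw_def)
  have rk\<pi>: "rk \<kappa> (\<pi> i) = i" if "i < N" for i
    unfolding \<pi>_def using rk(1)[of \<kappa>] that by (intro f_inv_into_f) (auto simp: bij_betw_def)
  have "shuffled x (run (pass key j) x) \<kappa> \<pi>"
    unfolding shuffled_def run using \<pi> x4[OF \<kappa> \<pi>N] rk\<pi> by simp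
  moreover have "dig key j (x (\<kappa> * N + \<pi> i)) * N + \<pi> i < dig key j (x (\<kappa> * N + \<pi> i')) * N + \<pi> i'"
    if "i < i'" "i' < N" for i i'
    using rk(2)[of "\<pi> i" "\<pi> i'" \<kappa>] rk\<pi>[of i] rk\<pi>[of i'] \<pi>N[of i] \<pi>N[of i'] that by (simp add: \<tau>_def dg_def)
  ultimately show "\<exists>\<pi>. shuffled x (run (pass key j) x) \<kappa> \<pi> \<and>
      (\<forall>i i'. i < i' \<and> i' < N \<longrightarrow> dig key j (x (\<kappa> * N + \<pi> i)) * N + \<pi> i < dig key j (x (\<kappa> * N + \<pi> i')) * N + \<pi> i')"
    by blast
qed

definition sort_by :: "(nat \<Rightarrow> nat) \<Rightarrow> nat \<Rightarrow> emitter list" where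
  "sort_by key w = concat (map (pass key) [0..<w])"

text \<open>Induction on the number of digits: as a pass is stable, words with equal new digit keep
  the order of the lower digits. With \<open>0 < w\<close> there is a last pass, which clears the
  cells beyond \<open>T\<close>.\<close>

lemma sort_by_run:
  assumes x: "\<And>c. x c < Y0" and w: "0 < w"
  shows "oks (sort_by key w) x" "good (run (sort_by key w) x)"
    and "\<And>\<kappa>. \<kappa> < 2 ^ a \<Longrightarrow> \<exists>\<pi>. shuffled x (run (sort_by key w) x) \<kappa> \<pi> \<and>
      (\<forall>i i'. i < i' \<and> i' < N \<longrightarrow>
        key (run (sort_by key w) x (\<kappa> * N + i)) mod s ^ w \<le> key (run (sort_by key w) x (\<kappa> * N + i')) mod s ^ w)"
proof -
  have *: "oks (sort_by key w) x \<and> (\<forall>c. run (sort_by key w) x c < Y0) \<and> (0 < w \<longrightarrow> good (run (sort_by key w) x)) \<and>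
    (\<forall>\<kappa><2 ^ a. \<exists>\<pi>. shuffled x (run (sort_by key w) x) \<kappa> \<pi> \<and>
      (\<forall>i i'. i < i' \<and> i' < N \<longrightarrow>
        key (run (sort_by key w) x (\<kappa> * N + i)) mod s ^ w \<le> key (run (sort_by key w) x (\<kappa> * N + i')) mod s ^ w))" for w
  proof (induction w)
    case 0
    have "shuffled x x \<kappa> (\<lambda>i. i)" for \<kappa> by (auto simp: shuffled_def bij_betw_def)
    then show ?case using x by (auto simp: sort_by_def)
  next
    case (Suc w)
    let ?y = "run (sort_by key w) x" and ?z = "run (sort_by key (Suc w)) x"
    have z: "?z = run (pass key w) ?y" by (simp add: sort_by_def)
    have y: "\<And>c. ?y c < Y0" using Suc by blast
    note P = pass_run[where x = ?y and key = key and j = w, OF y, folded z]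
    have ok: "oks (sort_by key (Suc w)) x"
      using Suc P(1) by (simp add: sort_by_def net_oks_append)
    have "\<exists>\<pi>. shuffled x ?z \<kappa> \<pi> \<and> (\<forall>i i'. i < i' \<and> i' < N \<longrightarrow>
        key (?z (\<kappa> * N + i)) mod s ^ Suc w \<le> key (?z (\<kappa> * N + i')) mod s ^ Suc w)" if \<kappa>: "\<kappa> < 2 ^ a" for \<kappa>
    proof -
      obtain \<pi> where \<pi>: "shuffled x ?y \<kappa> \<pi>" and s1: "\<And>i i'. i < i' \<Longrightarrow> i' < N \<Longrightarrow>
          key (?y (\<kappa> * N + i)) mod s ^ w \<le> key (?y (\<kappa> * N + i')) mod s ^ w"
        using Suc \<kappa> by blast
      obtain \<rho> where \<rho>: "shuffled ?y ?z \<kappa> \<rho>" and s2': "\<forall>i i'. i < i' \<and> i' < N \<longrightarrow>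
          dig key w (?y (\<kappa> * N + \<rho> i)) * N + \<rho> i < dig key w (?y (\<kappa> * N + \<rho> i')) * N + \<rho> i'"
        using P(3)[OF \<kappa>] by (elim exE conjE)
      have s2: "dig key w (?y (\<kappa> * N + \<rho> i)) * N + \<rho> i < dig key w (?y (\<kappa> * N + \<rho> i')) * N + \<rho> i'"
        if "i < i'" "i' < N" for i i'
        using s2' that by blast
      have \<rho>N: "\<rho> i < N" if "i < N" for i using \<rho> that by (auto simp: shuffled_def bij_betw_def)
      have "shuffled x ?z \<kappa> (\<pi> \<circ> \<rho>)"
        using \<pi> \<rho> \<rho>N unfolding shuffled_def by (auto intro: bij_betw_trans)
      moreover have "key (?z (\<kappa> * N + i)) mod s ^ Suc w \<le> key (?z (\<kappa> * N + i')) mod s ^ Suc w"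
        if "i < i'" "i' < N" for i i'
      proof -
        have zi: "?z (\<kappa> * N + i) = ?y (\<kappa> * N + \<rho> i)" "?z (\<kappa> * N + i') = ?y (\<kappa> * N + \<rho> i')"
          using \<rho> that by (auto simp: shuffled_def)
        have m: "k mod s ^ Suc w = (k div s ^ w) mod s * s ^ w + k mod s ^ w" for k
          using mod_mult2_eq[of k "s ^ w" s] by (simp add: mult.commute)
        have "dig key w (?y (\<kappa> * N + \<rho> i)) < dig key w (?y (\<kappa> * N + \<rho> i')) \<or>
            (dig key w (?y (\<kappa> * N + \<rho> i)) = dig key w (?y (\<kappa> * N + \<rho> i')) \<and> \<rho> i < \<rho> i')"
          using s2[OF that] lex_less[OF \<rho>N \<rho>N] that by auto
        then show ?thesis
        proof
          assume lt: "dig key w (?y (\<kappa> * N + \<rho> i)) < dig key w (?y (\<kappa> * N + \<rho> i'))"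
          have "0 < s ^ w" using s_pos by simp
          then show ?thesis
            unfolding zi m using lt lex_less[of "key (?y (\<kappa> * N + \<rho> i)) mod s ^ w" "s ^ w" "key (?y (\<kappa> * N + \<rho> i')) mod s ^ w"]
            by (auto simp: dig_def intro!: less_imp_le)
        next
          assume "dig key w (?y (\<kappa> * N + \<rho> i)) = dig key w (?y (\<kappa> * N + \<rho> i')) \<and> \<rho> i < \<rho> i'"
          then show ?thesis unfolding zi m using s1[of "\<rho> i" "\<rho> i'"] \<rho>N[of i'] that by (simp add: dig_def)
        qed
      qed
      ultimately show ?thesis by blast
    qed
    then show ?case using ok P(2) by (auto simp: good_def)
  qed
  show "oks (sort_by key w) x" "good (run (sort_by key w) x)"
    "\<And>\<kappa>. \<kappa> < 2 ^ a \<Longrightarrow> \<exists>\<pi>. shuffled x (run (sort_by key w) x) \<kappa> \<pi> \<and>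
      (\<forall>i i'. i < i' \<and> i' < N \<longrightarrow>
        key (run (sort_by key w) x (\<kappa> * N + i)) mod s ^ w \<le> key (run (sort_by key w) x (\<kappa> * N + i')) mod s ^ w)"
    using *[of w] w by auto
qed

end

section \<open>Steps with at most two readers per cell, and positions in sorted arrays\<close>

context net
begin

text \<open>Values that are too large become \<open>0\<close>, so that a step obeys the limits on
  arbitrary data. That nothing is lost on actual data is part of the correctness proofs.\<close>

definition cl :: "nat \<Rightarrow> nat" where
  "cl z = (if z < Y0 then z else 0)"

lemma cl_less: "cl z < Y0"
  using N_less by (simp add: cl_def)

definition gather :: "(nat \<Rightarrow> nat) \<Rightarrow> (nat \<Rightarrow> nat \<Rightarrow> nat) \<Rightarrow> emitter" where
  "gather sr h = pull T (\<lambda>c. sr c div s) (\<lambda>c y. cl (h c (y (sr c mod s))))"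

text \<open>\<open>t1\<close> and \<open>t2\<close> name the possible readers of a cell: no cell is
  read more than twice, hence no machine sends more than \<open>2 * s\<close> words.\<close>

lemma gather_step:
  assumes t: "\<And>c. c < T \<Longrightarrow> sr c < T \<Longrightarrow> c = t1 (sr c) \<or> c = t2 (sr c)"
  shows "net_step M s (gather sr h) x = (\<lambda>c. if c < T \<and> sr c < T then cl (h c (x (sr c))) else 0)"
    and "net_ok M s Z (gather sr h) x" and "good (net_step M s (gather sr h) x)"
proof -
  have iff: "sr c div s < M \<longleftrightarrow> sr c < T" for c
    using s_pos by (simp add: T_eq div_less_iff_less_mult)
  show *: "net_step M s (gather sr h) x = (\<lambda>c. if c < T \<and> sr c < T then cl (h c (x (sr c))) else 0)"
    using s_pos by (auto simp: gather_def net_step_pull iff blk_def)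
  show "good (net_step M s (gather sr h) x)"
    using cl_less N_less by (auto simp: * good_def)
  show "net_ok M s Z (gather sr h) x"
    unfolding gather_def
  proof (rule net_ok_pull)
    show "T \<le> M * s" by (simp add: T_eq)
    show "cl (h c (blk s x (sr c div s) (sr c mod s))) < Z" for c
      using cl_less Y0_le Y_le by (meson less_le_trans)
    fix B assume "B < M"
    then have BT: "B * s + k < T" if "k < s" for k
    proof -
      have "B * s + k < Suc B * s" using that by simp
      also have "\<dots> \<le> T" unfolding T_eq using \<open>B < M\<close> by (intro mult_right_mono) auto
      finally show ?thesis .
    qed
    have "{c. c < T \<and> sr c div s = B} \<subseteq> t1 ` {B * s..<B * s + s} \<union> t2 ` {B * s..<B * s + s}"
    proof
      fix c assume "c \<in> {c. c < T \<and> sr c div s = B}"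
      then have c: "c < T" "sr c div s = B" by auto
      then have "sr c = B * s + sr c mod s" by (metis div_mult_mod_eq)
      moreover have "sr c mod s < s" using s_pos by simp
      ultimately have "sr c \<in> {B * s..<B * s + s}" "sr c < T" using BT by (metis atLeastLessThan_iff le_add1 nat_add_left_cancel_less, metis)
      then show "c \<in> t1 ` {B * s..<B * s + s} \<union> t2 ` {B * s..<B * s + s}" using t[OF c(1)] by blast
    qed
    then have "card {c. c < T \<and> sr c div s = B} \<le> card (t1 ` {B * s..<B * s + s} \<union> t2 ` {B * s..<B * s + s})"
      by (intro card_mono) auto
    also have "\<dots> \<le> card (t1 ` {B * s..<B * s + s}) + card (t2 ` {B * s..<B * s + s})" by (rule card_Un_le)
    also have "\<dots> \<le> s + s"
      using card_image_le[of "{B * s..<B * s + s}" t1] card_image_le[of "{B * s..<B * s + s}" t2] by simp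
    finally show "card {c. c < T \<and> sr c div s = B} \<le> 2 * s" by simp
  qed
qed

lemma gather_id:
  "net_step M s (gather (\<lambda>c. c) h) x = (\<lambda>c. if c < T then cl (h c (x c)) else 0)"
  "net_ok M s Z (gather (\<lambda>c. c) h) x" "good (net_step M s (gather (\<lambda>c. c) h) x)"
  using gather_step[of "\<lambda>c. c" "\<lambda>c. c" "\<lambda>c. c" h x] by auto

definition is_sorted :: "(nat \<Rightarrow> nat) \<Rightarrow> (nat \<Rightarrow> nat) \<Rightarrow> nat \<Rightarrow> bool" where
  "is_sorted key x \<kappa> \<longleftrightarrow> (\<forall>i i'. i < i' \<and> i' < N \<longrightarrow> key (x (\<kappa> * N + i)) \<le> key (x (\<kappa> * N + i')))"

lemma sort_by_sorted:
  assumes x: "\<And>c. x c < Y0" and w: "0 < w" and key: "\<And>z. key z < s ^ w" and \<kappa>: "\<kappa> < 2 ^ a"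
  obtains \<pi> where "shuffled x (run (sort_by key w) x) \<kappa> \<pi>" "is_sorted key (run (sort_by key w) x) \<kappa>"
  using sort_by_run(3)[where x = x and key = key, OF x w \<kappa>] that key by (auto simp: is_sorted_def)

lemma shuffled_less: "shuffled x x' \<kappa> \<pi> \<Longrightarrow> i < N \<Longrightarrow> \<pi> i < N"
  by (auto simp: shuffled_def bij_betw_def)

lemma shuffled_eq: "shuffled x x' \<kappa> \<pi> \<Longrightarrow> i < N \<Longrightarrow> x' (\<kappa> * N + i) = x (\<kappa> * N + \<pi> i)"
  by (auto simp: shuffled_def)

lemma shuffled_ex: "shuffled x x' \<kappa> \<pi> \<Longrightarrow> p < N \<Longrightarrow> \<exists>i<N. \<pi> i = p"
  unfolding shuffled_def bij_betw_def by (metis imageE lessThan_iff)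

lemma shuffled_inj: "shuffled x x' \<kappa> \<pi> \<Longrightarrow> i < N \<Longrightarrow> i' < N \<Longrightarrow> \<pi> i = \<pi> i' \<Longrightarrow> i = i'"
  unfolding shuffled_def bij_betw_def by (meson inj_onD lessThan_iff)

lemma shuffled_card:
  assumes "shuffled x x' \<kappa> \<pi>"
  shows "card {p. p < N \<and> Q (x' (\<kappa> * N + p))} = card {p. p < N \<and> Q (x (\<kappa> * N + p))}"
proof -
  have "bij_betw \<pi> {p. p < N \<and> Q (x' (\<kappa> * N + p))} {p. p < N \<and> Q (x (\<kappa> * N + p))}"
  proof (rule bij_betw_imageI)
    show "inj_on \<pi> {p. p < N \<and> Q (x' (\<kappa> * N + p))}"
      using shuffled_inj[OF assms] by (auto intro: inj_onI)
    show "\<pi> ` {p. p < N \<and> Q (x' (\<kappa> * N + p))} = {p. p < N \<and> Q (x (\<kappa> * N + p))}"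
    proof (intro equalityI subsetI)
      fix p assume "p \<in> {p. p < N \<and> Q (x (\<kappa> * N + p))}"
      then obtain i where "i < N" "\<pi> i = p" "Q (x (\<kappa> * N + p))" using shuffled_ex[OF assms] by auto
      then show "p \<in> \<pi> ` {p. p < N \<and> Q (x' (\<kappa> * N + p))}" using shuffled_eq[OF assms] by auto
    qed (use shuffled_eq[OF assms] shuffled_less[OF assms] in auto)
  qed
  then show ?thesis by (rule bij_betw_same_card)
qed

text \<open>In a sorted array the words in front of one with a unique key are exactly those with a
  smaller key.\<close>

lemma sorted_pos:
  assumes sh: "shuffled x x' \<kappa> \<pi>" and so: "is_sorted key x' \<kappa>"
    and p0: "p0 < N" and uni: "\<And>p. p < N \<Longrightarrow> key (x (\<kappa> * N + p)) = key (x (\<kappa> * N + p0)) \<Longrightarrow> p = p0"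
  defines "r \<equiv> card {p. p < N \<and> key (x (\<kappa> * N + p)) < key (x (\<kappa> * N + p0))}"
  shows "r < N" "\<pi> r = p0" "x' (\<kappa> * N + r) = x (\<kappa> * N + p0)"
proof -
  obtain i0 where i0: "i0 < N" "\<pi> i0 = p0" using shuffled_ex[OF sh p0] by auto
  have "{p. p < N \<and> key (x (\<kappa> * N + p)) < key (x (\<kappa> * N + p0))} = \<pi> ` {..<i0}"
  proof (intro equalityI subsetI)
    fix p assume "p \<in> {p. p < N \<and> key (x (\<kappa> * N + p)) < key (x (\<kappa> * N + p0))}"
    then have p: "p < N" "key (x (\<kappa> * N + p)) < key (x (\<kappa> * N + p0))" by auto
    obtain i where i: "i < N" "\<pi> i = p" using shuffled_ex[OF sh p(1)] by auto
    have "i < i0"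
    proof (rule ccontr)
      assume "\<not> i < i0"
      then have "key (x' (\<kappa> * N + i0)) \<le> key (x' (\<kappa> * N + i))"
        using so i unfolding is_sorted_def by (cases "i = i0") auto
      then show False using p i i0 by (simp add: shuffled_eq[OF sh])
    qed
    then show "p \<in> \<pi> ` {..<i0}" using i by auto
  next
    fix p assume "p \<in> \<pi> ` {..<i0}"
    then obtain i where i: "i < i0" "p = \<pi> i" by auto
    have iN: "i < N" using i i0 by simp
    then have "key (x (\<kappa> * N + p)) \<le> key (x (\<kappa> * N + p0))"
      using so i i0 shuffled_eq[OF sh iN] shuffled_eq[OF sh i0(1)] unfolding is_sorted_def by metis
    moreover have "key (x (\<kappa> * N + p)) \<noteq> key (x (\<kappa> * N + p0))"
      using uni[of p] shuffled_less[OF sh iN] shuffled_inj[OF sh iN i0(1)] i i0 by auto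
    ultimately show "p \<in> {p. p < N \<and> key (x (\<kappa> * N + p)) < key (x (\<kappa> * N + p0))}"
      using shuffled_less[OF sh iN] i by simp
  qed
  moreover have "card (\<pi> ` {..<i0}) = i0"
    using shuffled_inj[OF sh] i0 by (subst card_image) (auto intro!: inj_onI)
  ultimately have "r = i0" by (simp add: r_def)
  then show "r < N" "\<pi> r = p0" "x' (\<kappa> * N + r) = x (\<kappa> * N + p0)"
    using i0 shuffled_eq[OF sh] by auto
qed

lemma comm_monoid_set_max: "comm_monoid_set max (0::nat)"
  by unfold_locales auto

lemma acc_max:
  assumes "finite A"
  shows "(acc max g A \<le> b \<longleftrightarrow> (\<forall>i\<in>A. g i \<le> b)) \<and> (acc max g A = 0 \<or> (\<exists>i\<in>A. acc max g A = g i))"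
proof -
  interpret F: comm_monoid_set max "0::nat" by (rule comm_monoid_set_max)
  have "acc max g A \<le> b \<longleftrightarrow> (\<forall>i\<in>A. g i \<le> b)" using assms by (induction A) auto
  moreover have "acc max g A = 0 \<or> (\<exists>i\<in>A. acc max g A = g i)"
    using assms by (induction A) (auto simp: max_def)
  ultimately show ?thesis by blast
qed

lemma acc_max_ge: "finite A \<Longrightarrow> i \<in> A \<Longrightarrow> g i \<le> acc max g A"
  using acc_max[of A g "acc max g A"] by simp

end

section \<open>Table lookups by many readers\<close>

text \<open>All words of the algorithm are tagged triples. The empty cell \<open>0\<close> has tag
  \<open>0\<close>, so the tags in use start from \<open>1\<close>.\<close>

definition W :: "nat \<Rightarrow> nat \<Rightarrow> nat \<Rightarrow> nat" where
  "W t u v = prod_encode (t, prod_encode (u, v))"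

definition tg :: "nat \<Rightarrow> nat" where "tg w = fst (prod_decode w)"
definition fa :: "nat \<Rightarrow> nat" where "fa w = fst (prod_decode (snd (prod_decode w)))"
definition fb :: "nat \<Rightarrow> nat" where "fb w = snd (prod_decode (snd (prod_decode w)))"

lemma W_simps [simp]: "tg (W t u v) = t" "fa (W t u v) = u" "fb (W t u v) = v"
  by (simp_all add: W_def tg_def fa_def fb_def)

lemma W_inject [simp]: "W t u v = W t' u' v' \<longleftrightarrow> t = t' \<and> u = u' \<and> v = v'"
  by (simp add: W_def prod_encode_eq)

lemma tg_0 [simp]: "tg 0 = 0"
proof -
  have "prod_encode (0, 0) = 0" by (simp add: prod_encode_def)
  then have "prod_decode 0 = (0, 0)" by (metis prod_encode_inverse)
  then show ?thesis by (simp add: tg_def)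
qed

locale net_join = net +
  fixes n K Q wd :: nat
  assumes wd: "0 < wd" "2 * K < s ^ wd" "n < s ^ wd"
    and KQ: "K * Q < Y0" and nN: "n \<le> N"
begin

text \<open>A word \<open>W 1 k b\<close> says that the table has entry \<open>b\<close> for key \<open>k\<close>, a word \<open>W 2 k v\<close> is the request
  of \<open>v\<close> for key \<open>k\<close>, and the answer to \<open>v\<close> is a word \<open>W 3 v _\<close>.\<close>

definition jkey where
  "jkey w = (if tg w = 1 \<and> fa w < K then 2 * fa w else if tg w = 2 \<and> fa w < K then 2 * fa w + 1 else 2 * K)"

text \<open>Positive and increasing in the key, so the prefix maximum at a request stems from the
  last entry before it; \<open>found\<close> tests whether that entry has the requested key. A
  prefix maximum serves any number of requests for one key.\<close>

definition jval where
  "jval w = (if tg w = 1 \<and> fa w < K \<and> fb w < Q then fa w * Q + fb w + 1 else 0)"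

definition found where
  "found k z = (if 0 < z \<and> (z - 1) div Q = k then Some ((z - 1) mod Q) else None)"

definition answer where
  "answer out (c::nat) w z = (if tg w = 2 then cl (W 3 (fb w) (out (fb w) (found (fa w) z))) else 0)"

text \<open>As every \<open>v < n\<close> asks exactly once, sorting the answers by requester brings
  the answer to \<open>v\<close> into cell \<open>v\<close>.\<close>

definition okey where
  "okey w = (if tg w = 3 \<and> fa w < n then fa w else n)"

definition join where
  "join out = sort_by jkey wd @ scan max (\<lambda>c w. jval w) (answer out) @ sort_by okey wd"

lemma jval_le: "jval w \<le> K * Q"
proof (cases "tg w = 1 \<and> fa w < K \<and> fb w < Q")
  case True
  then have "fa w * Q + fb w + 1 \<le> Suc (fa w) * Q" by simp
  also have "\<dots> \<le> K * Q" using True by (intro mult_right_mono) auto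
  finally show ?thesis using True by (simp add: jval_def)
qed (auto simp: jval_def)

lemma jkey_less: "jkey w < s ^ wd" and okey_less: "okey w < s ^ wd"
  using wd by (auto simp: jkey_def okey_def)

lemma answer_less: "answer out c w z < Y0"
  using cl_less N_less by (simp add: answer_def)

context
  fixes x :: "nat \<Rightarrow> nat" and out :: "nat \<Rightarrow> nat option \<Rightarrow> nat"
  assumes x: "\<And>c. x c < Y0"
begin

definition "jy = run (sort_by jkey wd) x"
definition "jz = run (scan max (\<lambda>c w. jval w) (answer out)) jy"

lemma y_less: "jy c < Y0"
  using sort_by_run(2)[where x = x and key = jkey, OF x wd(1)] by (simp add: jy_def good_def)

lemma scan_y:
  shows "oks (scan max (\<lambda>c w. jval w) (answer out)) jy"
    and "\<And>\<kappa> p. \<kappa> < 2 ^ a \<Longrightarrow> p < N \<Longrightarrow> jz (\<kappa> * N + p) =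
      answer out (\<kappa> * N + p) (jy (\<kappa> * N + p)) (acc max (\<lambda>i. jval (jy (\<kappa> * N + i))) {..<p})"
    and "\<And>c. T \<le> c \<Longrightarrow> jz c = 0"
proof -
  have 1: "jy c < Y" for c using y_less[of c] Y0_le by simp
  have 2: "\<forall>\<kappa><2 ^ a. \<forall>A\<subseteq>{..<N}. acc max (\<lambda>i. (\<lambda>c w. jval w) (\<kappa> * N + i) (jy (\<kappa> * N + i))) A < Y"
  proof (intro allI impI)
    fix \<kappa> :: nat and A :: "nat set" assume "A \<subseteq> {..<N}"
    then have "finite A" using finite_subset by blast
    then have "acc max (\<lambda>i. jval (jy (\<kappa> * N + i))) A \<le> K * Q"
      using acc_max jval_le by blast
    then show "acc max (\<lambda>i. (\<lambda>c w. jval w) (\<kappa> * N + i) (jy (\<kappa> * N + i))) A < Y"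
      using KQ Y0_le by simp
  qed
  have 3: "\<forall>\<kappa><2 ^ a. \<forall>p<N. answer out (\<kappa> * N + p) (jy (\<kappa> * N + p))
      (acc max (\<lambda>i. (\<lambda>c w. jval w) (\<kappa> * N + i) (jy (\<kappa> * N + i))) {..<p}) < Z"
    using answer_less Y0_le Y_le by (meson less_le_trans)
  note sc = scan_run[OF comm_monoid_set_max, where x = jy and g = "\<lambda>c w. jval w" and h = "answer out", OF 1 2 3]
  show "oks (scan max (\<lambda>c w. jval w) (answer out)) jy" by (rule sc(1))
  show "jz (\<kappa> * N + p) = answer out (\<kappa> * N + p) (jy (\<kappa> * N + p)) (acc max (\<lambda>i. jval (jy (\<kappa> * N + i))) {..<p})"
    if "\<kappa> < 2 ^ a" "p < N" for \<kappa> p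
    unfolding jz_def by (rule sc(2)[OF that])
  show "jz c = 0" if "T \<le> c" for c unfolding jz_def by (rule sc(3)[OF that])
qed

lemma z_less: "jz c < Y0"
proof (cases "c < T")
  case True
  then show ?thesis using scan_y(2) answer_less by (elim cell_cases) simp
next
  case False
  then show ?thesis using scan_y(3)[of c] N_less by simp
qed

lemma join_ok: "oks (join out) x" "good (run (join out) x)"
  using sort_by_run(1)[where x = x and key = jkey, OF x wd(1)] scan_y(1)
    sort_by_run(1,2)[where x = jz and key = okey, OF z_less wd(1)]
  by (auto simp: join_def net_oks_append jy_def jz_def)

text \<open>The table \<open>dat\<close> is partial. A request whose key has no entry sees a smaller
  key or no entry at all, and \<open>out\<close> then receives \<open>None\<close>.\<close>

lemma join_run:
  assumes \<kappa>: "\<kappa> < 2 ^ a"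
    and dat: "\<And>p. p < N \<Longrightarrow> tg (x (\<kappa> * N + p)) = 1 \<Longrightarrow>
        fa (x (\<kappa> * N + p)) < K \<and> fb (x (\<kappa> * N + p)) < Q \<and> dat (fa (x (\<kappa> * N + p))) = Some (fb (x (\<kappa> * N + p)))"
    and dat_ex: "\<And>k b. dat k = Some b \<Longrightarrow> \<exists>p<N. x (\<kappa> * N + p) = W 1 k b"
    and rq: "\<And>p. p < N \<Longrightarrow> tg (x (\<kappa> * N + p)) = 2 \<Longrightarrow> fb (x (\<kappa> * N + p)) < n"
    and rq_ex: "\<And>v. v < n \<Longrightarrow> \<exists>p<N. x (\<kappa> * N + p) = W 2 (rq v) v" "\<And>v. v < n \<Longrightarrow> rq v < K"
    and rq_uni: "\<And>p p'. p < N \<Longrightarrow> p' < N \<Longrightarrow> tg (x (\<kappa> * N + p)) = 2 \<Longrightarrow> tg (x (\<kappa> * N + p')) = 2 \<Longrightarrow>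
        fb (x (\<kappa> * N + p)) = fb (x (\<kappa> * N + p')) \<Longrightarrow> p = p'"
    and out: "\<And>v. v < n \<Longrightarrow> W 3 v (out v (dat (rq v))) < Y0"
    and v: "v < n"
  shows "run (join out) x (\<kappa> * N + v) = W 3 v (out v (dat (rq v)))"
proof -
  obtain \<pi> where sh: "shuffled x jy \<kappa> \<pi>" and so: "is_sorted jkey jy \<kappa>"
    using sort_by_sorted[where x = x and key = jkey, OF x wd(1) jkey_less \<kappa>] unfolding jy_def by metis
  have yx: "jy (\<kappa> * N + i) = x (\<kappa> * N + \<pi> i)" "\<pi> i < N" if "i < N" for i
    using shuffled_eq[OF sh that] shuffled_less[OF sh that] by auto
  have fnd: "found (rq v) (acc max (\<lambda>i. jval (jy (\<kappa> * N + i))) {..<i}) = dat (rq v)"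
    if i: "i < N" "jy (\<kappa> * N + i) = W 2 (rq v) v" and v: "v < n" for i v
  proof -
    let ?A = "acc max (\<lambda>i. jval (jy (\<kappa> * N + i))) {..<i}"
    have ki: "jkey (jy (\<kappa> * N + i)) = 2 * rq v + 1" using i rq_ex(2)[OF v] by (simp add: jkey_def)
    have before: "fa (jy (\<kappa> * N + i')) \<le> rq v \<and> fb (jy (\<kappa> * N + i')) < Q \<and>
        dat (fa (jy (\<kappa> * N + i'))) = Some (fb (jy (\<kappa> * N + i'))) \<and>
        jval (jy (\<kappa> * N + i')) = fa (jy (\<kappa> * N + i')) * Q + fb (jy (\<kappa> * N + i')) + 1"
      if i': "i' < i" "jval (jy (\<kappa> * N + i')) \<noteq> 0" for i'
    proof -
      have iN: "i' < N" using i i' by simp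
      have t: "tg (jy (\<kappa> * N + i')) = 1" using i'(2) by (auto simp: jval_def split: if_splits)
      have d: "fa (jy (\<kappa> * N + i')) < K" "fb (jy (\<kappa> * N + i')) < Q"
          "dat (fa (jy (\<kappa> * N + i'))) = Some (fb (jy (\<kappa> * N + i')))"
        using dat[of "\<pi> i'"] t yx[OF iN] by auto
      have "jkey (jy (\<kappa> * N + i')) \<le> jkey (jy (\<kappa> * N + i))"
        using so i(1) i'(1) unfolding is_sorted_def by blast
      then have "fa (jy (\<kappa> * N + i')) \<le> rq v" using t d ki by (simp add: jkey_def)
      then show ?thesis using t d by (simp add: jval_def)
    qed
    show ?thesis
    proof (cases "dat (rq v)")
      case (Some b)
      obtain p where p: "p < N" "x (\<kappa> * N + p) = W 1 (rq v) b" using dat_ex[OF Some] by auto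
      obtain i1 where i1: "i1 < N" "\<pi> i1 = p" using shuffled_ex[OF sh p(1)] by auto
      have y1: "jy (\<kappa> * N + i1) = W 1 (rq v) b" using yx[OF i1(1)] i1 p by simp
      have bQ: "b < Q" using dat[OF p(1)] p(2) by simp
      have "i1 < i"
      proof (rule ccontr)
        assume "\<not> i1 < i"
        then have "jkey (jy (\<kappa> * N + i)) \<le> jkey (jy (\<kappa> * N + i1))"
          using so i1 unfolding is_sorted_def by (cases "i = i1") auto
        then show False using ki y1 rq_ex(2)[OF v] by (simp add: jkey_def)
      qed
      have j1: "jval (jy (\<kappa> * N + i1)) = rq v * Q + b + 1" using y1 bQ rq_ex(2)[OF v] by (simp add: jval_def)
      have "jval (jy (\<kappa> * N + i')) \<le> rq v * Q + b + 1" if i': "i' < i" for i'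
      proof (cases "jval (jy (\<kappa> * N + i')) = 0")
        case False
        note B = before[OF i' False]
        show ?thesis
        proof (cases "fa (jy (\<kappa> * N + i')) = rq v")
          case True
          then show ?thesis using B Some by simp
        next
          case False
          then have "fa (jy (\<kappa> * N + i')) * Q + fb (jy (\<kappa> * N + i')) + 1 \<le> Suc (fa (jy (\<kappa> * N + i'))) * Q" using B by simp
          also have "\<dots> \<le> rq v * Q" using B False by (intro mult_right_mono) auto
          finally show ?thesis using B by simp
        qed
      qed simp
      then have "?A \<le> rq v * Q + b + 1" using acc_max[of "{..<i}"] by blast
      moreover have "jval (jy (\<kappa> * N + i1)) \<le> ?A"
        using acc_max_ge[of "{..<i}" i1 "\<lambda>i. jval (jy (\<kappa> * N + i))"] \<open>i1 < i\<close> by simp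
      ultimately have "?A = rq v * Q + b + 1" using j1 by simp
      then show ?thesis using Some bQ by (simp add: found_def)
    next
      case None
      show ?thesis
      proof (cases "?A = 0")
        case False
        then obtain i' where i': "i' < i" "?A = jval (jy (\<kappa> * N + i'))"
          using acc_max[of "{..<i}" "\<lambda>i. jval (jy (\<kappa> * N + i))" 0] by auto
        note B = before[OF i'(1)]
        have "(?A - 1) div Q = fa (jy (\<kappa> * N + i'))" using B False i'(2) by simp
        moreover have "fa (jy (\<kappa> * N + i')) \<noteq> rq v" using B False i'(2) None by auto
        ultimately show ?thesis using None by (simp add: found_def)
      qed (simp add: found_def None)
    qed
  qed
  define ans where "ans = (\<lambda>v. W 3 v (out v (dat (rq v))))"
  have z1: "tg (jz (\<kappa> * N + i)) = 3 \<longrightarrow> tg (jy (\<kappa> * N + i)) = 2" if "i < N" for i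
    using scan_y(2)[OF \<kappa> that] by (auto simp: answer_def)
  have z2: "jz (\<kappa> * N + i) = ans (fb (jy (\<kappa> * N + i))) \<and> fb (jy (\<kappa> * N + i)) < n"
    if i: "i < N" "tg (jy (\<kappa> * N + i)) = 2" for i
  proof -
    define v where "v = fb (jy (\<kappa> * N + i))"
    have v: "v < n" using rq[of "\<pi> i"] yx[OF i(1)] i(2) by (simp add: v_def)
    obtain p where p: "p < N" "x (\<kappa> * N + p) = W 2 (rq v) v" using rq_ex(1)[OF v] by auto
    then have "p = \<pi> i" using rq_uni[of p "\<pi> i"] yx[OF i(1)] i(2) by (simp add: v_def)
    then have jy': "jy (\<kappa> * N + i) = W 2 (rq v) v" using p yx[OF i(1)] by simp
    then show ?thesis
      using scan_y(2)[OF \<kappa> i(1)] fnd[OF i(1) jy' v] v out[OF v] by (simp add: answer_def ans_def cl_def)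
  qed
  have z3: "\<exists>i<N. jy (\<kappa> * N + i) = W 2 (rq v) v" if v: "v < n" for v
  proof -
    obtain p where p: "p < N" "x (\<kappa> * N + p) = W 2 (rq v) v" using rq_ex(1)[OF v] by auto
    then show ?thesis using shuffled_ex[OF sh p(1)] yx by metis
  qed
  have ok: "okey (jz (\<kappa> * N + i)) < n \<longleftrightarrow> tg (jy (\<kappa> * N + i)) = 2" if "i < N" for i
    using z1[OF that] z2[OF that] by (auto simp: okey_def ans_def)
  have ok': "okey (jz (\<kappa> * N + i)) = fb (jy (\<kappa> * N + i))" if "i < N" "tg (jy (\<kappa> * N + i)) = 2" for i
    using z2[OF that] by (simp add: okey_def ans_def)
  have uni: "i = i'" if "i < N" "i' < N" "okey (jz (\<kappa> * N + i)) = okey (jz (\<kappa> * N + i'))" "okey (jz (\<kappa> * N + i)) < n" for i i'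
  proof -
    have t: "tg (jy (\<kappa> * N + i)) = 2" "tg (jy (\<kappa> * N + i')) = 2"
      using ok[OF that(1)] ok[OF that(2)] that(3,4) by simp_all
    have "\<pi> i = \<pi> i'"
      using ok'[OF that(1) t(1)] ok'[OF that(2) t(2)] that(3) yx[OF that(1)] yx[OF that(2)] t
      by - (rule rq_uni, simp_all)
    then show ?thesis using shuffled_inj[OF sh] that by simp
  qed
  obtain i0 where i0: "i0 < N" "jy (\<kappa> * N + i0) = W 2 (rq v) v" using z3[OF v] by auto
  have ok0: "okey (jz (\<kappa> * N + i0)) = v" using ok'[OF i0(1)] i0(2) by simp
  obtain \<rho> where sh2: "shuffled jz (run (sort_by okey wd) jz) \<kappa> \<rho>" and so2: "is_sorted okey (run (sort_by okey wd) jz) \<kappa>"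
    using sort_by_sorted[where x = jz and key = okey, OF z_less wd(1) okey_less \<kappa>] by metis
  have pos: "card {p. p < N \<and> okey (jz (\<kappa> * N + p)) < okey (jz (\<kappa> * N + i0))} = v"
  proof -
    have "bij_betw (\<lambda>p. okey (jz (\<kappa> * N + p))) {p. p < N \<and> okey (jz (\<kappa> * N + p)) < v} {..<v}"
    proof (rule bij_betw_imageI)
      show "inj_on (\<lambda>p. okey (jz (\<kappa> * N + p))) {p. p < N \<and> okey (jz (\<kappa> * N + p)) < v}"
        using uni v by (intro inj_onI) auto
      show "(\<lambda>p. okey (jz (\<kappa> * N + p))) ` {p. p < N \<and> okey (jz (\<kappa> * N + p)) < v} = {..<v}"
      proof (intro equalityI subsetI)
        fix u assume "u \<in> {..<v}"
        then have u: "u < v" "u < n" using v by auto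
        then obtain i where i: "i < N" "jy (\<kappa> * N + i) = W 2 (rq u) u" using z3 by metis
        then have "okey (jz (\<kappa> * N + i)) = u" using ok'[of i] by simp
        then show "u \<in> (\<lambda>p. okey (jz (\<kappa> * N + p))) ` {p. p < N \<and> okey (jz (\<kappa> * N + p)) < v}" using i u by force
      qed auto
    qed
    then show ?thesis by (simp add: bij_betw_same_card ok0)
  qed
  have "run (sort_by okey wd) jz (\<kappa> * N + v) = jz (\<kappa> * N + i0)"
    using sorted_pos(3)[OF sh2 so2 i0(1)] uni[OF _ i0(1)] ok0 v unfolding pos by simp
  also have "\<dots> = ans v" using z2[OF i0(1)] i0(2) by simp
  finally show ?thesis by (simp add: join_def ans_def jy_def jz_def)
qed

end

end

section \<open>The distributed algorithm\<close>

text \<open>A copy must hold both arcs of every edge together with a home cell per vertex, and each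
  of its halves a table with \<open>n\<close> entries. Keys go up to \<open>2 * N\<close> because a
  position is increased by a port below \<open>2 * d\<close>; values below \<open>n * n\<close>
  encode arcs. With \<open>2 ^ rho \<le> s\<close>, machine \<open>0\<close> can hold the results of
  all repetitions.\<close>

locale alg = net_join s q a Y0 Y Z n K Q wd + lazy_walk n d E
  for s q a Y0 Y Z n K Q wd d :: nat and E :: "nat set set" +
  fixes lam rho :: nat
  assumes even_s: "even s"
    and size: "2 * card E + n \<le> N" "2 * n \<le> N" "2 * d \<le> N" "n < N" "0 < n"
    and K_eq: "K = 2 * N" and Q_eq: "Q = n * n" and a_eq: "a = lam + rho"
    and rho: "2 ^ rho \<le> s" and wd_n: "(n + 1) * (n + 1) < s ^ wd"
    and W_less: "\<And>t u v. t \<le> 3 \<Longrightarrow> u < 2 * N \<Longrightarrow> v < N * N \<Longrightarrow> W t u v < Y0"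
begin

definition N2 where "N2 = N div 2"

lemma N_even: "N = N2 + N2"
proof -
  have "even N" using even_s q_pos by (simp add: N_def)
  then have "2 * (N div 2) = N" by simp
  then show ?thesis by (simp add: N2_def)
qed

lemma n_N2: "n \<le> N2" using size(2) N_even by simp

lemma N_sq: "2 * N \<le> N * N"
  using size(4,5) by (intro mult_right_mono) auto

lemma nn_less: "u < n \<Longrightarrow> v < n \<Longrightarrow> u * n + v < n * n"
proof -
  assume "u < n" "v < n"
  then have "u * n + v < Suc u * n" by simp
  also have "\<dots> \<le> n * n" using \<open>u < n\<close> by (intro mult_right_mono) auto
  finally show ?thesis .
qed

lemma nn_le: "n * n \<le> N * N"
  using size(4) by (intro mult_mono) auto

text \<open>Stated for arbitrary contents of the cells, this property composes without knowledge of
  the data and separates the limits from correctness.\<close>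

definition safe :: "emitter list \<Rightarrow> bool" where
  "safe es \<longleftrightarrow> (\<forall>x. (\<forall>c. x c < Y0) \<longrightarrow> oks es x \<and> (\<forall>c. run es x c < Y0))"

lemma safe_Nil: "safe []" by (simp add: safe_def)

lemma safe_append: "safe es \<Longrightarrow> safe es' \<Longrightarrow> safe (es @ es')"
  by (auto simp: safe_def net_oks_append)

lemma safe_concat: "(\<And>es. es \<in> set ess \<Longrightarrow> safe es) \<Longrightarrow> safe (concat ess)"
  by (induction ess) (auto intro: safe_Nil safe_append)

lemma safe_Cons: "safe [e] \<Longrightarrow> safe es \<Longrightarrow> safe (e # es)"
  using safe_append[of "[e]" es] by simp

lemma safe_sort: "0 < w \<Longrightarrow> safe (sort_by key w)"
  unfolding safe_def using sort_by_run(1,2) by (auto simp: good_def)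

lemma safe_join: "safe (join out)"
  unfolding safe_def using join_ok by (auto simp: good_def)

lemma safe_gather:
  assumes "\<And>c. c < T \<Longrightarrow> sr c < T \<Longrightarrow> c = t1 (sr c) \<or> c = t2 (sr c)"
  shows "safe [gather sr h]"
  unfolding safe_def using gather_step(2,3)[where ?t1.0 = t1 and ?t2.0 = t2, OF assms] by (auto simp: good_def)

lemma safe_gather_id: "safe [gather (\<lambda>c. c) h]"
  by (rule safe_gather) auto

definition nk :: "nat \<Rightarrow> nat" where "nk w = of_bool (w = 0)"

definition nxt :: "nat \<Rightarrow> nat \<Rightarrow> nat" where "nxt i \<kappa> = (\<kappa> + 2 ^ i) mod 2 ^ a"

text \<open>The lower half of a copy is kept, and the upper half is filled with the lower half of
  copy \<open>nxt i\<close>. A lower cell thus has two readers, the most that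
  \<open>gather_step\<close> permits.\<close>

definition msrc :: "nat \<Rightarrow> nat \<Rightarrow> nat" where
  "msrc i c = (if c mod N < N2 then c else nxt i (c div N) * N + (c mod N - N2))"

text \<open>
  The edges initially lie in arbitrary cells. In round \<open>i\<close> of \<open>allreduce\<close> the copies \<open>\<kappa>\<close> and
  \<open>\<kappa> + 2 ^ i\<close> are merged; there is room because the words that a copy collects are distinct edges.
\<close>

definition allreduce :: "nat \<Rightarrow> emitter list" where
  "allreduce j = concat (map (\<lambda>i. sort_by nk 1 @ [gather (msrc i) (\<lambda>c w. w)]) [0..<j])"

text \<open>Cells \<open>2 * p\<close> and \<open>2 * p + 1\<close> both read the edge in cell
  \<open>p\<close>, and the odd one reverses it. As the edges have been moved to the front, the last
  \<open>n\<close> cells stay empty.\<close>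

definition to_arcs :: "emitter list" where
  "to_arcs = sort_by nk 1 @ [gather (\<lambda>c. c div N * N + c mod N div 2)
     (\<lambda>c w. if w = 0 then 0 else if even (c mod N) then w else W 1 (fb w) (fa w))]"

text \<open>The only randomized step: \<open>\<omega> c\<close> is the port drawn for cell
  \<open>c\<close>, and the last \<open>n\<close> cells of a copy issue the requests of its
  \<open>n\<close> vertices.\<close>

definition homes :: "(nat \<Rightarrow> nat) \<Rightarrow> emitter" where
  "homes \<omega> = gather (\<lambda>c. c) (\<lambda>c w. if N - n \<le> c mod N then W 2 (c mod N - (N - n)) (\<omega> c) else w)"

definition n1 where "n1 = n + 1"

text \<open>
  Sorting by \<open>skey\<close> puts the request \<open>W 2 u p\<close> of the walk at \<open>u\<close> for its \<open>p\<close>-th arc directly in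
  front of the arcs that leave \<open>u\<close>. The position of that arc is then known, and \<open>relabel\<close> turns the request
  into a table lookup keyed by positions. A lookup that misses the arcs of \<open>u\<close> means that the
  lazy walk stays put.
\<close>

definition skey :: "nat \<Rightarrow> nat" where
  "skey w = (if tg w = 1 \<and> fa w < n \<and> fb w < n then fa w * n1 + (fb w + 1)
     else if tg w = 2 \<and> fa w < n then fa w * n1 else n1 * n1)"

definition relabel :: "nat \<Rightarrow> nat \<Rightarrow> nat" where
  "relabel c w = (if tg w = 1 then W 1 (c mod N) (fa w * n + fb w)
     else if tg w = 2 then W 2 (c mod N + 1 + fb w) (fa w) else 0)"

definition out1 :: "nat \<Rightarrow> nat option \<Rightarrow> nat" where
  "out1 u r = (case r of None \<Rightarrow> u | Some b \<Rightarrow> if b div n = u then b mod n else u)"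

definition sample :: "emitter list" where
  "sample = sort_by skey wd @ gather (\<lambda>c. c) relabel # join out1"

definition out2 :: "nat \<Rightarrow> nat option \<Rightarrow> nat" where
  "out2 u r = (case r of None \<Rightarrow> 0 | Some b \<Rightarrow> b)"

text \<open>The pointers in the lower half become requests for their targets, and those of the other
  copy, in the upper half, become the table. One \<open>join\<close> then composes the two
  maps.\<close>

definition query :: "nat \<Rightarrow> nat \<Rightarrow> nat" where
  "query c w = (if c mod N < n then W 2 (fb w) (c mod N)
     else if N2 \<le> c mod N \<and> c mod N < N2 + n then W 1 (c mod N - N2) (fb w) else 0)"

text \<open>Pointer doubling: copy \<open>\<kappa>\<close> composes its map with the one of copy \<open>\<kappa> + 2 ^ i\<close>.\<close>

definition compose :: "nat \<Rightarrow> emitter list" where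
  "compose i = gather (msrc i) query # join out2"

text \<open>The map of repetition \<open>c\<close> ends up in copy \<open>c * 2 ^ lam\<close>.
  Prefix sums are exclusive, but the last cell covers all vertices since \<open>n < N\<close>. The
  source \<open>T\<close> leaves \<open>0\<close> in all other cells.\<close>

definition fsrc :: "nat \<Rightarrow> nat" where
  "fsrc c = (if c < 2 ^ rho then c * 2 ^ lam * N + (N - 1) else T)"

definition counting :: "emitter list" where
  "counting = scan (+) (\<lambda>c w. of_bool (c mod N < n \<and> fb w = c mod N)) (\<lambda>c w z. z) @ [gather fsrc (\<lambda>c w. w)]"

definition pre :: "emitter list" where "pre = allreduce a @ to_arcs"

definition post :: "emitter list" where
  "post = sample @ concat (map compose [0..<lam]) @ counting"

lemma nxt_less: "nxt i \<kappa> < 2 ^ a" by (simp add: nxt_def)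

lemma msrc_low: "p < N2 \<Longrightarrow> msrc i (\<kappa> * N + p) = \<kappa> * N + p"
  using N_even by (simp add: msrc_def)

lemma msrc_high: "p < N2 \<Longrightarrow> msrc i (\<kappa> * N + (N2 + p)) = nxt i \<kappa> * N + p"
proof -
  assume "p < N2"
  then have "N2 + p < N" using N_even by simp
  then show ?thesis by (simp add: msrc_def cell_div cell_mod)
qed

lemma half_cases:
  assumes "p < N"
  obtains "p < N2" | p' where "p = N2 + p'" "p' < N2"
proof (cases "p < N2")
  case True
  then show ?thesis by (rule that(1))
next
  case False
  then show ?thesis using assms N_even by (intro that(2)[of "p - N2"]) auto
qed

lemma msrc_inv:
  assumes "i \<le> a" "c < T"
  shows "c = msrc i c \<or> c = ((msrc i c div N + (2 ^ a - 2 ^ i)) mod 2 ^ a) * N + (N2 + msrc i c mod N)"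
  using assms(2)
proof (rule cell_cases)
  fix \<kappa> p assume *: "\<kappa> < 2 ^ a" "p < N" "c = \<kappa> * N + p"
  show ?thesis
    using *(2)
  proof (cases rule: half_cases)
    case 1
    then show ?thesis using * by (simp add: msrc_low)
  next
    case (2 p')
    have i: "(2::nat) ^ i \<le> 2 ^ a" using assms(1) by simp
    have "p' < N" using 2 N_even by simp
    moreover have "(nxt i \<kappa> + (2 ^ a - 2 ^ i)) mod 2 ^ a = \<kappa>"
    proof -
      have "(nxt i \<kappa> + (2 ^ a - 2 ^ i)) mod 2 ^ a = (\<kappa> + 2 ^ i + (2 ^ a - 2 ^ i)) mod 2 ^ a"
        by (simp add: nxt_def mod_add_left_eq)
      also have "\<kappa> + 2 ^ i + (2 ^ a - 2 ^ i) = \<kappa> + 2 ^ a" using i by simp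
      finally show ?thesis using * by simp
    qed
    ultimately show ?thesis using 2 * by (simp add: msrc_high cell_div cell_mod)
  qed
qed

lemma merge_step:
  assumes i: "i \<le> a"
  shows "\<And>\<kappa> p. \<kappa> < 2 ^ a \<Longrightarrow> p < N2 \<Longrightarrow>
      net_step M s (gather (msrc i) h) x (\<kappa> * N + p) = cl (h (\<kappa> * N + p) (x (\<kappa> * N + p)))"
    and "\<And>\<kappa> p. \<kappa> < 2 ^ a \<Longrightarrow> p < N2 \<Longrightarrow>
      net_step M s (gather (msrc i) h) x (\<kappa> * N + (N2 + p)) = cl (h (\<kappa> * N + (N2 + p)) (x (nxt i \<kappa> * N + p)))"
    and "safe [gather (msrc i) h]"
proof -
  note g = gather_step[where sr = "msrc i" and ?t1.0 = "\<lambda>c. c" and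
      ?t2.0 = "\<lambda>c. ((c div N + (2 ^ a - 2 ^ i)) mod 2 ^ a) * N + (N2 + c mod N)", OF msrc_inv[OF i]]
  have lt: "p < N2 \<Longrightarrow> p < N" "p < N2 \<Longrightarrow> N2 + p < N" for p using N_even by auto
  show "net_step M s (gather (msrc i) h) x (\<kappa> * N + p) = cl (h (\<kappa> * N + p) (x (\<kappa> * N + p)))"
    if "\<kappa> < 2 ^ a" "p < N2" for \<kappa> p
    using cell_less[OF that(1) lt(1)[OF that(2)]] by (simp add: g(1) msrc_low that)
  show "net_step M s (gather (msrc i) h) x (\<kappa> * N + (N2 + p)) = cl (h (\<kappa> * N + (N2 + p)) (x (nxt i \<kappa> * N + p)))"
    if "\<kappa> < 2 ^ a" "p < N2" for \<kappa> p
    using cell_less[OF that(1) lt(2)[OF that(2)]] cell_less[OF nxt_less lt(1)[OF that(2)], of i \<kappa>]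
    by (simp add: g(1) msrc_high that)
  show "safe [gather (msrc i) h]"
    by (rule safe_gather[where ?t1.0 = "\<lambda>c. c", OF msrc_inv[OF i]])
qed

lemma arcs_src_inv:
  assumes "c < T"
  shows "c = (c div N * N + c mod N div 2) div N * N + 2 * ((c div N * N + c mod N div 2) mod N)
    \<or> c = (c div N * N + c mod N div 2) div N * N + 2 * ((c div N * N + c mod N div 2) mod N) + 1"
  using assms
proof (rule cell_cases)
  fix \<kappa> p assume *: "\<kappa> < 2 ^ a" "p < N" "c = \<kappa> * N + p"
  then have "p div 2 < N" by simp
  then show ?thesis using * by (cases "even p") (auto simp: cell_div cell_mod)
qed

lemma safe_pre: "safe pre"
proof -
  have "safe (allreduce a)"
    unfolding allreduce_def
    by (rule safe_concat) (auto intro!: safe_append safe_sort merge_step(3))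
  moreover have "safe to_arcs"
    unfolding to_arcs_def
    by (intro safe_append safe_sort safe_gather[where
        ?t1.0 = "\<lambda>c. c div N * N + 2 * (c mod N)" and ?t2.0 = "\<lambda>c. c div N * N + 2 * (c mod N) + 1"] arcs_src_inv) auto
  ultimately show ?thesis unfolding pre_def by (rule safe_append)
qed

lemma safe_homes: "safe [homes \<omega>]"
  unfolding homes_def by (rule safe_gather_id)

lemma count_scan:
  assumes x: "\<And>c. x c < Y0"
  shows "oks (scan (+) (\<lambda>c w. of_bool (c mod N < n \<and> fb w = c mod N)) (\<lambda>c w z. z)) x"
    and "\<And>\<kappa> p. \<kappa> < 2 ^ a \<Longrightarrow> p < N \<Longrightarrow>
      run (scan (+) (\<lambda>c w. of_bool (c mod N < n \<and> fb w = c mod N)) (\<lambda>c w z. z)) x (\<kappa> * N + p)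
      = card {v. v < p \<and> v < n \<and> fb (x (\<kappa> * N + v)) = v}"
    and "\<And>c. run (scan (+) (\<lambda>c w. of_bool (c mod N < n \<and> fb w = c mod N)) (\<lambda>c w z. z)) x c < Y0"
proof -
  let ?g = "\<lambda>c w. of_bool (c mod N < n \<and> fb w = c mod N)"
  let ?h = "\<lambda>(c::nat) (w::nat) (z::nat). z"
  have sum: "acc (+) (\<lambda>i. ?g (\<kappa> * N + i) (x (\<kappa> * N + i))) A = card {v. v \<in> A \<and> v < n \<and> fb (x (\<kappa> * N + v)) = v}"
    if "A \<subseteq> {..<N}" for \<kappa> A
  proof -
    have "finite A" using that finite_subset by blast
    moreover have "(\<Sum>i\<in>A. ?g (\<kappa> * N + i) (x (\<kappa> * N + i)) :: nat) = (\<Sum>i\<in>A. of_bool (i < n \<and> fb (x (\<kappa> * N + i)) = i))"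
      using that by (intro sum.cong refl) (auto simp: cell_mod subset_iff)
    moreover have "A \<inter> {i. i < n \<and> fb (x (\<kappa> * N + i)) = i} = {v. v \<in> A \<and> v < n \<and> fb (x (\<kappa> * N + v)) = v}" by auto
    ultimately show ?thesis by (simp add: acc_plus)
  qed
  have le: "acc (+) (\<lambda>i. ?g (\<kappa> * N + i) (x (\<kappa> * N + i))) A \<le> N" if "A \<subseteq> {..<N}" for \<kappa> A
  proof -
    have "card {v. v \<in> A \<and> v < n \<and> fb (x (\<kappa> * N + v)) = v} \<le> card {..<N}"
      using that by (intro card_mono) auto
    then show ?thesis using sum[OF that, of \<kappa>] by simp
  qed
  have 1: "x c < Y" for c using x[of c] Y0_le by simp
  have 2: "\<forall>\<kappa><2 ^ a. \<forall>A\<subseteq>{..<N}. acc (+) (\<lambda>i. ?g (\<kappa> * N + i) (x (\<kappa> * N + i))) A < Y"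
    using le N_less Y0_le by (meson le_less_trans less_le_trans)
  have 3: "\<forall>\<kappa><2 ^ a. \<forall>p<N. ?h (\<kappa> * N + p) (x (\<kappa> * N + p)) (acc (+) (\<lambda>i. ?g (\<kappa> * N + i) (x (\<kappa> * N + i))) {..<p}) < Z"
  proof (intro allI impI)
    fix \<kappa> p :: nat assume "p < N"
    then have "{..<p} \<subseteq> {..<N}" by auto
    then show "?h (\<kappa> * N + p) (x (\<kappa> * N + p)) (acc (+) (\<lambda>i. ?g (\<kappa> * N + i) (x (\<kappa> * N + i))) {..<p}) < Z"
      using le[of "{..<p}" \<kappa>] N_less Y0_le Y_le by linarith
  qed
  note sc = scan_run[OF comm_monoid_set_plus, where x = x and g = ?g and h = ?h, OF 1 2 3]
  show "oks (scan (+) ?g ?h) x" by (rule sc(1))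
  have r: "run (scan (+) ?g ?h) x (\<kappa> * N + p) = acc (+) (\<lambda>i. ?g (\<kappa> * N + i) (x (\<kappa> * N + i))) {..<p}"
    if "\<kappa> < 2 ^ a" "p < N" for \<kappa> p
    by (rule sc(2)[OF that])
  show "run (scan (+) ?g ?h) x (\<kappa> * N + p) = card {v. v < p \<and> v < n \<and> fb (x (\<kappa> * N + v)) = v}"
    if "\<kappa> < 2 ^ a" "p < N" for \<kappa> p
  proof -
    have "{..<p} \<subseteq> {..<N}" using that by auto
    from sum[OF this, of \<kappa>] show ?thesis using r[OF that] by simp
  qed
  show "run (scan (+) ?g ?h) x c < Y0" for c
  proof (cases "c < T")
    case True
    then show ?thesis
    proof (rule cell_cases)
      fix \<kappa> p assume *: "\<kappa> < 2 ^ a" "p < N" "c = \<kappa> * N + p"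
      have "{..<p} \<subseteq> {..<N}" using * by auto
      from le[OF this, of \<kappa>] show ?thesis using r[OF *(1,2)] * N_less by simp
    qed
  next
    case False
    then show ?thesis using sc(3)[of c] N_less by simp
  qed
qed

lemma fsrc_inv: "fsrc c < T \<Longrightarrow> c = fsrc c div (2 ^ lam * N)"
proof -
  assume "fsrc c < T"
  then have c: "fsrc c = c * (2 ^ lam * N) + (N - 1)" by (auto simp: fsrc_def split: if_splits)
  have "N - 1 < 2 ^ lam * N" using N_pos by (metis diff_less less_le_trans mult_le_mono1 nat_mult_1 one_le_numeral one_le_power zero_less_one)
  moreover have "(c * k + r) div k = c" if "r < k" for r k :: nat using that by simp
  ultimately show ?thesis unfolding c by presburger
qed

lemma safe_post: "safe post"
proof -
  have "safe sample"
    unfolding sample_def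
    by (rule safe_append[OF safe_sort[OF wd(1)] safe_Cons[OF safe_gather_id safe_join]])
  moreover have "safe (concat (map compose [0..<lam]))"
  proof (rule safe_concat)
    fix es assume "es \<in> set (map compose [0..<lam])"
    then obtain i where "i < lam" "es = compose i" by auto
    moreover have "i \<le> a" if "i < lam" for i using that a_eq by simp
    ultimately show "safe es" unfolding compose_def using safe_Cons[OF merge_step(3) safe_join] by blast
  qed
  moreover have "safe counting"
    unfolding counting_def
  proof (rule safe_append)
    show "safe (scan (+) (\<lambda>c w. of_bool (c mod N < n \<and> fb w = c mod N)) (\<lambda>c w z. z))"
      unfolding safe_def using count_scan by blast
    show "safe [gather fsrc (\<lambda>c w. w)]"
      using fsrc_inv by (intro safe_gather[where ?t1.0 = "\<lambda>c. c div (2 ^ lam * N)" and ?t2.0 = "\<lambda>c. c"]) blast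
  qed
  ultimately show ?thesis unfolding post_def by (intro safe_append)
qed

lemma safe_prog: "safe (pre @ homes \<omega> # post)"
  by (rule safe_append[OF safe_pre safe_Cons[OF safe_homes safe_post]])

section \<open>Collecting all edges in every copy\<close>

definition cnt :: "(nat \<Rightarrow> nat) \<Rightarrow> nat \<Rightarrow> (nat \<Rightarrow> bool) \<Rightarrow> nat" where
  "cnt x \<kappa> B = card {p. p < N \<and> B (x (\<kappa> * N + p))}"

lemma cnt_total: "(\<Sum>\<kappa><2 ^ a. cnt x \<kappa> B) = card {c. c < T \<and> B (x c)}"
proof -
  have "(\<Sum>\<kappa><2 ^ a. cnt x \<kappa> B) = (\<Sum>\<kappa><2 ^ a. card ((\<lambda>p. \<kappa> * N + p) ` {p. p < N \<and> B (x (\<kappa> * N + p))}))"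
    unfolding cnt_def by (intro sum.cong refl card_image[symmetric]) (auto simp: inj_on_def)
  also have "\<dots> = card (\<Union>\<kappa><2 ^ a. (\<lambda>p. \<kappa> * N + p) ` {p. p < N \<and> B (x (\<kappa> * N + p))})"
  proof (intro card_UN_disjoint[symmetric] ballI impI)
    fix \<kappa> \<kappa>' :: nat assume ne: "\<kappa> \<noteq> \<kappa>'"
    show "(\<lambda>p. \<kappa> * N + p) ` {p. p < N \<and> B (x (\<kappa> * N + p))} \<inter> (\<lambda>p. \<kappa>' * N + p) ` {p. p < N \<and> B (x (\<kappa>' * N + p))} = {}"
    proof (rule equals0I)
      fix c
      assume "c \<in> (\<lambda>p. \<kappa> * N + p) ` {p. p < N \<and> B (x (\<kappa> * N + p))} \<inter> (\<lambda>p. \<kappa>' * N + p) ` {p. p < N \<and> B (x (\<kappa>' * N + p))}"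
      then obtain p p' where "p < N" "p' < N" "c = \<kappa> * N + p" "c = \<kappa>' * N + p'" by blast
      then show False using ne by (metis cell_div)
    qed
  qed auto
  also have "(\<Union>\<kappa><2 ^ a. (\<lambda>p. \<kappa> * N + p) ` {p. p < N \<and> B (x (\<kappa> * N + p))}) = {c. c < T \<and> B (x c)}"
  proof (intro equalityI subsetI)
    fix c assume "c \<in> {c. c < T \<and> B (x c)}"
    then have c: "c < T" "B (x c)" by auto
    from c(1) show "c \<in> (\<Union>\<kappa><2 ^ a. (\<lambda>p. \<kappa> * N + p) ` {p. p < N \<and> B (x (\<kappa> * N + p))})"
    proof (rule cell_cases)
      fix \<kappa> p assume "\<kappa> < 2 ^ a" "p < N" "c = \<kappa> * N + p"
      then show ?thesis using c(2) by blast
    qed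
  qed (auto simp: cell_less)
  finally show ?thesis .
qed

lemma front:
  assumes "is_sorted nk y \<kappa>" "p < N" "y (\<kappa> * N + p) \<noteq> 0"
  shows "p < cnt y \<kappa> (\<lambda>w. w \<noteq> 0)"
proof -
  have "{..p} \<subseteq> {p. p < N \<and> y (\<kappa> * N + p) \<noteq> 0}"
  proof
    fix i assume "i \<in> {..p}"
    then have "i = p \<or> nk (y (\<kappa> * N + i)) \<le> nk (y (\<kappa> * N + p))"
      using assms(1,2) unfolding is_sorted_def by (cases "i = p") auto
    then show "i \<in> {p. p < N \<and> y (\<kappa> * N + p) \<noteq> 0}"
      using assms \<open>i \<in> {..p}\<close> by (auto simp: nk_def of_bool_def split: if_splits)
  qed
  then have "card {..p} \<le> cnt y \<kappa> (\<lambda>w. w \<noteq> 0)"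
    unfolding cnt_def by (intro card_mono) auto
  then show ?thesis by simp
qed

lemma sort_nk:
  assumes x: "\<And>c. x c < Y0" and \<kappa>: "\<kappa> < 2 ^ a"
  defines "y \<equiv> run (sort_by nk 1) x"
  shows "cnt y \<kappa> B = cnt x \<kappa> B"
    and "\<And>p. p < N \<Longrightarrow> y (\<kappa> * N + p) \<noteq> 0 \<Longrightarrow> p < cnt x \<kappa> (\<lambda>w. w \<noteq> 0)"
proof -
  have "nk w < s ^ 1" for w using s_ge2 by (simp add: nk_def)
  then obtain \<pi> where sh: "shuffled x y \<kappa> \<pi>" and so: "is_sorted nk y \<kappa>"
    using sort_by_sorted[where x = x and key = nk and w = 1, OF x _ _ \<kappa>] unfolding y_def by auto
  show *: "cnt y \<kappa> B = cnt x \<kappa> B" for B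
    unfolding cnt_def by (rule shuffled_card[OF sh])
  show "p < cnt x \<kappa> (\<lambda>w. w \<noteq> 0)" if "p < N" "y (\<kappa> * N + p) \<noteq> 0" for p
    using front[OF so that] * by simp
qed

lemma sum_window:
  fixes f :: "nat \<Rightarrow> nat"
  shows "(\<Sum>j<2 ^ a. f ((\<kappa> + j) mod 2 ^ a)) = (\<Sum>\<kappa><2 ^ a. f \<kappa>)"
proof -
  have inj: "inj_on (\<lambda>j. (\<kappa> + j) mod 2 ^ a) {..<2 ^ a}"
  proof (rule inj_onI)
    have *: "j = j'" if "j < 2 ^ a" "j' < 2 ^ a" "j \<le> j'" "(\<kappa> + j) mod 2 ^ a = (\<kappa> + j') mod 2 ^ a" for j j' :: nat
    proof -
      have "2 ^ a dvd (\<kappa> + j') - (\<kappa> + j)" using that by (subst mod_eq_dvd_iff_nat[symmetric]) auto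
      then have "2 ^ a dvd j' - j" by simp
      moreover have "j' - j < 2 ^ a" using that by simp
      ultimately have "j' - j = 0" using nat_dvd_not_less by blast
      then show ?thesis using that by simp
    qed
    fix j j' :: nat
    assume "j \<in> {..<2 ^ a}" "j' \<in> {..<2 ^ a}" "(\<kappa> + j) mod 2 ^ a = (\<kappa> + j') mod 2 ^ a"
    then show "j = j'" using *[of j j'] *[of j' j] by (cases "j \<le> j'") auto
  qed
  have "(\<lambda>j. (\<kappa> + j) mod 2 ^ a) ` {..<2 ^ a} = {..<2 ^ a}"
    by (rule endo_inj_surj) (use inj in auto)
  then have "(\<Sum>\<kappa><2 ^ a. f \<kappa>) = sum f ((\<lambda>j. (\<kappa> + j) mod 2 ^ a) ` {..<2 ^ a})" by simp
  also have "\<dots> = (\<Sum>j<2 ^ a. f ((\<kappa> + j) mod 2 ^ a))" by (simp add: sum.reindex[OF inj])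
  finally show ?thesis ..
qed

lemma cnt_window: "(\<Sum>j<2 ^ a. cnt x ((\<kappa> + j) mod 2 ^ a) B) = card {c. c < T \<and> B (x c)}"
  using sum_window[of "\<lambda>\<kappa>. cnt x \<kappa> B"] by (simp add: cnt_total)

text \<open>Sorting forgets positions, so contents are compared as multisets, through the counts of
  all predicates that reject \<open>0\<close>. Copy \<open>\<kappa>\<close> collects a cyclic window
  of \<open>2 ^ i\<close> initial copies. The nonzero words of the whole network fit into half a
  copy; after compaction the upper half can be overwritten.\<close>

lemma allreduce_inv:
  assumes x: "\<And>c. x c < Y0" and nz: "card {c. c < T \<and> x c \<noteq> 0} \<le> N2" and "i \<le> a"
  shows "(\<forall>c. run (allreduce i) x c < Y0) \<and> (\<forall>\<kappa><2 ^ a. \<forall>B. \<not> B 0 \<longrightarrow>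
    cnt (run (allreduce i) x) \<kappa> B = (\<Sum>j<2 ^ i. cnt x ((\<kappa> + j) mod 2 ^ a) B))"
  using \<open>i \<le> a\<close>
proof (induction i)
  case 0
  then show ?case using x by (simp add: allreduce_def)
next
  case (Suc i)
  define y where "y = run (allreduce i) x"
  define y' where "y' = run (sort_by nk 1) y"
  have y: "\<And>c. y c < Y0" and IH: "\<And>\<kappa> B. \<kappa> < 2 ^ a \<Longrightarrow> \<not> B 0 \<Longrightarrow>
      cnt y \<kappa> B = (\<Sum>j<2 ^ i. cnt x ((\<kappa> + j) mod 2 ^ a) B)"
    using Suc by (auto simp: y_def)
  have ia: "i \<le> a" using Suc.prems by simp
  have y': "y' c < Y0" for c
    using sort_by_run(2)[where x = y and key = nk and w = 1, OF y] by (simp add: y'_def good_def)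
  define z where "z = net_step M s (gather (msrc i) (\<lambda>c w. w)) y'"
  have z: "run (allreduce (Suc i)) x = z"
    by (simp add: allreduce_def y_def y'_def z_def)
  have z_less: "z c < Y0" for c
    using merge_step(3)[OF ia, of "\<lambda>c w. w"] y' by (simp add: safe_def z_def)
  have z1: "z (\<kappa> * N + p) = y' (\<kappa> * N + p)" "z (\<kappa> * N + (N2 + p)) = y' (nxt i \<kappa> * N + p)"
    if "\<kappa> < 2 ^ a" "p < N2" for \<kappa> p
    using merge_step(1,2)[OF ia that, of "\<lambda>c w. w" y'] y' by (auto simp: z_def cl_def)
  have few: "cnt y \<kappa> (\<lambda>w. w \<noteq> 0) \<le> N2" if "\<kappa> < 2 ^ a" for \<kappa>
  proof -
    have "cnt y \<kappa> (\<lambda>w. w \<noteq> 0) = (\<Sum>j<2 ^ i. cnt x ((\<kappa> + j) mod 2 ^ a) (\<lambda>w. w \<noteq> 0))" using IH that by simp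
    also have "\<dots> \<le> (\<Sum>j<2 ^ a. cnt x ((\<kappa> + j) mod 2 ^ a) (\<lambda>w. w \<noteq> 0))"
    proof (rule sum_mono2)
      have "(2::nat) ^ i \<le> 2 ^ a" using ia by simp
      then show "{..<2 ^ i} \<subseteq> {..<(2::nat) ^ a}" by auto
    qed auto
    also have "\<dots> = card {c. c < T \<and> x c \<noteq> 0}" by (rule cnt_window)
    finally show ?thesis using nz by simp
  qed
  have half: "cnt y \<kappa> B = card {p. p < N2 \<and> B (y' (\<kappa> * N + p))}" if "\<kappa> < 2 ^ a" "\<not> B 0" for \<kappa> B
  proof -
    have "{p. p < N \<and> B (y' (\<kappa> * N + p))} = {p. p < N2 \<and> B (y' (\<kappa> * N + p))}"
    proof (intro equalityI subsetI)
      fix p assume p: "p \<in> {p. p < N \<and> B (y' (\<kappa> * N + p))}"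
      then have "y' (\<kappa> * N + p) \<noteq> 0" using that(2) by (metis (mono_tags) mem_Collect_eq)
      then have "p < cnt y \<kappa> (\<lambda>w. w \<noteq> 0)" using sort_nk(2)[where x = y, OF y that(1)] p by (auto simp: y'_def)
      then show "p \<in> {p. p < N2 \<and> B (y' (\<kappa> * N + p))}" using few[OF that(1)] p by simp
    qed (use N_even in auto)
    then show ?thesis using sort_nk(1)[where x = y, OF y that(1), of B] by (simp add: cnt_def y'_def)
  qed
  have "cnt z \<kappa> B = (\<Sum>j<2 ^ Suc i. cnt x ((\<kappa> + j) mod 2 ^ a) B)" if \<kappa>: "\<kappa> < 2 ^ a" and B: "\<not> B 0" for \<kappa> B
  proof -
    have "{p. p < N \<and> B (z (\<kappa> * N + p))} = {p. p < N2 \<and> B (y' (\<kappa> * N + p))}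
        \<union> (\<lambda>p. N2 + p) ` {p. p < N2 \<and> B (y' (nxt i \<kappa> * N + p))}"
    proof (intro equalityI subsetI)
      fix p assume "p \<in> {p. p < N \<and> B (z (\<kappa> * N + p))}"
      then have p: "p < N" "B (z (\<kappa> * N + p))" by auto
      from p(1) show "p \<in> {p. p < N2 \<and> B (y' (\<kappa> * N + p))} \<union> (\<lambda>p. N2 + p) ` {p. p < N2 \<and> B (y' (nxt i \<kappa> * N + p))}"
        by (cases rule: half_cases) (use p z1 \<kappa> in auto)
    qed (use z1 \<kappa> N_even in auto)
    then have "cnt z \<kappa> B = card {p. p < N2 \<and> B (y' (\<kappa> * N + p))} + card ((\<lambda>p. N2 + p) ` {p. p < N2 \<and> B (y' (nxt i \<kappa> * N + p))})"
      unfolding cnt_def by (subst card_Un_disjoint[symmetric]) auto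
    also have "card ((\<lambda>p. N2 + p) ` {p. p < N2 \<and> B (y' (nxt i \<kappa> * N + p))}) = card {p. p < N2 \<and> B (y' (nxt i \<kappa> * N + p))}"
      by (intro card_image) (auto simp: inj_on_def)
    finally have "cnt z \<kappa> B = cnt y \<kappa> B + cnt y (nxt i \<kappa>) B"
      using half[of \<kappa> B] half[of "nxt i \<kappa>" B] nxt_less \<kappa> B by simp
    also have "cnt y (nxt i \<kappa>) B = (\<Sum>j<2 ^ i. cnt x ((\<kappa> + (2 ^ i + j)) mod 2 ^ a) B)"
      using IH[of "nxt i \<kappa>" B] nxt_less B by (simp add: nxt_def mod_add_left_eq add.assoc)
    also have "cnt y \<kappa> B = (\<Sum>j<2 ^ i. cnt x ((\<kappa> + j) mod 2 ^ a) B)" using IH[of \<kappa> B] \<kappa> B by simp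
    also have "(\<Sum>j<2 ^ i. cnt x ((\<kappa> + j) mod 2 ^ a) B) + (\<Sum>j<2 ^ i. cnt x ((\<kappa> + (2 ^ i + j)) mod 2 ^ a) B)
        = (\<Sum>j<2 ^ i + 2 ^ i. cnt x ((\<kappa> + j) mod 2 ^ a) B)"
      using sum.nat_group[of "\<lambda>j. cnt x ((\<kappa> + j) mod 2 ^ a) B" "2 ^ i" 2]
        sum.shift_bounds_nat_ivl[of "\<lambda>j. cnt x ((\<kappa> + j) mod 2 ^ a) B" 0 "2 ^ i" "2 ^ i"]
      by (simp add: numeral_2_eq_2 lessThan_atLeast0 add.commute)
    finally show ?thesis by (simp add: mult_2)
  qed
  then show ?case unfolding z using z_less by blast
qed

text \<open>An edge may be stored in either orientation, but only once in all copies
  together.\<close>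

definition inputs :: "(nat \<Rightarrow> nat) \<Rightarrow> bool" where
  "inputs x \<longleftrightarrow> (\<forall>c. x c < Y0) \<and> card {c. c < T \<and> x c \<noteq> 0} = card E \<and>
     (\<forall>c<T. x c \<noteq> 0 \<longrightarrow> (\<exists>u v. x c = W 1 u v \<and> {u, v} \<in> E)) \<and>
     (\<forall>u v. {u, v} \<in> E \<longrightarrow> card {c. c < T \<and> (x c = W 1 u v \<or> x c = W 1 v u)} = 1)"

lemma W_ne_0: "0 < t \<Longrightarrow> W t u v \<noteq> 0"
  by (metis W_simps(1) less_numeral_extra(3) tg_0)

lemma W_edge_less: "{u, v} \<in> E \<Longrightarrow> t \<le> 3 \<Longrightarrow> W t u v < Y0"
proof -
  assume *: "{u, v} \<in> E" "t \<le> 3"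
  then have "u < n" "v < n" using edge_bounds by auto
  moreover have "n < N * N" using size(4) N_sq by linarith
  ultimately show ?thesis using * size(4) by (intro W_less) auto
qed

text \<open>For \<open>i = a\<close> the window of \<open>allreduce_inv\<close> is the whole
  network, so every copy holds each edge exactly once; \<open>to_arcs\<close> makes two distinct
  arcs of it because \<open>u \<noteq> v\<close>.\<close>

lemma pre_run:
  assumes inp: "inputs x" and \<kappa>: "\<kappa> < 2 ^ a"
  defines "z \<equiv> run pre x"
  shows "\<And>p. p < N \<Longrightarrow> z (\<kappa> * N + p) \<noteq> 0 \<Longrightarrow> p < N - n \<and> (\<exists>u v. z (\<kappa> * N + p) = W 1 u v \<and> {u, v} \<in> E)"
    and "\<And>u v. {u, v} \<in> E \<Longrightarrow> \<exists>p<N. z (\<kappa> * N + p) = W 1 u v"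
    and "\<And>u v p p'. p < N \<Longrightarrow> p' < N \<Longrightarrow> z (\<kappa> * N + p) = W 1 u v \<Longrightarrow> z (\<kappa> * N + p') = W 1 u v \<Longrightarrow> p = p'"
proof -
  have x: "\<And>c. x c < Y0" and nz: "card {c. c < T \<and> x c \<noteq> 0} = card E"
    and form: "\<And>c. c < T \<Longrightarrow> x c \<noteq> 0 \<Longrightarrow> \<exists>u v. x c = W 1 u v \<and> {u, v} \<in> E"
    and one: "\<And>u v. {u, v} \<in> E \<Longrightarrow> card {c. c < T \<and> (x c = W 1 u v \<or> x c = W 1 v u)} = 1"
    using inp by (auto simp: inputs_def)
  have mN: "2 * card E \<le> N - n" "card E \<le> N2" using size(1) N_even by auto
  define y where "y = run (allreduce a) x"
  define y' where "y' = run (sort_by nk 1) y"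
  have y: "\<And>c. y c < Y0" and yc: "\<And>B. \<not> B 0 \<Longrightarrow> cnt y \<kappa> B = card {c. c < T \<and> B (x c)}"
    using allreduce_inv[where x = x and i = a, OF x] nz mN(2) \<kappa> by (auto simp: y_def cnt_window)
  have y': "y' c < Y0" for c
    using sort_by_run(2)[where x = y and key = nk and w = 1, OF y] by (simp add: y'_def good_def)
  have y'c: "cnt y' \<kappa> B = card {c. c < T \<and> B (x c)}" if "\<not> B 0" for B
    using sort_nk(1)[where x = y, OF y \<kappa>, of B] yc[of B] that by (simp add: y'_def)
  have y'_pos: "p < card E" if "p < N" "y' (\<kappa> * N + p) \<noteq> 0" for p
    using sort_nk(2)[where x = y, OF y \<kappa> that(1)] that(2) yc[of "\<lambda>w. w \<noteq> 0"] nz by (simp add: y'_def)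
  have y'_form: "\<exists>u v. y' (\<kappa> * N + p) = W 1 u v \<and> {u, v} \<in> E" if "p < N" "y' (\<kappa> * N + p) \<noteq> 0" for p
  proof -
    \<comment> \<open>The equality of counts, applied to the predicate of malformed words: their
      count in the input is zero.\<close>
    let ?B = "\<lambda>w. w \<noteq> 0 \<and> \<not> (\<exists>u v. w = W 1 u v \<and> {u, v} \<in> E)"
    have "{c. c < T \<and> ?B (x c)} = {}" using form by blast
    then have "cnt y' \<kappa> ?B = 0" using y'c[of ?B] by (metis (no_types, lifting) card.empty)
    then have "{p. p < N \<and> ?B (y' (\<kappa> * N + p))} = {}" by (simp add: cnt_def)
    then show ?thesis using that by blast
  qed
  have y'_one: "\<exists>p0. {p. p < N \<and> (y' (\<kappa> * N + p) = W 1 u v \<or> y' (\<kappa> * N + p) = W 1 v u)} = {p0}"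
    if "{u, v} \<in> E" for u v
  proof -
    have "cnt y' \<kappa> (\<lambda>w. w = W 1 u v \<or> w = W 1 v u) = 1"
      using y'c[of "\<lambda>w. w = W 1 u v \<or> w = W 1 v u"] one[OF that] W_ne_0[of 1] by (metis zero_less_one)
    then show ?thesis unfolding cnt_def by (rule card_1_singletonE) blast
  qed
  define sr where "sr = (\<lambda>c. c div N * N + c mod N div 2)"
  define h where "h = (\<lambda>c w. if w = 0 then 0 else if even (c mod N) then w else W 1 (fb w) (fa w))"
  have zz: "z = net_step M s (gather sr h) y'"
    by (simp add: z_def pre_def to_arcs_def y_def y'_def sr_def h_def)
  have sr_inv: "c = sr c div N * N + 2 * (sr c mod N) \<or> c = sr c div N * N + 2 * (sr c mod N) + 1" if "c < T" for c
    using arcs_src_inv[OF that] by (simp add: sr_def)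
  have z1: "z (\<kappa> * N + p) = cl (h (\<kappa> * N + p) (y' (\<kappa> * N + p div 2)))" if p: "p < N" for p
  proof -
    have "sr (\<kappa> * N + p) = \<kappa> * N + p div 2" using p by (simp add: sr_def cell_div cell_mod)
    moreover have "\<kappa> * N + p div 2 < T" using p by (intro cell_less[OF \<kappa>]) simp
    ultimately show ?thesis
      using cell_less[OF \<kappa> p] unfolding zz
      by (subst gather_step(1)[where ?t1.0 = "\<lambda>c. c div N * N + 2 * (c mod N)" and ?t2.0 = "\<lambda>c. c div N * N + 2 * (c mod N) + 1"])
        (use sr_inv in auto)
  qed
  have z0: "z (\<kappa> * N + p) = 0" if "p < N" "y' (\<kappa> * N + p div 2) = 0" for p
    using z1[OF that(1)] that(2) by (simp add: h_def cl_def)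
  have z2: "z (\<kappa> * N + p) = (if even p then W 1 u v else W 1 v u)"
    if "p < N" "y' (\<kappa> * N + p div 2) = W 1 u v" "{u, v} \<in> E" for p u v
    using z1[OF that(1)] that W_edge_less[of u v 1] W_edge_less[of v u 1] W_ne_0[of 1 u v]
    by (simp add: h_def cl_def cell_mod insert_commute)
  show f: "p < N - n \<and> (\<exists>u v. z (\<kappa> * N + p) = W 1 u v \<and> {u, v} \<in> E)" if "p < N" "z (\<kappa> * N + p) \<noteq> 0" for p
  proof -
    have p2: "p div 2 < N" using that by simp
    have ne: "y' (\<kappa> * N + p div 2) \<noteq> 0" using z0[OF that(1)] that(2) by metis
    obtain u v where uv: "y' (\<kappa> * N + p div 2) = W 1 u v" "{u, v} \<in> E" using y'_form[OF p2 ne] by blast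
    have "p < 2 * card E" using y'_pos[OF p2 ne] by simp
    then show ?thesis using z2[OF that(1) uv] uv(2) mN by (auto simp: insert_commute)
  qed
  show "\<exists>p<N. z (\<kappa> * N + p) = W 1 u v" if uv: "{u, v} \<in> E" for u v
  proof -
    obtain p0 where "{p. p < N \<and> (y' (\<kappa> * N + p) = W 1 u v \<or> y' (\<kappa> * N + p) = W 1 v u)} = {p0}"
      using y'_one[OF uv] by blast
    then have p0: "p0 < N" "y' (\<kappa> * N + p0) = W 1 u v \<or> y' (\<kappa> * N + p0) = W 1 v u" by auto
    have "y' (\<kappa> * N + p0) \<noteq> 0" using p0(2) W_ne_0[of 1] by (metis zero_less_one)
    then have "p0 < card E" by (rule y'_pos[OF p0(1)])
    then have lt: "2 * p0 < N" "2 * p0 + 1 < N" using mN size(5) by auto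
    from p0(2) show ?thesis
    proof
      assume "y' (\<kappa> * N + p0) = W 1 u v"
      then show ?thesis using z2[of "2 * p0" u v] lt uv by (intro exI[of _ "2 * p0"]) simp
    next
      assume "y' (\<kappa> * N + p0) = W 1 v u"
      then show ?thesis using z2[of "2 * p0 + 1" v u] lt uv by (intro exI[of _ "2 * p0 + 1"]) (simp add: insert_commute)
    qed
  qed
  show "p = p'" if p: "p < N" "p' < N" and e: "z (\<kappa> * N + p) = W 1 u v" "z (\<kappa> * N + p') = W 1 u v" for u v p p'
  proof -
    have "z (\<kappa> * N + p) \<noteq> 0" using e(1) W_ne_0[of 1] by (metis zero_less_one)
    then obtain u' v' where "z (\<kappa> * N + p) = W 1 u' v'" "{u', v'} \<in> E" using f[OF p(1)] by blast
    then have E: "{u, v} \<in> E" using e(1) by simp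
    then have uv: "u \<noteq> v" using edge_bounds by blast
    have *: "y' (\<kappa> * N + p div 2) = (if even p then W 1 u v else W 1 v u)"
      if "p < N" "z (\<kappa> * N + p) = W 1 u v" for p
    proof -
      have "y' (\<kappa> * N + p div 2) \<noteq> 0" using z0[OF that(1)] that(2) W_ne_0[of 1] by (metis zero_less_one)
      moreover have "p div 2 < N" using that(1) by simp
      ultimately obtain u' v' where uv': "y' (\<kappa> * N + p div 2) = W 1 u' v'" "{u', v'} \<in> E"
        using y'_form[of "p div 2"] by blast
      then show ?thesis using z2[OF that(1) uv'] that(2) by (auto split: if_splits)
    qed
    obtain p0 where p0: "{p. p < N \<and> (y' (\<kappa> * N + p) = W 1 u v \<or> y' (\<kappa> * N + p) = W 1 v u)} = {p0}"
      using y'_one[OF E] by blast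
    have "p div 2 \<in> {p0}" "p' div 2 \<in> {p0}"
      unfolding p0[symmetric] mem_Collect_eq using *[OF p(1) e(1)] *[OF p(2) e(2)] p
      by (cases "even p"; cases "even p'"; simp)+
    then have d: "p div 2 = p' div 2" by simp
    moreover have "even p \<longleftrightarrow> even p'"
      using *[OF p(1) e(1)] *[OF p(2) e(2)] uv unfolding d by (cases "even p"; cases "even p'") simp_all
    ultimately show ?thesis by (metis even_two_times_div_two odd_two_times_div_two_succ)
  qed
qed

end

section \<open>Sampling one step of the walks in every copy, and composing the steps\<close>

context alg
begin

lemma W_less': "t \<le> 3 \<Longrightarrow> u < 2 * N \<Longrightarrow> v < N \<Longrightarrow> W t u v < Y0"
  using N_sq by (intro W_less) linarith+

lemma n1: "v < n \<Longrightarrow> v + 1 < n1" "0 < n1" "n < n1" "v < n \<Longrightarrow> v < n1"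
  by (auto simp: n1_def)

lemma n1_less: "u < n \<Longrightarrow> w < n1 \<Longrightarrow> u * n1 + w < n1 * n1"
proof -
  assume *: "u < n" "w < n1"
  then have "u * n1 + w < Suc u * n1" by simp
  also have "\<dots> \<le> n1 * n1" using * n1(1)[of u] by (intro mult_right_mono) auto
  finally show ?thesis .
qed

lemma skey_less: "skey w < s ^ wd"
proof -
  have "skey w \<le> n1 * n1"
    using n1_less[of "fa w" "fb w + 1"] n1_less[of "fa w" 0] n1(1)[of "fb w"] n1(2) by (auto simp: skey_def)
  moreover have "n1 * n1 < s ^ wd" unfolding n1_def by (rule wd_n)
  ultimately show ?thesis by linarith
qed

text \<open>\<open>pos\<close> turns sort keys into positions. The keys of requests and arcs are
  unique within a copy, and only empty cells share a key, the largest one; so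
  \<open>sorted_pos\<close> locates every word that matters.\<close>

lemma sample_run:
  assumes inp: "inputs x" and \<omega>: "\<And>c. \<omega> c < 2 * d" and \<kappa>: "\<kappa> < 2 ^ a" and u: "u < n"
  shows "run (pre @ homes \<omega> # sample) x (\<kappa> * N + u) = W 3 u (step_to u (\<omega> (\<kappa> * N + (N - n + u))))"
proof -
  define z where "z = run pre x"
  note pr = pre_run[OF inp \<kappa>, folded z_def]
  define h where "h = net_step M s (homes \<omega>) z"
  define y where "y = run (sort_by skey wd) h"
  define r where "r = net_step M s (gather (\<lambda>c. c) relabel) y"
  have run: "run (pre @ homes \<omega> # sample) x = run (join out1) r"
    by (simp add: sample_def z_def h_def y_def r_def)
  define prt where "prt = (\<lambda>u. \<omega> (\<kappa> * N + (N - n + u)))"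
  have prt: "prt u < 2 * d" for u using \<omega> by (simp add: prt_def)
  have z_less: "z c < Y0" for c
    using safe_pre inp unfolding safe_def inputs_def z_def by blast
  have h_less: "h c < Y0" for c
    using safe_homes[of \<omega>] z_less by (simp add: safe_def h_def)
  have y_less: "y c < Y0" for c
    using safe_sort[OF wd(1)] h_less by (simp add: safe_def y_def)
  have r_less: "r c < Y0" for c
    using gather_id(3)[of relabel y] by (simp add: good_def r_def)
  have h_eq: "h (\<kappa> * N + p) = (if N - n \<le> p then W 2 (p - (N - n)) (\<omega> (\<kappa> * N + p)) else z (\<kappa> * N + p))"
    if p: "p < N" for p
  proof -
    have "W 2 (p - (N - n)) (\<omega> (\<kappa> * N + p)) < Y0"
      using p \<omega>[of "\<kappa> * N + p"] size(3) by (intro W_less') auto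
    then show ?thesis
      using cell_less[OF \<kappa> p] p z_less by (simp add: h_def homes_def gather_id(1) cl_def cell_mod)
  qed
  have h_home: "h (\<kappa> * N + (N - n + u)) = W 2 u (prt u)" "N - n + u < N" if "u < n" for u
    using h_eq[of "N - n + u"] that size(4) by (auto simp: prt_def)
  have h_arc: "\<exists>p<N. h (\<kappa> * N + p) = W 1 u v" if uv: "{u, v} \<in> E" for u v
  proof -
    obtain p where p: "p < N" "z (\<kappa> * N + p) = W 1 u v" using pr(2)[OF uv] by blast
    have "z (\<kappa> * N + p) \<noteq> 0" using p(2) W_ne_0[of 1] by (metis zero_less_one)
    then have "p < N - n" using pr(1)[OF p(1)] by blast
    then show ?thesis using h_eq[OF p(1)] p by auto
  qed
  have h_cases: "h (\<kappa> * N + p) = 0 \<or> (\<exists>u v. {u, v} \<in> E \<and> h (\<kappa> * N + p) = W 1 u v) \<or>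
      (\<exists>u<n. p = N - n + u \<and> h (\<kappa> * N + p) = W 2 u (prt u))" if p: "p < N" for p
  proof (cases "N - n \<le> p")
    case True
    then have "p = N - n + (p - (N - n))" "p - (N - n) < n" using p size(4) by auto
    then show ?thesis using h_home[of "p - (N - n)"] by metis
  next
    case False
    then have e: "h (\<kappa> * N + p) = z (\<kappa> * N + p)" using h_eq[OF p] by simp
    show ?thesis
    proof (cases "z (\<kappa> * N + p) = 0")
      case False
      then show ?thesis using pr(1)[OF p] e by metis
    qed (use e in simp)
  qed
  have h_uni1: "p = p'" if "p < N" "p' < N" "h (\<kappa> * N + p) = W 1 u v" "h (\<kappa> * N + p') = W 1 u v" for p p' u v
  proof -
    have "z (\<kappa> * N + p) = W 1 u v" if "p < N" "h (\<kappa> * N + p) = W 1 u v" for p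
      using h_eq[OF that(1)] that(2) by (cases "N - n \<le> p") simp_all
    then show ?thesis using that by (intro pr(3)[OF that(1,2)])
  qed
  have sk_arc: "skey (W 1 u v) = u * n1 + (v + 1)" if "{u, v} \<in> E" for u v
    using edge_bounds[OF that] by (simp add: skey_def)
  have sk_home: "skey (W 2 u b) = u * n1" if "u < n" for u b
    using that by (simp add: skey_def)
  have sk_0: "skey 0 = n1 * n1" by (simp add: skey_def)
  note lt = n1_less
  have dig_eq: "u = u' \<and> w = w'" if "w < n1" "w' < n1" "u * n1 + w = u' * n1 + w'" for u u' w w'
    using arg_cong[OF that(3), of "\<lambda>k. k div n1"] arg_cong[OF that(3), of "\<lambda>k. k mod n1"] that(1,2) by simp
  have key_arc: "h (\<kappa> * N + p) = W 1 u v" if "p < N" "skey (h (\<kappa> * N + p)) = u * n1 + (v + 1)" "u < n" "v < n" for p u v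
    using h_cases[OF that(1)]
  proof (elim disjE exE conjE)
    assume "h (\<kappa> * N + p) = 0"
    then show ?thesis using that sk_0 lt[of u "v + 1"] n1(1)[of v] by simp
  next
    fix u' v' assume *: "{u', v'} \<in> E" "h (\<kappa> * N + p) = W 1 u' v'"
    then show ?thesis using that sk_arc[OF *(1)] edge_bounds[OF *(1)] dig_eq[of "v' + 1" "v + 1" u' u] n1(1)[of v] n1(1)[of v'] by simp
  next
    fix u' assume "u' < n" "h (\<kappa> * N + p) = W 2 u' (prt u')"
    then show ?thesis using that sk_home[of u' "prt u'"] dig_eq[of 0 "v + 1" u' u] n1(1)[of v] n1(2) by simp
  qed
  have key_home: "p = N - n + u" if "p < N" "skey (h (\<kappa> * N + p)) = u * n1" "u < n" for p u
    using h_cases[OF that(1)]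
  proof (elim disjE exE conjE)
    assume "h (\<kappa> * N + p) = 0"
    then show ?thesis using that sk_0 lt[of u 0] n1(2) by simp
  next
    fix u' v' assume *: "{u', v'} \<in> E" "h (\<kappa> * N + p) = W 1 u' v'"
    then show ?thesis using that sk_arc[OF *(1)] edge_bounds[OF *(1)] dig_eq[of "v' + 1" 0 u' u] n1(1)[of v'] n1(2) by simp
  next
    fix u' assume "u' < n" "p = N - n + u'" "h (\<kappa> * N + p) = W 2 u' (prt u')"
    then show ?thesis using that sk_home[of u' "prt u'"] dig_eq[of 0 0 u' u] n1(2) by simp
  qed
  obtain \<pi> where sh: "shuffled h y \<kappa> \<pi>" and so: "is_sorted skey y \<kappa>"
    using sort_by_sorted[where x = h and key = skey, OF h_less wd(1) skey_less \<kappa>] unfolding y_def by metis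
  define pos where "pos = (\<lambda>k. card {p. p < N \<and> skey (h (\<kappa> * N + p)) < k})"
  have y_home: "pos (u * n1) < N" "y (\<kappa> * N + pos (u * n1)) = W 2 u (prt u)" if "u < n" for u
  proof -
    have uni: "p = N - n + u" if "p < N" "skey (h (\<kappa> * N + p)) = skey (h (\<kappa> * N + (N - n + u)))" for p
      using key_home[OF that(1), of u] that(2) \<open>u < n\<close> h_home[OF \<open>u < n\<close>] sk_home by simp
    show "pos (u * n1) < N" "y (\<kappa> * N + pos (u * n1)) = W 2 u (prt u)"
      using sorted_pos(1,3)[OF sh so h_home(2)[OF that] uni] h_home(1)[OF that] sk_home[OF that] by (auto simp: pos_def)
  qed
  have arc_pos: "i = pos (u * n1 + (v + 1))" if uv: "{u, v} \<in> E" and i: "i < N" "y (\<kappa> * N + i) = W 1 u v" for i u v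
  proof -
    have pi: "\<pi> i < N" "h (\<kappa> * N + \<pi> i) = W 1 u v" using shuffled_less[OF sh i(1)] shuffled_eq[OF sh i(1)] i(2) by auto
    have uni: "p = \<pi> i" if "p < N" "skey (h (\<kappa> * N + p)) = skey (h (\<kappa> * N + \<pi> i))" for p
    proof -
      have "h (\<kappa> * N + p) = W 1 u v"
        using that pi sk_arc[OF uv] edge_bounds[OF uv] by (intro key_arc) auto
      then show ?thesis using h_uni1[OF that(1) pi(1)] pi(2) by blast
    qed
    have "\<pi> (pos (u * n1 + (v + 1))) = \<pi> i" "pos (u * n1 + (v + 1)) < N"
      using sorted_pos(1,2)[OF sh so pi(1) uni] pi(2) sk_arc[OF uv] by (auto simp: pos_def)
    then show ?thesis using shuffled_inj[OF sh] i(1) by metis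
  qed
  have y_arc: "pos (u * n1 + (v + 1)) < N \<and> y (\<kappa> * N + pos (u * n1 + (v + 1))) = W 1 u v" if uv: "{u, v} \<in> E" for u v
  proof -
    obtain p where "p < N" "h (\<kappa> * N + p) = W 1 u v" using h_arc[OF uv] by blast
    then obtain i where "i < N" "y (\<kappa> * N + i) = W 1 u v"
      using shuffled_ex[OF sh] shuffled_eq[OF sh] by metis
    then show ?thesis using arc_pos[OF uv] by metis
  qed
  \<comment> \<open>Strictly between the request of \<open>u\<close> and its arc to \<open>v\<close>
    lie exactly the arcs to smaller neighbours, and their number is \<open>port u v\<close>.\<close>
  have gap: "pos (u * n1 + (v + 1)) = pos (u * n1) + 1 + port u v" if uv: "{u, v} \<in> E" for u v
  proof -
    have un: "u < n" "v < n" using edge_bounds[OF uv] by auto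
    let ?A = "{p. p < N \<and> skey (h (\<kappa> * N + p)) < u * n1}"
    let ?B = "{v'. {u, v'} \<in> E \<and> v' < v}"
    let ?C = "{p. p < N \<and> u * n1 < skey (h (\<kappa> * N + p)) \<and> skey (h (\<kappa> * N + p)) < u * n1 + (v + 1)}"
    have "{p. p < N \<and> skey (h (\<kappa> * N + p)) < u * n1 + (v + 1)} = insert (N - n + u) (?A \<union> ?C)"
    proof (intro equalityI subsetI)
      fix p assume p: "p \<in> {p. p < N \<and> skey (h (\<kappa> * N + p)) < u * n1 + (v + 1)}"
      show "p \<in> insert (N - n + u) (?A \<union> ?C)"
        using key_home[of p u] p un by (cases "skey (h (\<kappa> * N + p))" "u * n1" rule: linorder_cases) auto
    next
      fix p assume "p \<in> insert (N - n + u) (?A \<union> ?C)"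
      then show "p \<in> {p. p < N \<and> skey (h (\<kappa> * N + p)) < u * n1 + (v + 1)}"
        using h_home[OF un(1)] sk_home[OF un(1)] by auto
    qed
    moreover have "N - n + u \<notin> ?A \<union> ?C" using h_home[OF un(1)] sk_home[OF un(1)] by auto
    moreover have "card (?A \<union> ?C) = card ?A + card ?C" by (intro card_Un_disjoint) auto
    ultimately have "pos (u * n1 + (v + 1)) = Suc (pos (u * n1) + card ?C)" by (simp add: pos_def)
    moreover have "card ?C = port u v"
    proof -
      have "bij_betw (\<lambda>p. fb (h (\<kappa> * N + p))) ?C ?B"
      proof (rule bij_betw_imageI)
        have C: "\<exists>v'. h (\<kappa> * N + p) = W 1 u v' \<and> {u, v'} \<in> E \<and> v' < v" if p: "p \<in> ?C" for p
        proof -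
          define w where "w = skey (h (\<kappa> * N + p)) - (u * n1 + 1)"
          have w: "skey (h (\<kappa> * N + p)) = u * n1 + (w + 1)" "w < v" "p < N" using p by (auto simp: w_def)
          then have e: "h (\<kappa> * N + p) = W 1 u w" using key_arc[of p u w] un by simp
          have "{u, w} \<in> E" using h_cases[OF w(3)] e W_ne_0[of 1 u w] by auto
          then show ?thesis using e w by blast
        qed
        show "inj_on (\<lambda>p. fb (h (\<kappa> * N + p))) ?C"
        proof (rule inj_onI)
          fix p p' assume p: "p \<in> ?C" "p' \<in> ?C" and e: "fb (h (\<kappa> * N + p)) = fb (h (\<kappa> * N + p'))"
          obtain v1 where 1: "h (\<kappa> * N + p) = W 1 u v1" using C[OF p(1)] by blast
          obtain v2 where 2: "h (\<kappa> * N + p') = W 1 u v2" using C[OF p(2)] by blast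
          have "v1 = v2" using 1 2 e by simp
          then show "p = p'" using h_uni1[of p p' u v1] 1 2 p by simp
        qed
        show "(\<lambda>p. fb (h (\<kappa> * N + p))) ` ?C = ?B"
        proof (intro equalityI subsetI)
          fix v' assume "v' \<in> (\<lambda>p. fb (h (\<kappa> * N + p))) ` ?C"
          then obtain p where "p \<in> ?C" "v' = fb (h (\<kappa> * N + p))" by blast
          then show "v' \<in> ?B" using C[of p] by auto
        next
          fix v' assume v': "v' \<in> ?B"
          then obtain p where p: "p < N" "h (\<kappa> * N + p) = W 1 u v'" using h_arc[of u v'] by blast
          then have "p \<in> ?C" using sk_arc[of u v'] v' by simp
          then show "v' \<in> (\<lambda>p. fb (h (\<kappa> * N + p))) ` ?C" using p(2) by (intro image_eqI[of _ _ p]) simp_all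
        qed
      qed
      then show ?thesis unfolding port_def by (rule bij_betw_same_card)
    qed
    ultimately show ?thesis by simp
  qed
  define rq where "rq = (\<lambda>u. pos (u * n1) + 1 + prt u)"
  define dat where "dat = (\<lambda>i. if i < N \<and> tg (y (\<kappa> * N + i)) = 1 then Some (fa (y (\<kappa> * N + i)) * n + fb (y (\<kappa> * N + i))) else None)"
  have y_cases: "y (\<kappa> * N + i) = 0 \<or> (\<exists>u v. {u, v} \<in> E \<and> y (\<kappa> * N + i) = W 1 u v) \<or>
      (\<exists>u<n. i = pos (u * n1) \<and> y (\<kappa> * N + i) = W 2 u (prt u))" if i: "i < N" for i
  proof -
    have pi: "\<pi> i < N" "y (\<kappa> * N + i) = h (\<kappa> * N + \<pi> i)" using shuffled_less[OF sh i] shuffled_eq[OF sh i] by auto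
    show ?thesis
      using h_cases[OF pi(1)]
    proof (elim disjE exE conjE)
      fix u assume *: "u < n" "\<pi> i = N - n + u" "h (\<kappa> * N + \<pi> i) = W 2 u (prt u)"
      have uni: "p = N - n + u" if "p < N" "skey (h (\<kappa> * N + p)) = skey (h (\<kappa> * N + (N - n + u)))" for p
        using key_home[OF that(1), of u] that(2) *(1) h_home[OF *(1)] sk_home by simp
      have "\<pi> (pos (u * n1)) = N - n + u"
        using sorted_pos(2)[OF sh so h_home(2)[OF *(1)] uni] h_home(1)[OF *(1)] sk_home[OF *(1)] by (auto simp: pos_def)
      then have "i = pos (u * n1)" using shuffled_inj[OF sh i y_home(1)[OF *(1)]] *(2) by simp
      then show ?thesis using * pi by auto
    qed (use pi in auto)
  qed
  have uv_less: "fa w < n \<and> fb w < n" if "w = W 1 u v" "{u, v} \<in> E" for w u v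
    using that edge_bounds[of u v] by simp
  have r_eq: "r (\<kappa> * N + i) = relabel (\<kappa> * N + i) (y (\<kappa> * N + i))" if i: "i < N" for i
  proof -
    have "relabel (\<kappa> * N + i) (y (\<kappa> * N + i)) < Y0"
      using y_cases[OF i]
    proof (elim disjE exE conjE)
      assume "y (\<kappa> * N + i) = 0"
      then show ?thesis using N_less by (simp add: relabel_def)
    next
      fix u v assume *: "{u, v} \<in> E" "y (\<kappa> * N + i) = W 1 u v"
      have "u * n + v < N * N" using nn_less[of u v] edge_bounds[OF *(1)] nn_le by simp
      then show ?thesis using * i by (simp add: relabel_def cell_mod W_less)
    next
      fix u assume *: "u < n" "y (\<kappa> * N + i) = W 2 u (prt u)"
      have "u < N" using *(1) size(4) by simp
      then show ?thesis using * i prt[of u] size(3) by (simp add: relabel_def cell_mod W_less')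
    qed
    then show ?thesis using cell_less[OF \<kappa> i] by (simp add: r_def gather_id(1) cl_def)
  qed
  have r_tg: "tg (r (\<kappa> * N + i)) = tg (y (\<kappa> * N + i))" if i: "i < N" for i
    using y_cases[OF i] by (auto simp: r_eq[OF i] relabel_def)
  have main: "run (join out1) r (\<kappa> * N + u) = W 3 u (out1 u (dat (rq u)))"
  proof (rule join_run[where x = r and dat = dat and rq = rq and out = out1, OF r_less \<kappa>])
    show "fa (r (\<kappa> * N + p)) < K \<and> fb (r (\<kappa> * N + p)) < Q \<and> dat (fa (r (\<kappa> * N + p))) = Some (fb (r (\<kappa> * N + p)))"
      if p: "p < N" "tg (r (\<kappa> * N + p)) = 1" for p
    proof -
      have t: "tg (y (\<kappa> * N + p)) = 1" using r_tg[OF p(1)] p(2) by simp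
      then obtain u v where uv: "{u, v} \<in> E" "y (\<kappa> * N + p) = W 1 u v" using y_cases[OF p(1)] by auto
      then have "r (\<kappa> * N + p) = W 1 p (u * n + v)" using r_eq[OF p(1)] p(1) by (simp add: relabel_def cell_mod)
      then show ?thesis using nn_less[of u v] edge_bounds[OF uv(1)] p(1) uv by (simp add: K_eq Q_eq dat_def)
    qed
    show "\<exists>p<N. r (\<kappa> * N + p) = W 1 k b" if "dat k = Some b" for k b
      using that r_eq[of k] by (intro exI[of _ k]) (auto simp: dat_def relabel_def cell_mod split: if_splits)
    show "fb (r (\<kappa> * N + p)) < n" if p: "p < N" "tg (r (\<kappa> * N + p)) = 2" for p
    proof -
      have t: "tg (y (\<kappa> * N + p)) = 2" using r_tg[OF p(1)] p(2) by simp
      then obtain u where u: "u < n" "y (\<kappa> * N + p) = W 2 u (prt u)" using y_cases[OF p(1)] by auto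
      then show ?thesis using r_eq[OF p(1)] by (simp add: relabel_def)
    qed
    show "\<exists>p<N. r (\<kappa> * N + p) = W 2 (rq v) v" if v: "v < n" for v
      using y_home[OF v] r_eq[OF y_home(1)[OF v]] by (intro exI[of _ "pos (v * n1)"]) (simp add: relabel_def cell_mod rq_def)
    show "rq v < K" if v: "v < n" for v
      using y_home(1)[OF v] prt[of v] size(3) by (simp add: rq_def K_eq)
    show "p = p'" if p: "p < N" "p' < N" "tg (r (\<kappa> * N + p)) = 2" "tg (r (\<kappa> * N + p')) = 2"
        "fb (r (\<kappa> * N + p)) = fb (r (\<kappa> * N + p'))" for p p'
    proof -
      have *: "\<exists>u<n. p = pos (u * n1) \<and> fb (r (\<kappa> * N + p)) = u" if p: "p < N" "tg (r (\<kappa> * N + p)) = 2" for p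
      proof -
        have "tg (y (\<kappa> * N + p)) = 2" using r_tg[OF p(1)] p(2) by simp
        then obtain u where "u < n" "p = pos (u * n1)" "y (\<kappa> * N + p) = W 2 u (prt u)" using y_cases[OF p(1)] by auto
        then show ?thesis using r_eq[OF p(1)] by (intro exI[of _ u]) (simp add: relabel_def)
      qed
      show ?thesis using *[OF p(1,3)] *[OF p(2,4)] p(5) by metis
    qed
    show "W 3 v (out1 v (dat (rq v))) < Y0" if v: "v < n" for v
    proof -
      have "out1 v (dat (rq v)) < n" using v size(5) by (auto simp: out1_def split: option.split)
      then show ?thesis using v size(4) by (intro W_less') auto
    qed
    show "u < n" by (rule u)
  qed
  have "out1 u (dat (rq u)) = step_to u (prt u)"
  proof (cases rule: step_to_cases[of u "prt u"])
    case (1 v)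
    have "rq u = pos (u * n1 + (v + 1))" using gap[OF 1(1)] 1(2) by (simp add: rq_def)
    then have "dat (rq u) = Some (u * n + v)" using y_arc[OF 1(1)] by (simp add: dat_def)
    then show ?thesis using 1 edge_bounds[OF 1(1)] by (simp add: out1_def)
  next
    case 2
    show ?thesis
    proof (cases "dat (rq u)")
      case (Some b)
      then have i: "rq u < N" "tg (y (\<kappa> * N + rq u)) = 1" "b = fa (y (\<kappa> * N + rq u)) * n + fb (y (\<kappa> * N + rq u))"
        by (auto simp: dat_def split: if_splits)
      obtain u' v where uv: "{u', v} \<in> E" "y (\<kappa> * N + rq u) = W 1 u' v" using y_cases[OF i(1)] i(2) by auto
      have b: "b div n = u'" using i(3) uv edge_bounds[OF uv(1)] by simp
      \<comment> \<open>An arc of \<open>u\<close> in the requested cell would have the drawn port,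
        but no edge at \<open>u\<close> has it. The arc found leaves another vertex, which
        \<open>out1\<close> detects.\<close>
      have "u' \<noteq> u"
      proof
        assume "u' = u"
        then have "rq u = pos (u * n1) + 1 + port u v" using arc_pos[OF uv(1) i(1) uv(2)] gap uv(1) by simp
        then have "port u v = prt u" by (simp add: rq_def)
        then show False using 2(1) uv(1) \<open>u' = u\<close> by blast
      qed
      then show ?thesis using Some b 2(2) by (simp add: out1_def)
    qed (simp add: out1_def 2(2))
  qed
  then show ?thesis using main unfolding run prt_def by simp
qed

text \<open>The map held by copy \<open>\<kappa>\<close> after \<open>i\<close> doublings:
  \<open>2 ^ i\<close> consecutive steps beginning with that of copy \<open>\<kappa>\<close>,
  cyclically in the copies.\<close>

primrec cmp :: "(nat \<Rightarrow> nat) \<Rightarrow> nat \<Rightarrow> nat \<Rightarrow> nat \<Rightarrow> nat" where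
  "cmp \<omega> 0 \<kappa> v = step_to v (\<omega> (\<kappa> * N + (N - n + v)))"
| "cmp \<omega> (Suc i) \<kappa> v = cmp \<omega> i (nxt i \<kappa>) (cmp \<omega> i \<kappa> v)"

lemma cmp_less: "v < n \<Longrightarrow> cmp \<omega> i \<kappa> v < n"
  by (induction i arbitrary: \<kappa> v) (auto simp: step_to_less)

lemma compose_step:
  assumes x: "\<And>c. x c < Y0" and i: "i \<le> a"
    and inv: "\<And>\<kappa> v. \<kappa> < 2 ^ a \<Longrightarrow> v < n \<Longrightarrow> x (\<kappa> * N + v) = W 3 v (F \<kappa> v) \<and> F \<kappa> v < n"
    and \<kappa>: "\<kappa> < 2 ^ a" and v: "v < n"
  shows "run (compose i) x (\<kappa> * N + v) = W 3 v (F (nxt i \<kappa>) (F \<kappa> v))"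
proof -
  define r where "r = net_step M s (gather (msrc i) query) x"
  have r_less: "r c < Y0" for c
    using merge_step(3)[OF i, of query] x by (simp add: safe_def r_def)
  have low: "r (\<kappa> * N + p) = (if p < n then W 2 (F \<kappa> p) p else 0)" if p: "p < N2" for p
  proof -
    have "p < N" using p N_even by simp
    moreover have "W 2 (F \<kappa> p) p < Y0" if "p < n"
      using inv[OF \<kappa> that] that size(4) by (intro W_less') auto
    ultimately show ?thesis
      using merge_step(1)[OF i \<kappa> p, of query x] inv[OF \<kappa>, of p] p by (auto simp: r_def query_def cell_mod cl_def)
  qed
  have high: "r (\<kappa> * N + (N2 + p)) = (if p < n then W 1 p (F (nxt i \<kappa>) p) else 0)" if p: "p < N2" for p
  proof -
    have "N2 + p < N" using p N_even by simp
    moreover have "W 1 p (F (nxt i \<kappa>) p) < Y0" if "p < n"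
      using inv[OF nxt_less that, of i \<kappa>] that size(4) by (intro W_less') auto
    moreover have "\<not> N2 + p < n" using n_N2 by simp
    ultimately show ?thesis
      using merge_step(2)[OF i \<kappa> p, of query x] inv[OF nxt_less, of p i \<kappa>] p by (auto simp: r_def query_def cell_mod cl_def)
  qed
  define dat where "dat = (\<lambda>w. if w < n then Some (F (nxt i \<kappa>) w) else None)"
  have cases: "(p < n \<and> r (\<kappa> * N + p) = W 2 (F \<kappa> p) p) \<or> (\<exists>w<n. p = N2 + w \<and> r (\<kappa> * N + p) = W 1 w (F (nxt i \<kappa>) w)) \<or> r (\<kappa> * N + p) = 0"
    if p: "p < N" for p
    using p by (cases rule: half_cases) (use low high in auto)
  have nQ: "n \<le> Q" unfolding Q_eq using size(5) by simp
  have "run (join out2) r (\<kappa> * N + v) = W 3 v (out2 v (dat (F \<kappa> v)))"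
  proof (rule join_run[where x = r and dat = dat and rq = "F \<kappa>" and out = out2, OF r_less \<kappa>])
    show "fa (r (\<kappa> * N + p)) < K \<and> fb (r (\<kappa> * N + p)) < Q \<and> dat (fa (r (\<kappa> * N + p))) = Some (fb (r (\<kappa> * N + p)))"
      if p: "p < N" "tg (r (\<kappa> * N + p)) = 1" for p
    proof -
      obtain w where w: "w < n" "r (\<kappa> * N + p) = W 1 w (F (nxt i \<kappa>) w)" using cases[OF p(1)] p(2) by auto
      have "F (nxt i \<kappa>) w < Q" using inv[OF nxt_less w(1), of i \<kappa>] nQ by simp
      then show ?thesis using w size(4) by (simp add: K_eq dat_def)
    qed
    show "\<exists>p<N. r (\<kappa> * N + p) = W 1 k b" if "dat k = Some b" for k b
    proof -
      have k: "k < n" "b = F (nxt i \<kappa>) k" using that by (auto simp: dat_def split: if_splits)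
      then show ?thesis using high[of k] n_N2 N_even by (intro exI[of _ "N2 + k"]) simp
    qed
    show "fb (r (\<kappa> * N + p)) < n" if "p < N" "tg (r (\<kappa> * N + p)) = 2" for p
      using cases[OF that(1)] that(2) by auto
    show "\<exists>p<N. r (\<kappa> * N + p) = W 2 (F \<kappa> v) v" if "v < n" for v
      using low[of v] that n_N2 N_even by (intro exI[of _ v]) simp
    show "F \<kappa> v < K" if "v < n" for v using inv[OF \<kappa> that] size(4) by (simp add: K_eq)
    show "p = p'" if "p < N" "p' < N" "tg (r (\<kappa> * N + p)) = 2" "tg (r (\<kappa> * N + p')) = 2"
        "fb (r (\<kappa> * N + p)) = fb (r (\<kappa> * N + p'))" for p p'
      using cases[OF that(1)] cases[OF that(2)] that(3-5) by auto
    show "W 3 v (out2 v (dat (F \<kappa> v))) < Y0" if v: "v < n" for v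
    proof -
      have "F \<kappa> v < n" using inv[OF \<kappa> v] by simp
      then have "out2 v (dat (F \<kappa> v)) < n" using inv[OF nxt_less, of "F \<kappa> v" i \<kappa>] by (simp add: out2_def dat_def)
      then show ?thesis using v size(4) by (intro W_less') auto
    qed
  qed (rule v)
  moreover have "out2 v (dat (F \<kappa> v)) = F (nxt i \<kappa>) (F \<kappa> v)" using inv[OF \<kappa> v] by (simp add: out2_def dat_def)
  ultimately show ?thesis by (simp add: compose_def r_def)
qed

lemma compose_run:
  assumes inp: "inputs x" and \<omega>: "\<And>c. \<omega> c < 2 * d" and "j \<le> a"
  shows "(\<forall>c. run (pre @ homes \<omega> # sample @ concat (map compose [0..<j])) x c < Y0) \<and>
    (\<forall>\<kappa><2 ^ a. \<forall>v<n. run (pre @ homes \<omega> # sample @ concat (map compose [0..<j])) x (\<kappa> * N + v) = W 3 v (cmp \<omega> j \<kappa> v))"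
  using \<open>j \<le> a\<close>
proof (induction j)
  case 0
  have "safe (pre @ homes \<omega> # sample)"
    unfolding sample_def
    by (rule safe_append[OF safe_pre safe_Cons[OF safe_homes safe_append[OF safe_sort[OF wd(1)] safe_Cons[OF safe_gather_id safe_join]]]])
  then show ?case using sample_run[OF inp \<omega>] inp by (simp add: safe_def inputs_def)
next
  case (Suc j)
  let ?y = "run (pre @ homes \<omega> # sample @ concat (map compose [0..<j])) x"
  have eq: "run (pre @ homes \<omega> # sample @ concat (map compose [0..<Suc j])) x = run (compose j) ?y" by simp
  have j: "j \<le> a" using Suc.prems by simp
  have y: "?y c < Y0" for c using Suc.IH j by blast
  have inv: "?y (\<kappa> * N + v) = W 3 v (cmp \<omega> j \<kappa> v) \<and> cmp \<omega> j \<kappa> v < n" if "\<kappa> < 2 ^ a" "v < n" for \<kappa> v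
    using Suc.IH j that cmp_less by blast
  have "run (compose j) ?y (\<kappa> * N + v) = W 3 v (cmp \<omega> (Suc j) \<kappa> v)" if "\<kappa> < 2 ^ a" "v < n" for \<kappa> v
    using compose_step[where x = ?y and F = "cmp \<omega> j", OF y j inv that] by simp
  moreover have "safe (compose j)"
    unfolding compose_def by (rule safe_Cons[OF merge_step(3)[OF j] safe_join])
  ultimately show ?case unfolding eq using y by (auto simp: safe_def)
qed

lemma prog_run:
  assumes inp: "inputs x" and \<omega>: "\<And>c. \<omega> c < 2 * d" and r: "r < 2 ^ rho"
  shows "run (pre @ homes \<omega> # post) x r = fixpoints (cmp \<omega> lam (r * 2 ^ lam))"
proof -
  let ?y = "run (pre @ homes \<omega> # sample @ concat (map compose [0..<lam])) x"
  have la: "lam \<le> a" by (simp add: a_eq)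
  have y: "?y c < Y0" and yv: "\<And>\<kappa> v. \<kappa> < 2 ^ a \<Longrightarrow> v < n \<Longrightarrow> ?y (\<kappa> * N + v) = W 3 v (cmp \<omega> lam \<kappa> v)" for c
    using compose_run[OF inp \<omega> la] by auto
  let ?sc = "scan (+) (\<lambda>c w. of_bool (c mod N < n \<and> fb w = c mod N)) (\<lambda>c w z. z)"
  let ?z = "run ?sc ?y"
  have \<kappa>: "r * 2 ^ lam < 2 ^ a" using r by (simp add: a_eq power_add)
  have N1: "N - 1 < N" using N_pos by simp
  have rT: "r < T"
  proof -
    have "r < 2 ^ a" using r by (metis \<kappa> le_less_trans mult_le_mono2 nat_mult_1_right one_le_numeral one_le_power)
    also have "2 ^ a \<le> T" using N_pos by (simp add: T_def)
    finally show ?thesis .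
  qed
  have src: "fsrc r = r * 2 ^ lam * N + (N - 1)" "fsrc r < T"
    using r cell_less[OF \<kappa> N1] by (auto simp: fsrc_def)
  have "run (pre @ homes \<omega> # post) x r = net_step M s (gather fsrc (\<lambda>c w. w)) ?z r"
    by (simp add: post_def counting_def)
  also have "\<dots> = cl (?z (fsrc r))"
    using fsrc_inv rT src(2) by (subst gather_step(1)[where ?t1.0 = "\<lambda>c. c div (2 ^ lam * N)" and ?t2.0 = "\<lambda>c. c"]) auto
  also have "\<dots> = ?z (r * 2 ^ lam * N + (N - 1))"
    using count_scan(3)[where x = ?y, OF y] by (simp add: cl_def src)
  also have "\<dots> = card {v. v < N - 1 \<and> v < n \<and> fb (?y (r * 2 ^ lam * N + v)) = v}"
    by (rule count_scan(2)[where x = ?y, OF y \<kappa> N1])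
  also have "{v. v < N - 1 \<and> v < n \<and> fb (?y (r * 2 ^ lam * N + v)) = v} = {v. v < n \<and> cmp \<omega> lam (r * 2 ^ lam) v = v}"
    using yv[OF \<kappa>] size(4) by auto
  finally show ?thesis by (simp add: fixpoints_def)
qed

end

section \<open>The law of the sampled flows\<close>

primrec comps :: "(nat \<Rightarrow> nat \<Rightarrow> nat) \<Rightarrow> nat \<Rightarrow> nat \<Rightarrow> nat" where
  "comps \<phi> 0 = id"
| "comps \<phi> (Suc t) = \<phi> t \<circ> comps \<phi> t"

lemma comps_add: "comps \<phi> (s + t) = comps (\<lambda>i. \<phi> (s + i)) t \<circ> comps \<phi> s"
  by (induction t) auto

lemma comps_cong: "(\<And>i. i < t \<Longrightarrow> \<phi> i = \<phi>' i) \<Longrightarrow> comps \<phi> t = comps \<phi>' t"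
  by (induction t) auto

lemma Pi_pmf_map_dep:
  assumes "finite A"
  shows "Pi_pmf A d (\<lambda>i. map_pmf (\<phi> i) (p i)) = map_pmf (\<lambda>h i. if i \<in> A then \<phi> i (h i) else d) (Pi_pmf A d' p)"
proof -
  have "Pi_pmf A d (\<lambda>i. bind_pmf (p i) (\<lambda>w. return_pmf (\<phi> i w)))
      = bind_pmf (Pi_pmf A d' p) (\<lambda>h. Pi_pmf A d (\<lambda>i. return_pmf (\<phi> i (h i))))"
    using assms by (rule Pi_pmf_bind)
  then show ?thesis using assms by (simp add: map_pmf_def)
qed

context lazy_walk
begin

lemma comps_flow:
  "map_pmf (\<lambda>\<phi>. comps \<phi> t) (Pi_pmf {..<t} z (\<lambda>_. step_pmf)) = flow_pmf t"
proof (induction t)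
  case (Suc t)
  have "Pi_pmf {..<Suc t} z (\<lambda>_. step_pmf)
      = bind_pmf step_pmf (\<lambda>f. bind_pmf (Pi_pmf {..<t} z (\<lambda>_. step_pmf)) (\<lambda>\<phi>. return_pmf (\<phi>(t := f))))"
    unfolding lessThan_Suc by (rule Pi_pmf_insert') auto
  then have "map_pmf (\<lambda>\<phi>. comps \<phi> (Suc t)) (Pi_pmf {..<Suc t} z (\<lambda>_. step_pmf))
      = bind_pmf step_pmf (\<lambda>f. map_pmf (\<lambda>\<phi>. comps (\<phi>(t := f)) (Suc t)) (Pi_pmf {..<t} z (\<lambda>_. step_pmf)))"
    by (simp add: map_bind_pmf map_pmf_def bind_assoc_pmf bind_return_pmf)
  also have "\<dots> = bind_pmf step_pmf (\<lambda>f. map_pmf (\<lambda>\<phi>. f \<circ> comps \<phi> t) (Pi_pmf {..<t} z (\<lambda>_. step_pmf)))"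
  proof -
    have "comps (\<phi>(t := f)) t = comps \<phi> t" for \<phi> f by (rule comps_cong) simp
    then show ?thesis by simp
  qed
  also have "\<dots> = bind_pmf step_pmf (\<lambda>f. bind_pmf (flow_pmf t) (\<lambda>F. return_pmf (f \<circ> F)))"
    unfolding Suc[symmetric] by (simp add: map_pmf_def bind_assoc_pmf bind_return_pmf)
  also have "\<dots> = bind_pmf (flow_pmf t) (\<lambda>F. bind_pmf step_pmf (\<lambda>f. return_pmf (f \<circ> F)))"
    by (rule bind_commute_pmf)
  finally show ?case by (simp only: flow_pmf.simps map_pmf_def)
qed (simp add: id_def)

lemma step_to_outside: "n \<le> u \<Longrightarrow> step_to u p = u"
  using edge_bounds[of u] by (auto simp: step_to_def)

text \<open>The ports of the last \<open>n\<close> cells are again independent and uniform, and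
  \<open>step_to\<close> fixes everything beyond the vertices.\<close>

lemma step_pmf_shift:
  assumes "n \<le> N"
  shows "map_pmf (\<lambda>\<eta> u. step_to u (\<eta> (N - n + u))) (Pi_pmf {..<N} 0 (\<lambda>_. ports)) = step_pmf"
proof -
  have "Pi_pmf {..<n} 0 (\<lambda>_. ports) = map_pmf (\<lambda>g. g \<circ> (\<lambda>u. N - n + u)) (Pi_pmf {N - n..<N} 0 (\<lambda>_. ports))"
    by (rule Pi_pmf_bij_betw) (use assms in \<open>auto intro!: bij_betwI[where g = "\<lambda>p. p - (N - n)"]\<close>)
  also have "Pi_pmf {N - n..<N} 0 (\<lambda>_. ports)
      = map_pmf (\<lambda>f x. if x \<in> {N - n..<N} then f x else 0) (Pi_pmf {..<N} 0 (\<lambda>_. ports))"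
    by (rule Pi_pmf_subset) auto
  finally have "step_pmf = map_pmf (\<lambda>\<eta> u. step_to u (if N - n + u < N then \<eta> (N - n + u) else 0)) (Pi_pmf {..<N} 0 (\<lambda>_. ports))"
    by (simp add: step_pmf_def map_pmf_comp o_def)
  also have "\<dots> = map_pmf (\<lambda>\<eta> u. step_to u (\<eta> (N - n + u))) (Pi_pmf {..<N} 0 (\<lambda>_. ports))"
  proof (rule map_pmf_cong[OF refl], rule ext)
    fix \<eta> u
    show "step_to u (if N - n + u < N then \<eta> (N - n + u) else 0) = step_to u (\<eta> (N - n + u))"
    proof (cases "u < n")
      case True
      then have "N - n + u < N" using assms by simp
      then show ?thesis by simp
    qed (simp add: step_to_outside)
  qed
  finally show ?thesis ..
qed

end

context alg
begin

definition flows :: "(nat \<Rightarrow> nat) \<Rightarrow> nat \<Rightarrow> nat \<Rightarrow> nat" where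
  "flows \<omega> \<kappa> v = step_to v (\<omega> (\<kappa> * N + (N - n + v)))"

text \<open>The hypothesis excludes wrapping around, so the steps composed come from
  \<open>2 ^ i\<close> different copies.\<close>

lemma cmp_comps: "\<kappa> + 2 ^ i \<le> 2 ^ a \<Longrightarrow> cmp \<omega> i \<kappa> = comps (\<lambda>t. flows \<omega> (\<kappa> + t)) (2 ^ i)"
proof (induction i arbitrary: \<kappa>)
  case 0
  show ?case by (auto simp: flows_def)
next
  case (Suc i)
  have pos: "0 < (2::nat) ^ i" by simp
  have le: "\<kappa> + 2 ^ i + 2 ^ i \<le> 2 ^ a" using Suc.prems by simp
  then have "\<kappa> + 2 ^ i < 2 ^ a" using pos by linarith
  then have nx: "nxt i \<kappa> = \<kappa> + 2 ^ i" by (simp add: nxt_def)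
  have "cmp \<omega> (Suc i) \<kappa> = cmp \<omega> i (\<kappa> + 2 ^ i) \<circ> cmp \<omega> i \<kappa>" by (auto simp: nx)
  also have "\<dots> = comps (\<lambda>t. flows \<omega> (\<kappa> + 2 ^ i + t)) (2 ^ i) \<circ> comps (\<lambda>t. flows \<omega> (\<kappa> + t)) (2 ^ i)"
    using Suc.IH[of "\<kappa> + 2 ^ i"] Suc.IH[of \<kappa>] le by simp
  also have "\<dots> = comps (\<lambda>t. flows \<omega> (\<kappa> + t)) (2 ^ i + 2 ^ i)"
    by (simp add: comps_add add.assoc)
  finally show ?case by (simp add: mult_2)
qed

text \<open>The ports of all cells are grouped by copies into independent steps, and the copies in
  runs of \<open>2 ^ lam\<close> into flows. Different repetitions use disjoint runs and are
  therefore independent.\<close>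

lemma cmp_law:
  "\<exists>z. map_pmf (\<lambda>\<omega> r. if r < 2 ^ rho then cmp \<omega> lam (r * 2 ^ lam) else z) (Pi_pmf {..<T} 0 (\<lambda>_. ports))
     = Pi_pmf {..<2 ^ rho} z (\<lambda>_. flow_pmf (2 ^ lam))"
proof -
  define d1 where "d1 = (\<lambda>u. step_to u 0)"
  define z where "z = comps (\<lambda>_. d1) (2 ^ lam)"
  define \<Omega> where "\<Omega> = Pi_pmf {..<T} 0 (\<lambda>_. ports)"
  have 1: "map_pmf (\<lambda>\<omega> \<kappa>. if \<kappa> < 2 ^ a then flows \<omega> \<kappa> else d1) \<Omega> = Pi_pmf {..<2 ^ a} d1 (\<lambda>_. step_pmf)"
  proof -
    have "Pi_pmf {..<(2::nat) ^ a} d1 (\<lambda>_. step_pmf)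
        = map_pmf (\<lambda>h \<kappa>. if \<kappa> \<in> {..<2 ^ a} then (\<lambda>\<eta> u. step_to u (\<eta> (N - n + u))) (h \<kappa>) else d1)
           (Pi_pmf {..<2 ^ a} (\<lambda>_. 0) (\<lambda>_. Pi_pmf {..<N} 0 (\<lambda>_. ports)))"
      unfolding step_pmf_shift[OF nN, symmetric] by (rule Pi_pmf_map_dep) simp
    also have "\<dots> = map_pmf (\<lambda>h \<kappa>. if \<kappa> \<in> {..<2 ^ a} then (\<lambda>u. step_to u (h \<kappa> (N - n + u))) else d1)
        (map_pmf (\<lambda>g r t. if r < 2 ^ a \<and> t < N then g (r * N + t) else 0) \<Omega>)"
      unfolding \<Omega>_def T_def Pi_pmf_unflatten ..
    also have "\<dots> = map_pmf (\<lambda>\<omega> \<kappa>. if \<kappa> < 2 ^ a then flows \<omega> \<kappa> else d1) \<Omega>"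
      unfolding map_pmf_comp
    proof (rule map_pmf_cong[OF refl], rule ext, rule ext)
      fix \<omega> \<kappa> u
      show "(if \<kappa> \<in> {..<2 ^ a} then \<lambda>u. step_to u (if \<kappa> < 2 ^ a \<and> N - n + u < N then \<omega> (\<kappa> * N + (N - n + u)) else 0) else d1) u
          = (if \<kappa> < 2 ^ a then flows \<omega> \<kappa> else d1) u"
        using nN step_to_outside[of u] by (cases "u < n") (auto simp: flows_def)
    qed
    finally show ?thesis ..
  qed
  have L: "(2::nat) ^ a = 2 ^ rho * 2 ^ lam" unfolding a_eq power_add by (rule mult.commute)
  have "Pi_pmf {..<(2::nat) ^ rho} z (\<lambda>_. flow_pmf (2 ^ lam))
      = map_pmf (\<lambda>h r. if r \<in> {..<2 ^ rho} then comps (h r) (2 ^ lam) else z)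
          (Pi_pmf {..<2 ^ rho} (\<lambda>_. d1) (\<lambda>_. Pi_pmf {..<2 ^ lam} d1 (\<lambda>_. step_pmf)))"
    unfolding comps_flow[where z = d1, symmetric] by (rule Pi_pmf_map_dep) simp
  also have "\<dots> = map_pmf (\<lambda>\<omega> r. if r < 2 ^ rho then cmp \<omega> lam (r * 2 ^ lam) else z) \<Omega>"
    unfolding Pi_pmf_unflatten[symmetric] L[symmetric] 1[symmetric] map_pmf_comp
  proof (rule map_pmf_cong[OF refl], rule ext, rule ext)
    fix \<omega> r v
    show "(if r \<in> {..<2 ^ rho} then comps (\<lambda>t. if r < 2 ^ rho \<and> t < 2 ^ lam then if r * 2 ^ lam + t < 2 ^ a
          then flows \<omega> (r * 2 ^ lam + t) else d1 else d1) (2 ^ lam) else z) v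
        = (if r < 2 ^ rho then cmp \<omega> lam (r * 2 ^ lam) else z) v"
    proof (cases "r < 2 ^ rho")
      case True
      have "r * 2 ^ lam + 2 ^ lam = Suc r * 2 ^ lam" by simp
      also have "\<dots> \<le> 2 ^ rho * 2 ^ lam" using True by (intro mult_right_mono) auto
      finally have le: "r * 2 ^ lam + 2 ^ lam \<le> 2 ^ a" by (simp add: L)
      have "comps (\<lambda>t. if r < 2 ^ rho \<and> t < 2 ^ lam then if r * 2 ^ lam + t < 2 ^ a
          then flows \<omega> (r * 2 ^ lam + t) else d1 else d1) (2 ^ lam) = comps (\<lambda>t. flows \<omega> (r * 2 ^ lam + t)) (2 ^ lam)"
        using True le by (intro comps_cong) auto
      then show ?thesis using True cmp_comps[OF le] by simp
    qed simp
  qed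
  finally show ?thesis unfolding \<Omega>_def by (intro exI[of _ z]) simp
qed

end

section \<open>Simulation of networks in the MPC model\<close>

definition outbox :: "nat \<Rightarrow> (nat \<times> nat) list \<Rightarrow> mailbox" where
  "outbox s l j = map (\<lambda>(c, v). prod_encode (c mod s, v)) (filter (\<lambda>(c, v). c div s = j) l)"

definition decode :: "nat \<Rightarrow> mailbox \<Rightarrow> nat \<Rightarrow> nat" where
  "decode M b k = (case map_of (map prod_decode (concat (map b [0..<M]))) k of None \<Rightarrow> 0 | Some v \<Rightarrow> v)"

definition load :: "nat \<Rightarrow> nat list \<Rightarrow> nat \<Rightarrow> nat" where
  "load s mem k = (if k < s \<and> 2 * k + 1 < length mem then W 1 (mem ! (2 * k)) (mem ! (2 * k + 1)) else 0)"

text \<open>Between rounds the memories are empty: the state of the network sits entirely in the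
  messages just delivered.\<close>

definition cfg :: "nat \<Rightarrow> nat \<Rightarrow> emitter \<Rightarrow> (nat \<Rightarrow> nat) \<Rightarrow> config" where
  "cfg M s em x = (\<lambda>j. ([], \<lambda>i. if i < M then outbox s (em i (blk s x i)) j else []))"

lemma map_of_block:
  fixes s j k :: nat
  assumes "0 < s"
  shows "map_of (map (\<lambda>(c, v). (c mod s, v)) (filter (\<lambda>(c, v). c div s = j) l)) k
    = (if k < s then map_of l (j * s + k) else None)"
proof (induction l)
  case (Cons a l)
  obtain c v where a: "a = (c, v)" by (cases a)
  have "c div s = j \<and> c mod s = k \<longleftrightarrow> k < s \<and> c = j * s + k"
    using assms div_mult_mod_eq[of c s] by auto
  then show ?case using Cons by (auto simp: a)
qed simp

lemma decode_cfg:
  assumes "0 < s" "j < M"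
  shows "decode M (snd (cfg M s em x j)) = blk s (net_step M s em x) j"
proof
  fix k
  have "concat (map (\<lambda>i. if i < M then outbox s (em i (blk s x i)) j else []) [0..<M])
      = outbox s (emissions M s em x) j"
  proof -
    have "concat (map (\<lambda>i. if i < M then outbox s (em i (blk s x i)) j else []) [0..<M])
        = concat (map (\<lambda>i. outbox s (em i (blk s x i)) j) [0..<M])"
      by (intro arg_cong[where f = concat] map_cong) auto
    then show ?thesis by (simp add: outbox_def emissions_def map_concat filter_concat o_def)
  qed
  moreover have "map prod_decode (outbox s (emissions M s em x) j)
      = map (\<lambda>(c, v). (c mod s, v)) (filter (\<lambda>(c, v). c div s = j) (emissions M s em x))"
    by (auto simp: outbox_def)
  ultimately have "map prod_decode (concat (map (snd (cfg M s em x j)) [0..<M]))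
      = map (\<lambda>(c, v). (c mod s, v)) (filter (\<lambda>(c, v). c div s = j) (emissions M s em x))"
    by (simp only: cfg_def snd_conv)
  then have "map_of (map prod_decode (concat (map (snd (cfg M s em x j)) [0..<M]))) k
      = (if k < s then map_of (emissions M s em x) (j * s + k) else None)"
    by (simp only: map_of_block[OF assms(1)])
  then show "decode M (snd (cfg M s em x j)) k = blk s (net_step M s em x) j k"
    by (simp add: decode_def blk_def net_step_def)
qed

text \<open>The local space \<open>2 * s\<close> accommodates the input, two words for each of at
  most \<open>s\<close> edges, as well as outboxes of \<open>2 * s\<close> words. In round
  \<open>length pre\<close> a machine draws values for its own \<open>s\<close> cells only, indexed
  by \<open>c mod s\<close>.\<close>

definition sim :: "nat \<Rightarrow> nat \<Rightarrow> nat \<Rightarrow> emitter list \<Rightarrow> ((nat \<Rightarrow> nat) \<Rightarrow> emitter) \<Rightarrow> emitter list \<Rightarrow> nat \<Rightarrow>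
    ((nat \<Rightarrow> nat) \<Rightarrow> verdict) \<Rightarrow> mpc" where
  "sim M s wb pre rn post D ann = \<lparr>machines = M, local_space = 2 * s, word_bits = wb,
     rounds = length pre + 1 + length post,
     local_step = (\<lambda>t i mem inbox.
       let y = (if t = 0 then load s mem else decode M inbox)
       in if t = length pre
          then map_pmf (\<lambda>w. ([], outbox s (rn (\<lambda>c. w (c mod s)) i y))) (Pi_pmf {..<s} 0 (\<lambda>_. pmf_of_set {..<D}))
          else return_pmf ([], outbox s (((pre @ rn (\<lambda>_. 0) # post) ! t) i y))),
     announce = (\<lambda>mem inbox. ann (decode M inbox))\<rparr>"

lemma outbox_total:
  assumes "\<And>c v. (c, v) \<in> set l \<Longrightarrow> c div s < M"
  shows "(\<Sum>j<M. length (outbox s l j)) = length l"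
  using assms
proof (induction l)
  case (Cons a l)
  obtain c v where a: "a = (c, v)" by (cases a)
  have "c div s < M" using Cons.prems a by auto
  have "(\<Sum>j<M. length (outbox s (a # l) j)) = (\<Sum>j<M. of_bool (c div s = j) + length (outbox s l j))"
    by (intro sum.cong refl) (auto simp: outbox_def a)
  also have "\<dots> = 1 + (\<Sum>j<M. length (outbox s l j))"
    using \<open>c div s < M\<close> by (simp add: sum.distrib of_bool_def sum.delta')
  also have "(\<Sum>j<M. length (outbox s l j)) = length l" using Cons.prems by (intro Cons.IH) auto
  finally show ?case by simp
qed (simp add: outbox_def)

text \<open>By \<open>rn_local\<close> a machine looks only at the draws for its own cells, so the
  draws of separate machines can be merged into one family over all cells.\<close>

locale simulation =
  fixes M s wb Z D :: nat and pre post :: "emitter list" and rn :: "(nat \<Rightarrow> nat) \<Rightarrow> emitter"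
    and ann :: "(nat \<Rightarrow> nat) \<Rightarrow> verdict" and x0 :: "nat \<Rightarrow> nat" and \<sigma> :: config
  assumes s0: "0 < s" and M0: "0 < M"
    and bits: "\<And>k v. k < s \<Longrightarrow> v < Z \<Longrightarrow> prod_encode (k, v) < 2 ^ wb"
    and rn_local: "\<And>\<omega> \<omega>' B y. (\<And>c. c div s = B \<Longrightarrow> \<omega> c = \<omega>' c) \<Longrightarrow> rn \<omega> B y = rn \<omega>' B y"
    and oks: "\<And>\<omega>. net_oks M s Z (pre @ rn \<omega> # post) x0"
    and \<sigma>_load: "\<And>i. i < M \<Longrightarrow> load s (fst (\<sigma> i)) = blk s x0 i"
    and \<sigma>_fits: "\<And>i. i < M \<Longrightarrow> length (fst (\<sigma> i)) \<le> 2 * s \<and> (\<forall>w\<in>set (fst (\<sigma> i)). w < 2 ^ wb)"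
    and \<sigma>_inbox: "\<And>i. snd (\<sigma> i) = (\<lambda>_. [])"
begin

abbreviation "S \<equiv> sim M s wb pre rn post D ann"
abbreviation "prog \<omega> \<equiv> pre @ rn \<omega> # post"

definition state :: "(nat \<Rightarrow> nat) \<Rightarrow> nat \<Rightarrow> nat \<Rightarrow> nat" where
  "state \<omega> t = net_run M s (take t (prog \<omega>)) x0"

abbreviation "len \<equiv> length pre + 1 + length post"

lemma state_Suc: "t < len \<Longrightarrow> state \<omega> (Suc t) = net_step M s (prog \<omega> ! t) (state \<omega> t)"
proof -
  assume "t < len"
  then have "take (Suc t) (prog \<omega>) = take t (prog \<omega>) @ [prog \<omega> ! t]"
    by (intro take_Suc_conv_app_nth) simp
  then show ?thesis unfolding state_def by (simp only: fold_append fold.simps comp_apply id_apply)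
qed

lemma step_ok: "t < len \<Longrightarrow> net_ok M s Z (prog \<omega> ! t) (state \<omega> t)"
proof -
  assume t: "t < len"
  have "prog \<omega> = take t (prog \<omega>) @ prog \<omega> ! t # drop (Suc t) (prog \<omega>)"
    using t by (intro id_take_nth_drop) simp
  then have "net_oks M s Z (take t (prog \<omega>) @ prog \<omega> ! t # drop (Suc t) (prog \<omega>)) x0"
    using oks[of \<omega>] by metis
  then show ?thesis by (simp add: net_oks_append state_def)
qed

lemma state_pre: "t \<le> length pre \<Longrightarrow> state \<omega> t = state \<omega>' t"
  by (simp add: state_def)

definition conf :: "(nat \<Rightarrow> nat) \<Rightarrow> nat \<Rightarrow> config" where
  "conf \<omega> t = (if t = 0 then \<sigma> else cfg M s (prog \<omega> ! (t - 1)) (state \<omega> (t - 1)))"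

definition "view t mem inbox = (if t = 0 then load s mem else decode M inbox)"

lemma view_conf: "t \<le> len \<Longrightarrow> i < M \<Longrightarrow> view t (fst (conf \<omega> t i)) (snd (conf \<omega> t i)) = blk s (state \<omega> t) i"
proof (cases t)
  case 0
  assume "i < M"
  then show ?thesis using 0 \<sigma>_load by (simp add: view_def conf_def state_def)
next
  case (Suc t')
  assume "t \<le> len" "i < M"
  then show ?thesis using Suc state_Suc[of t' \<omega>] decode_cfg[OF s0] by (simp add: view_def conf_def)
qed

abbreviation "\<Omega> \<equiv> Pi_pmf {..<M * s} 0 (\<lambda>_. pmf_of_set {..<D})"

lemma local_step_det:
  assumes "t < len" "t \<noteq> length pre" "i < M"
  shows "local_step S t i (fst (conf \<omega> t i)) (snd (conf \<omega> t i))
    = return_pmf ([], outbox s ((prog \<omega> ! t) i (blk s (state \<omega> t) i)))"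
proof -
  have "(pre @ rn (\<lambda>_. 0) # post) ! t = prog \<omega> ! t"
    using assms(2) by (auto simp: nth_append nth_Cons split: nat.split)
  then show ?thesis
    using assms(2) view_conf[of t i \<omega>] assms by (simp add: sim_def Let_def view_def)
qed

lemma local_step_rnd:
  assumes "i < M"
  shows "local_step S (length pre) i (fst (conf \<omega> (length pre) i)) (snd (conf \<omega> (length pre) i))
    = map_pmf (\<lambda>w. ([], outbox s (rn (\<lambda>c. w (c mod s)) i (blk s (state \<omega> (length pre)) i))))
        (Pi_pmf {..<s} 0 (\<lambda>_. pmf_of_set {..<D}))"
  using view_conf[of "length pre" i \<omega>] assms by (simp add: sim_def Let_def view_def)

lemma deliver_cfg: "deliver (\<lambda>i. if i < M then ([], outbox s (em i (blk s x i))) else ([], \<lambda>_. [])) = cfg M s em x"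
  by (auto simp: deliver_def cfg_def fun_eq_iff)

lemma round_det:
  assumes "t < len" "t \<noteq> length pre"
  shows "mpc_round S t (conf \<omega> t) = return_pmf (conf \<omega> (Suc t))"
proof -
  have "Pi_pmf {..<M} ([], \<lambda>_. []) (\<lambda>i. local_step S t i (fst (conf \<omega> t i)) (snd (conf \<omega> t i)))
      = Pi_pmf {..<M} ([], \<lambda>_. []) (\<lambda>i. return_pmf ([], outbox s ((prog \<omega> ! t) i (blk s (state \<omega> t) i))))"
    using local_step_det[OF assms] by (intro Pi_pmf_cong) auto
  moreover have "machines S = M" by (simp add: sim_def)
  ultimately show ?thesis
    by (simp add: mpc_round_def conf_def deliver_cfg)
qed

lemma round_rnd:
  "mpc_round S (length pre) (conf \<omega>0 (length pre)) = map_pmf (\<lambda>\<omega>. conf \<omega> (Suc (length pre))) \<Omega>"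
proof -
  define x where "x = state \<omega>0 (length pre)"
  have "Pi_pmf {..<M} ([], \<lambda>_. []) (\<lambda>i. local_step S (length pre) i (fst (conf \<omega>0 (length pre) i)) (snd (conf \<omega>0 (length pre) i)))
      = Pi_pmf {..<M} ([], \<lambda>_. []) (\<lambda>i. map_pmf (\<lambda>w. ([], outbox s (rn (\<lambda>c. w (c mod s)) i (blk s x i))))
        (Pi_pmf {..<s} 0 (\<lambda>_. pmf_of_set {..<D})))"
    using local_step_rnd by (intro Pi_pmf_cong) (auto simp: x_def)
  also have "\<dots> = map_pmf (\<lambda>h i. if i \<in> {..<M} then ([], outbox s (rn (\<lambda>c. h i (c mod s)) i (blk s x i))) else ([], \<lambda>_. []))
      (Pi_pmf {..<M} (\<lambda>_. 0) (\<lambda>_. Pi_pmf {..<s} 0 (\<lambda>_. pmf_of_set {..<D})))"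
    by (rule Pi_pmf_map_dep) simp
  also have "\<dots> = map_pmf (\<lambda>\<omega> i. if i < M then ([], outbox s (rn \<omega> i (blk s x i))) else ([], \<lambda>_. [])) \<Omega>"
    unfolding Pi_pmf_unflatten[symmetric] map_pmf_comp
  proof (rule map_pmf_cong[OF refl], rule ext)
    fix \<omega> i
    have "rn (\<lambda>c. if i < M \<and> c mod s < s then \<omega> (i * s + c mod s) else 0) i (blk s x i) = rn \<omega> i (blk s x i)" if "i < M"
    proof (rule rn_local)
      fix c assume "c div s = i"
      then have "i * s + c mod s = c" by (metis div_mult_mod_eq)
      then show "(if i < M \<and> c mod s < s then \<omega> (i * s + c mod s) else 0) = \<omega> c" using s0 that by simp
    qed
    then show "(if i \<in> {..<M} then ([], outbox s (rn (\<lambda>c. if i < M \<and> c mod s < s then \<omega> (i * s + c mod s) else 0) i (blk s x i))) else ([], \<lambda>_. []))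
      = (if i < M then ([], outbox s (rn \<omega> i (blk s x i))) else ([], \<lambda>_. []))" by auto
  qed
  moreover have "machines S = M" by (simp add: sim_def)
  ultimately have "mpc_round S (length pre) (conf \<omega>0 (length pre)) = map_pmf (\<lambda>\<omega>. cfg M s (rn \<omega>) x) \<Omega>"
    by (simp add: mpc_round_def map_pmf_comp deliver_cfg)
  also have "(\<lambda>\<omega>. cfg M s (rn \<omega>) x) = (\<lambda>\<omega>. conf \<omega> (Suc (length pre)))"
  proof
    fix \<omega>
    have "state \<omega> (length pre) = x" unfolding x_def by (rule state_pre) simp
    then show "cfg M s (rn \<omega>) x = conf \<omega> (Suc (length pre))" by (simp add: conf_def nth_append)
  qed
  finally show ?thesis .
qed

lemma conf_pre: "t \<le> length pre \<Longrightarrow> conf \<omega> t = conf \<omega>' t"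
  using state_pre[of "t - 1" \<omega> \<omega>'] by (auto simp: conf_def nth_append)

text \<open>A single draw \<open>\<omega>\<close> determines the whole run: configurations before
  the random round do not depend on it, and all later rounds are deterministic.\<close>

lemma run_conf: "t \<le> len \<Longrightarrow> mpc_run S t \<sigma> = map_pmf (\<lambda>\<omega>. conf \<omega> t) \<Omega>"
proof (induction t)
  case 0
  show ?case by (simp add: conf_def)
next
  case (Suc t)
  then have t: "t < len" and IH: "mpc_run S t \<sigma> = map_pmf (\<lambda>\<omega>. conf \<omega> t) \<Omega>" by auto
  show ?case
  proof (cases "t = length pre")
    case True
    have "(\<lambda>\<omega>. conf \<omega> t) = (\<lambda>\<omega>. conf (\<lambda>_. 0) t)" using conf_pre True by blast
    then have "mpc_run S (Suc t) \<sigma> = mpc_round S t (conf (\<lambda>_. 0) t)"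
      using IH by (simp add: bind_return_pmf)
    then show ?thesis using round_rnd[of "\<lambda>_. 0"] by (simp add: True)
  next
    case False
    have "mpc_run S (Suc t) \<sigma> = bind_pmf \<Omega> (\<lambda>\<omega>. mpc_round S t (conf \<omega> t))"
      using IH by (simp add: bind_map_pmf)
    also have "\<dots> = bind_pmf \<Omega> (\<lambda>\<omega>. return_pmf (conf \<omega> (Suc t)))"
      using round_det[OF t False] by simp
    finally show ?thesis by (simp only: map_pmf_def)
  qed
qed

lemma emit_bounds:
  assumes "t < len" "i < M"
  shows "length ((prog \<omega> ! t) i (blk s (state \<omega> t) i)) \<le> 2 * s"
    and "\<And>c v. (c, v) \<in> set ((prog \<omega> ! t) i (blk s (state \<omega> t) i)) \<Longrightarrow> c div s < M \<and> v < Z"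
proof -
  note ok = step_ok[OF assms(1), of \<omega>, unfolded net_ok_def]
  show "length ((prog \<omega> ! t) i (blk s (state \<omega> t) i)) \<le> 2 * s" using ok assms(2) by blast
  fix c v assume "(c, v) \<in> set ((prog \<omega> ! t) i (blk s (state \<omega> t) i))"
  then have "(c, v) \<in> set (emissions M s (prog \<omega> ! t) (state \<omega> t))"
    using assms(2) by (auto simp: emissions_def)
  then have "c < M * s" "v < Z" using ok by auto
  then show "c div s < M \<and> v < Z" by (simp add: less_mult_imp_div_less)
qed

lemma outbox_fits:
  assumes "t < len" "i < M"
  shows "mailbox_fits S (outbox s ((prog \<omega> ! t) i (blk s (state \<omega> t) i)))"
proof -
  let ?l = "(prog \<omega> ! t) i (blk s (state \<omega> t) i)"
  note b = emit_bounds[OF assms, where \<omega> = \<omega>]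
  have "(\<Sum>j<M. length (outbox s ?l j)) \<le> 2 * s" using outbox_total[of ?l s M] b by simp
  moreover have "w < 2 ^ wb" if "w \<in> set (outbox s ?l j)" for w j
    using that b(2) bits s0 by (auto simp: outbox_def)
  moreover have "outbox s ?l j = []" if "M \<le> j" for j
    using that b(2) by (fastforce simp: outbox_def filter_empty_conv)
  ultimately show ?thesis by (simp add: mailbox_fits_def sim_def)
qed

lemma inbox_fits:
  assumes "t \<le> len" "j < M"
  shows "fits S (fst (conf \<omega> t j)) \<and> mailbox_fits S (snd (conf \<omega> t j))"
proof (cases t)
  case 0
  then show ?thesis using \<sigma>_fits[OF assms(2)] \<sigma>_inbox by (simp add: conf_def fits_def mailbox_fits_def sim_def)
next
  case (Suc t')
  let ?em = "prog \<omega> ! t'" and ?x = "state \<omega> t'"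
  have t': "t' < len" using Suc assms by simp
  let ?es = "emissions M s ?em ?x"
  have dis: "distinct (map fst ?es)" using step_ok[OF t', of \<omega>] by (simp add: net_ok_def)
  have "(\<Sum>i<M. length (outbox s (?em i (blk s ?x i)) j)) = length (outbox s ?es j)"
  proof -
    have "outbox s ?es j = concat (map (\<lambda>i. outbox s (?em i (blk s ?x i)) j) [0..<M])"
      by (simp add: outbox_def emissions_def map_concat filter_concat o_def)
    then show ?thesis by (simp add: length_concat o_def interv_sum_list_conv_sum_set_nat atLeast0LessThan)
  qed
  also have "length (outbox s ?es j) = card (fst ` set (filter (\<lambda>(c, v). c div s = j) ?es))"
  proof -
    have "distinct (map fst (filter (\<lambda>(c, v). c div s = j) ?es))"
      using dis by (simp add: distinct_map_filter)
    then have "card (set (map fst (filter (\<lambda>(c, v). c div s = j) ?es))) = length (map fst (filter (\<lambda>(c, v). c div s = j) ?es))"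
      by (rule distinct_card)
    then show ?thesis by (simp add: outbox_def)
  qed
  also have "\<dots> \<le> card {j * s..<j * s + s}"
  proof (rule card_mono)
    show "fst ` set (filter (\<lambda>(c, v). c div s = j) ?es) \<subseteq> {j * s..<j * s + s}"
    proof
      fix c assume "c \<in> fst ` set (filter (\<lambda>(c, v). c div s = j) ?es)"
      then have "c div s = j" by auto
      then show "c \<in> {j * s..<j * s + s}" using div_mult_mod_eq[of c s] mod_less_divisor[OF s0, of c] by auto
    qed
  qed simp
  finally have 1: "(\<Sum>i<M. length (outbox s (?em i (blk s ?x i)) j)) \<le> 2 * s" by simp
  have 2: "w < 2 ^ wb" if "i < M" "w \<in> set (outbox s (?em i (blk s ?x i)) j)" for i w
    using that emit_bounds(2)[OF t' that(1), where \<omega> = \<omega>] bits s0 by (auto simp: outbox_def)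
  show ?thesis using 1 2 by (simp add: Suc conf_def cfg_def fits_def mailbox_fits_def sim_def)
qed


lemma sim_limits: "within_limits S \<sigma>"
  unfolding within_limits_def
proof (intro allI impI ballI conjI)
  fix t \<rho> i
  assume t: "t \<le> rounds S" and \<rho>: "\<rho> \<in> set_pmf (mpc_run S t \<sigma>)" and i: "i < machines S"
  have t': "t \<le> len" and i': "i < M" using t i by (auto simp: sim_def)
  obtain \<omega> where \<omega>: "\<rho> = conf \<omega> t" using \<rho> run_conf[OF t'] by auto
  show "fits S (fst (\<rho> i))" "mailbox_fits S (snd (\<rho> i))" using inbox_fits[OF t' i'] \<omega> by auto
  fix z assume lt: "t < rounds S" and z: "z \<in> set_pmf (local_step S t i (fst (\<rho> i)) (snd (\<rho> i)))"
  have lt': "t < len" using lt by (simp add: sim_def)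
  show "case z of (mem, ob) \<Rightarrow> mailbox_fits S ob"
  proof (cases "t = length pre")
    case False
    then show ?thesis using z local_step_det[OF lt' False i', of \<omega>] outbox_fits[OF lt' i', of \<omega>] by (simp add: \<omega>)
  next
    case True
    then obtain w where w: "z = ([], outbox s (rn (\<lambda>c. w (c mod s)) i (blk s (state \<omega> t) i)))"
      using z local_step_rnd[OF i', of \<omega>] by (auto simp: \<omega>)
    have "state \<omega> t = state (\<lambda>c. w (c mod s)) t" using state_pre True by simp
    then show ?thesis
      using outbox_fits[OF lt' i', of "\<lambda>c. w (c mod s)"] w True by (simp add: nth_append)
  qed
qed

lemma sim_output: "mpc_output S \<sigma> = map_pmf (\<lambda>\<omega>. ann (blk s (net_run M s (prog \<omega>) x0) 0)) \<Omega>"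
proof -
  have "mpc_output S \<sigma> = map_pmf (\<lambda>\<omega>. announce S (fst (conf \<omega> len 0)) (snd (conf \<omega> len 0))) \<Omega>"
    unfolding mpc_output_def using run_conf[of len] by (simp add: map_pmf_comp sim_def)
  also have "\<dots> = map_pmf (\<lambda>\<omega>. ann (blk s (net_run M s (prog \<omega>) x0) 0)) \<Omega>"
    using view_conf[of len 0] M0 by (intro map_pmf_cong refl) (simp add: sim_def view_def state_def)
  finally show ?thesis .
qed

end

section \<open>Running the algorithm on an input graph\<close>

lemma concat_pairs:
  "length (concat (map (\<lambda>(u, v). [u, v]) es)) = 2 * length es"
  "k < length es \<Longrightarrow> concat (map (\<lambda>(u, v). [u, v]) es) ! (2 * k) = fst (es ! k)"
  "k < length es \<Longrightarrow> concat (map (\<lambda>(u, v). [u, v]) es) ! (2 * k + 1) = snd (es ! k)"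
proof -
  show "length (concat (map (\<lambda>(u, v). [u, v]) es)) = 2 * length es" by (induction es) auto
  show "k < length es \<Longrightarrow> concat (map (\<lambda>(u, v). [u, v]) es) ! (2 * k) = fst (es ! k)"
    by (induction es arbitrary: k) (auto simp: nth_Cons split: nat.splits)
  show "k < length es \<Longrightarrow> concat (map (\<lambda>(u, v). [u, v]) es) ! (2 * k + 1) = snd (es ! k)"
    by (induction es arbitrary: k) (auto simp: nth_Cons split: nat.splits)
qed

lemma load_pairs:
  assumes "length es \<le> s"
  shows "load s (concat (map (\<lambda>(u, v). [u, v]) es)) k
    = (if k < length es then W 1 (fst (es ! k)) (snd (es ! k)) else 0)"
  using assms concat_pairs(1)[of es] concat_pairs(2,3)[of k es] by (auto simp: load_def)

context alg
begin

definition verdict_of :: "(nat \<Rightarrow> nat) \<Rightarrow> verdict" where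
  "verdict_of y = (if 14 * 2 ^ rho \<le> 10 * (\<Sum>r<2 ^ rho. min (y r) 10) then Reject else Accept)"

definition machine :: "nat \<Rightarrow> mpc" where
  "machine wb = sim M s wb pre homes post (2 * d) verdict_of"

lemma homes_local: "(\<And>c. c div s = B \<Longrightarrow> \<omega> c = \<omega>' c) \<Longrightarrow> homes \<omega> B y = homes \<omega>' B y"
  unfolding homes_def gather_def pull_def by (intro map_cong refl) auto

context
  fixes wb \<sigma>
  assumes bits: "\<And>k v. k < s \<Longrightarrow> v < Z \<Longrightarrow> prod_encode (k, v) < 2 ^ wb" and n_wb: "n \<le> 2 ^ wb"
    and init: "initial_config (machine wb) E \<sigma>"
begin

definition x0 :: "nat \<Rightarrow> nat" where
  "x0 c = (if c < M * s then load s (fst (\<sigma> (c div s))) (c mod s) else 0)"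

lemma M_pos: "0 < M" using NB_pos by (simp add: M_def)

text \<open>There are as many occupied cells as edges and every edge occurs, so the map from
  occupied cells to edges is injective. In this way the condition on lengths excludes that an edge
  is stored twice, in whatever orientation.\<close>

lemma init_facts:
  "inputs x0" "\<And>i. i < M \<Longrightarrow> load s (fst (\<sigma> i)) = blk s x0 i"
  "\<And>i. i < M \<Longrightarrow> length (fst (\<sigma> i)) \<le> 2 * s \<and> (\<forall>w\<in>set (fst (\<sigma> i)). w < 2 ^ wb)"
  "\<And>i. snd (\<sigma> i) = (\<lambda>_. [])"
proof -
  have mach: "machines (machine wb) = M" "local_space (machine wb) = 2 * s" by (auto simp: machine_def sim_def)
  obtain es where un: "(\<Union>i<M. (\<lambda>(u, v). {u, v}) ` set (es i)) = E"
    and tot: "(\<Sum>i<M. length (es i)) = card E"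
    and len: "\<And>i. i < M \<Longrightarrow> length (es i) \<le> s"
    and \<sigma>: "\<And>i. \<sigma> i = (if i < M then concat (map (\<lambda>(u, v). [u, v]) (es i)) else [], \<lambda>_. [])"
    using init unfolding initial_config_def mach by auto
  have edge: "{fst z, snd z} \<in> E" if "i < M" "z \<in> set (es i)" for i z
  proof -
    have "(\<lambda>(u, v). {u, v}) z \<in> E" using un that by blast
    then show ?thesis by (simp add: case_prod_unfold)
  qed
  show "snd (\<sigma> i) = (\<lambda>_. [])" for i by (simp add: \<sigma>)
  show "length (fst (\<sigma> i)) \<le> 2 * s \<and> (\<forall>w\<in>set (fst (\<sigma> i)). w < 2 ^ wb)" if i: "i < M" for i
  proof (intro conjI ballI)
    show "length (fst (\<sigma> i)) \<le> 2 * s" using len[OF i] i concat_pairs(1)[of "es i"] by (simp add: \<sigma>)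
    fix w assume "w \<in> set (fst (\<sigma> i))"
    then obtain z where "z \<in> set (es i)" "w = fst z \<or> w = snd z" using i by (auto simp: \<sigma>)
    then have "w < n" using edge[OF i] edge_bounds by blast
    then show "w < 2 ^ wb" using n_wb by simp
  qed
  have ld: "load s (fst (\<sigma> i)) k = (if k < length (es i) then W 1 (fst (es i ! k)) (snd (es i ! k)) else 0)" if "i < M" for i k
    using load_pairs[OF len[OF that]] that by (simp add: \<sigma>)
  show "load s (fst (\<sigma> i)) = blk s x0 i" if i: "i < M" for i
  proof
    fix k
    show "load s (fst (\<sigma> i)) k = blk s x0 i k"
    proof (cases "k < s")
      case True
      have "i * s + k < Suc i * s" using True by simp
      also have "\<dots> \<le> M * s" using i by (intro mult_right_mono) auto
      finally show ?thesis using True by (simp add: blk_def x0_def)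
    next
      case False
      then show ?thesis using ld[OF i, of k] len[OF i] by (simp add: blk_def)
    qed
  qed
  have x0: "x0 (i * s + k) = (if k < length (es i) then W 1 (fst (es i ! k)) (snd (es i ! k)) else 0)"
    if i: "i < M" and k: "k < s" for i k
  proof -
    have "i * s + k < Suc i * s" using k by simp
    also have "\<dots> \<le> M * s" using i by (intro mult_right_mono) auto
    finally show ?thesis using ld[OF i, of k] k by (simp add: x0_def)
  qed
  have cell: "\<exists>i k. i < M \<and> k < s \<and> c = i * s + k" if "c < T" for c
    using that s_pos div_mult_mod_eq[of c s] unfolding T_eq
    by (intro exI[of _ "c div s"] exI[of _ "c mod s"]) (auto simp: less_mult_imp_div_less)
  have form: "\<exists>u v. x0 c = W 1 u v \<and> {u, v} \<in> E" if c: "c < T" "x0 c \<noteq> 0" for c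
  proof -
    obtain i k where ik: "i < M" "k < s" "c = i * s + k" using cell[OF c(1)] by blast
    then have "k < length (es i)" using c(2) x0[OF ik(1,2)] by (auto split: if_splits)
    then show ?thesis using x0[OF ik(1,2)] ik edge[OF ik(1), of "es i ! k"] by auto
  qed
  define I where "I = {c. c < T \<and> x0 c \<noteq> 0}"
  have cI: "card I = card E"
  proof -
    have "I = (\<Union>i<M. (\<lambda>k. i * s + k) ` {..<length (es i)})"
    proof (intro equalityI subsetI)
      fix c assume "c \<in> I"
      then have c: "c < T" "x0 c \<noteq> 0" by (auto simp: I_def)
      obtain i k where ik: "i < M" "k < s" "c = i * s + k" using cell[OF c(1)] by blast
      then have "k < length (es i)" using c(2) x0[OF ik(1,2)] by (auto split: if_splits)
      then show "c \<in> (\<Union>i<M. (\<lambda>k. i * s + k) ` {..<length (es i)})" using ik by blast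
    next
      fix c assume "c \<in> (\<Union>i<M. (\<lambda>k. i * s + k) ` {..<length (es i)})"
      then obtain i k where ik: "i < M" "k < length (es i)" "c = i * s + k" by blast
      then have k: "k < s" using len[OF ik(1)] by simp
      have "i * s + k < Suc i * s" using k by simp
      also have "\<dots> \<le> M * s" using ik by (intro mult_right_mono) auto
      finally have "c < T" using ik by (simp add: T_eq)
      moreover have "x0 c = W 1 (fst (es i ! k)) (snd (es i ! k))" using x0[OF ik(1) k] ik by simp
      then have "x0 c \<noteq> 0" using W_ne_0[of 1] by (metis zero_less_one)
      ultimately show "c \<in> I" by (simp add: I_def)
    qed
    then have "card I = card (\<Union>i<M. (\<lambda>k. i * s + k) ` {..<length (es i)})" by simp
    also have "\<dots> = (\<Sum>i<M. card ((\<lambda>k. i * s + k) ` {..<length (es i)}))"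
    proof (intro card_UN_disjoint ballI impI)
      fix i j assume ij: "i \<in> {..<M}" "j \<in> {..<M}" "i \<noteq> j"
      show "(\<lambda>k. i * s + k) ` {..<length (es i)} \<inter> (\<lambda>k. j * s + k) ` {..<length (es j)} = {}"
      proof (rule equals0I)
        fix c assume "c \<in> (\<lambda>k. i * s + k) ` {..<length (es i)} \<inter> (\<lambda>k. j * s + k) ` {..<length (es j)}"
        then obtain k k' where k: "k < length (es i)" "k' < length (es j)" and c: "c = i * s + k" "c = j * s + k'" by blast
        have "length (es i) \<le> s" "length (es j) \<le> s" using len ij by auto
        then have "k < s" "k' < s" using k by linarith+
        then have "(i * s + k) div s = i" "(j * s + k') div s = j" by simp_all
        then show False using ij(3) c by metis
      qed
    qed auto
    also have "\<dots> = (\<Sum>i<M. length (es i))"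
      by (intro sum.cong refl, subst card_image) (auto simp: inj_on_def)
    finally show ?thesis using tot by simp
  qed
  define ed where "ed = (\<lambda>c. {fa (x0 c), fb (x0 c)})"
  have img: "ed ` I = E"
  proof (intro equalityI subsetI)
    fix e assume "e \<in> ed ` I"
    then obtain c where "c < T" "x0 c \<noteq> 0" "e = ed c" by (auto simp: I_def)
    then show "e \<in> E" using form[of c] by (auto simp: ed_def)
  next
    fix e assume "e \<in> E"
    then obtain i z where iz: "i < M" "z \<in> set (es i)" "e = (\<lambda>(u, v). {u, v}) z" using un by blast
    obtain k where k: "k < length (es i)" "z = es i ! k" using iz(2) by (metis in_set_conv_nth)
    have ks: "k < s" using k len[OF iz(1)] by simp
    have "i * s + k < Suc i * s" using ks by simp
    also have "\<dots> \<le> M * s" using iz by (intro mult_right_mono) auto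
    finally have "i * s + k < T" by (simp add: T_eq)
    moreover have x: "x0 (i * s + k) = W 1 (fst z) (snd z)" using x0[OF iz(1) ks] k by simp
    then have "x0 (i * s + k) \<noteq> 0" using W_ne_0[of 1] by (metis zero_less_one)
    moreover have "ed (i * s + k) = e" using x iz(3) by (simp add: ed_def case_prod_unfold)
    ultimately show "e \<in> ed ` I" unfolding I_def by blast
  qed
  have finI: "finite I" by (simp add: I_def)
  have inj: "inj_on ed I" using img cI finI by (intro eq_card_imp_inj_on) auto
  have one: "card {c. c < T \<and> (x0 c = W 1 u v \<or> x0 c = W 1 v u)} = 1" if uvE: "{u, v} \<in> E" for u v
  proof -
    have "{u, v} \<in> ed ` I" using img uvE by simp
    then obtain c0 where c0: "c0 \<in> I" "ed c0 = {u, v}" by (elim imageE) simp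
    have "{c. c < T \<and> (x0 c = W 1 u v \<or> x0 c = W 1 v u)} = {c0}"
    proof (intro equalityI subsetI)
      fix c assume "c \<in> {c. c < T \<and> (x0 c = W 1 u v \<or> x0 c = W 1 v u)}"
      then have c: "c < T" "x0 c = W 1 u v \<or> x0 c = W 1 v u" by auto
      then have "x0 c \<noteq> 0" using W_ne_0[of 1] by (metis zero_less_one)
      then have "c \<in> I" using c by (simp add: I_def)
      moreover have "ed c = {u, v}" using c(2) by (elim disjE) (simp_all add: ed_def doubleton_eq_iff)
      then have "ed c = ed c0" using c0(2) by simp
      ultimately have "c = c0" using inj_onD[OF inj, of c c0] c0(1) by blast
      then show "c \<in> {c0}" by simp
    next
      fix c assume "c \<in> {c0}"
      then have c: "c < T" "x0 c \<noteq> 0" "ed c = {u, v}" using c0 by (auto simp: I_def)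
      then obtain u' v' where "x0 c = W 1 u' v'" using form by blast
      then show "c \<in> {c. c < T \<and> (x0 c = W 1 u v \<or> x0 c = W 1 v u)}" using c by (auto simp: ed_def doubleton_eq_iff)
    qed
    then show ?thesis by simp
  qed
  have "x0 c < Y0" for c
  proof (cases "c < T \<and> x0 c \<noteq> 0")
    case True
    then show ?thesis using form[of c] W_edge_less[of _ _ 1] by auto
  next
    case False
    then have "x0 c = 0" by (auto simp: x0_def T_eq)
    then show ?thesis using N_less by simp
  qed
  then show "inputs x0" unfolding inputs_def using cI form one by (simp add: I_def)
qed

lemma simulation: "simulation M s wb Z pre post homes x0 \<sigma>"
proof
  show "net_oks M s Z (pre @ homes \<omega> # post) x0" for \<omega>
    using safe_prog[of \<omega>] init_facts(1) by (simp add: safe_def inputs_def)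
  show "homes \<omega> B y = homes \<omega>' B y" if "\<And>c. c div s = B \<Longrightarrow> \<omega> c = \<omega>' c" for \<omega> \<omega>' B y
    using that by (rule homes_local)
qed (use s_pos M_pos bits init_facts(2-4) in blast)+

lemma machine_limits: "within_limits (machine wb) \<sigma>"
proof -
  interpret simulation M s wb Z "2 * d" pre post homes verdict_of x0 \<sigma> by (rule simulation)
  show ?thesis unfolding machine_def by (rule sim_limits)
qed

lemma machine_output:
  "\<exists>z. mpc_output (machine wb) \<sigma> = map_pmf (\<lambda>\<phi>. verdict_of (\<lambda>r. fixpoints (\<phi> r)))
     (Pi_pmf {..<2 ^ rho} z (\<lambda>_. flow_pmf (2 ^ lam)))"
proof -
  interpret simulation M s wb Z "2 * d" pre post homes verdict_of x0 \<sigma> by (rule simulation)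
  let ?\<Omega> = "Pi_pmf {..<T} 0 (\<lambda>_. ports)"
  obtain z where z: "map_pmf (\<lambda>\<omega> r. if r < 2 ^ rho then cmp \<omega> lam (r * 2 ^ lam) else z) ?\<Omega>
     = Pi_pmf {..<2 ^ rho} z (\<lambda>_. flow_pmf (2 ^ lam))"
    using cmp_law by blast
  have "mpc_output (machine wb) \<sigma> = map_pmf (\<lambda>\<omega>. verdict_of (blk s (run (pre @ homes \<omega> # post) x0) 0)) ?\<Omega>"
    unfolding machine_def using sim_output by (simp add: T_eq)
  also have "\<dots> = map_pmf (\<lambda>\<omega>. verdict_of (\<lambda>r. fixpoints (if r < 2 ^ rho then cmp \<omega> lam (r * 2 ^ lam) else z))) ?\<Omega>"
  proof (rule map_pmf_cong[OF refl])
    fix \<omega> assume "\<omega> \<in> set_pmf ?\<Omega>"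
    then have "\<omega> \<in> PiE_dflt {..<T} 0 (\<lambda>_. {..<2 * d})"
      using d_pos by (simp add: set_Pi_pmf o_def set_pmf_of_set lessThan_empty_iff)
    then have \<omega>: "\<omega> c < 2 * d" for c using d_pos by (cases "c < T") (auto simp: PiE_dflt_def)
    have "(\<Sum>r<2 ^ rho. min (blk s (run (pre @ homes \<omega> # post) x0) 0 r) 10)
        = (\<Sum>r<2 ^ rho. min (fixpoints (if r < 2 ^ rho then cmp \<omega> lam (r * 2 ^ lam) else z)) 10)"
    proof (rule sum.cong[OF refl])
      fix r :: nat assume r: "r \<in> {..<2 ^ rho}"
      have "r < s" using r rho by simp
      then have "blk s (run (pre @ homes \<omega> # post) x0) 0 r = run (pre @ homes \<omega> # post) x0 r" by (simp add: blk_def)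
      also have "\<dots> = fixpoints (cmp \<omega> lam (r * 2 ^ lam))"
        using prog_run[where x = x0 and \<omega> = \<omega> and r = r, OF init_facts(1) \<omega>] r by simp
      finally show "min (blk s (run (pre @ homes \<omega> # post) x0) 0 r) 10
        = min (fixpoints (if r < 2 ^ rho then cmp \<omega> lam (r * 2 ^ lam) else z)) 10" using r by simp
    qed
    then show "verdict_of (blk s (run (pre @ homes \<omega> # post) x0) 0)
        = verdict_of (\<lambda>r. fixpoints (if r < 2 ^ rho then cmp \<omega> lam (r * 2 ^ lam) else z))"
      by (simp only: verdict_of_def)
  qed
  also have "\<dots> = map_pmf (\<lambda>\<phi>. verdict_of (\<lambda>r. fixpoints (\<phi> r))) (Pi_pmf {..<2 ^ rho} z (\<lambda>_. flow_pmf (2 ^ lam)))"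
    unfolding z[symmetric] map_pmf_comp ..
  finally show ?thesis by blast
qed

lemma machine_accept:
  assumes "(\<Sum>v<n. pw (2 ^ lam) v v) \<le> 11 / 10"
  shows "pmf (mpc_output (machine wb) \<sigma>) Accept \<ge> 1 - exp (- (2 ^ rho) / 600)"
proof -
  obtain z where z: "mpc_output (machine wb) \<sigma> = map_pmf (\<lambda>\<phi>. verdict_of (\<lambda>r. fixpoints (\<phi> r)))
     (Pi_pmf {..<2 ^ rho} z (\<lambda>_. flow_pmf (2 ^ lam)))"
    using machine_output by blast
  let ?p = "Pi_pmf {..<(2::nat) ^ rho} z (\<lambda>_. flow_pmf (2 ^ lam))"
  let ?R = "{\<phi>. 14 * 2 ^ rho \<le> 10 * (\<Sum>r<2 ^ rho. min (fixpoints (\<phi> r)) 10)}"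
  have "pmf (mpc_output (machine wb) \<sigma>) Accept = measure_pmf.prob ?p (- ?R)"
    unfolding z pmf_map by (intro arg_cong[where f = "measure_pmf.prob _"]) (auto simp: verdict_of_def)
  also have "\<dots> = 1 - measure_pmf.prob ?p ?R"
    using measure_pmf.prob_compl[of ?R ?p] by (simp add: Compl_eq_Diff_UNIV)
  finally show ?thesis
    using reject_rare[of "2 ^ rho" "2 ^ lam" z] assms by simp
qed

lemma machine_reject:
  assumes "(\<Sum>v<n. pw (2 ^ lam) v v) \<ge> 19 / 10"
  shows "pmf (mpc_output (machine wb) \<sigma>) Reject \<ge> 1 - exp (- (2 ^ rho) / 600)"
proof -
  obtain z where z: "mpc_output (machine wb) \<sigma> = map_pmf (\<lambda>\<phi>. verdict_of (\<lambda>r. fixpoints (\<phi> r)))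
     (Pi_pmf {..<2 ^ rho} z (\<lambda>_. flow_pmf (2 ^ lam)))"
    using machine_output by blast
  let ?p = "Pi_pmf {..<(2::nat) ^ rho} z (\<lambda>_. flow_pmf (2 ^ lam))"
  let ?R = "{\<phi>. \<not> 14 * 2 ^ rho \<le> 10 * (\<Sum>r<2 ^ rho. min (fixpoints (\<phi> r)) 10)}"
  have "pmf (mpc_output (machine wb) \<sigma>) Reject = measure_pmf.prob ?p (- ?R)"
    unfolding z pmf_map by (intro arg_cong[where f = "measure_pmf.prob _"]) (auto simp: verdict_of_def)
  also have "\<dots> = 1 - measure_pmf.prob ?p ?R"
    using measure_pmf.prob_compl[of ?R ?p] by (simp add: Compl_eq_Diff_UNIV)
  finally show ?thesis
    using accept_rare[of "2 ^ rho" "2 ^ lam" z] assms by simp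
qed

end

section \<open>Number of rounds\<close>

lemma length_scan: "length (scan f g h) = q + 2"
  by (simp add: scan_def)

lemma length_sort_by: "length (sort_by key w) = w * (q + 5)"
proof -
  have "length (pass key j) = q + 5" for j by (simp add: pass_def length_scan)
  then show ?thesis by (simp add: sort_by_def length_concat o_def sum_list_triv)
qed

lemma length_join: "length (join out) = 2 * (wd * (q + 5)) + q + 2"
  by (simp add: join_def length_sort_by length_scan)

text \<open>\<open>H\<close> covers a sort with \<open>wd\<close> digits together with a scan.
  Collecting the edges takes \<open>a\<close> sorts by a single digit, each within \<open>H\<close>;
  a doubling is a \<open>join\<close> within \<open>2 * H\<close>; the remaining routines add up to
  \<open>5 * H\<close>.\<close>

lemma machine_rounds: "rounds (machine wb) \<le> (3 * a + 5) * ((wd + 1) * (q + 6))"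
proof -
  define H where "H = (wd + 1) * (q + 6)"
  have H: "wd * (q + 5) \<le> H" "q + 6 \<le> H" "wd * (q + 5) + (q + 6) \<le> H"
    by (simp_all add: H_def algebra_simps)
  have J: "length (join out) + 1 \<le> 2 * H" for out using H unfolding length_join by linarith
  have "length (allreduce a) = a * (q + 6)"
    by (simp add: allreduce_def length_concat o_def length_sort_by sum_list_triv)
  moreover have "length to_arcs = q + 6" by (simp add: to_arcs_def length_sort_by)
  ultimately have pre: "length pre \<le> a * H + H" using H(2) by (simp add: pre_def mult_le_mono2 add_mono)
  have "length (concat (map compose [0..<lam])) = lam * (length (join out2) + 1)"
    by (simp add: compose_def length_concat o_def sum_list_triv)
  also have "\<dots> \<le> a * (2 * H)" using J a_eq by (intro mult_le_mono) auto
  finally have comp: "length (concat (map compose [0..<lam])) \<le> 2 * (a * H)" by simp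
  have "length sample = wd * (q + 5) + (length (join out1) + 1)" by (simp add: sample_def length_sort_by)
  then have "length sample \<le> H + 2 * H" using H(1) J[of out1] by linarith
  moreover have "length counting + 1 \<le> H" using H(2) by (simp add: counting_def length_scan)
  ultimately have "length post + 1 \<le> 2 * (a * H) + 4 * H" using comp by (simp add: post_def)
  moreover have "rounds (machine wb) = length pre + 1 + length post" by (simp add: machine_def sim_def)
  ultimately have "rounds (machine wb) \<le> 3 * (a * H) + 5 * H" using pre by linarith
  then show ?thesis by (simp add: H_def algebra_simps)
qed

end

section \<open>Choice of the parameters\<close>

text \<open>The code of \<open>(u, v)\<close> is below the square of \<open>u + v + 1\<close>:
  pairing doubles the number of bits and adds two.\<close>

lemma prod_encode_less_pow2:
  assumes "u < 2 ^ j" "v < 2 ^ j" "2 * j + 2 \<le> i"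
  shows "prod_encode (u, v) < 2 ^ i"
proof -
  define z where "z = (2::nat) ^ j"
  have uv: "u + 1 \<le> z" "v + 1 \<le> z" using assms by (auto simp: z_def)
  have "prod_encode (u, v) \<le> (u + v) * Suc (u + v) + u"
    by (simp add: prod_encode_def triangle_def)
  also have "\<dots> < Suc (u + v) * Suc (u + v)" by simp
  also have "\<dots> \<le> (2 * z) * (2 * z)" using uv by (intro mult_le_mono) auto
  also have "\<dots> = 2 ^ (2 * j + 2)" by (simp add: z_def power_add power_mult power2_eq_square algebra_simps)
  also have "\<dots> \<le> 2 ^ i" using assms(3) by (intro power_increasing) auto
  finally show ?thesis .
qed

lemma prod_encode3_less_pow2:
  assumes "u < 2 ^ j" "v < 2 ^ j" "w < 2 ^ j" "4 * j + 6 \<le> i"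
  shows "prod_encode (u, prod_encode (v, w)) < 2 ^ i"
proof (rule prod_encode_less_pow2)
  show "u < 2 ^ (2 * j + 2)"
    by (rule less_le_trans[OF assms(1)]) (intro power_increasing, auto)
  show "prod_encode (v, w) < 2 ^ (2 * j + 2)" by (rule prod_encode_less_pow2[OF assms(2,3)]) simp
qed (use assms(4) in simp)

lemma pow2_ceiling_log:
  fixes x :: real
  assumes "1 \<le> x"
  shows "x \<le> 2 ^ nat \<lceil>log 2 x\<rceil>" "2 ^ nat \<lceil>log 2 x\<rceil> \<le> 2 * x" "real (nat \<lceil>log 2 x\<rceil>) \<le> log 2 x + 1"
proof -
  define j where "j = nat \<lceil>log 2 x\<rceil>"
  have nn: "0 \<le> log 2 x" using assms by simp
  have lo: "log 2 x \<le> real j" unfolding j_def by linarith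
  show hi: "real (nat \<lceil>log 2 x\<rceil>) \<le> log 2 x + 1" using nn by linarith
  have "x = 2 powr log 2 x" using assms by simp
  also have "\<dots> \<le> 2 powr real j" using lo by simp
  finally show "x \<le> 2 ^ nat \<lceil>log 2 x\<rceil>" by (simp add: powr_realpow j_def)
  have "(2::real) ^ j = 2 powr real j" by (simp add: powr_realpow)
  also have "\<dots> \<le> 2 powr (log 2 x + 1)" using hi by (simp add: j_def)
  also have "\<dots> = 2 * x" using assms by (simp add: powr_add)
  finally show "2 ^ nat \<lceil>log 2 x\<rceil> \<le> 2 * x" by (simp add: j_def)
qed

section \<open>Elementary facts on graphs and vertex expanders\<close>

lemma ugraph_finite_edges: "ugraph V E \<Longrightarrow> finite E"
  using finite_subset[of E "Pow V"] by (auto simp: ugraph_def)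

lemma card_neighbours_le_max_degree:
  assumes "ugraph V E" "u \<in> V"
  shows "card {v. {u, v} \<in> E} \<le> max_degree V E"
proof -
  have "card {v. {u, v} \<in> E} \<le> card {e \<in> E. u \<in> e}"
    using ugraph_finite_edges[OF assms(1)]
    by (intro card_inj_on_le[of "\<lambda>v. {u, v}"]) (auto simp: inj_on_def doubleton_eq_iff)
  also have "\<dots> \<le> max_degree V E"
    unfolding max_degree_def using assms by (intro Max_ge) (auto simp: ugraph_def)
  finally show ?thesis .
qed

lemma max_degree_le_card_edges:
  assumes "ugraph V E" "V \<noteq> {}"
  shows "max_degree V E \<le> card E"
proof -
  have "card {e \<in> E. v \<in> e} \<le> card E" for v
    using ugraph_finite_edges[OF assms(1)] by (intro card_mono) auto
  then show ?thesis
    unfolding max_degree_def using assms by (intro Max.boundedI) (auto simp: ugraph_def)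
qed

lemma max_degree_pos:
  assumes "ugraph V E" "E \<noteq> {}"
  shows "0 < max_degree V E"
proof -
  obtain e where e: "e \<in> E" using assms by blast
  then obtain u v where "e = {u, v}" using assms(1) by (metis ugraph_def card_2_iff)
  then have u: "u \<in> e" "u \<in> V" using assms(1) e by (auto simp: ugraph_def)
  have "0 < card {e \<in> E. u \<in> e}"
    using e u ugraph_finite_edges[OF assms(1)] by (auto simp: card_gt_0_iff)
  also have "\<dots> \<le> max_degree V E"
    unfolding max_degree_def using assms u by (intro Max_ge) (auto simp: ugraph_def)
  finally show ?thesis .
qed

lemma card_edges_le_square:
  fixes n :: nat
  assumes "ugraph {..<n} E"
  shows "card E \<le> n * n"
proof -
  have "E \<subseteq> (\<lambda>(u, v). {u, v}) ` ({..<n} \<times> {..<n})"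
  proof
    fix e assume e: "e \<in> E"
    then obtain u v where "e = {u, v}" using assms by (metis ugraph_def card_2_iff)
    moreover from this have "u < n" "v < n" using e assms by (auto simp: ugraph_def)
    ultimately show "e \<in> (\<lambda>(u, v). {u, v}) ` ({..<n} \<times> {..<n})" by (intro image_eqI[of _ _ "(u, v)"]) auto
  qed
  then have "card E \<le> card ((\<lambda>(u, v). {u, v}) ` ({..<n} \<times> {..<n}))" by (intro card_mono) auto
  also have "\<dots> \<le> card ({..<n} \<times> {..<n})" by (intro card_image_le) auto
  finally show ?thesis by simp
qed

lemma vertices_ge2:
  fixes n :: nat
  assumes "ugraph {..<n} E" "E \<noteq> {}"
  shows "2 \<le> n"
proof -
  obtain e where "e \<in> E" using assms by blast
  then have "e \<subseteq> {..<n}" "card e = 2" using assms by (auto simp: ugraph_def)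
  then show ?thesis using card_mono[of "{..<n}" e] by simp
qed

lemma vertex_expander_neighbours:
  fixes n :: nat
  assumes "vertex_expander {..<n} E \<alpha>" "2 \<le> n" "u < n"
  shows "\<alpha> \<le> card (nbhd E {u} ({..<n} - {u}))"
proof -
  have "{u} \<subseteq> {..<n}" "real (card {u}) \<le> real (card {..<n}) / 2" using assms by auto
  then have "\<alpha> * real (card {u}) \<le> card (nbhd E {u} ({..<n} - {u}))"
    using assms(1) unfolding vertex_expander_def by blast
  then show ?thesis by simp
qed

lemma vertex_expander_le_degree:
  fixes n :: nat
  assumes "ugraph {..<n} E" "2 \<le> n" "vertex_expander {..<n} E \<alpha>"
  shows "\<alpha> \<le> max_degree {..<n} E"
proof -
  have sub: "{v. {0, v} \<in> E} \<subseteq> {..<n}" using assms(1) by (auto simp: ugraph_def)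
  have "card (nbhd E {0} ({..<n} - {0})) \<le> card {v. {0, v} \<in> E}"
    by (intro card_mono finite_subset[OF sub]) (auto simp: nbhd_def)
  also have "\<dots> \<le> max_degree {..<n} E"
    using assms by (intro card_neighbours_le_max_degree) auto
  finally show ?thesis using vertex_expander_neighbours[OF assms(3,2), of 0] assms(2) by simp
qed

text \<open>Singletons are small enough to expand, so every vertex has a neighbour, and an edge
  covers only two vertices.\<close>

lemma vertex_expander_card_edges:
  fixes n :: nat
  assumes "ugraph {..<n} E" "2 \<le> n" "vertex_expander {..<n} E \<alpha>" "0 < \<alpha>"
  shows "n \<le> 2 * card E"
proof -
  note fin = ugraph_finite_edges[OF assms(1)]
  have "u \<in> \<Union>E" if "u < n" for u
  proof -
    have "0 < card (nbhd E {u} ({..<n} - {u}))"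
      using vertex_expander_neighbours[OF assms(3,2) that] assms(4) by simp
    then have "nbhd E {u} ({..<n} - {u}) \<noteq> {}" by (auto simp: card_gt_0_iff)
    then obtain v where "{u, v} \<in> E" by (auto simp: nbhd_def)
    then show ?thesis by blast
  qed
  moreover have "finite (\<Union>E)" using assms(1) finite_subset[of "\<Union>E" "{..<n}"] by (auto simp: ugraph_def)
  ultimately have "card {..<n} \<le> card (\<Union>E)" by (intro card_mono) auto
  also have "\<dots> \<le> (\<Sum>e\<in>E. card e)" using card_Union_le_sum_card by blast
  also have "\<dots> = (\<Sum>e\<in>E. 2)" using assms(1) by (intro sum.cong) (auto simp: ugraph_def)
  finally show ?thesis by simp
qed

text \<open>Otherwise the graph itself would be an expander at distance zero.\<close>

lemma far_not_expander:
  assumes "ugraph V E" "far_from_expanders V E \<epsilon> \<beta>" "0 \<le> \<epsilon>"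
  shows "\<not> vertex_expander V E \<beta>"
proof
  assume "vertex_expander V E \<beta>"
  then have "real (card ((E - E) \<union> (E - E))) > \<epsilon> * real (max_degree V E) * real (card V)"
    using assms unfolding far_from_expanders_def by blast
  then show False using assms(3) by (simp add: not_less mult_nonneg_nonneg flip: not_le)
qed

text \<open>For graphs that cannot be expanders: as many machines as edges, each with room for one
  edge.\<close>

definition always_reject :: "nat \<Rightarrow> nat \<Rightarrow> mpc" where
  "always_reject n m = \<lparr>machines = m, local_space = 2, word_bits = nat \<lceil>log 2 (real n)\<rceil>, rounds = 0,
     local_step = (\<lambda>_ _ _ _. return_pmf ([], \<lambda>_. [])), announce = (\<lambda>_ _. Reject)\<rparr>"

lemma always_reject_output: "pmf (mpc_output (always_reject n m) \<sigma>) Reject = 1"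
  by (simp add: mpc_output_def always_reject_def)

lemma always_reject_limits:
  assumes "ugraph {..<n} E" "1 \<le> n" "initial_config (always_reject n m) E \<sigma>"
  shows "within_limits (always_reject n m) \<sigma>"
proof -
  let ?P = "always_reject n m"
  obtain es where un: "(\<Union>i<m. (\<lambda>(u, v). {u, v}) ` set (es i)) = E"
    and len: "\<And>i. i < m \<Longrightarrow> 2 * length (es i) \<le> 2"
    and \<sigma>: "\<And>i. \<sigma> i = (if i < m then concat (map (\<lambda>(u, v). [u, v]) (es i)) else [], \<lambda>_. [])"
    using assms(3) unfolding initial_config_def by (auto simp: always_reject_def)
  have "fits ?P (fst (\<sigma> i))" if i: "i < m" for i
    unfolding fits_def
  proof (intro conjI ballI)
    show "length (fst (\<sigma> i)) \<le> local_space ?P"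
      using len[OF i] concat_pairs(1)[of "es i"] i by (simp add: \<sigma> always_reject_def)
    fix w assume "w \<in> set (fst (\<sigma> i))"
    then obtain z where z: "z \<in> set (es i)" "w = fst z \<or> w = snd z" using i by (auto simp: \<sigma>)
    have "(\<lambda>(u, v). {u, v}) z \<in> E" using un z i by blast
    then have "w < n" using assms(1) z(2) by (auto simp: ugraph_def case_prod_unfold)
    moreover have "real n \<le> 2 ^ nat \<lceil>log 2 (real n)\<rceil>" using assms(2) by (intro pow2_ceiling_log) simp
    ultimately have "real w < 2 ^ nat \<lceil>log 2 (real n)\<rceil>" by simp
    then show "w < 2 ^ word_bits ?P" by (simp add: always_reject_def flip: of_nat_less_iff)
  qed
  then show ?thesis by (auto simp: within_limits_def always_reject_def mailbox_fits_def \<sigma>)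
qed

text \<open>Copies are indexed by repetition and step, hence by \<open>lam + rho\<close> bits.
  Sorting by \<open>3 * q\<close> digits admits keys up to the cube of \<open>s ^ q\<close>, which
  exceeds all keys in use.\<close>

definition tester :: "nat \<Rightarrow> nat \<Rightarrow> nat \<Rightarrow> nat \<Rightarrow> nat \<Rightarrow> nat \<Rightarrow> mpc" where
  "tester s q lam rho n d = (let b = nat \<lceil>log 2 (real (s ^ q))\<rceil> in
     alg.machine s q (lam + rho) (2 ^ (8 * b + 14)) n (2 * s ^ q) (n * n) (3 * q) d lam rho (128 * b + 254))"

locale test_instance =
  fixes s q lam rho n d :: nat and E :: "nat set set"
  assumes graph: "ugraph {..<n} E" and nonempty: "E \<noteq> {}" and d_eq: "d = max_degree {..<n} E"
    and dense: "n \<le> 2 * card E" and q: "0 < q" and even_s: "even s"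
    and room: "12 * card E \<le> s ^ q" and reps: "2 ^ rho \<le> s"
begin

definition b where "b = nat \<lceil>log 2 (real (s ^ q))\<rceil>"

text \<open>The exponents follow the nesting of codes: a tagged word is a triple of numbers with
  \<open>2 * b + 2\<close> bits, \<open>cap1\<close> is for pairs of such words, \<open>cap2\<close>
  for triples of those, and \<open>bits\<close> for a message, the pair of a cell offset and such a
  triple.\<close>

definition "cap0 = (2::nat) ^ (8 * b + 14)"
definition "cap1 = (2::nat) ^ (16 * b + 30)"
definition "cap2 = (2::nat) ^ (64 * b + 126)"
definition "bits = 128 * b + 254"

lemma card_pos: "1 \<le> card E"
  using nonempty ugraph_finite_edges[OF graph] by (simp add: Suc_le_eq card_gt_0_iff)

lemma s_le: "s \<le> s ^ q"
  using q by (cases "s = 0") (auto intro!: self_le_power)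

lemma N_le: "s ^ q \<le> 2 ^ b"
proof -
  have "1 \<le> real (s ^ q)" using room card_pos by (simp flip: of_nat_power)
  then have "real (s ^ q) \<le> 2 ^ b" unfolding b_def by (rule pow2_ceiling_log)
  also have "\<dots> = real (2 ^ b)" by simp
  finally show ?thesis unfolding of_nat_le_iff .
qed

lemma instance_alg:
  "alg s q (lam + rho) cap0 cap1 cap2 n (2 * s ^ q) (n * n) (3 * q) d E lam rho"
proof -
  define Nq where "Nq = s ^ q"
  have N12: "12 \<le> Nq" "12 * card E \<le> Nq" using room card_pos by (auto simp: Nq_def)
  have Nb: "Nq \<le> 2 ^ b" using N_le by (simp add: Nq_def)
  have s2: "2 \<le> s" using even_s N12 q by (cases "s = 0") (auto simp: Nq_def zero_power elim!: evenE)
  have d: "0 < d" "d \<le> card E"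
    using max_degree_pos[OF graph nonempty] max_degree_le_card_edges[OF graph] vertices_ge2[OF graph nonempty]
    by (auto simp: d_eq lessThan_empty_iff)
  have n: "2 \<le> n" using vertices_ge2[OF graph nonempty] .
  have wd: "s ^ (3 * q) = Nq * Nq * Nq"
    by (simp add: Nq_def power_mult[symmetric] mult.commute[of 3] power_mult power3_eq_cube)
  have NN: "12 * Nq \<le> Nq * Nq" "12 * (Nq * Nq) \<le> Nq * Nq * Nq" using N12 by auto
  have n1: "n + 1 \<le> Nq" using dense N12 by linarith
  have "Nq < cap0"
    unfolding cap0_def by (rule le_less_trans[OF Nb]) (intro power_strict_increasing, auto)
  moreover have "2 * Nq * (n * n) < cap0"
  proof -
    have "2 * Nq * (n * n) \<le> 2 * 2 ^ b * (2 ^ b * 2 ^ b)" using Nb n1 by (intro mult_le_mono) auto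
    also have "\<dots> = 2 ^ (b + b + b + 1)" by (simp only: power_add power_one_right mult_ac)
    also have "\<dots> < cap0" unfolding cap0_def by (intro power_strict_increasing) auto
    finally show ?thesis .
  qed
  moreover have "(n + 1) * (n + 1) < Nq * Nq * Nq"
  proof -
    have "(n + 1) * (n + 1) \<le> Nq * Nq" using n1 by (intro mult_le_mono)
    also have "\<dots> < Nq * Nq * Nq" using NN N12 by linarith
    finally show ?thesis .
  qed
  moreover have "W t u v < cap0" if tuv: "t \<le> 3" "u < 2 * Nq" "v < Nq * Nq" for t u v
  proof -
    have "t < 2 ^ 2" using tuv by simp
    also have "(2::nat) ^ 2 \<le> 2 ^ (2 * b + 2)" by (intro power_increasing) auto
    finally have t: "t < 2 ^ (2 * b + 2)" .
    have "2 * Nq \<le> 2 ^ (b + 1)" using Nb by simp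
    also have "\<dots> \<le> 2 ^ (2 * b + 2)" by (intro power_increasing) auto
    finally have u: "u < 2 ^ (2 * b + 2)" using tuv by simp
    have "Nq * Nq \<le> 2 ^ b * 2 ^ b" using Nb by (intro mult_le_mono)
    also have "\<dots> = 2 ^ (b + b)" by (simp add: power_add)
    also have "\<dots> \<le> 2 ^ (2 * b + 2)" by (intro power_increasing) auto
    finally have v: "v < 2 ^ (2 * b + 2)" using tuv by simp
    show ?thesis unfolding W_def cap0_def by (rule prod_encode3_less_pow2[OF t u v]) simp
  qed
  moreover have "prod_encode (u, v) < cap1" if "u < cap0" "v < cap0" for u v
    unfolding cap1_def by (rule prod_encode_less_pow2[OF that[unfolded cap0_def]]) simp
  moreover have "prod_encode (u, prod_encode (v, w)) < cap2" if "u < cap1" "v < cap1" "w < cap1" for u v w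
    unfolding cap2_def by (rule prod_encode3_less_pow2[OF that[unfolded cap1_def]]) simp
  ultimately have facts: "net s q cap0 cap1 cap2"
      "2 * Nq * (n * n) < cap0" "(n + 1) * (n + 1) < Nq * Nq * Nq"
      "\<And>t u v. t \<le> 3 \<Longrightarrow> u < 2 * Nq \<Longrightarrow> v < Nq * Nq \<Longrightarrow> W t u v < cap0"
    using s2 q unfolding Nq_def by (auto intro!: net.intro)
  interpret net s q "lam + rho" cap0 cap1 cap2
    by (rule facts(1))
  have eqs: "s ^ q = Nq" "N = Nq" by (simp_all add: Nq_def N_def)
  show ?thesis
  proof (intro alg.intro net_join.intro lazy_walk.intro net_join_axioms.intro alg_axioms.intro)
    show "net s q cap0 cap1 cap2" by (rule facts(1))
    show "0 < 3 * q" using q by simp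
    show "2 * (2 * s ^ q) < s ^ (3 * q)" "n < s ^ (3 * q)" unfolding wd eqs using NN N12 n1 by linarith+
    show "2 * s ^ q * (n * n) < cap0" unfolding eqs by (rule facts(2))
    show "n \<le> N" "2 * n \<le> N" "n < N" "2 * card E + n \<le> N" "2 * d \<le> N"
      unfolding eqs using n1 dense N12 d by linarith+
    show "card {v. {u, v} \<in> E} \<le> d" if "u < n" for u
      using card_neighbours_le_max_degree[OF graph, of u] that by (simp add: d_eq)
    show "ugraph {..<n} E" "0 < d" "even s" "2 ^ rho \<le> s" "0 < n" using graph d even_s reps n by simp_all
    show "2 * s ^ q = 2 * N" unfolding eqs ..
    show "(n + 1) * (n + 1) < s ^ (3 * q)" unfolding wd by (rule facts(3))
    show "W t u v < cap0" if "t \<le> 3" "u < 2 * N" "v < N * N" for t u v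
      using that facts(4) unfolding eqs by blast
  qed (rule refl)+
qed

abbreviation "test \<equiv> tester s q lam rho n d"

lemma tester_eq:
  "test = alg.machine s q (lam + rho) cap0 n (2 * s ^ q) (n * n) (3 * q) d lam rho bits"
  unfolding tester_def b_def cap0_def bits_def Let_def ..

lemma tester_sizes:
  "machines test = 2 ^ (lam + rho) * s ^ (q - 1)" "local_space test = 2 * s" "word_bits test = bits"
  "total_space test = 2 * 2 ^ (lam + rho) * s ^ q"
proof -
  note net = instance_alg[THEN alg.axioms(1), THEN net_join.axioms(1)]
  show *: "machines test = 2 ^ (lam + rho) * s ^ (q - 1)" "local_space test = 2 * s" "word_bits test = bits"
    unfolding tester_eq alg.machine_def[OF instance_alg] net.M_def[OF net] net.NB_def[OF net]
    by (simp_all add: sim_def)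
  show "total_space test = 2 * 2 ^ (lam + rho) * s ^ q"
    using q unfolding total_space_def * by (cases q) auto
qed

lemma encode_bits: "k < s \<Longrightarrow> v < cap2 \<Longrightarrow> prod_encode (k, v) < 2 ^ bits"
proof -
  assume k: "k < s" and v: "v < cap2"
  have "k < 2 ^ b" using k s_le N_le by linarith
  also have "\<dots> \<le> 2 ^ (64 * b + 126)" by (intro power_increasing) auto
  finally show ?thesis
    by (rule prod_encode_less_pow2[OF _ v[unfolded cap2_def]]) (simp add: bits_def)
qed

lemma n_bits: "n \<le> 2 ^ bits"
proof -
  have "n \<le> 2 ^ b" using dense room N_le by linarith
  also have "\<dots> \<le> 2 ^ bits" unfolding bits_def by (intro power_increasing) auto
  finally show ?thesis .
qed

lemma
  assumes init: "initial_config test E \<sigma>"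
  shows tester_limits: "within_limits test \<sigma>"
    and tester_accept: "(\<Sum>v<n. kernel.pw n (lazy_walk.P n d E) (2 ^ lam) v v) \<le> 11 / 10
      \<Longrightarrow> pmf (mpc_output test \<sigma>) Accept \<ge> 1 - exp (- (2 ^ rho) / 600)"
    and tester_reject: "(\<Sum>v<n. kernel.pw n (lazy_walk.P n d E) (2 ^ lam) v v) \<ge> 19 / 10
      \<Longrightarrow> pmf (mpc_output test \<sigma>) Reject \<ge> 1 - exp (- (2 ^ rho) / 600)"
proof -
  note init' = init[unfolded tester_eq]
  show "within_limits test \<sigma>"
    unfolding tester_eq by (rule alg.machine_limits[OF instance_alg _ n_bits init']) (rule encode_bits)
  show "pmf (mpc_output test \<sigma>) Accept \<ge> 1 - exp (- (2 ^ rho) / 600)"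
    if tr: "(\<Sum>v<n. kernel.pw n (lazy_walk.P n d E) (2 ^ lam) v v) \<le> 11 / 10"
    unfolding tester_eq by (rule alg.machine_accept[OF instance_alg _ n_bits init' tr]) (rule encode_bits)
  show "pmf (mpc_output test \<sigma>) Reject \<ge> 1 - exp (- (2 ^ rho) / 600)"
    if tr: "(\<Sum>v<n. kernel.pw n (lazy_walk.P n d E) (2 ^ lam) v v) \<ge> 19 / 10"
    unfolding tester_eq by (rule alg.machine_reject[OF instance_alg _ n_bits init' tr]) (rule encode_bits)
qed

lemmas tester_rounds = alg.machine_rounds[OF instance_alg, of bits, folded tester_eq]

end

section \<open>Walk length, number of repetitions and block size\<close>

definition walk_length :: "nat \<Rightarrow> nat \<Rightarrow> real \<Rightarrow> real \<Rightarrow> real" where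
  "walk_length n d \<alpha> \<epsilon> = 32 * (real d)\<^sup>2 * ln (real n / \<epsilon>) / \<alpha>\<^sup>2"

text \<open>Rounding up to a power of two gives a walk length between \<open>4 * l\<close> and
  \<open>8 * l\<close>. The lower end serves the spectral bound, the upper end limits the escape
  from a set that does not expand.\<close>

definition doublings :: "real \<Rightarrow> nat" where "doublings l = nat \<lceil>log 2 (4 * l)\<rceil>"

text \<open>With \<open>R \<ge> 600 * k * ln n\<close> repetitions the error
  \<open>exp (- R / 600)\<close> is at most \<open>1 / n ^ k\<close>; the \<open>max\<close> keeps
  the logarithm nonnegative.\<close>

definition log_reps :: "nat \<Rightarrow> nat \<Rightarrow> nat" where
  "log_reps k n = nat \<lceil>log 2 (max 1 (600 * real k * ln (real n)))\<rceil>"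

text \<open>The summand \<open>6\<close>, doubled in \<open>block_size\<close>, gives
  \<open>12 * m \<le> s ^ q\<close>; the other summand makes room in one machine for the results of
  all repetitions. The factor \<open>2\<close> in \<open>block_size\<close> makes \<open>s\<close>
  even, so that a copy can be halved.\<close>

definition block_factor :: "nat \<Rightarrow> nat \<Rightarrow> real" where "block_factor k q = 6 + 2400 * real k * real q"

definition block_size :: "nat \<Rightarrow> nat \<Rightarrow> nat \<Rightarrow> nat" where
  "block_size k q m = 2 * nat \<lceil>block_factor k q * real m powr (1 / real q)\<rceil>"

text \<open>\<open>ln y \<le> y - 1\<close> at the \<open>q\<close>-th root \<open>y\<close> of
  \<open>m\<close>. It bounds the logarithmic number of repetitions by the block size.\<close>

lemma ln_le_root:
  assumes "2 \<le> n" "n \<le> 2 * m" "0 < q"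
  shows "ln (real n) \<le> 2 * real q * real m powr (1 / real q)"
proof -
  let ?y = "real m powr (1 / real q)"
  have m: "1 \<le> m" using assms by linarith
  have y: "1 \<le> ?y" using m by (simp add: ge_one_powr_ge_zero)
  have "ln (real m) = real q * ln ?y" using assms(3) m by (simp add: ln_powr)
  also have "\<dots> \<le> real q * (?y - 1)" using y by (intro mult_left_mono ln_le_minus_one) linarith+
  finally have lnm: "ln (real m) \<le> real q * (?y - 1)" .
  have "ln (real n) \<le> ln (2 * real m)" using assms m by (subst ln_le_cancel_iff) auto
  also have "\<dots> = ln 2 + ln (real m)" using m by (simp add: ln_mult)
  also have "\<dots> \<le> 1 + real q * (?y - 1)" using lnm ln_2_less_1 by linarith
  also have "\<dots> \<le> real q * ?y + real q * ?y" using assms(3) mult_mono[of 1 "real q" 1 ?y] y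
    by (simp add: algebra_simps)
  finally show ?thesis by simp
qed

lemma log_reps_bounds:
  "600 * real k * ln (real n) \<le> 2 ^ log_reps k n"
  "(2::real) ^ log_reps k n \<le> 2 * max 1 (600 * real k * ln (real n))"
  "real (log_reps k n) \<le> log 2 (max 1 (600 * real k * ln (real n))) + 1"
  using pow2_ceiling_log[of "max 1 (600 * real k * ln (real n))"] by (auto simp: log_reps_def)

lemma block_size_bounds:
  assumes "2 \<le> n" "n \<le> 2 * m" "0 < q"
  shows "even (block_size k q m)" "12 * m \<le> block_size k q m ^ q" "2 ^ log_reps k n \<le> block_size k q m"
    "real (block_size k q m) \<le> 4 * block_factor k q * real m powr (1 / real q)"
    "real (block_size k q m ^ q) \<le> (4 * block_factor k q) ^ q * real m"
proof -
  let ?s = "block_size k q m" and ?c = "block_factor k q"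
  define y where "y = real m powr (1 / real q)"
  have m: "1 \<le> m" using assms by linarith
  have y: "1 \<le> y" using m by (simp add: ge_one_powr_ge_zero y_def)
  have yq: "y ^ q = real m" using m assms(3) y by (simp add: y_def powr_powr flip: powr_realpow)
  have c: "6 \<le> ?c" by (simp add: block_factor_def)
  have cy: "6 \<le> ?c * y" using mult_mono[of 6 ?c 1 y] c y by simp
  show "even ?s" by (simp add: block_size_def)
  have ge: "2 * (?c * y) \<le> real ?s" unfolding block_size_def y_def by simp linarith
  have le: "real ?s \<le> 4 * ?c * y" proof -
    have "real_of_int \<lceil>?c * y\<rceil> \<le> 2 * (?c * y)" using cy by linarith
    moreover have "0 \<le> \<lceil>?c * y\<rceil>" using cy by linarith
    ultimately show ?thesis unfolding block_size_def y_def[symmetric] by (simp add: mult.commute)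
  qed
  then show "real ?s \<le> 4 * ?c * real m powr (1 / real q)" by (simp add: y_def)
  have "real (?s ^ q) = real ?s ^ q" by simp
  also have "\<dots> \<le> (4 * ?c * y) ^ q" using le by (intro power_mono) auto
  finally show "real (?s ^ q) \<le> (4 * ?c) ^ q * real m" by (simp add: power_mult_distrib yq)
  have "12 * y \<le> 2 * (?c * y)" using c y by simp
  then have "12 * y \<le> real ?s" using ge by linarith
  then have "(12 * y) ^ q \<le> real ?s ^ q" using y by (intro power_mono) auto
  moreover have "12 * real m \<le> (12 * y) ^ q"
    using self_le_power[of "12::real" q] assms(3) by (simp add: power_mult_distrib yq mult_right_mono)
  ultimately have "real (12 * m) \<le> real (?s ^ q)" by simp
  then show "12 * m \<le> ?s ^ q" unfolding of_nat_le_iff .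
  have "(2::real) ^ log_reps k n \<le> 2 * max 1 (600 * real k * ln (real n))" by (rule log_reps_bounds)
  also have "\<dots> \<le> 2 + 1200 * real k * ln (real n)" using assms(1) by (simp add: max_def)
  also have "\<dots> \<le> 2 * y + 1200 * real k * (2 * real q * y)"
    using y ln_le_root[OF assms] by (intro add_mono mult_left_mono) (auto simp: y_def)
  also have "\<dots> \<le> ?c * y" using y by (simp add: block_factor_def algebra_simps)
  also have "\<dots> \<le> real ?s" using ge cy by linarith
  finally have "real (2 ^ log_reps k n) \<le> real ?s" by simp
  then show "2 ^ log_reps k n \<le> ?s" unfolding of_nat_le_iff .
qed

text \<open>\<open>\<epsilon> \<le> 1\<close> gives \<open>ln n \<le> ln (n / \<epsilon>)\<close>,
  and \<open>\<alpha> \<le> d\<close> makes the remaining factor of \<open>l\<close> at least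
  \<open>32\<close>. The number \<open>21\<close> comes from \<open>32 * (2 / 3)\<close>, as
  \<open>ln 2 \<ge> 2 / 3\<close>.\<close>

lemma walk_length_bounds:
  assumes "2 \<le> n" "0 < \<alpha>" "\<alpha> \<le> real d" "0 < \<epsilon>" "\<epsilon> \<le> 1"
  defines "l \<equiv> walk_length n d \<alpha> \<epsilon>"
  shows "ln (real n) \<le> ln (real n / \<epsilon>)" "32 * ln (real n) \<le> l" "21 \<le> l" "1 \<le> ln l"
    "4 * l \<le> 2 ^ doublings l" "(2::real) ^ doublings l \<le> 8 * l" "real (doublings l) \<le> log 2 (4 * l) + 1"
    "\<exists>t. doublings l = Suc t"
proof -
  show le: "ln (real n) \<le> ln (real n / \<epsilon>)"
    using assms by (subst ln_le_cancel_iff) (auto simp: field_simps mult_le_cancel_left1)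
  have "ln 2 \<le> ln (real n)" using assms by simp
  then have n: "2 / 3 \<le> ln (real n)" using ln2_ge_two_thirds by linarith
  have "1 \<le> (real d / \<alpha>)\<^sup>2" using assms by (simp add: one_le_power)
  then have "32 * ln (real n) * 1 \<le> 32 * ln (real n / \<epsilon>) * (real d / \<alpha>)\<^sup>2"
    using le n by (intro mult_mono) auto
  also have "\<dots> = l" by (simp add: l_def walk_length_def power_divide)
  finally show l: "32 * ln (real n) \<le> l" by simp
  then show l21: "21 \<le> l" using n by linarith
  have "exp 1 \<le> l" using exp_le l21 by linarith
  then show "1 \<le> ln l" using l21 by (simp add: ln_ge_iff)
  have "1 \<le> 4 * l" using l21 by linarith
  note p = pow2_ceiling_log[OF this]
  show g: "4 * l \<le> 2 ^ doublings l" "(2::real) ^ doublings l \<le> 8 * l" "real (doublings l) \<le> log 2 (4 * l) + 1"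
    using p by (simp_all add: doublings_def)
  show "\<exists>t. doublings l = Suc t" using g(1) l21 by (cases "doublings l") auto
qed

lemma trace_accept:
  assumes "ugraph {..<n} E" "E \<noteq> {}" "d = max_degree {..<n} E" "vertex_expander {..<n} E \<alpha>"
    "0 < \<alpha>" "\<alpha> \<le> real d" "0 < \<epsilon>" "\<epsilon> \<le> 1"
  shows "(\<Sum>v<n. kernel.pw n (lazy_walk.P n d E) (2 ^ doublings (walk_length n d \<alpha> \<epsilon>)) v v) \<le> 11 / 10"
proof -
  define l where "l = walk_length n d \<alpha> \<epsilon>"
  have n: "2 \<le> n" using vertices_ge2[OF assms(1,2)] .
  note wl = walk_length_bounds[OF n assms(5-8), folded l_def]
  interpret expander_walk n d E \<alpha>
    using assms max_degree_pos[OF assms(1,2)] card_neighbours_le_max_degree[OF assms(1)]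
    by unfold_locales auto
  obtain i where i: "doublings l = Suc i" using wl(8) by blast
  define t where "t = (2::nat) ^ i"
  have t: "2 ^ doublings l = 2 * t" by (simp add: i t_def)
  define \<gamma> where "\<gamma> = \<alpha>\<^sup>2 / (4 * (real d)\<^sup>2)"
  have d: "0 < real d" using assms by linarith
  have \<gamma>: "0 < \<gamma>" "\<gamma> \<le> 1"
  proof -
    show "0 < \<gamma>" using assms d by (simp add: \<gamma>_def)
    have "\<alpha>\<^sup>2 \<le> (real d)\<^sup>2" using assms by (intro power_mono) auto
    moreover have "0 \<le> (real d)\<^sup>2" by simp
    ultimately show "\<gamma> \<le> 1" using d unfolding \<gamma>_def by (subst divide_le_eq_1_pos) (simp, linarith)
  qed
  have "4 * l \<le> 2 * real t" using wl(5) by (simp add: i t_def)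
  then have "2 * l * \<gamma> \<le> real t * \<gamma>" using \<gamma> by (intro mult_right_mono) auto
  \<comment> \<open>With \<open>t\<close> half of the walk length, this makes the excess of the
    trace over one at most \<open>n\<close> to the power \<open>-15\<close>.\<close>
  moreover have "2 * l * \<gamma> = 16 * ln (real n / \<epsilon>)"
    using assms d by (simp add: l_def walk_length_def \<gamma>_def field_simps)
  ultimately have tg: "16 * ln (real n) \<le> real t * \<gamma>" using wl(1) by linarith
  have "(1 - \<gamma>) ^ t \<le> exp (- \<gamma>) ^ t"
    using \<gamma> exp_ge_add_one_self[of "- \<gamma>"] by (intro power_mono) auto
  also have "\<dots> = exp (- (real t * \<gamma>))" by (simp flip: exp_of_nat_mult)
  also have "\<dots> \<le> exp (- 16 * ln (real n))" using tg by simp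
  finally have "real n * (1 - \<gamma>) ^ t \<le> exp (ln (real n)) * exp (- 16 * ln (real n))"
    using n by (intro mult_mono) (use \<gamma> in auto)
  also have "\<dots> = exp (- (15 * ln (real n)))" by (simp flip: exp_add)
  also have "\<dots> \<le> exp (- 10)"
  proof -
    have "ln 2 \<le> ln (real n)" using n by simp
    then show ?thesis using ln2_ge_two_thirds by simp
  qed
  also have "\<dots> \<le> 1 / 10" using exp_ge_add_one_self[of "10::real"] by (simp add: exp_minus field_simps)
  finally have "real n * (1 - \<gamma>) ^ t \<le> 1 / 10" .
  then show ?thesis
    using trace_expander[of t] assms(6) n unfolding l_def[symmetric] t \<gamma>_def by linarith
qed

text \<open>Half of the walk length is at most \<open>4 * l\<close>, and in
  \<open>4 * l * \<beta>\<close> everything cancels but \<open>128 / 4000\<close>. The constant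
  \<open>1 / 4000\<close> is small enough that \<open>2 * (1 - 64 / 4000)^2\<close> still exceeds
  \<open>19 / 10\<close>.\<close>

lemma trace_reject:
  assumes "ugraph {..<n} E" "E \<noteq> {}" "d = max_degree {..<n} E"
    "0 < \<alpha>" "\<alpha> \<le> real d" "0 < \<epsilon>" "\<epsilon> \<le> 1"
    "\<not> vertex_expander {..<n} E (1 / 4000 * \<alpha>\<^sup>2 / ((real d)\<^sup>2 * ln (real n / \<epsilon>)))"
  shows "(\<Sum>v<n. kernel.pw n (lazy_walk.P n d E) (2 ^ doublings (walk_length n d \<alpha> \<epsilon>)) v v) \<ge> 19 / 10"
proof -
  define l where "l = walk_length n d \<alpha> \<epsilon>"
  define \<beta> where "\<beta> = 1 / 4000 * \<alpha>\<^sup>2 / ((real d)\<^sup>2 * ln (real n / \<epsilon>))"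
  have n: "2 \<le> n" using vertices_ge2[OF assms(1,2)] .
  note wl = walk_length_bounds[OF n assms(4-7), folded l_def]
  interpret lazy_walk n d E
    using assms max_degree_pos[OF assms(1,2)] card_neighbours_le_max_degree[OF assms(1)]
    by unfold_locales auto
  obtain i where i: "doublings l = Suc i" using wl(8) by blast
  define t where "t = (2::nat) ^ i"
  have t: "2 ^ doublings l = 2 * t" by (simp add: i t_def)
  have d: "0 < real d" using assms by linarith
  have "0 < ln (real n)" using n by simp
  then have L: "0 < ln (real n / \<epsilon>)" using wl(1) by linarith
  then have \<beta>: "0 \<le> \<beta>" by (simp add: \<beta>_def)
  have "2 * real t \<le> 8 * l" using wl(6) by (simp add: i t_def)
  then have "real t * \<beta> \<le> 4 * l * \<beta>" using \<beta> by (intro mult_right_mono) auto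
  also have "\<dots> = 128 / 4000"
    using assms d L by (simp add: l_def walk_length_def \<beta>_def field_simps)
  finally have tb: "real t * \<beta> \<le> 128 / 4000" .
  have "19 / 10 \<le> 2 * (1 - (64 / 4000 :: real))\<^sup>2" by (simp add: power2_eq_square)
  also have "\<dots> \<le> 2 * (1 - real t * (\<beta> / 2))\<^sup>2" using tb by (intro mult_left_mono power_mono) auto
  also have "\<dots> \<le> (\<Sum>u<n. pw (2 * t) u u)"
    using tb assms(8)[folded \<beta>_def] \<beta> by (intro trace_nonexpander) simp_all
  finally show ?thesis unfolding l_def[symmetric] t .
qed

lemma test_instance_block:
  assumes "ugraph {..<n} E" "E \<noteq> {}" "n \<le> 2 * card E" "0 < q"
  shows "test_instance (block_size k q (card E)) q (log_reps k n) n (max_degree {..<n} E) E"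
  using block_size_bounds(1-3)[OF vertices_ge2[OF assms(1,2)] assms(3,4)]
  by (intro test_instance.intro[OF assms(1,2) refl assms(3,4)])

lemma log_reps_error:
  assumes "2 \<le> n"
  shows "exp (- (2 ^ log_reps k n) / 600) \<le> 1 / real n ^ k"
proof -
  have "exp (- (2 ^ log_reps k n) / 600) \<le> exp (- (real k * ln (real n)))"
    using log_reps_bounds(1)[of k n] by simp
  also have "\<dots> = 1 / real n ^ k" using assms by (simp add: exp_minus exp_of_nat_mult divide_inverse)
  finally show ?thesis .
qed

section \<open>Guarantees of the tester outside the degenerate cases\<close>

context
  fixes n k q :: nat and E :: "nat set set" and \<alpha> \<epsilon> :: real
  assumes gr: "ugraph {..<n} E" "E \<noteq> {}" and edges: "n \<le> 2 * card E" and q0: "0 < q"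
    and \<alpha>: "0 < \<alpha>" "\<alpha> \<le> real (max_degree {..<n} E)" and \<epsilon>: "0 < \<epsilon>" "\<epsilon> \<le> 1"
begin

private definition "m = card E"
private definition "d = max_degree {..<n} E"
private definition "l = walk_length n d \<alpha> \<epsilon>"
private definition "s = block_size k q m"

interpretation test_instance s q "doublings l" "log_reps k n" n d E
  unfolding s_def m_def d_def using test_instance_block[OF gr edges q0] .

private lemmas n2 = vertices_ge2[OF gr]
private lemmas wl = walk_length_bounds[OF n2 \<alpha>(1) \<alpha>(2)[folded d_def] \<epsilon>, folded l_def]
private lemmas bs = block_size_bounds[OF n2 edges q0, of k, folded m_def, folded s_def]

lemma test_can_store: "can_store test m"
proof -
  have "m \<le> s ^ q" using bs(2) by simp
  also have "\<dots> \<le> 2 ^ (doublings l + log_reps k n) * s ^ q" by simp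
  also have "\<dots> = machines test * (local_space test div 2)"
    using q unfolding tester_sizes by (cases q) auto
  finally show ?thesis unfolding can_store_def .
qed

text \<open>A graph has at most \<open>n * n\<close> edges, so the \<open>q\<close>-th root of
  \<open>m\<close> is at most \<open>n powr \<delta>\<close> as soon as
  \<open>q \<ge> 2 / \<delta>\<close>.\<close>

lemma test_local_space:
  assumes "2 / \<delta> \<le> real q" "0 < \<delta>"
  shows "real (local_space test) \<le> 8 * block_factor k q * real n powr \<delta>"
proof -
  have m: "1 \<le> m" using card_pos by (simp add: m_def)
  have "real m \<le> real (n * n)" using card_edges_le_square[OF gr(1)] unfolding of_nat_le_iff m_def .
  also have "\<dots> = real n powr 2" using n2 by (simp add: powr_numeral power2_eq_square)
  finally have "real m powr (1 / real q) \<le> (real n powr 2) powr (1 / real q)"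
    by (intro powr_mono2) auto
  also have "\<dots> = real n powr (2 / real q)" unfolding powr_powr by simp
  also have "\<dots> \<le> real n powr \<delta>" using n2 q assms by (intro powr_mono) (auto simp: field_simps)
  finally have "4 * block_factor k q * real m powr (1 / real q) \<le> 4 * block_factor k q * real n powr \<delta>"
    by (intro mult_left_mono) (auto simp: block_factor_def)
  then have "real s \<le> 4 * block_factor k q * real n powr \<delta>" using bs(4) by linarith
  then show ?thesis by (simp add: tester_sizes)
qed

lemma test_total_space:
  "real (total_space test) \<le> 16 * (4 + 1200 * real k) * (4 * block_factor k q) ^ q * real m * max 1 l * ln (real n)"
proof -
  have "ln 2 \<le> ln (real n)" using n2 by simp
  then have n: "2 / 3 \<le> ln (real n)" using ln2_ge_two_thirds by linarith
  have "max 1 (600 * real k * ln (real n)) \<le> 1 + 600 * real k * ln (real n)" using n by simp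
  then have "(2::real) ^ log_reps k n \<le> 2 + 1200 * real k * ln (real n)"
    using log_reps_bounds(2)[of k n] by linarith
  also have "\<dots> \<le> (4 + 1200 * real k) * ln (real n)" using n by (simp add: algebra_simps)
  finally have R: "(2::real) ^ log_reps k n \<le> (4 + 1200 * real k) * ln (real n)" .
  have "real (total_space test) = 2 * ((2 ^ doublings l * 2 ^ log_reps k n) * real (s ^ q))"
    unfolding tester_sizes by (simp add: power_add)
  also have "\<dots> \<le> 2 * ((8 * l * ((4 + 1200 * real k) * ln (real n))) * ((4 * block_factor k q) ^ q * real m))"
    using wl R bs(5) n by (intro mult_left_mono mult_mono) auto
  also have "\<dots> = 16 * (4 + 1200 * real k) * (4 * block_factor k q) ^ q * real m * max 1 l * ln (real n)"
    using wl(3) by (simp add: max_def)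
  finally show ?thesis .
qed

text \<open>\<open>128 * b + 254\<close> with \<open>b \<le> log 2 x + 1\<close> and
  \<open>1 \<le> log 2 x\<close> is at most \<open>510 * log 2 x\<close>.\<close>

lemma test_word_bits: "real (word_bits test) \<le> 510 / ln 2 * ln (real n + real (total_space test))"
proof -
  define x where "x = real (s ^ q)"
  have N: "2 \<le> s ^ q" using bs(2) card_pos by (simp add: m_def)
  have x: "2 \<le> x" using of_nat_mono[OF N, where 'a = real] by (simp add: x_def)
  then have "1 \<le> x" by linarith
  then have b: "real b \<le> log 2 x + 1" unfolding b_def x_def by (rule pow2_ceiling_log(3))
  have lg: "1 \<le> log 2 x" using x by (subst le_log_iff) auto
  have "real (word_bits test) \<le> 510 * log 2 x"
    unfolding tester_sizes bits_def using b lg by simp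
  also have "\<dots> = 510 / ln 2 * ln x" by (simp add: log_def)
  also have "\<dots> \<le> 510 / ln 2 * ln (real n + real (total_space test))"
  proof -
    have "s ^ q \<le> total_space test" unfolding tester_sizes by simp
    then have "x \<le> real n + real (total_space test)" unfolding x_def by linarith
    then show ?thesis using x by (intro mult_left_mono) auto
  qed
  finally show ?thesis .
qed

text \<open>The number of phases includes the logarithm of the number of repetitions. As
  \<open>32 * ln n \<le> l\<close>, there are \<open>O(l)\<close> repetitions for fixed
  \<open>k\<close>, and this logarithm is of order \<open>ln l\<close> as well.\<close>

lemma test_rounds:
  "real (rounds test) \<le> (3 * (2 / ln 2 + 4 + log 2 (20 * (real k + 1))) + 5) * ((3 * real q + 1) * (real q + 6)) * max 1 (ln l)"
proof -
  define g where "g = log 2 (20 * (real k + 1))"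
  have "1 \<le> 20 * (real k + 1)" by simp
  then have g: "0 \<le> g" unfolding g_def by (subst zero_le_log_cancel_iff) auto
  have "600 * real k * ln (real n) \<le> 600 * real k * (l / 32)" using wl(2) by (intro mult_left_mono) auto
  also have "\<dots> \<le> 20 * (real k + 1) * l" using wl(3) by (simp add: algebra_simps)
  finally have "max 1 (600 * real k * ln (real n)) \<le> 20 * (real k + 1) * l"
    using wl(3) by (simp add: algebra_simps) (smt (verit) mult_nonneg_nonneg of_nat_0_le_iff)
  then have "log 2 (max 1 (600 * real k * ln (real n))) \<le> log 2 (20 * (real k + 1) * l)"
    by (subst log_le_cancel_iff) auto
  also have "\<dots> = g + log 2 l" unfolding g_def using wl(3) by (subst log_mult) auto
  finally have rho: "real (log_reps k n) \<le> g + log 2 l + 1" using log_reps_bounds(3)[of k n] by linarith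
  have "log 2 (4 * l) = log 2 (2 ^ 2) + log 2 l" using wl(3) by (subst log_mult) auto
  also have "log 2 (2 ^ 2) = (2::real)" by (subst log_nat_power) auto
  finally have lam: "real (doublings l) \<le> 3 + log 2 l" using wl(7) by linarith
  have "real (doublings l + log_reps k n) \<le> 2 * log 2 l + 4 + g" using rho lam by simp
  also have "\<dots> = 2 / ln 2 * ln l + (4 + g)" by (simp add: log_def)
  also have "\<dots> \<le> 2 / ln 2 * ln l + (4 + g) * ln l" using g wl(4) by simp
  finally have A: "real (doublings l + log_reps k n) \<le> (2 / ln 2 + 4 + g) * ln l" by (simp add: algebra_simps)
  have "real (rounds test) \<le> real ((3 * (doublings l + log_reps k n) + 5) * ((3 * q + 1) * (q + 6)))"
    unfolding of_nat_le_iff by (rule tester_rounds)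
  also have "\<dots> = (3 * real (doublings l + log_reps k n) + 5) * ((3 * real q + 1) * (real q + 6))"
    by (simp only: of_nat_mult of_nat_add of_nat_numeral of_nat_1)
  also have "\<dots> \<le> ((3 * (2 / ln 2 + 4 + g) + 5) * ln l) * ((3 * real q + 1) * (real q + 6))"
  proof (intro mult_right_mono)
    have "5 \<le> 5 * ln l" using wl(4) by simp
    then show "3 * real (doublings l + log_reps k n) + 5 \<le> (3 * (2 / ln 2 + 4 + g) + 5) * ln l"
      using A by (simp add: algebra_simps)
  qed simp
  also have "\<dots> = (3 * (2 / ln 2 + 4 + g) + 5) * ((3 * real q + 1) * (real q + 6)) * max 1 (ln l)"
    using wl(4) by (simp add: max_def)
  finally show ?thesis by (simp add: g_def)
qed

lemma test_correct:
  assumes "initial_config test E \<sigma>"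
  shows "within_limits test \<sigma>"
    "vertex_expander {..<n} E \<alpha> \<Longrightarrow> pmf (mpc_output test \<sigma>) Accept \<ge> 1 - 1 / real n ^ k"
    "far_from_expanders {..<n} E \<epsilon> (1 / 4000 * \<alpha>\<^sup>2 / ((real d)\<^sup>2 * ln (real n / \<epsilon>)))
      \<Longrightarrow> pmf (mpc_output test \<sigma>) Reject \<ge> 1 - 1 / real n ^ k"
proof -
  show "within_limits test \<sigma>" using assms by (rule tester_limits)
  show "pmf (mpc_output test \<sigma>) Accept \<ge> 1 - 1 / real n ^ k" if "vertex_expander {..<n} E \<alpha>"
    using tester_accept[OF assms trace_accept[OF gr d_def that \<alpha>(1) \<alpha>(2)[folded d_def] \<epsilon>, folded l_def]]
      log_reps_error[OF n2, of k] by simp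
  show "pmf (mpc_output test \<sigma>) Reject \<ge> 1 - 1 / real n ^ k"
    if "far_from_expanders {..<n} E \<epsilon> (1 / 4000 * \<alpha>\<^sup>2 / ((real d)\<^sup>2 * ln (real n / \<epsilon>)))"
    using tester_reject[OF assms trace_reject[OF gr d_def \<alpha>(1) \<alpha>(2)[folded d_def] \<epsilon>
        far_not_expander[OF gr(1) that], folded l_def]] \<epsilon>(1)
      log_reps_error[OF n2, of k] by simp
qed

lemmas test_guarantees = test_can_store test_local_space test_total_space test_word_bits test_rounds test_correct
lemmas tester_guarantees = test_guarantees[unfolded l_def, unfolded s_def, unfolded m_def d_def]

end

theorem theorem8p3:
  shows "\<exists>c::real. c > 0 \<and>
    (\<forall>(\<delta>::real) (k::nat). 0 < \<delta> \<and> \<delta> < 1 \<longrightarrow>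
      (\<exists>(C::real) (A :: nat \<Rightarrow> nat \<Rightarrow> nat \<Rightarrow> real \<Rightarrow> real \<Rightarrow> mpc). C > 0 \<and>
        (\<forall>(n::nat) (E :: nat set set) (\<alpha>::real) (\<epsilon>::real).
          ugraph {..<n} E \<and> E \<noteq> {} \<and> 0 < \<alpha> \<and> 0 < \<epsilon> \<and> \<epsilon> \<le> 1 \<longrightarrow>
          (let m = card E;
               d = max_degree {..<n} E;
               l = 32 * (real d)\<^sup>2 * ln (real n / \<epsilon>) / \<alpha>\<^sup>2;
               \<alpha>' = c * \<alpha>\<^sup>2 / ((real d)\<^sup>2 * ln (real n / \<epsilon>));
               P = A n m d \<alpha> \<epsilon>
           in can_store P m \<and>
              (\<forall>\<sigma>. initial_config P E \<sigma> \<longrightarrow>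
                 within_limits P \<sigma> \<and>
                 (vertex_expander {..<n} E \<alpha> \<longrightarrow>
                    pmf (mpc_output P \<sigma>) Accept \<ge> 1 - 1 / real n ^ k) \<and>
                 (far_from_expanders {..<n} E \<epsilon> \<alpha>' \<longrightarrow>
                    pmf (mpc_output P \<sigma>) Reject \<ge> 1 - 1 / real n ^ k)) \<and>
              real (rounds P) \<le> C * max 1 (ln l) \<and>
              real (local_space P) \<le> C * real n powr \<delta> \<and>
              real (total_space P) \<le> C * real m * max 1 l * ln (real n) \<and>
              real (word_bits P) \<le> C * ln (real n + real (total_space P))))))"
proof (rule exI[of _ "1 / 4000"], intro conjI allI impI)
  show "0 < (1 / 4000 :: real)" by simp
  fix \<delta> :: real and k :: nat
  assume \<delta>: "0 < \<delta> \<and> \<delta> < 1"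
  define q where "q = nat \<lceil>2 / \<delta>\<rceil>"
  have "0 < 2 / \<delta>" using \<delta> by simp
  then have q: "2 / \<delta> \<le> real q" "0 < q" unfolding q_def by linarith+
  define Cr where "Cr = (3 * (2 / ln 2 + 4 + log 2 (20 * (real k + 1))) + 5) * ((3 * real q + 1) * (real q + 6))"
  define Cs where "Cs = 8 * block_factor k q"
  define Ct where "Ct = 16 * (4 + 1200 * real k) * (4 * block_factor k q) ^ q"
  have "0 \<le> log 2 (20 * (real k + 1))" by (subst zero_le_log_cancel_iff) auto
  then have "0 \<le> Cr" unfolding Cr_def by (intro mult_nonneg_nonneg add_nonneg_nonneg) auto
  moreover have "0 \<le> Cs" "0 \<le> Ct" by (auto simp: Cs_def Ct_def block_factor_def)
  \<comment> \<open>This yields \<open>3 \<le> C\<close> for the rejecting machine: with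
    \<open>ln n \<ge> 2 / 3\<close>, a factor of \<open>3\<close> covers its total space
    \<open>2 * m\<close>.\<close>
  moreover have "(510::real) \<le> 510 / ln 2" using ln_2_less_1 by (simp add: field_simps)
  moreover define C where "C = Cr + Cs + Ct + 510 / ln 2"
  ultimately have C: "Cr \<le> C" "Cs \<le> C" "Ct \<le> C" "510 / ln 2 \<le> C" "3 \<le> C" by auto
  define A where "A = (\<lambda>n m d \<alpha> \<epsilon>. if real d < \<alpha> \<or> 2 * m < n then always_reject n m
    else tester (block_size k q m) q (doublings (walk_length n d \<alpha> \<epsilon>)) (log_reps k n) n d)"
  show "\<exists>(C::real) (A :: nat \<Rightarrow> nat \<Rightarrow> nat \<Rightarrow> real \<Rightarrow> real \<Rightarrow> mpc). C > 0 \<and>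
        (\<forall>(n::nat) (E :: nat set set) (\<alpha>::real) (\<epsilon>::real).
          ugraph {..<n} E \<and> E \<noteq> {} \<and> 0 < \<alpha> \<and> 0 < \<epsilon> \<and> \<epsilon> \<le> 1 \<longrightarrow>
          (let m = card E;
               d = max_degree {..<n} E;
               l = 32 * (real d)\<^sup>2 * ln (real n / \<epsilon>) / \<alpha>\<^sup>2;
               \<alpha>' = 1 / 4000 * \<alpha>\<^sup>2 / ((real d)\<^sup>2 * ln (real n / \<epsilon>));
               P = A n m d \<alpha> \<epsilon>
           in can_store P m \<and>
              (\<forall>\<sigma>. initial_config P E \<sigma> \<longrightarrow>
                 within_limits P \<sigma> \<and>
                 (vertex_expander {..<n} E \<alpha> \<longrightarrow>
                    pmf (mpc_output P \<sigma>) Accept \<ge> 1 - 1 / real n ^ k) \<and>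
                 (far_from_expanders {..<n} E \<epsilon> \<alpha>' \<longrightarrow>
                    pmf (mpc_output P \<sigma>) Reject \<ge> 1 - 1 / real n ^ k)) \<and>
              real (rounds P) \<le> C * max 1 (ln l) \<and>
              real (local_space P) \<le> C * real n powr \<delta> \<and>
              real (total_space P) \<le> C * real m * max 1 l * ln (real n) \<and>
              real (word_bits P) \<le> C * ln (real n + real (total_space P))))"
  proof (intro exI[of _ C] exI[of _ A] conjI allI impI)
    show "0 < C" using C(5) by simp
    fix n :: nat and E :: "nat set set" and \<alpha> \<epsilon> :: real
    assume hyp: "ugraph {..<n} E \<and> E \<noteq> {} \<and> 0 < \<alpha> \<and> 0 < \<epsilon> \<and> \<epsilon> \<le> 1"
    then have G: "ugraph {..<n} E" "E \<noteq> {}" and par: "0 < \<alpha>" "0 < \<epsilon>" "\<epsilon> \<le> 1" by auto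
    have n: "2 \<le> n" using vertices_ge2[OF G] .
    have "ln 2 \<le> ln (real n)" using n by simp
    then have ln_n: "2 / 3 \<le> ln (real n)" using ln2_ge_two_thirds by linarith
    define m where "m = card E"
    define d where "d = max_degree {..<n} E"
    define l where "l = walk_length n d \<alpha> \<epsilon>"
    define P where "P = A n m d \<alpha> \<epsilon>"
    let ?far = "far_from_expanders {..<n} E \<epsilon> (1 / 4000 * \<alpha>\<^sup>2 / ((real d)\<^sup>2 * ln (real n / \<epsilon>)))"
    have main: "can_store P m \<and>
        (\<forall>\<sigma>. initial_config P E \<sigma> \<longrightarrow> within_limits P \<sigma> \<and>
           (vertex_expander {..<n} E \<alpha> \<longrightarrow> pmf (mpc_output P \<sigma>) Accept \<ge> 1 - 1 / real n ^ k) \<and>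
           (?far \<longrightarrow> pmf (mpc_output P \<sigma>) Reject \<ge> 1 - 1 / real n ^ k)) \<and>
        real (rounds P) \<le> C * max 1 (ln l) \<and>
        real (local_space P) \<le> C * real n powr \<delta> \<and>
        real (total_space P) \<le> C * real m * max 1 l * ln (real n) \<and>
        real (word_bits P) \<le> C * ln (real n + real (total_space P))"
    proof (cases "real d < \<alpha> \<or> 2 * m < n")
      case True
      then have P: "P = always_reject n m" by (simp add: P_def A_def)
      have "\<not> vertex_expander {..<n} E \<alpha>"
        using True vertex_expander_le_degree[OF G(1) n] vertex_expander_card_edges[OF G(1) n _ par(1)]
        by (fastforce simp: d_def m_def)
      moreover have "within_limits P \<sigma>" if "initial_config P E \<sigma>" for \<sigma>
        using always_reject_limits[OF G(1) _ that[unfolded P]] n unfolding P by simp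
      moreover have "pmf (mpc_output P \<sigma>) Reject \<ge> 1 - 1 / real n ^ k" for \<sigma>
        unfolding P always_reject_output by simp
      moreover have "can_store P m" by (simp add: P always_reject_def can_store_def)
      moreover have "real (rounds P) \<le> C * max 1 (ln l)" using C(5) by (simp add: P always_reject_def)
      moreover have "real (local_space P) \<le> C * real n powr \<delta>"
      proof -
        have "1 \<le> real n powr \<delta>" using n \<delta> by (intro ge_one_powr_ge_zero) auto
        then have "3 * 1 \<le> C * real n powr \<delta>" using C(5) by (intro mult_mono) auto
        then show ?thesis by (simp add: P always_reject_def)
      qed
      moreover have "real (total_space P) \<le> C * real m * max 1 l * ln (real n)"
      proof -
        have "3 * real m * 1 * (2 / 3) \<le> C * real m * max 1 l * ln (real n)"
          using C(5) ln_n by (intro mult_mono) auto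
        then show ?thesis by (simp add: P always_reject_def total_space_def)
      qed
      moreover have "real (word_bits P) \<le> C * ln (real n + real (total_space P))"
      proof -
        have "real (word_bits P) \<le> log 2 (real n) + 1"
          unfolding P always_reject_def using n by (simp add: pow2_ceiling_log(3))
        also have "\<dots> \<le> 2 * log 2 (real n)" using n by (simp add: le_log_iff)
        also have "\<dots> \<le> 510 / ln 2 * ln (real n)" using n by (simp add: log_def field_simps)
        also have "\<dots> \<le> C * ln (real n + real (total_space P))"
          using C(4,5) n by (intro mult_mono) auto
        finally show ?thesis .
      qed
      ultimately show ?thesis by blast
    next
      case False
      then have P: "P = tester (block_size k q m) q (doublings l) (log_reps k n) n d"
        by (simp add: P_def A_def l_def)
      have edges: "n \<le> 2 * card E" and \<alpha>d: "\<alpha> \<le> real (max_degree {..<n} E)"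
        using False by (auto simp: m_def d_def)
      note T = tester_guarantees[OF G edges q(2) par(1) \<alpha>d par(2,3), where k = k,
          folded d_def m_def, folded l_def, folded P]
      have "real (rounds P) \<le> C * max 1 (ln l)"
        by (rule order_trans[OF T(5)[folded Cr_def]]) (intro mult_right_mono C, simp)
      moreover have "real (local_space P) \<le> C * real n powr \<delta>"
        by (rule order_trans[OF T(2)[OF q(1), folded Cs_def]]) (use \<delta> in \<open>auto intro: mult_right_mono C\<close>)
      moreover have "real (total_space P) \<le> C * real m * max 1 l * ln (real n)"
        by (rule order_trans[OF T(3)[folded Ct_def]]) (intro mult_right_mono C, use ln_n in auto)
      moreover have "real (word_bits P) \<le> C * ln (real n + real (total_space P))"
        by (rule order_trans[OF T(4)]) (intro mult_right_mono C, use n in auto)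
      ultimately show ?thesis using T(1,6-8) by blast
    qed
    show "let m = card E;
               d = max_degree {..<n} E;
               l = 32 * (real d)\<^sup>2 * ln (real n / \<epsilon>) / \<alpha>\<^sup>2;
               \<alpha>' = 1 / 4000 * \<alpha>\<^sup>2 / ((real d)\<^sup>2 * ln (real n / \<epsilon>));
               P = A n m d \<alpha> \<epsilon>
           in can_store P m \<and>
              (\<forall>\<sigma>. initial_config P E \<sigma> \<longrightarrow>
                 within_limits P \<sigma> \<and>
                 (vertex_expander {..<n} E \<alpha> \<longrightarrow>
                    pmf (mpc_output P \<sigma>) Accept \<ge> 1 - 1 / real n ^ k) \<and>
                 (far_from_expanders {..<n} E \<epsilon> \<alpha>' \<longrightarrow>
                    pmf (mpc_output P \<sigma>) Reject \<ge> 1 - 1 / real n ^ k)) \<and>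
              real (rounds P) \<le> C * max 1 (ln l) \<and>
              real (local_space P) \<le> C * real n powr \<delta> \<and>
              real (total_space P) \<le> C * real m * max 1 l * ln (real n) \<and>
              real (word_bits P) \<le> C * ln (real n + real (total_space P))"
      unfolding Let_def using main unfolding P_def l_def walk_length_def m_def d_def .
  qed
qed

end
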